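(* Let $C\subset\mathbb{C}^2$ be the affine plane quartic curve $$C=\{(x,y)\mid (x^2+y^2)^2+x^3+9xy^2+\tfrac{27}{4}y^2=0\}.$$ Consider the braid monodromy of $C$ with respect to a generic linear projection sufficiently close to the projection $(x,y)\mapsto x$, with base point a real number $b>0$ and with the ordered system of paths $\gamma_1,\gamma_2,\gamma_3,\gamma_4$ from $b$ to the critical values specified in the context. The fibre over $b$ consists of four points lying (up to the small perturbation of the projection) on the imaginary axis, named from top to bottom $A_1,B_2,A_2,B_1$. Let $a_1,a_2,a_3,a_4$ be the arcs in $\mathbb{C}$ with endpoints in $\{A_1,B_2,A_2,B_1\}$ described in the context: $a_1$ connects $A_1$ and $A_2$, $a_2$ connects $B_2$ and $B_1$, $a_3$ connects $A_1$ and $B_1$, and $a_4$ connects $A_2$ and $B_2$. Then the braid monodromy of $C$ is given, in this order, by the cube of the half-twist around $a_1$, the cube of the half-twist around $a_2$, the half-twist around $a_3$, and the cube of the half-twist around $a_4$.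
   Context: **Braid monodromy.** Let $C\subset\mathbb{C}^2$ be a curve whose equation is monic of degree $4$ in $y$, and let $p$ be a linear projection to $\mathbb{C}$ such that $p|_C$ is finite of degree $4$. Given a base point $b$ which is not a critical value of $p|_C$ (a critical value being the image of a singular point of $C$ or of a point with tangent line contained in a fibre of $p$), each loop in $\mathbb{C}\setminus\{\text{critical values}\}$ based at $b$ moves the four points of $C\cap p^{-1}(b)$ in the fibre $\cong\mathbb{C}$ and thus gives a braid on these four points. For a path from $b$ to a critical value, the corresponding loop follows the path until close to the critical value, makes one full counterclockwise turn around it, and returns along the path. The braid monodromy (factorization) is the ordered list of the braids associated to a system of paths to all critical values, disjoint outside $b$ and ordered counterclockwise around $b$. For a simple arc $a$ joining two of the four points and avoiding the other two, the half-twist around $a$ is the positive (counterclockwise) half-twist, supported in a small neighbourhood of $a$, exchanging the endpoints of $a$. **Critical values.** For the projection $x$ the critical values are $x=-\frac98$ (two cusps of $C$, at $y=\pm\frac38\sqrt3$), $x=-1$ (one vertical tangency, at $y=0$), and $x=0$ (one cusp, at $y=0$). A small generic change of the linear projection splits $-\frac98$ into two nearby critical values; the other critical values and the fibres are changed only slightly and are identified with those of the projection $x$. The arcs $a_1,a_2$ below are disjoint, so the order between these two critical values is immaterial. **Paths.** Start with the auxiliary base point $x_0=\frac34(\sqrt3-3)\in(-1,0)$. Over $x_0$ the fibre consists of two real points $A_2<0<B_2$ and two purely imaginary points, $A_1$ with positive and $B_1$ with negative imaginary part. From $x_0$ consider the following paths, in this order (counterclockwise around $x_0$): first, two paths that go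 left along the real axis until close to $-1$, make a half turn counterclockwise around $-1$ (through the upper half plane), continue left along the real axis until near $-\frac98$ and end at the two critical values near $-\frac98$ (slightly displaced so as to be disjoint), the first to the critical value where $A_1$ and $A_2$ meet, the second to the one where $B_1$ and $B_2$ meet; third, the path going left along the real axis to $-1$; fourth, the path going right along the real axis to $0$. Now move the base point from $x_0$ to $b>0$ to the right along the real axis, passing $0$ by a half turn clockwise around it (through the upper half plane), dragging the paths along; that is, $\gamma_i$ is the path from $b$ obtained by first travelling the reverse of this motion from $b$ to $x_0$ and then the $i$-th path from $x_0$. The names $A_1,A_2,B_1,B_2$ of the points of the fibre are transported along this motion of the base point: $A_2,B_2$ turn clockwise around $0$ by an angle $\frac32\pi$, and for $x=b$ all four points lie on the imaginary axis, in the order $A_1,B_2,A_2,B_1$ from top to bottom. **Arcs in the fibre over $b$** (up to isotopy fixing the four points). - $a_1$ goes from $A_1$ to $A_2$, passing to the right of $B_2$ (a half-circle in the right half plane). - $a_2$ goes from $B_2$ to $B_1$, passing to the left of $A_2$ (a half-circle in the left half plane). - $a_3$ is the S-shaped arc which starts from $A_1$, descends in the right half plane to a point of the imaginary axis between $A_2$ and $B_1$, then ascends in the left half plane, passing to the left of $A_2$, to the midpoint between $A_2$ and $B_2$, then ascends in the right half plane, passing to the right of $B_2$, to a point of the imaginary axis between $B_2$ and $A_1$, and then descends in the left half plane to $B_1$. - $a_4$ is the straight segment from $A_2$ to $B_2$. *)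

theory Defs
  imports "HOL-Complex_Analysis.Complex_Analysis"
begin

section \<open>Plane curves and linear projections\<close>

text \<open>
  A curve is given by its equation, a polynomial function \<open>F\<close> of two complex variables. The pair
  \<open>p\<close> of complex numbers stands for the linear projection sending \<open>(x, y)\<close> to
  \<open>fst p * x + snd p * y\<close>; the projection to \<open>x\<close> is \<open>(1, 0)\<close>.
\<close>

definition curve :: "(complex \<Rightarrow> complex \<Rightarrow> complex) \<Rightarrow> (complex \<times> complex) set" where
  "curve F = {(x, y). F x y = 0}"

definition proj :: "complex \<times> complex \<Rightarrow> complex \<times> complex \<Rightarrow> complex" where
  "proj p q = fst p * fst q + snd p * snd q"

definition partial_x :: "(complex \<Rightarrow> complex \<Rightarrow> complex) \<Rightarrow> complex \<times> complex \<Rightarrow> complex" where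
  "partial_x F q = deriv (\<lambda>x. F x (snd q)) (fst q)"

definition partial_y :: "(complex \<Rightarrow> complex \<Rightarrow> complex) \<Rightarrow> complex \<times> complex \<Rightarrow> complex" where
  "partial_y F q = deriv (\<lambda>y. F (fst q) y) (snd q)"

definition singular_point :: "(complex \<Rightarrow> complex \<Rightarrow> complex) \<Rightarrow> complex \<times> complex \<Rightarrow> bool" where
  "singular_point F q \<longleftrightarrow> q \<in> curve F \<and> partial_x F q = 0 \<and> partial_y F q = 0"

definition tangent_line ::
    "(complex \<Rightarrow> complex \<Rightarrow> complex) \<Rightarrow> complex \<times> complex \<Rightarrow> (complex \<times> complex) set" where
  "tangent_line F q =
     {(x, y). partial_x F q * (x - fst q) + partial_y F q * (y - snd q) = 0}"

definition critical_points ::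
    "(complex \<Rightarrow> complex \<Rightarrow> complex) \<Rightarrow> complex \<times> complex \<Rightarrow> (complex \<times> complex) set" where
  "critical_points F p =
     {q \<in> curve F. singular_point F q \<or> tangent_line F q \<subseteq> {q'. proj p q' = proj p q}}"

definition critical_values ::
    "(complex \<Rightarrow> complex \<Rightarrow> complex) \<Rightarrow> complex \<times> complex \<Rightarrow> complex set" where
  "critical_values F p = proj p ` critical_points F p"

text \<open>Genericity: different critical points lie over different critical values.\<close>

definition generic_projection ::
    "(complex \<Rightarrow> complex \<Rightarrow> complex) \<Rightarrow> complex \<times> complex \<Rightarrow> bool" where
  "generic_projection F p \<longleftrightarrow> inj_on (proj p) (critical_points F p)"

text \<open>
  The part of the curve in a fibre of \<open>p\<close>; the fibre, a line, is identified with the complex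
  numbers by the coordinate \<open>y\<close>, as is possible when \<open>fst p \<noteq> 0\<close>. The argument is a pair
  consisting of a projection and a point of its target, so that both may vary along a path.
\<close>

definition fibre ::
    "(complex \<Rightarrow> complex \<Rightarrow> complex) \<Rightarrow> (complex \<times> complex) \<times> complex \<Rightarrow> complex set" where
  "fibre F s = snd ` {q \<in> curve F. proj (fst s) q = snd s}"

section \<open>Braids\<close>

text \<open>
  A braid on the points \<open>P $ i\<close> is represented by its strands: a path in the ordered
  configuration space which starts at \<open>P\<close> and ends at \<open>P\<close> with permuted indices. Two such paths
  represent the same braid iff they are homotopic in the configuration space with fixed ends.
\<close>

definition config :: "(complex ^ 'n::finite) set" where
  "config = {v. inj (vec_nth v)}"

definition enumerates :: "complex ^ 'n::finite \<Rightarrow> complex set \<Rightarrow> bool" where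
  "enumerates v S \<longleftrightarrow> inj (vec_nth v) \<and> range (vec_nth v) = S"

text \<open>First \<open>g\<close>, then \<open>h\<close>, with the strands of \<open>h\<close> renamed so as to continue those of \<open>g\<close>.\<close>

definition braid_mult ::
    "(real \<Rightarrow> complex ^ 'n::finite) \<Rightarrow> (real \<Rightarrow> complex ^ 'n) \<Rightarrow> real \<Rightarrow> complex ^ 'n" where
  "braid_mult g h =
     g +++ (\<lambda>t. \<chi> i. h t $ (THE j. pathstart h $ j = pathfinish g $ i))"

primrec braid_power :: "(real \<Rightarrow> complex ^ 'n::finite) \<Rightarrow> nat \<Rightarrow> real \<Rightarrow> complex ^ 'n" where
  "braid_power h 0 = (\<lambda>t. pathstart h)"
| "braid_power h (Suc n) = braid_mult (braid_power h n) h"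

text \<open>
  \<open>h\<close> represents the positive half-twist around the simple arc \<open>a\<close>. The map \<open>\<phi>\<close> is an orientation
  preserving embedding of the disc of radius \<open>2\<close> as a neighbourhood of \<open>a\<close>, free of further points
  of the configuration, which takes the interval \<open>[-1, 1]\<close> to \<open>a\<close>; the end points of \<open>a\<close> are
  exchanged by the image of a counterclockwise half turn of the unit circle. The braid does not
  depend on the choice of \<open>\<phi>\<close>.
\<close>

definition half_twist ::
    "complex ^ 'n::finite \<Rightarrow> (real \<Rightarrow> complex) \<Rightarrow> (real \<Rightarrow> complex ^ 'n) \<Rightarrow> bool" where
  "half_twist P a h \<longleftrightarrow> arc a \<and>
     (\<exists>\<phi> i j. i \<noteq> j \<and> P $ i = pathstart a \<and> P $ j = pathfinish a \<and>
        continuous_on (cball 0 2) \<phi> \<and> inj_on \<phi> (cball 0 2) \<and>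
        winding_number (\<phi> \<circ> circlepath 0 1) (\<phi> 0) = 1 \<and>
        \<phi> ` closed_segment (-1) 1 = path_image a \<and>
        \<phi> (-1) = pathstart a \<and> \<phi> 1 = pathfinish a \<and>
        (\<forall>k. k \<noteq> i \<and> k \<noteq> j \<longrightarrow> P $ k \<notin> \<phi> ` cball 0 2) \<and>
        h = (\<lambda>t. \<chi> k. if k = i then \<phi> (- cis (pi * t))
                     else if k = j then \<phi> (cis (pi * t)) else P $ k))"

section \<open>Braid monodromy\<close>

definition follows_fibres ::
    "(complex \<Rightarrow> complex \<Rightarrow> complex) \<Rightarrow> (real \<Rightarrow> (complex \<times> complex) \<times> complex)
     \<Rightarrow> (real \<Rightarrow> complex ^ 'n::finite) \<Rightarrow> bool" where
  "follows_fibres F s z \<longleftrightarrow> path z \<and> (\<forall>t\<in>{0..1}. enumerates (z t) (fibre F (s t)))"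

text \<open>
  The fibre over \<open>b\<close> of a projection \<open>p\<close> close to \<open>(1, 0)\<close> is identified with the fibre over \<open>b\<close>
  of \<open>(1, 0)\<close> by following the points along the segment from \<open>(1, 0)\<close> to \<open>p\<close>.
\<close>

definition deform :: "complex \<Rightarrow> complex \<times> complex \<Rightarrow> real \<Rightarrow> (complex \<times> complex) \<times> complex" where
  "deform b p = linepath ((1, 0), b) (p, b)"

text \<open>
  The loop belonging to a path \<open>\<gamma>\<close> to a critical value: follow \<open>\<gamma>\<close> up to time \<open>\<tau>\<close>, make a full
  counterclockwise turn around the end point of \<open>\<gamma>\<close>, and return.
\<close>

definition loop_around :: "(real \<Rightarrow> complex) \<Rightarrow> real \<Rightarrow> real \<Rightarrow> complex" where
  "loop_around \<gamma> \<tau> =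
     subpath 0 \<tau> \<gamma> +++
     (\<lambda>t. pathfinish \<gamma> + (\<gamma> \<tau> - pathfinish \<gamma>) * cis (2 * pi * t)) +++
     subpath \<tau> 0 \<gamma>"

definition close_to_end :: "complex set \<Rightarrow> (real \<Rightarrow> complex) \<Rightarrow> real \<Rightarrow> bool" where
  "close_to_end K \<gamma> \<tau> \<longleftrightarrow> 0 < \<tau> \<and> \<tau> < 1 \<and>
     (\<exists>\<epsilon>. K \<inter> cball (pathfinish \<gamma>) \<epsilon> = {pathfinish \<gamma>} \<and>
          \<gamma> ` {\<tau>..1} \<subseteq> cball (pathfinish \<gamma>) \<epsilon>)"

text \<open>
  \<open>\<beta>\<close> represents the braid of the path \<open>\<gamma>\<close> for the projection \<open>p\<close>, as a braid on the points \<open>P\<close>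
  of the fibre over \<open>b\<close> of the projection \<open>(1, 0)\<close>.
\<close>

definition monodromy_braid ::
    "(complex \<Rightarrow> complex \<Rightarrow> complex) \<Rightarrow> complex \<times> complex \<Rightarrow> complex \<Rightarrow> complex ^ 'n::finite
     \<Rightarrow> (real \<Rightarrow> complex) \<Rightarrow> (real \<Rightarrow> complex ^ 'n) \<Rightarrow> bool" where
  "monodromy_braid F p b P \<gamma> \<beta> \<longleftrightarrow>
     (\<exists>\<tau> z. close_to_end (critical_values F p) \<gamma> \<tau> \<and> pathstart z = P \<and>
        follows_fibres F
          (deform b p +++ (\<lambda>t. (p, loop_around \<gamma> \<tau> t)) +++ reversepath (deform b p)) z \<and>
        homotopic_paths config z \<beta>)"

definition braid_monodromy ::
    "(complex \<Rightarrow> complex \<Rightarrow> complex) \<Rightarrow> complex \<times> complex \<Rightarrow> complex \<Rightarrow> complex ^ 'n::finite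
     \<Rightarrow> (real \<Rightarrow> complex) list \<Rightarrow> (real \<Rightarrow> complex ^ 'n) list \<Rightarrow> bool" where
  "braid_monodromy F p b P \<gamma>s \<beta>s \<longleftrightarrow> list_all2 (monodromy_braid F p b P) \<gamma>s \<beta>s"

text \<open>
  A system of paths from \<open>b\<close> to all points of \<open>K\<close>, disjoint outside \<open>b\<close> and ordered
  counterclockwise around \<open>b\<close>; the order is read off from the directions \<open>cis (\<theta> i)\<close> in which
  the paths leave \<open>b\<close>, and is a cyclic order as the angles are only required to lie in some
  interval of length \<open>2 * pi\<close>.
\<close>

definition path_system :: "complex set \<Rightarrow> complex \<Rightarrow> (real \<Rightarrow> complex) list \<Rightarrow> bool" where
  "path_system K b \<gamma>s \<longleftrightarrow>
     (\<forall>\<gamma>\<in>set \<gamma>s. arc \<gamma> \<and> pathstart \<gamma> = b \<and> path_image \<gamma> \<inter> K = {pathfinish \<gamma>}) \<and>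
     bij_betw (\<lambda>i. pathfinish (\<gamma>s ! i)) {..<length \<gamma>s} K \<and>
     (\<forall>j<length \<gamma>s. \<forall>i<j. path_image (\<gamma>s ! i) \<inter> path_image (\<gamma>s ! j) = {b}) \<and>
     (\<exists>\<theta>. (\<forall>j<length \<gamma>s. \<forall>i<j. \<theta> i < \<theta> j \<and> \<theta> j < \<theta> i + 2 * pi) \<and>
          (\<forall>i<length \<gamma>s. \<exists>d>0.
             (\<gamma>s ! i has_vector_derivative of_real d * cis (\<theta> i)) (at 0 within {0..1})))"

text \<open>
  Displacement of a path with end point in \<open>K\<close>: a homotopy with fixed ends which meets \<open>K\<close>
  only at the end of the paths.
\<close>

definition displaced :: "complex set \<Rightarrow> (real \<Rightarrow> complex) \<Rightarrow> (real \<Rightarrow> complex) \<Rightarrow> bool" where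
  "displaced K g \<gamma> \<longleftrightarrow>
     homotopic_with_canon
       (\<lambda>f. pathstart f = pathstart g \<and> pathfinish f = pathfinish g \<and> (\<forall>t\<in>{0..<1}. f t \<notin> K))
       {0..1} UNIV g \<gamma>"

text \<open>
  \<open>\<gamma>\<close> is, up to displacement, the path which runs along \<open>g\<close> until it is at distance at most \<open>r\<close>
  from \<open>c\<close>, and then ends, without leaving the disc of radius \<open>r\<close> around \<open>c\<close>, at a point of \<open>K\<close>.
\<close>

definition ends_near ::
    "complex set \<Rightarrow> (real \<Rightarrow> complex) \<Rightarrow> complex \<Rightarrow> real \<Rightarrow> (real \<Rightarrow> complex) \<Rightarrow> bool" where
  "ends_near K g c r \<gamma> \<longleftrightarrow>
     (\<exists>e. path e \<and> pathstart e = pathfinish g \<and> path_image e \<subseteq> cball c r \<and>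
          (\<forall>t\<in>{0..<1}. e t \<notin> K) \<and> pathfinish e \<in> K \<and> displaced K (g +++ e) \<gamma>)"

text \<open>
  Along the path \<open>\<gamma>\<close> from \<open>b\<close>, the points of the fibre of \<open>p\<close> named \<open>i\<close> and \<open>j\<close> come together at
  the end of \<open>\<gamma>\<close>.
\<close>

definition meet_at_end ::
    "(complex \<Rightarrow> complex \<Rightarrow> complex) \<Rightarrow> complex \<times> complex \<Rightarrow> complex \<Rightarrow> complex ^ 'n::finite
     \<Rightarrow> (real \<Rightarrow> complex) \<Rightarrow> 'n \<Rightarrow> 'n \<Rightarrow> bool" where
  "meet_at_end F p b P \<gamma> i j \<longleftrightarrow>
     (\<exists>u. path u \<and> pathstart u = P \<and>
        (\<forall>t\<in>{0..<1}. enumerates (u t) (fibre F ((deform b p +++ (\<lambda>t. (p, \<gamma> t))) t))) \<and>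
        pathfinish u $ i = pathfinish u $ j)"

section \<open>The curve, the paths and the arcs\<close>

definition deltoid :: "complex \<Rightarrow> complex \<Rightarrow> complex" where
  "deltoid x y = (x^2 + y^2)^2 + x^3 + 9 * x * y^2 + 27/4 * y^2"

datatype point_name = A1 | A2 | B1 | B2

instance point_name :: finite
proof
  have "(UNIV :: point_name set) = {A1, A2, B1, B2}"
    using point_name.exhaust by blast
  then show "finite (UNIV :: point_name set)"
    by (metis finite.emptyI finite_insert)
qed

definition aux_base :: real where
  "aux_base = 3/4 * (sqrt 3 - 3)"

text \<open>
  The radius \<open>r\<close> is used for the half circles around \<open>0\<close> and \<open>-1\<close>, and for what counts as being
  close to \<open>0\<close>, \<open>-1\<close> and \<open>-9/8\<close>.
\<close>

definition base_move :: "real \<Rightarrow> real \<Rightarrow> real \<Rightarrow> complex" where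
  "base_move r b =
     linepath (of_real aux_base) (of_real (-r)) +++ part_circlepath 0 r pi 0 +++
     linepath (of_real r) (of_real b)"

definition route_cusps :: "real \<Rightarrow> real \<Rightarrow> real \<Rightarrow> complex" where
  "route_cusps r b =
     reversepath (base_move r b) +++ linepath (of_real aux_base) (of_real (-1 + r)) +++
     part_circlepath (-1) r 0 pi +++ linepath (of_real (-1 - r)) (of_real (-9/8 + r))"

definition route_tangency :: "real \<Rightarrow> real \<Rightarrow> real \<Rightarrow> complex" where
  "route_tangency r b =
     reversepath (base_move r b) +++ linepath (of_real aux_base) (of_real (-1 + r))"

definition route_origin :: "real \<Rightarrow> real \<Rightarrow> real \<Rightarrow> complex" where
  "route_origin r b =
     reversepath (base_move r b) +++ linepath (of_real aux_base) (of_real (-r))"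

text \<open>
  For points \<open>u \<noteq> v\<close> of the imaginary axis: the half circle from \<open>u\<close> to \<open>v\<close> in the right half
  plane, which runs from angle \<open>pi/2\<close> to \<open>-pi/2\<close> or conversely. The left half circle is its
  reflection in the imaginary axis.
\<close>

definition right_arc :: "complex \<Rightarrow> complex \<Rightarrow> real \<Rightarrow> complex" where
  "right_arc u v = part_circlepath (midpoint u v) (dist u v / 2) (Arg (u - v)) (Arg (v - u))"

definition left_arc :: "complex \<Rightarrow> complex \<Rightarrow> real \<Rightarrow> complex" where
  "left_arc u v = (\<lambda>t. - cnj (right_arc u v t))"

definition arc1 :: "complex ^ point_name \<Rightarrow> real \<Rightarrow> complex" where
  "arc1 P = right_arc (P $ A1) (P $ A2)"

definition arc2 :: "complex ^ point_name \<Rightarrow> real \<Rightarrow> complex" where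
  "arc2 P = left_arc (P $ B2) (P $ B1)"

definition arc3 :: "complex ^ point_name \<Rightarrow> real \<Rightarrow> complex" where
  "arc3 P =
     right_arc (P $ A1) (midpoint (P $ A2) (P $ B1)) +++
     left_arc (midpoint (P $ A2) (P $ B1)) (midpoint (P $ A2) (P $ B2)) +++
     right_arc (midpoint (P $ A2) (P $ B2)) (midpoint (P $ B2) (P $ A1)) +++
     left_arc (midpoint (P $ B2) (P $ A1)) (P $ B1)"

definition arc4 :: "complex ^ point_name \<Rightarrow> real \<Rightarrow> complex" where
  "arc4 P = linepath (P $ A2) (P $ B2)"

end

theory Submission
  imports Defs "HOL-Computational_Algebra.Computational_Algebra"
begin

text \<open>
  The quartic is a three-cusped hypocycloid, and its fibres over \<open>x\<close> can be written down: if \<open>v^2 = 8 * x + 9\<close>, then the equation of the curve is the product of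
  \<open>y^2 - f v\<close> and \<open>y^2 - f (-v)\<close> with \<open>f v = (3 - v)^3 * (1 + v) / 64\<close> (\<open>deltoid_factor\<close>).
  The fibre consists of \<open>\<plusminus>A1\<close> and \<open>\<plusminus>A2\<close>; taking logarithms of \<open>A1\<close> and \<open>A2\<close>, the
  motion of the four points over the closed upper half plane becomes an explicit path in
  \<open>log_config\<close>, a subset of the plane of pairs of logarithms. All routes of the theorem run in
  the simply connected set \<open>upper\<close>, so only their ends matter, and the path in logarithmic
  coordinates may be replaced by a polygon with corners over the neighbourhoods of \<open>0\<close>, \<open>-1\<close>
  and \<open>-9/8\<close> (\<open>route_to_origin\<close>, \<open>route_to_tangency\<close>, \<open>route_to_cusps\<close>).

  Close to a critical value the pair of points that meets there turns around its midpoint, by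
  three half turns at a cusp and by one at the tangency. This is a power of the half-twist around
  a short segment, which has to be carried back along the route to the fibre over \<open>b\<close>. The first
  edge of the polygon turns \<open>A2\<close> and \<open>B2\<close> as a rigid pair around the origin. It is realised by
  a rotation of the plane whose angle depends on the radius; such a rotation bends
  the segment into one of the arcs of the theorem, since every half circle with diameter on the
  imaginary axis meets each circle around the origin at most once. Along the remaining edges the
  segment between the two points stays free of the other two. This gives the braids for the
  projection to \<open>x\<close> itself (\<open>cusp_monodromy\<close>, \<open>tangency_monodromy\<close>, \<open>origin_monodromy\<close>).

  Everything depends on the loops only up to homotopy: ordered fibres with four points
  form a covering space over the set \<open>regular\<close> of pairs of a projection and a regular value, so
  homotopic loops of parameters give homotopic braids (\<open>follows_homotopic\<close>). By compactness,
  for a projection \<open>p\<close> near \<open>(1, 0)\<close> all values on the routes and on annuli at the boundary of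
  small discs around \<open>0\<close>, \<open>-1\<close> and \<open>-9/8\<close> are regular. In the discs around \<open>0\<close> and \<open>-1\<close> there is one critical
  value of \<open>p\<close>, and the loop in question is classified by its winding number around it; it may be
  pushed to the boundary annulus and there deformed to a loop for the projection to \<open>x\<close>.

  The disc around \<open>-9/8\<close> contains two critical values of \<open>p\<close>, and a loop around one of them is
  not determined by winding numbers. But over this disc two points of the fibre stay in the left
  half plane and two in the right half plane. Each pair degenerates over only one of the two
  critical values, and the two pairs may be moved independently of each other, each with a loop
  of its own (\<open>local_loop_clusters\<close>); for each of these loops the winding number again decides.
\<close>

no_notation fps_nth (infixl \<open>$\<close> 75)

section \<open>Lifting homotopies to ordered configurations\<close>

definition follows ::
    "('a::topological_space \<Rightarrow> complex set) \<Rightarrow> (real \<Rightarrow> 'a) \<Rightarrow> (real \<Rightarrow> complex ^ 'n::finite) \<Rightarrow> bool"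
  where "follows E s z \<longleftrightarrow> path z \<and> (\<forall>t\<in>{0..1}. enumerates (z t) (E (s t)))"

definition ordered_points :: "'a set \<Rightarrow> ('a \<Rightarrow> complex set) \<Rightarrow> ('a \<times> (complex ^ 'n::finite)) set" where
  "ordered_points S E = {(s, v). s \<in> S \<and> enumerates v (E s)}"

text \<open>
  Sets of \<open>n\<close> points depending continuously on a parameter. Lower semicontinuity
  suffices for this, as the number of points is constant.
\<close>

definition moving_set :: "nat \<Rightarrow> 'a::metric_space set \<Rightarrow> ('a \<Rightarrow> complex set) \<Rightarrow> bool" where
  "moving_set n S E \<longleftrightarrow> (\<forall>s\<in>S. card (E s) = n) \<and>
     (\<forall>s\<in>S. \<forall>y\<in>E s. \<forall>e>0. \<forall>\<^sub>F s' in at s within S. \<exists>y'\<in>E s'. dist y' y < e)"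

lemma moving_setD:
  assumes "moving_set n S E" "s \<in> S"
  shows "card (E s) = n"
    and "\<And>y e. y \<in> E s \<Longrightarrow> e > 0 \<Longrightarrow> \<forall>\<^sub>F s' in at s within S. \<exists>y'\<in>E s'. dist y' y < e"
  using assms unfolding moving_set_def by blast+

lemma enumerates_exists:
  fixes A :: "complex set"
  assumes "card A = CARD('n::finite)"
  shows "\<exists>v :: complex ^ 'n. enumerates v A"
proof -
  have "finite A" using assms by (metis card.infinite finite_UNIV_card_ge_0 less_nat_zero_code finite_class.finite_UNIV)
  then obtain f where "bij_betw f (UNIV :: 'n set) A"
    using assms finite_same_card_bij[of "UNIV :: 'n set" A] by auto
  then show ?thesis
    by (intro exI[of _ "vec_lambda f"]) (auto simp: enumerates_def bij_betw_def vec_lambda_inverse inj_def)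
qed

lemma enumerates_in_config: "enumerates v A \<Longrightarrow> v \<in> config"
  by (simp add: enumerates_def config_def)

text \<open>A common radius for disjoint discs around the points of a finite set.\<close>

lemma finite_separation:
  fixes v :: "complex ^ 'n::finite"
  assumes "inj (vec_nth v)"
  obtains e where "e > 0" "\<And>i j. i \<noteq> j \<Longrightarrow> ball (v $ i) e \<inter> ball (v $ j) e = {}"
proof -
  define D where "D = (\<lambda>(i,j). dist (v $ i) (v $ j) / 2) ` {(i,j). i \<noteq> j}"
  define e where "e = Min (insert 1 D)"
  have fin: "finite D" unfolding D_def by simp
  have pos: "d > 0" if "d \<in> D" for d
    using that assms by (auto simp: D_def inj_def)
  have "e > 0" using fin pos by (simp add: e_def)
  moreover have "ball (v $ i) e \<inter> ball (v $ j) e = {}" if "i \<noteq> j" for i j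
  proof -
    have "dist (v $ i) (v $ j) / 2 \<in> D" using that by (auto simp: D_def)
    then have "e \<le> dist (v $ i) (v $ j) / 2" unfolding e_def using fin by (intro Min_le) auto
    then show ?thesis by (intro disjoint_ballI) simp
  qed
  ultimately show ?thesis using that by blast
qed

lemma local_enumeration:
  fixes S :: "'a::metric_space set"
  assumes mov: "moving_set CARD('n::finite) S E" and s0: "s0 \<in> S"
  obtains v0 :: "complex ^ 'n" and e T V where "s0 \<in> T" "openin (top_of_set S) T" "T \<subseteq> S"
    "continuous_on T V" "\<And>s. s \<in> T \<Longrightarrow> enumerates (V s) (E s)"
    "\<And>s i. s \<in> T \<Longrightarrow> V s $ i \<in> ball (v0 $ i) e"
    "\<And>i j. i \<noteq> j \<Longrightarrow> ball (v0 $ i) e \<inter> ball (v0 $ j) e = {}"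
proof -
  obtain v0 :: "complex ^ 'n" where v0: "enumerates v0 (E s0)"
    using enumerates_exists moving_setD(1)[OF mov s0] by blast
  obtain e where e: "e > 0" and sep: "\<And>i j. i \<noteq> j \<Longrightarrow> ball (v0 $ i) e \<inter> ball (v0 $ j) e = {}"
    using finite_separation v0 unfolding enumerates_def by metis
  define T where "T = {s \<in> S. \<forall>i. \<exists>y\<in>E s. y \<in> ball (v0 $ i) e}"
  define V :: "'a \<Rightarrow> complex ^ 'n" where "V s = (\<chi> i. SOME y. y \<in> E s \<and> y \<in> ball (v0 $ i) e)" for s
  have V: "V s $ i \<in> E s \<and> V s $ i \<in> ball (v0 $ i) e" if "s \<in> T" for s i
    using that someI_ex[of "\<lambda>y. y \<in> E s \<and> y \<in> ball (v0 $ i) e"] by (auto simp: T_def V_def)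
  have enum: "enumerates (V s) (E s)" if s: "s \<in> T" for s
  proof -
    have inj: "inj (vec_nth (V s))"
    proof (rule injI)
      fix i j assume "V s $ i = V s $ j"
      then show "i = j" using V[OF s, of i] V[OF s, of j] sep[of i j] by (metis disjoint_iff)
    qed
    have card: "card (E s) = CARD('n)" using mov s by (simp add: T_def moving_setD(1))
    then have "finite (E s)" by (metis card.infinite finite_UNIV_card_ge_0 less_nat_zero_code finite_class.finite_UNIV)
    moreover have "range (vec_nth (V s)) \<subseteq> E s" using V[OF s] by blast
    moreover have "card (range (vec_nth (V s))) = card (E s)"
      using inj card by (simp add: card_image)
    ultimately have "range (vec_nth (V s)) = E s" by (simp add: card_subset_eq)
    then show ?thesis using inj by (simp add: enumerates_def)
  qed
  have uniq: "y = V s $ i" if h: "s \<in> T" "y \<in> E s" "y \<in> ball (v0 $ i) e" for s y i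
  proof -
    obtain j where j: "y = V s $ j" using enum[OF h(1)] h(2) unfolding enumerates_def by blast
    then show ?thesis using V[OF h(1), of j] sep[of i j] h(3) by (metis disjoint_iff)
  qed
  have near: "\<forall>\<^sub>F s' in at s within S. \<exists>y\<in>E s'. y \<in> ball (v0 $ i) e \<and> dist y (V s $ i) < d"
    if s: "s \<in> T" and d: "d > 0" for s i d
  proof -
    have "e - dist (v0 $ i) (V s $ i) > 0" using V[OF s, of i] by simp
    then have "min d (e - dist (v0 $ i) (V s $ i)) > 0" using d by simp
    moreover have "s \<in> S" using s by (simp add: T_def)
    ultimately have "\<forall>\<^sub>F s' in at s within S. \<exists>y'\<in>E s'. dist y' (V s $ i) < min d (e - dist (v0 $ i) (V s $ i))"
      using moving_setD(2)[OF mov] V[OF s] by blast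
    then show ?thesis
    proof (rule eventually_mono)
      fix s' assume "\<exists>y'\<in>E s'. dist y' (V s $ i) < min d (e - dist (v0 $ i) (V s $ i))"
      then obtain y' where y': "y' \<in> E s'" "dist y' (V s $ i) < d"
        "dist y' (V s $ i) < e - dist (v0 $ i) (V s $ i)" by auto
      have "dist (v0 $ i) y' \<le> dist (v0 $ i) (V s $ i) + dist y' (V s $ i)"
        by (metis dist_commute dist_triangle)
      then have "y' \<in> ball (v0 $ i) e" using y'(3) by simp
      then show "\<exists>y\<in>E s'. y \<in> ball (v0 $ i) e \<and> dist y (V s $ i) < d" using y' by blast
    qed
  qed
  have "openin (top_of_set S) T"
    unfolding openin_euclidean_subtopology_iff
  proof (intro conjI ballI)
    show "T \<subseteq> S" by (auto simp: T_def)
    fix s assume s: "s \<in> T"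
    have "\<forall>\<^sub>F s' in at s within S. \<forall>i. \<exists>y\<in>E s'. y \<in> ball (v0 $ i) e \<and> dist y (V s $ i) < 1"
      by (intro eventually_all_finite near s) simp
    then obtain d where "d > 0" and d: "\<And>s'. s' \<in> S \<Longrightarrow> s' \<noteq> s \<Longrightarrow> dist s' s < d \<Longrightarrow>
        \<forall>i. \<exists>y\<in>E s'. y \<in> ball (v0 $ i) e \<and> dist y (V s $ i) < 1"
      unfolding eventually_at by blast
    then have "s' \<in> T" if "s' \<in> S" "dist s' s < d" for s'
      using that s by (cases "s' = s") (auto simp: T_def, meson mem_ball)
    with \<open>d > 0\<close> show "\<exists>e>0. \<forall>x'\<in>S. dist x' s < e \<longrightarrow> x' \<in> T" by blast
  qed
  moreover have "continuous_on T V"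
  proof -
    have "((\<lambda>s. V s $ i) \<longlongrightarrow> V s $ i) (at s within T)" if s: "s \<in> T" for s i
    proof (rule tendstoI)
      fix d :: real assume "d > 0"
      from near[OF s this] have "\<forall>\<^sub>F s' in at s within T. \<exists>y\<in>E s'. y \<in> ball (v0 $ i) e \<and> dist y (V s $ i) < d"
        by (rule filter_leD[rotated]) (auto simp: T_def intro: at_le)
      moreover have "\<forall>\<^sub>F s' in at s within T. s' \<in> T" by (auto simp: eventually_at_filter)
      ultimately show "\<forall>\<^sub>F s' in at s within T. dist (V s' $ i) (V s $ i) < d"
        by eventually_elim (use uniq in blast)
    qed
    then have "continuous_on T (\<lambda>s. V s $ i)" for i by (simp add: continuous_on_def)
    then show ?thesis unfolding continuous_on_def by (auto intro!: vec_tendstoI)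
  qed
  moreover have "s0 \<in> T" proof -
    have "v0 $ i \<in> E s0" for i using v0 unfolding enumerates_def by blast
    then have "v0 $ i \<in> E s0 \<and> v0 $ i \<in> ball (v0 $ i) e" for i using e by simp
    then show ?thesis using s0 unfolding T_def by blast
  qed
  ultimately show ?thesis using that[of T V v0 e] V enum sep by (auto simp: T_def)
qed

text \<open>
  Why the ordered configurations form a covering: near a parameter each point stays in its own
  small disc, and a sheet is given by saying which label lies in which disc.
\<close>

lemma covering_ordered_points:
  fixes S :: "'a::metric_space set"
  assumes mov: "moving_set CARD('n::finite) S E"
  shows "covering_space (ordered_points S E :: ('a \<times> (complex ^ 'n)) set) fst S"
proof
  let ?C = "ordered_points S E :: ('a \<times> (complex ^ 'n)) set"
  show "continuous_on ?C fst" by (intro continuous_intros)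
  show "fst ` ?C = S"
    using enumerates_exists[where 'n='n] moving_setD(1)[OF mov]
    by (force simp: ordered_points_def image_iff)
  fix s0 assume "s0 \<in> S"
  then obtain v0 :: "complex ^ 'n" and e T V where T: "s0 \<in> T" "openin (top_of_set S) T" "T \<subseteq> S"
    and V: "continuous_on T V" "\<And>s. s \<in> T \<Longrightarrow> enumerates (V s) (E s)"
    "\<And>s i. s \<in> T \<Longrightarrow> V s $ i \<in> ball (v0 $ i) e"
    and sep: "\<And>i j. i \<noteq> j \<Longrightarrow> ball (v0 $ i) e \<inter> ball (v0 $ j) e = {}"
    using local_enumeration[OF mov] by metis
  define u where "u \<pi> = {(s, w). s \<in> T \<and> enumerates w (E s) \<and> (\<forall>i. w $ i \<in> ball (v0 $ \<pi> i) e)}"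
    for \<pi> :: "'n \<Rightarrow> 'n"
  have uV: "w $ i = V s $ \<pi> i" if "(s, w) \<in> u \<pi>" for s w \<pi> i
  proof -
    have "w $ i \<in> E s" "s \<in> T" using that by (auto simp: u_def enumerates_def)
    then obtain j where "w $ i = V s $ j" using V(2) unfolding enumerates_def by blast
    moreover have "w $ i \<in> ball (v0 $ \<pi> i) e" using that by (simp add: u_def)
    ultimately show ?thesis using V(3)[OF \<open>s \<in> T\<close>, of j] sep[of j "\<pi> i"] by (metis disjoint_iff)
  qed
  have "\<Union> (u ` {\<pi>. bij \<pi>}) = ?C \<inter> fst -` T"
  proof (rule equalityI)
    show "\<Union> (u ` {\<pi>. bij \<pi>}) \<subseteq> ?C \<inter> fst -` T" using T(3) by (intro UN_least) (simp add: u_def ordered_points_def subset_iff)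
    show "?C \<inter> fst -` T \<subseteq> \<Union> (u ` {\<pi>. bij \<pi>})"
    proof (rule subsetI)
      fix q assume q: "q \<in> ?C \<inter> fst -` T"
      obtain s w where qs: "q = (s, w)" by (rule prod.exhaust)
      have s: "s \<in> T" and w: "enumerates w (E s)" using q unfolding ordered_points_def qs by simp_all
      have rg: "range (vec_nth w) = range (vec_nth (V s))" and inj: "inj (vec_nth w)"
        using V(2)[OF s] w by (simp_all add: enumerates_def)
      have "\<exists>j. w $ i = V s $ j" for i using rangeI[of "vec_nth w" i] unfolding rg image_iff by simp
      then have "\<forall>i. \<exists>j. w $ i = V s $ j" ..
      from choice[OF this] obtain \<pi> where "\<forall>i. w $ i = V s $ \<pi> i" ..
      then have \<pi>: "w $ i = V s $ \<pi> i" for i ..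
      have "inj \<pi>"
      proof (rule injI)
        fix i j assume "\<pi> i = \<pi> j"
        then have "w $ i = w $ j" by (simp only: \<pi>)
        then show "i = j" by (rule injD[OF inj])
      qed
      then have "bij \<pi>" using finite_UNIV_inj_surj[OF finite_class.finite_UNIV] by (intro bijI) blast+
      moreover have "w $ i \<in> ball (v0 $ \<pi> i) e" for i unfolding \<pi> by (rule V(3)[OF s])
      then have "q \<in> u \<pi>" using s w unfolding u_def qs by simp
      ultimately show "q \<in> \<Union> (u ` {\<pi>. bij \<pi>})" by (intro UN_I[of \<pi>]) simp_all
    qed
  qed
  moreover have "openin (top_of_set ?C) (u \<pi>)" for \<pi>
  proof -
    obtain O1 where O1: "open O1" "T = S \<inter> O1" using T(2) by (auto simp: openin_open)
    let ?D = "fst -` O1 \<inter> (\<Inter>i. {q :: 'a \<times> (complex ^ 'n). dist (v0 $ \<pi> i) (snd q $ i) < e})"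
    have "open {q :: 'a \<times> (complex ^ 'n). dist (v0 $ \<pi> i) (snd q $ i) < e}" for i
      by (intro open_Collect_less continuous_intros)
    then have "open ?D"
      by (intro open_Int open_INT ballI open_vimage_fst O1(1)) simp_all
    then have "openin (top_of_set ?C) (?C \<inter> ?D)" by (rule openin_open_Int)
    moreover have "?C \<inter> ?D = u \<pi>"
      unfolding u_def ordered_points_def O1(2) by (simp add: set_eq_iff) blast
    ultimately show ?thesis by simp
  qed
  moreover have "pairwise disjnt (u ` {\<pi>. bij \<pi>})"
  proof (rule pairwiseI)
    fix A B assume "A \<in> u ` {\<pi>. bij \<pi>}" "B \<in> u ` {\<pi>. bij \<pi>}" "A \<noteq> B"
    then obtain \<pi> \<pi>' where AB: "A = u \<pi>" "B = u \<pi>'" "\<pi> \<noteq> \<pi>'" by blast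
    then obtain i where "\<pi> i \<noteq> \<pi>' i" by blast
    then have "ball (v0 $ \<pi> i) e \<inter> ball (v0 $ \<pi>' i) e = {}" by (rule sep)
    then show "disjnt A B" unfolding disjnt_iff u_def AB by blast
  qed
  moreover have "homeomorphism (u \<pi>) T fst (\<lambda>s. (s, \<chi> i. V s $ \<pi> i))" if "bij \<pi>" for \<pi>
  proof -
    have mem: "(s, \<chi> i. V s $ \<pi> i) \<in> u \<pi>" if s: "s \<in> T" for s
    proof -
      have "range (\<lambda>i. V s $ \<pi> i) = vec_nth (V s) ` range \<pi>"
        by (simp only: image_image)
      also have "\<dots> = range (vec_nth (V s))" using \<open>bij \<pi>\<close> by (simp add: bij_is_surj)
      finally have "range (\<lambda>i. V s $ \<pi> i) = range (vec_nth (V s))" .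
      moreover have "inj (\<lambda>i. V s $ \<pi> i)"
        using V(2)[OF s] bij_is_inj[OF \<open>bij \<pi>\<close>] unfolding enumerates_def inj_def by blast
      ultimately show ?thesis using V(2,3)[OF s] s
        by (simp add: u_def enumerates_def vec_lambda_inverse)
    qed
    have "continuous_on T (\<lambda>s. \<chi> i. V s $ \<pi> i)"
      by (intro continuous_on_vec_lambda continuous_on_component V(1)) 
    then show ?thesis
    proof (intro homeomorphismI)
      show "continuous_on (u \<pi>) fst" by (intro continuous_intros)
      show "(\<lambda>s. (s, \<chi> i. V s $ \<pi> i)) ` T \<subseteq> u \<pi>" using mem by blast
      show "fst ` u \<pi> \<subseteq> T" by (auto simp: u_def)
      show "(fst p, \<chi> i. V (fst p) $ \<pi> i) = p" if "p \<in> u \<pi>" for p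
        using that uV[of "fst p" "snd p" \<pi>] by (cases p) (simp add: vec_eq_iff)
    qed (auto intro!: continuous_on_Pair continuous_on_id)
  qed
  ultimately show "\<exists>T. s0 \<in> T \<and> openin (top_of_set S) T \<and> (\<exists>v. \<Union> v = ?C \<inter> fst -` T \<and>
      (\<forall>u\<in>v. openin (top_of_set ?C) u) \<and> pairwise disjnt v \<and> (\<forall>u\<in>v. \<exists>q. homeomorphism u T fst q))"
    using T(1,2) by (intro exI[of _ T] conjI exI[of _ "u ` {\<pi>. bij \<pi>}"]) blast+
qed

text \<open>Path lifting in the covering of ordered point sets.\<close>

lemma follows_exists:
  fixes S :: "'a::real_normed_vector set" and P :: "complex ^ 'n::finite"
  assumes "moving_set CARD('n) S E" "path s" "path_image s \<subseteq> S" "enumerates P (E (pathstart s))"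
  obtains z where "follows E s z" "pathstart z = P"
proof -
  have "(pathstart s, P) \<in> ordered_points S E"
    using assms by (auto simp: ordered_points_def)
  from covering_space_lift_path_strong[OF covering_ordered_points[OF assms(1)] this assms(2,3)]
  obtain h where h: "path h" "path_image h \<subseteq> ordered_points S E" "pathstart h = (pathstart s, P)"
    "\<And>t. t \<in> {0..1} \<Longrightarrow> fst (h t) = s t" by auto
  have "follows E s (snd \<circ> h)"
    unfolding follows_def
  proof (intro conjI ballI)
    show "path (snd \<circ> h)" using h(1) by (intro path_continuous_image) (auto intro: continuous_intros)
    fix t :: real assume t: "t \<in> {0..1}"
    then have "h t \<in> ordered_points S E" using h(2) by (auto simp: path_image_def)
    then show "enumerates ((snd \<circ> h) t) (E (s t))" using h(4)[OF t] by (auto simp: ordered_points_def)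
  qed
  moreover have "pathstart (snd \<circ> h) = P" using h(3) by (simp add: pathstart_compose)
  ultimately show ?thesis using that by blast
qed

text \<open>
  Homotopy lifting in the covering of ordered point sets: this is what makes the braid depend only
  on the homotopy class of the loop of parameters.
\<close>

lemma follows_homotopic:
  fixes S :: "'a::real_normed_vector set" and z z' :: "real \<Rightarrow> complex ^ 'n::finite"
  assumes "moving_set CARD('n) S E" "homotopic_paths S s s'" "follows E s z" "follows E s' z'"
    "pathstart z = pathstart z'"
  shows "homotopic_paths config z z'"
proof -
  let ?C = "ordered_points S E :: ('a \<times> (complex ^ 'n)) set"
  have s: "path s" "path_image s \<subseteq> S" "path s'" "path_image s' \<subseteq> S" "pathstart s = pathstart s'"
    using assms(2) homotopic_paths_imp_path homotopic_paths_imp_subset homotopic_paths_imp_pathstart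
    by blast+
  have "homotopic_paths ?C (\<lambda>t. (s t, z t)) (\<lambda>t. (s' t, z' t))"
  proof (rule covering_space_lift_homotopic_paths[OF covering_ordered_points[OF assms(1)]])
    show "path (\<lambda>t. (s t, z t))" "path (\<lambda>t. (s' t, z' t))"
      using s assms(3,4) by (auto simp: path_def follows_def intro: continuous_intros)
    show "path_image (\<lambda>t. (s t, z t)) \<subseteq> ?C" "path_image (\<lambda>t. (s' t, z' t)) \<subseteq> ?C"
      using s assms(3,4) by (auto simp: path_image_def follows_def ordered_points_def)
    show "pathstart (\<lambda>t. (s t, z t)) = pathstart (\<lambda>t. (s' t, z' t))"
      using s(5) assms(5) by (simp add: pathstart_def)
  qed (use s assms(2) in auto)
  then have "homotopic_paths config (snd \<circ> (\<lambda>t. (s t, z t))) (snd \<circ> (\<lambda>t. (s' t, z' t)))"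
    by (rule homotopic_paths_continuous_image)
      (auto intro: continuous_intros simp: ordered_points_def enumerates_in_config)
  then show ?thesis by (simp add: o_def)
qed

lemma follows_unique:
  fixes S :: "'a::real_normed_vector set" and z z' :: "real \<Rightarrow> complex ^ 'n::finite"
  assumes "moving_set CARD('n) S E" "path s" "path_image s \<subseteq> S" "follows E s z" "follows E s z'"
    "pathstart z = pathstart z'"
  shows "pathfinish z = pathfinish z'"
  using follows_homotopic[OF assms(1) _ assms(4-6)] assms(2,3)
  by (metis homotopic_paths_imp_pathfinish homotopic_paths_refl)

lemma follows_join:
  assumes "follows E s z" "follows E s' z'" "pathfinish z = pathstart z'"
  shows "follows E (s +++ s') (z +++ z')"
  unfolding follows_def
proof
  show "path (z +++ z')" using assms by (simp add: follows_def)
  show "\<forall>t\<in>{0..1}. enumerates ((z +++ z') t) (E ((s +++ s') t))"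
    using assms by (auto simp: follows_def joinpaths_def)
qed

lemma follows_reverse: "follows E s z \<Longrightarrow> follows E (reversepath s) (reversepath z)"
  by (auto simp: follows_def reversepath_def path_reversepath[unfolded reversepath_def])

lemma follows_cong:
  assumes "follows E s z" "\<And>t. t \<in> {0..1} \<Longrightarrow> E' (s' t) = E (s t)"
  shows "follows E' s' z"
  using assms by (simp add: follows_def)

lemma follows_path_image_config:
  "follows E s z \<Longrightarrow> path_image z \<subseteq> config"
  by (auto simp: follows_def path_image_def enumerates_in_config)

section \<open>Homotopies of paths\<close>

lemma homotopic_paths_through_convex:
  fixes S :: "'a::real_normed_vector set"
  assumes "convex S" "path p" "path q" "path_image p \<subseteq> S" "path_image q \<subseteq> S"
    "pathstart q = pathstart p" "pathfinish q = pathfinish p"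
  shows "homotopic_paths S p q"
proof (rule homotopic_paths_linear)
  fix t :: real assume "t \<in> {0..1}"
  then show "closed_segment (p t) (q t) \<subseteq> S"
    using assms by (intro closed_segment_subset) (auto simp: path_image_def)
qed (use assms in auto)

lemma homotopic_paths_square:
  fixes f :: "real \<times> real \<Rightarrow> 'a::topological_space"
  assumes "continuous_on ({0..1} \<times> {0..1}) f" "f \<in> {0..1} \<times> {0..1} \<rightarrow> S"
  shows "homotopic_paths S (\<lambda>t. f (0, t))
           ((\<lambda>s. f (s, 0)) +++ (\<lambda>t. f (1, t)) +++ reversepath (\<lambda>s. f (s, 1)))"
proof -
  let ?Q = "{0..1} \<times> {0..1} :: (real \<times> real) set"
  have Q: "convex ?Q" by (intro convex_Times) auto
  have lp: "path_image (linepath a b) \<subseteq> ?Q" if "a \<in> ?Q" "b \<in> ?Q" for a b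
    using Q that by (simp add: closed_segment_subset)
  have "homotopic_paths ?Q (linepath (0,0) (0,1))
     (linepath (0,0) (1,0) +++ linepath (1,0) (1,1) +++ reversepath (linepath (0,1) (1,1)))"
  proof (rule homotopic_paths_through_convex[OF Q])
    show "path_image (linepath (0,0) (0,1)) \<subseteq> ?Q" by (rule lp) auto
    show "path_image (linepath (0,0) (1,0) +++ linepath (1,0) (1,1) +++
        reversepath (linepath (0,1) (1,1))) \<subseteq> ?Q"
      unfolding reversepath_linepath by (intro subset_path_image_join lp) auto
  qed (auto simp: path_join_imp)
  from homotopic_paths_continuous_image[OF this assms] show ?thesis
    by (simp only: path_compose_join path_compose_reversepath) (simp add: o_def linepath_def)
qed

lemma homotopic_paths_join_left:
  assumes "homotopic_paths S q q'" "path p" "path_image p \<subseteq> S" "pathfinish p = pathstart q"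
  shows "homotopic_paths S (p +++ q) (p +++ q')"
  by (rule homotopic_paths_join) (use assms in auto)

lemma homotopic_paths_join_right:
  assumes "homotopic_paths S p p'" "path q" "path_image q \<subseteq> S" "pathfinish p = pathstart q"
  shows "homotopic_paths S (p +++ q) (p' +++ q)"
  by (rule homotopic_paths_join) (use assms in auto)

text \<open>Conjugation of a loop-like path by another path, in presence of a relabelling \<open>\<sigma>\<close>.\<close>

definition conj_path :: "('a \<Rightarrow> 'a) \<Rightarrow> (real \<Rightarrow> 'a) \<Rightarrow> (real \<Rightarrow> 'a) \<Rightarrow> real \<Rightarrow> 'a::topological_space" where
  "conj_path \<sigma> w k = w +++ k +++ reversepath (\<sigma> \<circ> w)"

lemma homotopic_conj_path:
  assumes "homotopic_paths S w w'" "homotopic_paths S k k'" "pathfinish w = pathstart k"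
    "pathfinish k = \<sigma> (pathfinish w)" "continuous_on S \<sigma>" "\<sigma> \<in> S \<rightarrow> S"
  shows "homotopic_paths S (conj_path \<sigma> w k) (conj_path \<sigma> w' k')"
  unfolding conj_path_def
  using assms homotopic_paths_continuous_image[OF assms(1,5,6)]
  by (intro homotopic_paths_join homotopic_paths_reversepath_D)
    (auto simp: pathfinish_compose dest: homotopic_paths_imp_pathfinish)

lemma conj_path_conj_path:
  assumes "path w1" "path w2" "path k" "path_image w1 \<subseteq> S" "path_image w2 \<subseteq> S" "path_image k \<subseteq> S"
    "pathfinish w1 = pathstart w2" "pathfinish w2 = pathstart k"
    "pathfinish k = \<sigma> (pathfinish w2)" "continuous_on S \<sigma>" "\<sigma> \<in> S \<rightarrow> S"
  shows "homotopic_paths S (conj_path \<sigma> w1 (conj_path \<sigma> w2 k)) (conj_path \<sigma> (w1 +++ w2) k)"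
proof -
  let ?r1 = "reversepath (\<sigma> \<circ> w1)" and ?r2 = "reversepath (\<sigma> \<circ> w2)"
  have p: "path (\<sigma> \<circ> w1)" "path (\<sigma> \<circ> w2)" "path_image (\<sigma> \<circ> w1) \<subseteq> S" "path_image (\<sigma> \<circ> w2) \<subseteq> S"
    using assms by (auto intro!: path_continuous_image continuous_on_subset[OF assms(10)] simp: path_image_compose)
  have "homotopic_paths S ((w2 +++ k +++ ?r2) +++ ?r1) (w2 +++ (k +++ ?r2) +++ ?r1)"
    by (rule homotopic_paths_sym, rule homotopic_paths_assoc)
      (use assms p in \<open>auto simp: pathfinish_compose pathstart_compose path_image_join\<close>)
  moreover have "homotopic_paths S ((k +++ ?r2) +++ ?r1) (k +++ ?r2 +++ ?r1)"
    by (rule homotopic_paths_sym, rule homotopic_paths_assoc)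
      (use assms p in \<open>auto simp: pathfinish_compose pathstart_compose path_image_join\<close>)
  then have "homotopic_paths S (w2 +++ (k +++ ?r2) +++ ?r1) (w2 +++ k +++ ?r2 +++ ?r1)"
    by (rule homotopic_paths_join_left) (use assms in auto)
  ultimately have "homotopic_paths S ((w2 +++ k +++ ?r2) +++ ?r1) (w2 +++ k +++ ?r2 +++ ?r1)"
    by (rule homotopic_paths_trans)
  then have 1: "homotopic_paths S (w1 +++ (w2 +++ k +++ ?r2) +++ ?r1) (w1 +++ w2 +++ k +++ ?r2 +++ ?r1)"
    by (rule homotopic_paths_join_left) (use assms in auto)
  have 2: "homotopic_paths S (w1 +++ w2 +++ k +++ ?r2 +++ ?r1) ((w1 +++ w2) +++ k +++ ?r2 +++ ?r1)"
    by (rule homotopic_paths_assoc)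
      (use assms p in \<open>auto simp: pathfinish_compose pathstart_compose path_image_join\<close>)
  have "reversepath (\<sigma> \<circ> (w1 +++ w2)) = ?r2 +++ ?r1"
    using assms by (simp add: path_compose_join reversepath_joinpaths pathfinish_compose pathstart_compose)
  then show ?thesis unfolding conj_path_def
    using homotopic_paths_trans[OF 1 2] by simp
qed

lemma homotopic_paths_square':
  fixes f :: "real \<times> real \<Rightarrow> 'a::topological_space"
  assumes "continuous_on ({0..1} \<times> {0..1}) f" "\<And>s t. s \<in> {0..1} \<Longrightarrow> t \<in> {0..1} \<Longrightarrow> f (s, t) \<in> S"
    and "\<And>t. t \<in> {0..1} \<Longrightarrow> f (0, t) = l t" "\<And>t. t \<in> {0..1} \<Longrightarrow> f (1, t) = r t"
    and "\<And>s. s \<in> {0..1} \<Longrightarrow> f (s, 0) = b s" "\<And>s. s \<in> {0..1} \<Longrightarrow> f (s, 1) = u s"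
  shows "homotopic_paths S l (b +++ r +++ reversepath u)"
proof -
  let ?l = "\<lambda>t. f (0, t)" and ?R = "(\<lambda>s. f (s, 0)) +++ (\<lambda>t. f (1, t)) +++ reversepath (\<lambda>s. f (s, 1))"
  have h: "homotopic_paths S ?l ?R"
    by (rule homotopic_paths_square[OF assms(1)]) (use assms(2) in auto)
  have "homotopic_paths S l ?l"
    by (rule homotopic_paths_sym, rule homotopic_paths_eq)
      (use homotopic_paths_imp_path[OF h] homotopic_paths_imp_subset[OF h] assms(3) in auto)
  moreover have "homotopic_paths S ?R (b +++ r +++ reversepath u)"
    by (rule homotopic_paths_eq)
      (use homotopic_paths_imp_path[OF h] homotopic_paths_imp_subset[OF h] assms(4-6)
        in \<open>auto simp: joinpaths_def reversepath_def\<close>)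
  ultimately show ?thesis using h homotopic_paths_trans by blast
qed

section \<open>Twists\<close>

definition swap_labels :: "'n \<Rightarrow> 'n \<Rightarrow> complex ^ 'n::finite \<Rightarrow> complex ^ 'n" where
  "swap_labels i j v = (\<chi> k. if k = i then v $ j else if k = j then v $ i else v $ k)"

lemma continuous_on_swap_labels [continuous_intros]: "continuous_on S (swap_labels i j)"
  unfolding swap_labels_def
proof (rule continuous_on_vec_lambda)
  show "continuous_on S (\<lambda>v. if k = i then v $ j else if k = j then v $ i else v $ k)" for k
    by (cases "k = i"; cases "k = j") (auto intro!: continuous_intros)
qed

lemma swap_labels_swap_labels [simp]: "swap_labels i j (swap_labels i j v) = v"
  by (auto simp: swap_labels_def vec_eq_iff)

lemma enumerates_swap_labels: "enumerates v A \<Longrightarrow> enumerates (swap_labels i j v) A"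
proof -
  assume v: "enumerates v A"
  let ?\<sigma> = "\<lambda>k. if k = i then j else if k = j then i else k"
  have \<sigma>: "vec_nth (swap_labels i j v) = vec_nth v \<circ> ?\<sigma>" by (auto simp: swap_labels_def fun_eq_iff)
  have inv: "?\<sigma> \<circ> ?\<sigma> = id" by (auto simp: fun_eq_iff)
  then have bij: "bij ?\<sigma>" by (rule o_bij) (rule inv)
  have "range (vec_nth v \<circ> ?\<sigma>) = vec_nth v ` range ?\<sigma>" by (rule image_comp[symmetric])
  also have "\<dots> = range (vec_nth v)" by (simp only: bij_is_surj[OF bij])
  finally show ?thesis using v bij_is_inj[OF bij] unfolding enumerates_def \<sigma>
    by (blast intro: inj_compose)
qed

lemma swap_labels_config: "v \<in> config \<Longrightarrow> swap_labels i j v \<in> config"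
  using enumerates_swap_labels[of v "range (vec_nth v)" i j] by (simp add: enumerates_def config_def)

text \<open>The two strands \<open>i\<close>, \<open>j\<close> on the image of the unit circle after \<open>t\<close> half turns.\<close>

definition twist ::
    "(complex \<Rightarrow> complex) \<Rightarrow> 'n \<Rightarrow> 'n \<Rightarrow> complex ^ 'n::finite \<Rightarrow> real \<Rightarrow> complex ^ 'n" where
  "twist \<phi> i j P t =
     (\<chi> k. if k = i then \<phi> (- cis (pi * t)) else if k = j then \<phi> (cis (pi * t)) else P $ k)"

lemma twist_0: "\<phi> (-1) = P $ i \<Longrightarrow> \<phi> 1 = P $ j \<Longrightarrow> twist \<phi> i j P 0 = P"
  by (auto simp: twist_def vec_eq_iff)

text \<open>
  A half turn exchanges the labels. Hence \<open>n\<close> half turns are the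
  \<open>n\<close>-fold product of one of them, up to the parametrisation.
\<close>

lemma twist_add_1: "i \<noteq> j \<Longrightarrow> twist \<phi> i j P (t + 1) = swap_labels i j (twist \<phi> i j P t)"
  by (auto simp: twist_def swap_labels_def vec_eq_iff distrib_left cis_mult[symmetric])

lemma twist_add_nat:
  "i \<noteq> j \<Longrightarrow> twist \<phi> i j P (real n + t) =
     (if even n then twist \<phi> i j P t else swap_labels i j (twist \<phi> i j P t))"
proof (induction n)
  case (Suc n)
  then show ?case using twist_add_1[of i j \<phi> P "real n + t"] by (simp add: add_ac)
qed simp

lemma twist_config:
  assumes "inj_on \<phi> (sphere 0 1)" "P \<in> config" "\<And>k. k \<noteq> i \<Longrightarrow> k \<noteq> j \<Longrightarrow> P $ k \<notin> \<phi> ` sphere 0 1"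
  shows "twist \<phi> i j P t \<in> config"
proof -
  have c: "cis (pi * t) \<in> sphere 0 1" "- cis (pi * t) \<in> sphere 0 1" by simp_all
  moreover have "cis (pi * t) \<noteq> - cis (pi * t)"
  proof
    assume "cis (pi * t) = - cis (pi * t)"
    then have "cis (pi * t) + cis (pi * t) = 0" by (simp only: eq_neg_iff_add_eq_0)
    then have "2 * cis (pi * t) = 0" by (simp only: mult_2)
    then show False by simp
  qed
  ultimately have "\<phi> (cis (pi * t)) \<noteq> \<phi> (- cis (pi * t))"
    using assms(1) by (meson inj_onD)
  then have ne: "\<phi> (- cis (pi * t)) \<noteq> \<phi> (cis (pi * t))" by metis
  have P: "P $ k = P $ l \<longleftrightarrow> k = l" for k l using assms(2) by (simp add: config_def inj_eq)
  have o: "P $ k \<noteq> \<phi> (cis (pi * t))" "P $ k \<noteq> \<phi> (- cis (pi * t))" if "k \<noteq> i" "k \<noteq> j" for k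
    using assms(3)[OF that] c by blast+
  have "k = l" if "twist \<phi> i j P t $ k = twist \<phi> i j P t $ l" for k l
    using that ne ne[symmetric] o[of k] o[of l] o[of k, THEN not_sym] o[of l, THEN not_sym]
    by (auto simp: twist_def P split: if_splits)
  then show ?thesis unfolding config_def inj_def by blast
qed

lemma continuous_on_twist:
  assumes "continuous_on (S \<times> sphere 0 1) (\<lambda>(s, z). \<phi> s z)" "continuous_on S v" "continuous_on S' (\<lambda>p. f p)"
    "continuous_on S' g" "g ` S' \<subseteq> S"
  shows "continuous_on S' (\<lambda>p. twist (\<phi> (g p)) i j (v (g p)) (f p :: real))"
proof -
  have "continuous_on S' (\<lambda>p. \<phi> (g p) (- cis (pi * f p)))" "continuous_on S' (\<lambda>p. \<phi> (g p) (cis (pi * f p)))"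
    by (rule continuous_on_compose2[OF assms(1), of S' "\<lambda>p. (g p, - cis (pi * f p))", simplified],
        use assms in \<open>auto intro!: continuous_intros\<close>)
      (rule continuous_on_compose2[OF assms(1), of S' "\<lambda>p. (g p, cis (pi * f p))", simplified],
        use assms in \<open>auto intro!: continuous_intros\<close>)
  note c1 = this
  have c2: "continuous_on S' (\<lambda>p. v (g p) $ k)" for k
    using continuous_on_compose2[OF assms(2,4,5)] by (intro continuous_on_component) auto
  show ?thesis
    unfolding twist_def
  proof (intro continuous_on_vec_lambda)
    show "continuous_on S' (\<lambda>p. if k = i then \<phi> (g p) (- cis (pi * f p))
      else if k = j then \<phi> (g p) (cis (pi * f p)) else v (g p) $ k)" for k
      using c1 c2[of k] by (cases "k = i"; cases "k = j") auto
  qed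
qed

lemma braid_power_twist:
  fixes P :: "complex ^ 'n::finite"
  assumes "i \<noteq> j" "P \<in> config" "\<phi> (-1) = P $ i" "\<phi> 1 = P $ j"
  shows "\<exists>g. path g \<and> pathstart g = 0 \<and> pathfinish g = real n \<and>
    braid_power (twist \<phi> i j P) n = twist \<phi> i j P \<circ> g"
proof (induction n)
  case 0
  show ?case by (intro exI[of _ "\<lambda>t. 0"]) (auto simp: pathstart_def pathfinish_def path_def fun_eq_iff)
next
  case (Suc n)
  let ?T = "twist \<phi> i j P"
  let ?\<sigma> = "\<lambda>k. if even n then k else if k = i then j else if k = j then i else k"
  from Suc obtain g where g: "path g" "pathstart g = 0" "pathfinish g = real n"
    "braid_power ?T n = ?T \<circ> g" by blast
  have \<sigma>: "?T (real n + t) $ k = ?T t $ ?\<sigma> k" for t k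
    by (simp add: twist_add_nat[OF assms(1)] swap_labels_def)
  have T0: "?T 0 = P" using assms by (intro twist_0) auto
  have "(THE l. pathstart ?T $ l = pathfinish (?T \<circ> g) $ k) = ?\<sigma> k" for k
  proof (rule the_equality)
    have *: "pathstart ?T = P" "pathfinish (?T \<circ> g) $ k = P $ ?\<sigma> k"
      using \<sigma>[of 0 k] T0 g(3) by (simp_all add: pathstart_def pathfinish_compose)
    then show "pathstart ?T $ ?\<sigma> k = pathfinish (?T \<circ> g) $ k" by simp
    show "l = ?\<sigma> k" if "pathstart ?T $ l = pathfinish (?T \<circ> g) $ k" for l
      using that * assms(2) by (simp only: config_def inj_eq mem_Collect_eq)
  qed
  then have "braid_power ?T (Suc n) = (?T \<circ> g) +++ (?T \<circ> (\<lambda>t. real n + t))"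
    by (simp add: g(4) braid_mult_def o_def \<sigma>[symmetric])
  also have "\<dots> = ?T \<circ> (g +++ (\<lambda>t. real n + t))" by (simp add: path_compose_join)
  finally have "braid_power ?T (Suc n) = ?T \<circ> (g +++ (\<lambda>t. real n + t))" .
  moreover have "path (\<lambda>t. real n + t)" by (auto simp: path_def intro!: continuous_intros)
  moreover have "pathstart (\<lambda>t. real n + t) = real n" "pathfinish (\<lambda>t. real n + t) = real (Suc n)"
    by (simp_all add: pathstart_def pathfinish_def)
  ultimately show ?case using g
    by (intro exI[of _ "g +++ (\<lambda>t. real n + t)"]) simp
qed

lemma braid_power_twist_homotopic:
  fixes P :: "complex ^ 'n::finite"
  assumes "i \<noteq> j" "P \<in> config" "\<phi> (-1) = P $ i" "\<phi> 1 = P $ j" "continuous_on (sphere 0 1) \<phi>"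
    "inj_on \<phi> (sphere 0 1)" "\<And>k. k \<noteq> i \<Longrightarrow> k \<noteq> j \<Longrightarrow> P $ k \<notin> \<phi> ` sphere 0 1"
  shows "homotopic_paths config (braid_power (twist \<phi> i j P) n) (\<lambda>t. twist \<phi> i j P (real n * t))"
proof -
  let ?T = "twist \<phi> i j P"
  obtain g where g: "path g" "pathstart g = 0" "pathfinish g = real n"
    "braid_power ?T n = ?T \<circ> g" using braid_power_twist[OF assms(1-4)] by blast
  have "homotopic_paths UNIV g (\<lambda>t. real n * t)"
    by (rule homotopic_paths_through_convex)
      (use g in \<open>auto simp: pathstart_def pathfinish_def path_def intro!: continuous_intros\<close>)
  moreover have "continuous_on UNIV ?T"
    using continuous_on_twist[of UNIV "\<lambda>_. \<phi>" "\<lambda>_. P" UNIV "\<lambda>t. t" "\<lambda>t. 0" i j]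
      continuous_on_compose2[OF assms(5), of "UNIV \<times> sphere 0 1" snd]
    by (auto simp: case_prod_unfold continuous_on_snd)
  moreover have "?T \<in> UNIV \<rightarrow> config" using twist_config[OF assms(6,2,7)] by auto
  ultimately have "homotopic_paths config (?T \<circ> g) (?T \<circ> (\<lambda>t. real n * t))"
    by (rule homotopic_paths_continuous_image)
  then show ?thesis by (simp add: g(4) o_def)
qed

text \<open>
  Moving a disc along with the configuration conjugates the twist in it: the twists at all times
  fill a square whose sides are the two twists and the motion of the configuration.
\<close>

lemma twist_transport:
  fixes v :: "real \<Rightarrow> complex ^ 'n::finite"
  assumes "i \<noteq> j" "odd n" "path v" "path_image v \<subseteq> config"
    "continuous_on ({0..1} \<times> sphere 0 1) (\<lambda>(s, z). \<phi> s z)"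
    "\<And>s. s \<in> {0..1} \<Longrightarrow> inj_on (\<phi> s) (sphere 0 1)"
    "\<And>s. s \<in> {0..1} \<Longrightarrow> \<phi> s (-1) = v s $ i" "\<And>s. s \<in> {0..1} \<Longrightarrow> \<phi> s 1 = v s $ j"
    "\<And>s k. s \<in> {0..1} \<Longrightarrow> k \<noteq> i \<Longrightarrow> k \<noteq> j \<Longrightarrow> v s $ k \<notin> \<phi> s ` sphere 0 1"
  shows "homotopic_paths config (\<lambda>t. twist (\<phi> 0) i j (v 0) (real n * t))
    (conj_path (swap_labels i j) v (\<lambda>t. twist (\<phi> 1) i j (v 1) (real n * t)))"
  unfolding conj_path_def
proof (rule homotopic_paths_square')
  let ?f = "\<lambda>p. twist (\<phi> (fst p)) i j (v (fst p)) (real n * snd p)"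
  show "continuous_on ({0..1} \<times> {0..1}) ?f"
    by (rule continuous_on_twist[OF assms(5) assms(3)[unfolded path_def]]) (auto intro!: continuous_intros)
  show "?f (s, t) \<in> config" if "s \<in> {0..1}" "t \<in> {0..1}" for s t
    unfolding fst_conv snd_conv
    by (rule twist_config) (use assms(4,6,9) that in \<open>auto simp: path_image_def\<close>)
  have *: "twist (\<phi> s) i j (v s) 0 = v s" if "s \<in> {0..1}" for s
    by (rule twist_0) (use assms(7,8) that in auto)
  show "?f (s, 0) = v s" if "s \<in> {0..1}" for s using *[OF that] by simp
  show "?f (s, 1) = (swap_labels i j \<circ> v) s" if "s \<in> {0..1}" for s
    using *[OF that] twist_add_nat[OF assms(1), of "\<phi> s" "v s" n 0] assms(2) by simp
qed auto

section \<open>Discs around segments\<close>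

text \<open>
  The squeezing is the identity on the real axis of the unit disc, and for small \<open>e\<close> the disc of
  radius \<open>2\<close> is mapped close to the interval \<open>[-1, 1]\<close>.
\<close>

definition thin :: "real \<Rightarrow> complex \<Rightarrow> complex" where
  "thin e z = (let k = e + (1 - e) / max 1 (norm z) in Complex (k * Re z) (e * (k * Im z)))"

definition seg_disc :: "real \<Rightarrow> complex \<Rightarrow> complex \<Rightarrow> complex \<Rightarrow> complex" where
  "seg_disc e a m z = (a + m) / 2 + (m - a) / 2 * thin e z"

lemma thin_unit: "norm z \<le> 1 \<Longrightarrow> thin e z = Complex (Re z) (e * Im z)"
  by (simp add: thin_def max_def)

lemma seg_disc_ends [simp]: "seg_disc e a m (-1) = a" "seg_disc e a m 1 = m"
  by (simp_all add: seg_disc_def thin_unit field_simps Complex_eq)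

lemma continuous_on_thin [continuous_intros]:
  "continuous_on S f \<Longrightarrow> continuous_on S (\<lambda>x. thin e (f x))"
  unfolding thin_def Let_def Complex_eq
  by (intro continuous_intros) auto

lemma inj_thin:
  assumes e: "0 < e" "e \<le> 1"
  shows "inj (thin e)"
proof (rule injI)
  fix z w assume eq: "thin e z = thin e w"
  define k where "k x = e + (1 - e) / max 1 x" for x :: real
  have k: "k x > 0" for x using e by (auto simp: k_def intro!: add_pos_nonneg)
  have "k (norm z) * Re z = k (norm w) * Re w" "k (norm z) * Im z = k (norm w) * Im w"
    using eq e by (auto simp: thin_def Let_def k_def)
  then have kk: "k (norm z) *\<^sub>R z = k (norm w) *\<^sub>R w" by (simp add: complex_eq_iff)
  then have "norm (k (norm z) *\<^sub>R z) = norm (k (norm w) *\<^sub>R w)" by simp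
  then have *: "k (norm z) * norm z = k (norm w) * norm w" using k by (simp add: abs_of_pos)
  have mono: "k x * x < k y * y" if "0 \<le> x" "x < y" for x y
  proof -
    have f: "k x * x = e * x + (1 - e) * min 1 x" if "0 \<le> x" for x
    proof (cases "x \<le> 1")
      case False
      then have "x > 0" "max 1 x = x" "min 1 x = 1" by linarith+
      then show ?thesis by (simp add: k_def distrib_right)
    qed (use that in \<open>simp add: k_def algebra_simps\<close>)
    have "e * x < e * y" using that e by simp
    moreover have "(1 - e) * min 1 x \<le> (1 - e) * min 1 y" using that e by (intro mult_left_mono) auto
    ultimately show ?thesis using f that by simp
  qed
  have "norm z = norm w"
    using mono[of "norm z" "norm w"] mono[of "norm w" "norm z"] * by (cases "norm z" "norm w" rule: linorder_cases) auto
  then show "z = w" using kk k[of "norm w"] by simp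
qed

lemma thin_near:
  assumes e: "0 < e" "e \<le> 1" and z: "norm z \<le> 2"
  obtains x where "x \<in> {-1..1}" "norm (thin e z - of_real x) \<le> 3 * e"
proof -
  define k where "k = e + (1 - e) / max 1 (norm z)"
  have k0: "k > 0" using e by (auto simp: k_def intro!: add_pos_nonneg)
  have kz: "k * norm z \<le> 1 + e"
  proof -
    have "k * norm z = e * norm z + (1 - e) * min 1 (norm z)"
    proof (cases "norm z \<le> 1")
      case False
      then have "norm z > 0" "max 1 (norm z) = norm z" "min 1 (norm z) = 1" by linarith+
      then show ?thesis by (simp add: k_def distrib_right)
    qed (simp add: k_def algebra_simps)
    moreover have "e * norm z \<le> e * 2" using e z by (intro mult_left_mono) auto
    moreover have "(1 - e) * min 1 (norm z) \<le> (1 - e) * 1" using e by (intro mult_left_mono) auto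
    ultimately show ?thesis by simp
  qed
  have re: "\<bar>k * Re z\<bar> \<le> 1 + e" and im: "\<bar>k * Im z\<bar> \<le> 1 + e"
  proof -
    have "k * \<bar>Re z\<bar> \<le> k * norm z" "k * \<bar>Im z\<bar> \<le> k * norm z"
      using k0 by (auto intro!: mult_left_mono abs_Re_le_cmod abs_Im_le_cmod)
    then have "k * \<bar>Re z\<bar> \<le> 1 + e" "k * \<bar>Im z\<bar> \<le> 1 + e" using kz by linarith+
    then show "\<bar>k * Re z\<bar> \<le> 1 + e" "\<bar>k * Im z\<bar> \<le> 1 + e" using k0 by (simp_all add: abs_mult)
  qed
  define x where "x = max (-1) (min 1 (k * Re z))"
  have x: "x \<in> {-1..1}" "\<bar>k * Re z - x\<bar> \<le> e"
    using re e by (auto simp: x_def)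
  have "norm (thin e z - of_real x) \<le> \<bar>k * Re z - x\<bar> + \<bar>e * (k * Im z)\<bar>"
    using cmod_le[of "thin e z - of_real x"] by (simp add: thin_def Let_def k_def)
  also have "\<dots> \<le> e + e * 2"
  proof (intro add_mono x(2))
    show "\<bar>e * (k * Im z)\<bar> \<le> e * 2"
      using im e unfolding abs_mult[of e] by (intro mult_mono) auto
  qed
  finally show ?thesis using that x(1) by simp
qed

lemma seg_disc_avoids_point:
  fixes a m q :: "real \<Rightarrow> complex"
  assumes cont: "continuous_on {0..1} a" "continuous_on {0..1} m" "continuous_on {0..1} q"
    and q: "\<And>s. s \<in> {0..1} \<Longrightarrow> q s \<notin> closed_segment (a s) (m s)"
  obtains e0 where "0 < e0" "e0 \<le> 1"
    "\<And>e s. 0 < e \<Longrightarrow> e \<le> e0 \<Longrightarrow> s \<in> {0..1} \<Longrightarrow> q s \<notin> seg_disc e (a s) (m s) ` cball 0 2"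
proof -
  let ?K = "{0..1} \<times> {-1..1} :: (real \<times> real) set"
  define g where "g = (\<lambda>(s, x). norm (q s - ((a s + m s) / 2 + (m s - a s) / 2 * of_real x)))"
  have K: "compact ?K" "?K \<noteq> {}" by (auto intro: compact_Times)
  have comp: "continuous_on ?K (\<lambda>p. f (fst p))" if "continuous_on {0..1} f" for f :: "real \<Rightarrow> complex"
    by (rule continuous_on_compose2[OF that]) (auto intro!: continuous_intros)
  have "continuous_on ?K g"
    unfolding g_def case_prod_unfold by (intro continuous_intros comp cont) auto
  from continuous_attains_inf[OF K this] obtain p where p: "p \<in> ?K" "\<And>y. y \<in> ?K \<Longrightarrow> g p \<le> g y"
    by blast
  have "g p > 0"
  proof -
    obtain s x where [simp]: "p = (s, x)" by (cases p)
    have "(a s + m s) / 2 + (m s - a s) / 2 * of_real x \<in> closed_segment (a s) (m s)"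
      unfolding in_segment using p(1)
      by (intro exI[of _ "(1 + x) / 2"])
        (auto simp: scaleR_conv_of_real add_divide_distrib diff_divide_distrib algebra_simps)
    then have "q s \<noteq> (a s + m s) / 2 + (m s - a s) / 2 * of_real x" using q[of s] p(1) by auto
    then show ?thesis by (simp add: g_def)
  qed
  have "compact ((\<lambda>s. (m s - a s) / 2) ` {0..1})"
    by (intro compact_continuous_image continuous_intros cont) auto
  then obtain B where B: "B > 0" "\<And>s. s \<in> {0..1} \<Longrightarrow> norm ((m s - a s) / 2) \<le> B"
    by (auto dest!: compact_imp_bounded simp: bounded_pos)
  define e0 where "e0 = min 1 (g p / (6 * B))"
  show ?thesis
  proof
    show "0 < e0" "e0 \<le> 1" using \<open>g p > 0\<close> B(1) by (auto simp: e0_def)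
    fix e s :: real assume e: "0 < e" "e \<le> e0" and s: "s \<in> {0..1}"
    show "q s \<notin> seg_disc e (a s) (m s) ` cball 0 2"
    proof
      assume "q s \<in> seg_disc e (a s) (m s) ` cball 0 2"
      then obtain z where z: "norm z \<le> 2" "q s = seg_disc e (a s) (m s) z" by auto
      obtain x where x: "x \<in> {-1..1}" "norm (thin e z - of_real x) \<le> 3 * e"
        by (rule thin_near[of e z]) (use e z(1) \<open>e0 \<le> 1\<close> in auto)
      have "g (s, x) = norm ((m s - a s) / 2 * (thin e z - of_real x))"
        by (simp add: g_def z(2) seg_disc_def right_diff_distrib)
      also have "\<dots> = norm ((m s - a s) / 2) * norm (thin e z - of_real x)" by (rule norm_mult)
      also have "\<dots> \<le> B * (3 * e)" using B s x by (intro mult_mono) auto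
      also have "\<dots> \<le> B * (3 * (g p / (6 * B)))" using e B(1) by (intro mult_left_mono) (auto simp: e0_def)
      also have "\<dots> < g p" using B(1) \<open>g p > 0\<close> by (simp add: field_simps)
      finally show False using p(2)[of "(s, x)"] s x(1) by auto
    qed
  qed
qed

text \<open>
  The squeezed disc lies close to its segment, so it avoids points off the segment, uniformly
  along a path, when \<open>e\<close> is small.
\<close>

lemma seg_disc_avoids:
  fixes v :: "real \<Rightarrow> complex ^ 'n::finite"
  assumes v: "path v"
    and seg: "\<And>s k. s \<in> {0..1} \<Longrightarrow> k \<noteq> i \<Longrightarrow> k \<noteq> j \<Longrightarrow> v s $ k \<notin> closed_segment (v s $ i) (v s $ j)"
  obtains e where "0 < e" "e \<le> 1"
    "\<And>s k. s \<in> {0..1} \<Longrightarrow> k \<noteq> i \<Longrightarrow> k \<noteq> j \<Longrightarrow> v s $ k \<notin> seg_disc e (v s $ i) (v s $ j) ` cball 0 2"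
proof -
  have c: "continuous_on {0..1} (\<lambda>s. v s $ k)" for k
    using v unfolding path_def by (rule continuous_on_component)
  have "\<exists>e0. 0 < e0 \<and> e0 \<le> 1 \<and> (k \<noteq> i \<longrightarrow> k \<noteq> j \<longrightarrow> (\<forall>e s. 0 < e \<longrightarrow> e \<le> e0 \<longrightarrow> s \<in> {0..1} \<longrightarrow>
      v s $ k \<notin> seg_disc e (v s $ i) (v s $ j) ` cball 0 2))" for k
  proof (cases "k \<noteq> i \<and> k \<noteq> j")
    case True
    then have "v s $ k \<notin> closed_segment (v s $ i) (v s $ j)" if "s \<in> {0..1}" for s
      using seg that by blast
    from seg_disc_avoids_point[OF c c c this] obtain e0 where "0 < e0" "e0 \<le> 1"
      "\<And>e s. 0 < e \<Longrightarrow> e \<le> e0 \<Longrightarrow> s \<in> {0..1} \<Longrightarrow> v s $ k \<notin> seg_disc e (v s $ i) (v s $ j) ` cball 0 2"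
      by blast
    then show ?thesis by blast
  qed (auto intro: exI[of _ 1])
  then obtain e0 where e0: "\<And>k. 0 < e0 k \<and> e0 k \<le> 1 \<and> (k \<noteq> i \<longrightarrow> k \<noteq> j \<longrightarrow> (\<forall>e s. 0 < e \<longrightarrow> e \<le> e0 k \<longrightarrow>
      s \<in> {0..1} \<longrightarrow> v s $ k \<notin> seg_disc e (v s $ i) (v s $ j) ` cball 0 2))" by metis
  define e where "e = Min (range e0)"
  have e: "0 < e" "\<And>k. e \<le> e0 k" using e0 by (auto simp: e_def)
  moreover have "e \<le> 1" using e(2)[of undefined] e0[of undefined] by linarith
  ultimately show ?thesis using that[of e] e0 by meson
qed

lemma inj_seg_disc: "0 < e \<Longrightarrow> e \<le> 1 \<Longrightarrow> a \<noteq> m \<Longrightarrow> inj (seg_disc e a m)"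
  using inj_thin[of e] by (auto simp: seg_disc_def inj_def)

lemma continuous_on_seg_disc [continuous_intros]:
  "continuous_on S a \<Longrightarrow> continuous_on S m \<Longrightarrow> continuous_on S f \<Longrightarrow>
    continuous_on S (\<lambda>x. seg_disc e (a x) (m x) (f x))"
  unfolding seg_disc_def by (intro continuous_intros) auto

lemma seg_disc_segment: "seg_disc e a m ` closed_segment (-1) 1 = closed_segment a m"
proof -
  have "closed_segment (-1) (1::complex) = of_real ` {-1..1::real}"
    using closed_segment_of_real[of "-1" 1, where 'a=complex] by (simp add: closed_segment_eq_real_ivl)
  moreover have "seg_disc e a m (of_real x) = (1 - (1 + x) / 2) *\<^sub>R a + ((1 + x) / 2) *\<^sub>R m" if "x \<in> {-1..1}" for x
  proof -
    have "thin e (of_real x) = of_real x" using that by (subst thin_unit) (auto simp: Complex_eq)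
    then show ?thesis by (simp add: seg_disc_def scaleR_conv_of_real field_simps)
  qed
  ultimately have "seg_disc e a m ` closed_segment (-1) 1 =
      (\<lambda>u. (1 - u) *\<^sub>R a + u *\<^sub>R m) ` (\<lambda>x. (1 + x) / 2) ` {-1..1}"
    by (auto simp: image_image)
  also have "(\<lambda>x. (1 + x) / 2) ` {-1..1} = {0..1::real}"
  proof
    show "{0..1} \<subseteq> (\<lambda>x. (1 + x) / 2) ` {-1..1::real}"
    proof
      fix u :: real assume "u \<in> {0..1}"
      then show "u \<in> (\<lambda>x. (1 + x) / 2) ` {-1..1}" by (intro image_eqI[of _ _ "2 * u - 1"]) auto
    qed
  qed auto
  finally show ?thesis by (simp add: closed_segment_image_interval)
qed


text \<open>A twist of the plane: the circle of radius \<open>\<rho>\<close> is turned by the angle \<open>s * \<theta> \<rho>\<close>.\<close>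

definition rot :: "(real \<Rightarrow> real) \<Rightarrow> real \<Rightarrow> complex \<Rightarrow> complex" where
  "rot \<theta> s z = z * cis (s * \<theta> (norm z))"

lemma norm_rot [simp]: "norm (rot \<theta> s z) = norm z"
  by (simp add: rot_def norm_mult)

lemma rot_0 [simp]: "rot \<theta> 0 z = z"
  by (simp add: rot_def)

text \<open>
  Circles around \<open>0\<close> are preserved, so the rotation can be undone radius by radius.
\<close>

lemma inj_rot: "inj (rot \<theta> s)"
proof (rule injI)
  fix z w assume eq: "rot \<theta> s z = rot \<theta> s w"
  then have "norm z = norm w" by (metis norm_rot)
  then show "z = w" using eq by (simp add: rot_def)
qed

lemma continuous_on_rot:
  assumes "continuous_on UNIV \<theta>" "continuous_on S f" "continuous_on S g"
  shows "continuous_on S (\<lambda>x. rot \<theta> (f x) (g x))"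
  unfolding rot_def
  by (intro continuous_intros assms continuous_on_compose2[OF assms(1)]) auto

text \<open>
  Along the isotopy from the straight disc to the rotated one the winding number cannot change.
\<close>

lemma winding_number_rot_seg_disc:
  assumes \<theta>: "continuous_on UNIV \<theta>" and e: "0 < e" "e \<le> 1" and am: "a \<noteq> m"
  defines "\<phi> \<equiv> rot \<theta> 1 \<circ> seg_disc e a m"
  shows "winding_number (\<phi> \<circ> circlepath 0 1) (\<phi> 0) = 1"
proof -
  let ?d = "(m - a) / 2" and ?D = "seg_disc e a m"
  define L where "L s t = rot \<theta> s (?D (circlepath 0 1 t)) - rot \<theta> s (?D 0)" for s t
  define M where "M u t = exp ((1 - complex_of_real u) * Ln ?d) *
      (of_real (cos (2 * pi * t)) + \<i> * of_real (((1 - u) * e + u) * sin (2 * pi * t)))" for u t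
  have circ: "circlepath 0 1 t = cis (2 * pi * t)" for t
    by (simp add: circlepath cis_conv_exp mult_ac)
  have "homotopic_loops (- {0}) (L 0) (L 1)"
    unfolding homotopic_loops
  proof (intro exI[of _ "\<lambda>(s, t). L s t"] conjI ballI)
    show "continuous_on ({0..1} \<times> {0..1}) (\<lambda>(s, t). L s t)"
      unfolding L_def case_prod_unfold circ
      by (intro continuous_intros continuous_on_rot[OF \<theta>])
    show "(\<lambda>(s, t). L s t) \<in> {0..1} \<times> {0..1} \<rightarrow> - {0}"
    proof clarsimp
      fix s t assume "L s t = 0"
      then have "?D (cis (2 * pi * t)) = ?D 0"
        using inj_rot[of \<theta> s] by (simp add: L_def circ inj_eq)
      then show False using inj_seg_disc[OF e am] by (simp add: inj_eq)
    qed
    show "pathfinish ((\<lambda>(s, t). L s t) \<circ> Pair s) = pathstart ((\<lambda>(s, t). L s t) \<circ> Pair s)" for s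
      by (simp add: pathfinish_def pathstart_def L_def circ)
  qed auto
  then have "winding_number (L 0) 0 = winding_number (L 1) 0"
    by (rule winding_number_homotopic_loops)
  moreover have "homotopic_loops (- {0}) (M 0) (M 1)"
    unfolding homotopic_loops
  proof (intro exI[of _ "\<lambda>(s, t). M s t"] conjI ballI)
    show "continuous_on ({0..1} \<times> {0..1}) (\<lambda>(s, t). M s t)"
      unfolding M_def case_prod_unfold by (intro continuous_intros)
    show "(\<lambda>(s, t). M s t) \<in> {0..1} \<times> {0..1} \<rightarrow> - {0}"
    proof clarsimp
      fix u t assume u: "0 \<le> u" "u \<le> 1" and "M u t = 0"
      then have 0: "complex_of_real (cos (2 * pi * t)) + \<i> * complex_of_real (((1 - u) * e + u) * sin (2 * pi * t)) = 0"
        unfolding M_def mult_eq_0_iff by (metis exp_not_eq_zero)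
      then have "Re (complex_of_real (cos (2 * pi * t)) + \<i> * complex_of_real (((1 - u) * e + u) * sin (2 * pi * t))) = 0"
        "Im (complex_of_real (cos (2 * pi * t)) + \<i> * complex_of_real (((1 - u) * e + u) * sin (2 * pi * t))) = 0"
        by (simp_all only: zero_complex.sel)
      then have cs: "cos (2 * pi * t) = 0" "((1 - u) * e + u) * sin (2 * pi * t) = 0" by simp_all
      have "(1 - u) * e + u > 0" using u e by (cases "u = 0") (auto intro!: add_nonneg_pos)
      then have "sin (2 * pi * t) = 0" using cs by simp
      then show False using cs(1) sin_cos_squared_add[of "2 * pi * t"] by simp
    qed
    show "pathfinish ((\<lambda>(s, t). M s t) \<circ> Pair s) = pathstart ((\<lambda>(s, t). M s t) \<circ> Pair s)" for s
      by (simp add: pathfinish_def pathstart_def M_def)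
  qed auto
  then have "winding_number (M 0) 0 = winding_number (M 1) 0"
    by (rule winding_number_homotopic_loops)
  moreover have "L 0 = M 0"
  proof
    fix t
    have "thin e (cis (2 * pi * t)) = of_real (cos (2 * pi * t)) + \<i> * of_real (e * sin (2 * pi * t))"
      by (simp add: thin_unit Complex_eq)
    moreover have "thin e 0 = 0" by (simp add: thin_unit Complex_eq)
    moreover have "exp (Ln ?d) = ?d" using am by (intro exp_Ln) simp
    ultimately show "L 0 t = M 0 t"
      by (simp add: L_def M_def circ seg_disc_def)
  qed
  moreover have "M 1 = circlepath 0 1"
    by (simp add: fun_eq_iff M_def circ complex_eq_iff)
  moreover have "winding_number (circlepath 0 1) 0 = 1" by (rule winding_number_circlepath) simp
  moreover have "winding_number (\<phi> \<circ> circlepath 0 1) (\<phi> 0) = winding_number (L 1) 0"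
  proof -
    have "L 1 = (\<lambda>t. (\<phi> \<circ> circlepath 0 1) t - \<phi> 0)" by (simp add: fun_eq_iff L_def \<phi>_def)
    then show ?thesis by (simp only: winding_number_offset[of "\<phi> \<circ> circlepath 0 1" "\<phi> 0"])
  qed
  ultimately show ?thesis by simp
qed

text \<open>
  A rotated segment is an arc, and the rotated disc is a neighbourhood as required for the half-
  twist around it.
\<close>

lemma half_twist_rot_seg_disc:
  fixes Q :: "complex ^ 'n::finite"
  assumes \<theta>: "continuous_on UNIV \<theta>" and e: "0 < e" "e \<le> 1" and Q: "Q \<in> config" "i \<noteq> j"
    and free: "\<And>k. k \<noteq> i \<Longrightarrow> k \<noteq> j \<Longrightarrow> Q $ k \<notin> seg_disc e (Q $ i) (Q $ j) ` cball 0 2"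
    and P: "\<And>k. P $ k = rot \<theta> 1 (Q $ k)"
    and a: "arc a" "pathstart a = P $ i" "pathfinish a = P $ j"
      "path_image a = rot \<theta> 1 ` closed_segment (Q $ i) (Q $ j)"
  shows "half_twist P a (twist (rot \<theta> 1 \<circ> seg_disc e (Q $ i) (Q $ j)) i j P)"
proof -
  let ?\<phi> = "rot \<theta> 1 \<circ> seg_disc e (Q $ i) (Q $ j)"
  have ne: "Q $ i \<noteq> Q $ j" using Q by (simp add: config_def inj_eq)
  have "continuous_on (cball 0 2) ?\<phi>"
    unfolding o_def by (intro continuous_on_rot[OF \<theta>] continuous_intros)
  moreover have inj: "inj ?\<phi>" by (intro inj_compose inj_rot inj_seg_disc e ne)
  moreover have "?\<phi> ` closed_segment (-1) 1 = path_image a"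
    by (simp only: a(4) image_comp[symmetric] seg_disc_segment)
  moreover have "P $ k \<notin> ?\<phi> ` cball 0 2" if "k \<noteq> i" "k \<noteq> j" for k
    using free[OF that] inj_rot[of \<theta> 1] unfolding P by (auto simp: inj_eq)
  moreover have "inj_on ?\<phi> (cball 0 2)" using inj inj_on_subset by blast
  ultimately show ?thesis
    unfolding half_twist_def twist_def using a Q(2) winding_number_rot_seg_disc[OF \<theta> e ne]
    by (intro conjI exI[of _ ?\<phi>] exI[of _ i] exI[of _ j]) (auto simp: P)
qed

text \<open>
  The twist in a bent disc is conjugate to the twist in the straight disc from which it arises,
  and hence to the twist at the other end of any motion during which the segment between the
  two points stays free of the other points.
\<close>

lemma bent_twist_homotopic:
  fixes v :: "real \<Rightarrow> complex ^ 'n::finite"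
  assumes \<theta>: "continuous_on UNIV \<theta>" and e: "0 < e" "e \<le> 1" and ij: "i \<noteq> j" and n: "odd n"
    and v: "path v" "path_image v \<subseteq> config"
    and free: "\<And>s k. s \<in> {0..1} \<Longrightarrow> k \<noteq> i \<Longrightarrow> k \<noteq> j \<Longrightarrow>
      v s $ k \<notin> seg_disc e (v s $ i) (v s $ j) ` cball 0 2"
    and P: "\<And>k. P $ k = rot \<theta> 1 (v 0 $ k)"
  defines "h \<equiv> twist (rot \<theta> 1 \<circ> seg_disc e (v 0 $ i) (v 0 $ j)) i j P"
  shows "homotopic_paths config (braid_power h n)
    (conj_path (swap_labels i j) ((\<lambda>s. \<chi> k. rot \<theta> (1 - s) (v 0 $ k)) +++ v)
      (\<lambda>t. twist (seg_disc e (v 1 $ i) (v 1 $ j)) i j (v 1) (real n * t)))"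
    and "homotopic_paths config (\<lambda>t. h (real n * t))
    (conj_path (swap_labels i j) ((\<lambda>s. \<chi> k. rot \<theta> (1 - s) (v 0 $ k)) +++ v)
      (\<lambda>t. twist (seg_disc e (v 1 $ i) (v 1 $ j)) i j (v 1) (real n * t)))"
proof -
  let ?\<sigma> = "swap_labels i j"
  define u where "u s = (\<chi> k. rot \<theta> (1 - s) (v 0 $ k))" for s
  define T where "T s t = twist (seg_disc e (v s $ i) (v s $ j)) i j (v s) (real n * t)" for s t
  have vc: "v s \<in> config" if "s \<in> {0..1}" for s using v(2) that by (auto simp: path_image_def)
  have ne: "v s $ i \<noteq> v s $ j" if "s \<in> {0..1}" for s using vc[OF that] ij by (simp add: config_def inj_eq)
  have uc: "u s \<in> config" for s
    using vc[of 0] inj_rot[of \<theta> "1 - s"] by (simp add: u_def config_def inj_def)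
  have pu: "path u" unfolding path_def u_def
    by (intro continuous_on_vec_lambda continuous_on_rot[OF \<theta>] continuous_intros)
  have u01: "u 0 = P" "u 1 = v 0" by (simp_all add: u_def P vec_eq_iff)
  have Pc: "P \<in> config" using uc[of 0] u01 by simp
  have free0: "v 0 $ k \<notin> seg_disc e (v 0 $ i) (v 0 $ j) ` sphere 0 1" if "k \<noteq> i" "k \<noteq> j" for k
    using free[of 0, OF _ that] by auto
  let ?\<phi> = "\<lambda>s. rot \<theta> (1 - s) \<circ> seg_disc e (v 0 $ i) (v 0 $ j)"
  have inj\<phi>: "inj (?\<phi> s)" for s by (intro inj_compose inj_rot inj_seg_disc e ne) auto
  have free\<phi>: "u s $ k \<notin> ?\<phi> s ` sphere 0 1" if "k \<noteq> i" "k \<noteq> j" for s k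
    using free0[OF that] inj_rot[of \<theta> "1 - s"] by (auto simp: inj_eq u_def)
  have cont\<phi>: "continuous_on UNIV (\<lambda>(s, z). ?\<phi> s z)"
    unfolding case_prod_unfold o_def by (intro continuous_on_rot[OF \<theta>] continuous_intros)
  have "homotopic_paths config (\<lambda>t. twist (?\<phi> 0) i j (u 0) (real n * t))
    (conj_path ?\<sigma> u (\<lambda>t. twist (?\<phi> 1) i j (u 1) (real n * t)))"
  proof (rule twist_transport[OF ij n pu])
    show "path_image u \<subseteq> config" using uc by (auto simp: path_image_def)
    show "continuous_on ({0..1} \<times> sphere 0 1) (\<lambda>(s, z). ?\<phi> s z)"
      by (rule continuous_on_subset[OF cont\<phi>]) simp
    show "inj_on (?\<phi> s) (sphere 0 1)" for s using inj\<phi>[of s] inj_on_subset by blast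
    show "u s $ k \<notin> ?\<phi> s ` sphere 0 1" if "k \<noteq> i" "k \<noteq> j" for s k by (rule free\<phi>[OF that])
  qed (simp_all add: u_def)
  then have 1: "homotopic_paths config (\<lambda>t. twist (?\<phi> 0) i j P (real n * t)) (conj_path ?\<sigma> u (T 0))"
    by (simp add: u01 T_def[abs_def] o_def)
  have c: "continuous_on ({0..1} \<times> S) (\<lambda>p. v (fst p) $ k)" for k and S :: "complex set"
    by (rule continuous_on_compose2[OF continuous_on_component[OF v(1)[unfolded path_def]]])
      (auto intro!: continuous_intros)
  have contD: "continuous_on ({0..1} \<times> sphere 0 1) (\<lambda>(s, z). seg_disc e (v s $ i) (v s $ j) z)"
    unfolding case_prod_unfold by (intro continuous_intros c)
  have injD: "inj_on (seg_disc e (v s $ i) (v s $ j)) (sphere 0 1)" if "s \<in> {0..1}" for s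
    using inj_seg_disc[OF e ne[OF that]] inj_on_subset by blast
  have freeD: "v s $ k \<notin> seg_disc e (v s $ i) (v s $ j) ` sphere 0 1"
    if "s \<in> {0..1}" "k \<noteq> i" "k \<noteq> j" for s k using free[OF that] by auto
  have "continuous_on {0..1} (\<lambda>t. twist (seg_disc e (v 1 $ i) (v 1 $ j)) i j (v 1) (real n * t))"
    by (rule continuous_on_twist[OF contD v(1)[unfolded path_def], of "{0..1}" _ "\<lambda>_. 1"])
      (auto intro!: continuous_intros)
  then have pT: "path (T 1)" by (simp add: path_def T_def[abs_def])
  have imT: "path_image (T 1) \<subseteq> config"
    using twist_config[OF injD vc freeD, of 1] by (auto simp: path_image_def T_def)
  have 2: "homotopic_paths config (T 0) (conj_path ?\<sigma> v (T 1))"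
    unfolding T_def[abs_def]
  proof (rule twist_transport[OF ij n v])
  qed (use contD injD freeD in simp_all)
  have T: "T s 0 = v s" "T s 1 = ?\<sigma> (v s)" for s
    using twist_0[of "seg_disc e (v s $ i) (v s $ j)" "v s" i j] n
      twist_add_nat[OF ij, of "seg_disc e (v s $ i) (v s $ j)" "v s" n 0] by (simp_all add: T_def)
  note conf\<sigma> = continuous_on_swap_labels[of config i j] swap_labels_config
  have "homotopic_paths config (conj_path ?\<sigma> u (T 0)) (conj_path ?\<sigma> u (conj_path ?\<sigma> v (T 1)))"
    by (rule homotopic_conj_path[OF _ 2])
      (use pu uc u01 T in \<open>auto simp: path_image_def pathstart_def pathfinish_def intro: conf\<sigma>\<close>)
  also have "homotopic_paths config \<dots> (conj_path ?\<sigma> (u +++ v) (T 1))"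
  proof (rule conj_path_conj_path)
  qed (use pT imT pu uc u01 T v in \<open>auto simp: path_image_def pathstart_def pathfinish_def intro: conf\<sigma>\<close>)
  finally have 3: "homotopic_paths config (conj_path ?\<sigma> u (T 0)) (conj_path ?\<sigma> (u +++ v) (T 1))" .
  have h: "h = twist (?\<phi> 0) i j P" by (simp add: h_def)
  have "homotopic_paths config (braid_power h n) (\<lambda>t. h (real n * t))"
    unfolding h
  proof (rule braid_power_twist_homotopic[OF ij Pc])
    show "continuous_on (sphere 0 1) (?\<phi> 0)"
      unfolding o_def by (intro continuous_on_rot[OF \<theta>] continuous_intros)
    show "inj_on (?\<phi> 0) (sphere 0 1)" using inj\<phi>[of 0] inj_on_subset by blast
    show "P $ k \<notin> ?\<phi> 0 ` sphere 0 1" if "k \<noteq> i" "k \<noteq> j" for k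
      using free\<phi>[OF that, of 0] u01 by simp
  qed (simp_all add: P)
  note hp = this
  from homotopic_paths_trans[OF 1 3]
  show "homotopic_paths config (\<lambda>t. h (real n * t)) (conj_path ?\<sigma> ((\<lambda>s. \<chi> k. rot \<theta> (1 - s) (v 0 $ k)) +++ v)
      (\<lambda>t. twist (seg_disc e (v 1 $ i) (v 1 $ j)) i j (v 1) (real n * t)))"
    unfolding h u_def[abs_def] T_def[abs_def] .
  from homotopic_paths_trans[OF homotopic_paths_trans[OF hp[unfolded h] 1] 3]
  show "homotopic_paths config (braid_power h n) (conj_path ?\<sigma> ((\<lambda>s. \<chi> k. rot \<theta> (1 - s) (v 0 $ k)) +++ v)
      (\<lambda>t. twist (seg_disc e (v 1 $ i) (v 1 $ j)) i j (v 1) (real n * t)))"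
    unfolding h u_def[abs_def] T_def[abs_def] .
qed

section \<open>The fibres of the projection to \<open>x\<close>\<close>

definition branch_sq :: "complex \<Rightarrow> complex" where
  "branch_sq v = (3 - v)^3 * (1 + v) / 64"

lemma deltoid_factor:
  assumes "v^2 = 8 * x + 9"
  shows "deltoid x y = (y^2 - branch_sq v) * (y^2 - branch_sq (- v))"
proof -
  have x: "x = (v^2 - 9) / 8" using assms by simp
  show ?thesis unfolding deltoid_def branch_sq_def x by (simp add: field_simps power2_eq_square power3_eq_cube)
qed

lemma fibre_x: "fibre deltoid ((1, 0), x) = {y. deltoid x y = 0}"
  by (force simp: fibre_def curve_def proj_def image_iff)

text \<open>
  The configuration \<open>A1\<close>, \<open>A2\<close>, \<open>B1 = -A1\<close>, \<open>B2 =
  -A2\<close> with given logarithms of \<open>A1\<close> and \<open>A2\<close>.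
\<close>

definition conf :: "complex \<times> complex \<Rightarrow> complex ^ point_name" where
  "conf q = (\<chi> k. case k of A1 \<Rightarrow> exp (fst q) | A2 \<Rightarrow> exp (snd q)
                          | B1 \<Rightarrow> - exp (fst q) | B2 \<Rightarrow> - exp (snd q))"

lemma conf_simps [simp]:
  "conf q $ A1 = exp (fst q)" "conf q $ A2 = exp (snd q)"
  "conf q $ B1 = - exp (fst q)" "conf q $ B2 = - exp (snd q)"
  by (simp_all add: conf_def)

lemma UNIV_point_name: "(UNIV :: point_name set) = {A1, A2, B1, B2}"
  using point_name.exhaust by blast

lemma continuous_on_conf [continuous_intros]:
  assumes "continuous_on S g" shows "continuous_on S (\<lambda>x. conf (g x))"
  unfolding conf_def
proof (intro continuous_on_vec_lambda)
  show "continuous_on S (\<lambda>x. case k of A1 \<Rightarrow> exp (fst (g x)) | A2 \<Rightarrow> exp (snd (g x))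
      | B1 \<Rightarrow> - exp (fst (g x)) | B2 \<Rightarrow> - exp (snd (g x)))" for k
    by (cases k) (auto intro!: continuous_intros assms)
qed

definition log_config :: "(complex \<times> complex) set" where
  "log_config = {q. exp (fst q) ^ 2 \<noteq> exp (snd q) ^ 2}"

text \<open>
  A part of \<open>log_config\<close> that is visibly a union of convex sets: the moduli of
  \<open>A1\<close> and \<open>A2\<close> differ, or \<open>A2\<close> lies strictly within the
  half turn counterclockwise from \<open>A1\<close> to \<open>B1\<close>.
\<close>

definition charts :: "(complex \<times> complex) set" where
  "charts = {q. Re (snd q) \<noteq> Re (fst q) \<or> (0 < Im (snd q - fst q) \<and> Im (snd q - fst q) < pi)}"

lemma conf_distinct:
  assumes "q \<in> log_config"
  shows "conf q \<in> config"
proof -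
  have assms: "exp (fst q) ^ 2 \<noteq> exp (snd q) ^ 2" using assms by (simp add: log_config_def)
  have n: "exp (fst q) \<noteq> - exp (fst q)" "exp (snd q) \<noteq> - exp (snd q)"
    using exp_not_eq_zero[of "fst q"] exp_not_eq_zero[of "snd q"]
    by (metis eq_neg_iff_add_eq_0 mult_2 mult_eq_0_iff zero_neq_numeral)+
  have m: "exp (fst q) \<noteq> exp (snd q)" "exp (fst q) \<noteq> - exp (snd q)" using assms by auto
  have "k = l" if "conf q $ k = conf q $ l" for k l
    using that n m n[symmetric] m[symmetric]
    by (cases k; cases l) (auto simp: minus_equation_iff)
  then show ?thesis unfolding config_def inj_def by blast
qed

lemma charts_subset: "charts \<subseteq> log_config"
  unfolding log_config_def
proof (rule subsetI, rule CollectI, rule notI)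
  fix q assume assms: "q \<in> charts"
  assume "exp (fst q) ^ 2 = exp (snd q) ^ 2"
  then have "exp (2 * (snd q - fst q)) = 1"
    by (simp add: exp_diff exp_double right_diff_distrib)
  then obtain n :: int where n: "Re (2 * (snd q - fst q)) = 0" "Im (2 * (snd q - fst q)) = of_int (2 * n) * pi"
    unfolding exp_eq_1 by blast
  then have *: "Re (snd q) = Re (fst q)" "Im (snd q - fst q) = of_int n * pi" by simp_all
  then have "0 < of_int n * pi" "of_int n * pi < 1 * pi" using assms by (auto simp: charts_def)
  then show False by (auto simp: zero_less_mult_iff)
qed

lemma convex_chart:
  "convex {q :: complex \<times> complex. Re (snd q) < Re (fst q)}"
  "convex {q :: complex \<times> complex. Re (fst q) < Re (snd q)}"
  "convex {q :: complex \<times> complex. 0 < Im (snd q - fst q) \<and> Im (snd q - fst q) < pi}"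
  "convex {q :: complex \<times> complex. \<bar>Im (snd q - fst q)\<bar> < pi}"
proof -
  have lin: "bounded_linear (\<lambda>q :: complex \<times> complex. Re (snd q - fst q))"
    "bounded_linear (\<lambda>q :: complex \<times> complex. Im (snd q - fst q))"
    by (intro bounded_linear_compose[OF bounded_linear_Re] bounded_linear_compose[OF bounded_linear_Im]
        bounded_linear_sub bounded_linear_fst bounded_linear_snd)+
  have v: "convex ((\<lambda>q :: complex \<times> complex. Re (snd q - fst q)) -` S)"
    "convex ((\<lambda>q :: complex \<times> complex. Im (snd q - fst q)) -` S)" if "convex S" for S
    using lin that by (auto intro!: convex_linear_vimage bounded_linear.linear)
  have "{q :: complex \<times> complex. Re (snd q) < Re (fst q)} = (\<lambda>q. Re (snd q - fst q)) -` {..<0}"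
    "{q :: complex \<times> complex. Re (fst q) < Re (snd q)} = (\<lambda>q. Re (snd q - fst q)) -` {0<..}"
    "{q :: complex \<times> complex. 0 < Im (snd q - fst q) \<and> Im (snd q - fst q) < pi} =
      (\<lambda>q. Im (snd q - fst q)) -` {0<..<pi}"
    "{q :: complex \<times> complex. \<bar>Im (snd q - fst q)\<bar> < pi} = (\<lambda>q. Im (snd q - fst q)) -` {-pi<..<pi}"
    by auto
  then show "convex {q :: complex \<times> complex. Re (snd q) < Re (fst q)}"
  "convex {q :: complex \<times> complex. Re (fst q) < Re (snd q)}"
  "convex {q :: complex \<times> complex. 0 < Im (snd q - fst q) \<and> Im (snd q - fst q) < pi}"
  "convex {q :: complex \<times> complex. \<bar>Im (snd q - fst q)\<bar> < pi}" by (simp_all only: v convex_real_interval)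
qed

text \<open>
  Logarithms of \<open>A1\<close> and \<open>A2\<close>, obtained from the factorisation by
  writing \<open>3 - v\<close> as \<open>- 8 * x / (3 + v)\<close> and \<open>1 - v\<close> as
  \<open>- 8 * (x + 1) / (1 + v)\<close>; the numbers \<open>l0\<close> and \<open>l1\<close> are
  logarithms of \<open>-x\<close> and \<open>x + 1\<close>, to be chosen continuously along the
  path in question. The other logarithms are principal values, since \<open>v\<close> has
  nonnegative real part.
\<close>

definition branches :: "complex \<Rightarrow> complex \<Rightarrow> complex \<Rightarrow> complex \<times> complex" where
  "branches l0 l1 x = (let v = csqrt (8 * x + 9) in
     (\<i> * pi / 2 + l1 / 2 + 3 / 2 * Ln (3 + v) - Ln (1 + v) / 2 - of_real (ln 8) / 2,
      \<i> * pi + 3 / 2 * l0 - 3 / 2 * Ln (3 + v) + Ln (1 + v) / 2 + of_real (ln 8) / 2))"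

lemma Re_csqrt_nonneg: "0 \<le> Re (csqrt z)"
  using csqrt_principal[of z] by linarith

lemma csqrt_shift_nonzero: "3 + csqrt z \<noteq> 0" "1 + csqrt z \<noteq> 0"
proof -
  have "Re (3 + csqrt z) > 0" "Re (1 + csqrt z) > 0"
    using Re_csqrt_nonneg[of z] by (simp_all del: csqrt.simps)
  then show "3 + csqrt z \<noteq> 0" "1 + csqrt z \<noteq> 0" by (metis less_irrefl zero_complex.sel(1))+
qed

lemma branches_sq:
  assumes "exp l0 = - x" "exp l1 = x + 1"
  defines "v \<equiv> csqrt (8 * x + 9)"
  shows "exp (fst (branches l0 l1 x))^2 = branch_sq (- v)"
    and "exp (snd (branches l0 l1 x))^2 = branch_sq v"
proof -
  have v2: "v^2 = 8 * x + 9" by (simp add: v_def)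
  have nz: "3 + v \<noteq> 0" "1 + v \<noteq> 0" by (simp_all add: v_def csqrt_shift_nonzero)
  have e8: "exp (complex_of_real (ln 8)) = 8" by (simp add: exp_of_real)
  have e3: "exp (3 * Ln (3 + v)) = (3 + v)^3"
    using exp_of_nat_mult[of 3 "Ln (3 + v)"] nz by simp
  have e30: "exp (3 * l0) = (- x)^3"
    using exp_of_nat_mult[of 3 l0] assms(1) by simp
  have 1: "2 * fst (branches l0 l1 x) = \<i> * pi + l1 + 3 * Ln (3 + v) - Ln (1 + v) - of_real (ln 8)"
    by (simp add: branches_def Let_def v_def algebra_simps)
  have 2: "2 * snd (branches l0 l1 x) = (2 * pi * \<i>) + 3 * l0 - 3 * Ln (3 + v) + Ln (1 + v) + of_real (ln 8)"
    by (simp add: branches_def Let_def v_def algebra_simps)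
  have "exp (fst (branches l0 l1 x))^2 = exp (2 * fst (branches l0 l1 x))"
    by (simp add: exp_double)
  also have "\<dots> = - (x + 1) * (3 + v)^3 / (1 + v) / 8"
    unfolding 1 using nz by (simp add: exp_add exp_diff e8 e3 assms(2))
  also have "\<dots> = branch_sq (- v)"
  proof -
    have "x + 1 = (v - 1) * (v + 1) / 8" using v2 by (simp add: algebra_simps power2_eq_square)
    then have "- (x + 1) * (3 + v)^3 / (1 + v) / 8 = - ((v - 1) * (v + 1) / 8) * (3 + v)^3 / (1 + v) / 8"
      by (simp only:)
    also have "- ((v - 1) * (v + 1) / 8) * (3 + v)^3 / (1 + v) = (1 - v) * (3 + v)^3 / 8"
      by (rule nonzero_divide_eq_eq[OF nz(2), THEN iffD2])
        (simp add: algebra_simps diff_divide_distrib add_divide_distrib)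
    finally show ?thesis unfolding branch_sq_def by simp
  qed
  finally show "exp (fst (branches l0 l1 x))^2 = branch_sq (- v)" .
  have "exp (snd (branches l0 l1 x))^2 = exp (2 * snd (branches l0 l1 x))"
    by (simp add: exp_double)
  also have "\<dots> = (- x)^3 * (1 + v) * 8 / (3 + v)^3"
    unfolding 2 using nz by (simp add: exp_add exp_diff e8 e3 e30)
  also have "\<dots> = branch_sq v"
  proof -
    have "- x = (3 - v) * (3 + v) / 8" using v2 by (simp add: algebra_simps power2_eq_square)
    then have "(- x)^3 = ((3 - v) * (3 + v) / 8)^3" by (simp only:)
    also have "\<dots> = (3 - v)^3 * (3 + v)^3 / 512" by (simp add: power_mult_distrib power_divide)
    finally have "(- x)^3 = (3 - v)^3 * (3 + v)^3 / 512" .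
    then have "(- x)^3 * (1 + v) * 8 / (3 + v)^3 = ((3 - v)^3 * (3 + v)^3 / 512) * (1 + v) * 8 / (3 + v)^3"
      by (simp only:)
    also have "\<dots> = branch_sq v" unfolding branch_sq_def using nz by simp
    finally show ?thesis .
  qed
  finally show "exp (snd (branches l0 l1 x))^2 = branch_sq v" .
qed

lemma branch_sq_diff: "branch_sq v - branch_sq (- v) = v^3 / 4"
  by (simp add: branch_sq_def field_simps power3_eq_cube)

lemma enumerates_branches:
  assumes "exp l0 = - x" "exp l1 = x + 1" "x \<noteq> -9/8"
  shows "enumerates (conf (branches l0 l1 x)) (fibre deltoid ((1, 0), x))"
proof -
  let ?q = "branches l0 l1 x" and ?v = "csqrt (8 * x + 9)"
  have v: "?v^2 = 8 * x + 9" by simp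
  have "8 * x + 9 \<noteq> 0"
  proof
    assume "8 * x + 9 = 0"
    then have "x = -9/8" by (simp add: field_simps eq_neg_iff_add_eq_0)
    with assms(3) show False by simp
  qed
  then have "?v^3 / 4 \<noteq> 0" by simp
  then have "branch_sq ?v \<noteq> branch_sq (- ?v)" using branch_sq_diff[of ?v] by auto
  then have c: "conf ?q \<in> config" by (intro conf_distinct) (simp add: log_config_def branches_sq[OF assms(1,2)])
  have "y \<in> fibre deltoid ((1, 0), x) \<longleftrightarrow> y \<in> range (vec_nth (conf ?q))" for y
  proof -
    have "y \<in> fibre deltoid ((1, 0), x) \<longleftrightarrow> y^2 = exp (snd ?q)^2 \<or> y^2 = exp (fst ?q)^2"
      unfolding fibre_x mem_Collect_eq deltoid_factor[OF v] branches_sq[OF assms(1,2)] by simp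
    also have "\<dots> \<longleftrightarrow> y \<in> range (vec_nth (conf ?q))"
      unfolding UNIV_point_name power2_eq_iff by auto
    finally show ?thesis .
  qed
  then show ?thesis using c unfolding enumerates_def config_def by blast
qed

section \<open>The ordered fibre over the upper half plane\<close>

definition upper :: "complex set" where
  "upper = {x. 0 \<le> Im x \<and> -9/8 < Re x \<and> x \<noteq> 0 \<and> x \<noteq> -1}"

definition upper_branches :: "complex \<Rightarrow> complex \<times> complex" where
  "upper_branches x = branches (Ln (- \<i> * x) - \<i> * pi / 2) (Ln (- \<i> * (x + 1)) + \<i> * pi / 2) x"

lemma upper_logs:
  assumes "x \<in> upper"
  shows "exp (Ln (- \<i> * x) - \<i> * pi / 2) = - x" "exp (Ln (- \<i> * (x + 1)) + \<i> * pi / 2) = x + 1"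
proof -
  have nz: "- \<i> * x \<noteq> 0" "- \<i> * (x + 1) \<noteq> 0" using assms by (auto simp: upper_def add_eq_0_iff2)
  have "exp (\<i> * pi / 2) = \<i>" using exp_pi_i' exp_Euler cis_conv_exp[of "pi/2"] by (simp add: mult_ac)
  then show "exp (Ln (- \<i> * x) - \<i> * pi / 2) = - x" "exp (Ln (- \<i> * (x + 1)) + \<i> * pi / 2) = x + 1"
    unfolding exp_diff exp_add exp_Ln[OF nz(1)] exp_Ln[OF nz(2)] by (auto simp: algebra_simps)
qed

lemma enumerates_upper:
  "x \<in> upper \<Longrightarrow> enumerates (conf (upper_branches x)) (fibre deltoid ((1, 0), x))"
  unfolding upper_branches_def
  by (rule enumerates_branches[OF upper_logs]) (auto simp: upper_def)

lemma upper_log_config: "x \<in> upper \<Longrightarrow> upper_branches x \<in> log_config"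
proof -
  assume "x \<in> upper"
  then have "inj (vec_nth (conf (upper_branches x)))" using enumerates_upper by (simp add: enumerates_def)
  from inj_eq[OF this, of A1 A2] inj_eq[OF this, of A1 B2]
  show ?thesis by (simp add: log_config_def power2_eq_iff)
qed

lemma continuous_on_branches:
  assumes "continuous_on S l0" "continuous_on S l1" "continuous_on S g"
    and "\<And>t. t \<in> S \<Longrightarrow> 8 * g t + 9 \<notin> \<real>\<^sub>\<le>\<^sub>0"
  shows "continuous_on S (\<lambda>t. branches (l0 t) (l1 t) (g t))"
proof -
  have c: "continuous_on S (\<lambda>t. csqrt (8 * g t + 9))"
    by (rule continuous_on_compose2[of "- \<real>\<^sub>\<le>\<^sub>0" csqrt])
      (use assms(4) in \<open>auto intro!: continuous_intros assms(3) continuous_at_imp_continuous_on continuous_at_csqrt\<close>)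
  have "3 + csqrt (8 * g t + 9) \<notin> \<real>\<^sub>\<le>\<^sub>0" "1 + csqrt (8 * g t + 9) \<notin> \<real>\<^sub>\<le>\<^sub>0" for t
    using Re_csqrt_nonneg[of "8 * g t + 9"] by (auto simp: complex_nonpos_Reals_iff simp del: csqrt.simps)
  then show ?thesis
    unfolding branches_def Let_def
    by (intro continuous_intros assms c) auto
qed

lemma continuous_on_upper_branches: "continuous_on upper upper_branches"
  unfolding upper_branches_def
proof (rule continuous_on_branches)
  show "continuous_on upper (\<lambda>x. Ln (- \<i> * x) - \<i> * pi / 2)"
    "continuous_on upper (\<lambda>x. Ln (- \<i> * (x + 1)) + \<i> * pi / 2)"
    by (intro continuous_intros; auto simp: upper_def complex_nonpos_Reals_iff complex_eq_iff)+
  show "8 * x + 9 \<notin> \<real>\<^sub>\<le>\<^sub>0" if "x \<in> upper" for x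
    using that by (auto simp: upper_def complex_nonpos_Reals_iff)
qed (intro continuous_intros)

lemma simply_connected_upper: "simply_connected upper"
proof (rule starlike_imp_simply_connected)
  show "starlike upper"
    unfolding starlike_def
  proof (intro bexI[of _ \<i>] ballI subsetI)
    fix x z assume x: "x \<in> upper" and "z \<in> closed_segment \<i> x"
    then obtain u where u: "0 \<le> u" "u \<le> 1" and z: "z = (1 - u) *\<^sub>R \<i> + u *\<^sub>R x"
      by (auto simp: in_segment)
    have im: "Im z = (1 - u) + u * Im x" and re: "Re z = u * Re x" by (simp_all add: z)
    show "z \<in> upper"
    proof (cases "u = 1")
      case False
      then have "Im z > 0" using u x by (auto simp: im upper_def intro: add_pos_nonneg)
      moreover have "-9/8 < Re z"
      proof (cases "Re x \<ge> 0")
        case True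
        then have "u * Re x \<ge> 0" using u by simp
        then show ?thesis by (simp add: re)
      next
        case False
        then have "u * Re x \<ge> 1 * Re x" using u by (intro mult_right_mono_neg) auto
        then show ?thesis using x by (simp add: re upper_def)
      qed
      ultimately show ?thesis by (auto simp: upper_def)
    qed (use x z in simp)
  qed (auto simp: upper_def complex_eq_iff)
qed

lemma upper_homotopic:
  assumes "path g" "path_image g \<subseteq> upper" "path h" "path_image h \<subseteq> upper"
    "pathstart g = pathstart h" "pathfinish g = pathfinish h"
  shows "homotopic_paths upper g h"
  using simply_connected_upper assms unfolding simply_connected_eq_homotopic_paths by metis

lemma csqrt_real_shift: "-9/8 \<le> x \<Longrightarrow> csqrt (8 * complex_of_real x + 9) = of_real (sqrt (8 * x + 9))"
  using csqrt_of_real_nonneg[of "complex_of_real (8 * x + 9)"] by simp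

lemma Ln_i_real:
  "0 < t \<Longrightarrow> Ln (\<i> * complex_of_real t) = of_real (ln t) + \<i> * pi / 2"
  "0 < t \<Longrightarrow> Ln (- (\<i> * complex_of_real t)) = of_real (ln t) - \<i> * pi / 2"
  using Ln_times_of_real[of t \<i>] Ln_times_of_real[of t "-\<i>"] by (simp_all add: mult_ac Ln_of_real)

lemma upper_branches_real_Im:
  fixes x :: real
  assumes "-9/8 < x" "x \<noteq> 0" "x \<noteq> -1"
  shows "Im (fst (upper_branches x)) = (if x < -1 then pi else pi / 2)"
    and "Im (snd (upper_branches x)) = (if x < 0 then pi else - pi / 2)"
proof -
  define s where "s = sqrt (8 * x + 9)"
  have s: "s > 0" using assms by (simp add: s_def)
  have v: "csqrt (8 * of_real x + 9) = of_real s" using assms by (simp add: s_def csqrt_real_shift)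
  have "Ln (3 + complex_of_real s) = of_real (ln (3 + s))" "Ln (1 + complex_of_real s) = of_real (ln (1 + s))"
    using s Ln_of_real[of "3 + s"] Ln_of_real[of "1 + s"] by simp_all
  then have im: "Im (Ln (3 + complex_of_real s)) = 0" "Im (Ln (1 + complex_of_real s)) = 0" by simp_all
  have l0: "Im (Ln (- \<i> * of_real x) - \<i> * pi / 2) = (if x < 0 then 0 else - pi)"
    using Ln_i_real(1)[of "-x"] Ln_i_real(2)[of x] assms(2) by auto
  have "- \<i> * (complex_of_real x + 1) = - (\<i> * of_real (x + 1))" by (simp add: algebra_simps)
  then have l1: "Im (Ln (- \<i> * (of_real x + 1)) + \<i> * pi / 2) = (if x < -1 then pi else 0)"
    using Ln_i_real(1)[of "-(x + 1)"] Ln_i_real(2)[of "x + 1"] assms(3)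
    by (cases "x < -1") (auto simp: algebra_simps)
  show "Im (fst (upper_branches x)) = (if x < -1 then pi else pi / 2)"
  proof -
    define A where "A = Ln (- \<i> * (of_real x + 1)) + \<i> * pi / 2"
    show ?thesis using l1 im unfolding upper_branches_def branches_def Let_def v fst_conv A_def[symmetric] by simp
  qed
  show "Im (snd (upper_branches x)) = (if x < 0 then pi else - pi / 2)"
  proof -
    define A where "A = Ln (- \<i> * complex_of_real x) - \<i> * pi / 2"
    show ?thesis using l0 im unfolding upper_branches_def branches_def Let_def v snd_conv A_def[symmetric] by simp
  qed
qed

lemma branches_Re:
  assumes "exp l0 = - x" "exp l1 = x + 1"
  defines "v \<equiv> csqrt (8 * x + 9)"
  shows "norm (branch_sq v) < norm (branch_sq (- v)) \<Longrightarrow> Re (snd (branches l0 l1 x)) < Re (fst (branches l0 l1 x))"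
    and "norm (branch_sq (- v)) < norm (branch_sq v) \<Longrightarrow> Re (fst (branches l0 l1 x)) < Re (snd (branches l0 l1 x))"
proof -
  have *: "norm (exp z ^ 2) = exp (Re z) ^ 2" for z :: complex by (simp add: norm_power)
  note sq = branches_sq[OF assms(1,2), folded v_def, THEN arg_cong[where f = norm], unfolded *]
  have **: "Re z < Re w" if "exp (Re z) ^ 2 < exp (Re w) ^ 2" for z w :: complex
    using power_less_imp_less_base[OF that] by simp
  show "norm (branch_sq v) < norm (branch_sq (- v)) \<Longrightarrow> Re (snd (branches l0 l1 x)) < Re (fst (branches l0 l1 x))"
    "norm (branch_sq (- v)) < norm (branch_sq v) \<Longrightarrow> Re (fst (branches l0 l1 x)) < Re (snd (branches l0 l1 x))"
    unfolding sq[symmetric] by (rule **, assumption)+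
qed

text \<open>
  Near the origin \<open>v\<close> is near \<open>3\<close>, so that \<open>A2\<close> and
  \<open>B2\<close> are much closer to \<open>0\<close> than \<open>A1\<close> and
  \<open>B1\<close>.
\<close>

lemma branch_compare_origin:
  assumes "norm x \<le> 1/16"
  defines "v \<equiv> csqrt (8 * x + 9)"
  shows "norm (branch_sq v) < norm (branch_sq (- v))"
proof -
  have re: "Re v \<ge> 0" unfolding v_def by (rule Re_csqrt_nonneg)
  have v2: "v^2 = 8 * x + 9" by (simp add: v_def)
  have "(3 - v) * (3 + v) = - 8 * x" using v2 by (simp add: algebra_simps power2_eq_square)
  then have "norm (3 - v) * norm (3 + v) = 8 * norm x" by (metis norm_mult norm_minus_cancel norm_numeral mult_minus_left)
  moreover have n3: "norm (3 + v) \<ge> 3" using complex_Re_le_cmod[of "3 + v"] re by simp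
  then have "norm (3 - v) * 3 \<le> norm (3 - v) * norm (3 + v)" by (intro mult_left_mono) auto
  ultimately have d: "norm (3 - v) \<le> 1/6" using assms by simp
  have b1: "norm (3 + v) \<ge> 5" "norm (1 + v) \<le> 5" "norm (1 - v) \<ge> 1"
    using d norm_triangle_ineq2[of 6 "3 - v"] norm_triangle_ineq4[of 4 "3 - v"] norm_triangle_ineq2[of 2 "3 - v"]
    by (simp_all add: norm_minus_commute algebra_simps)
  have "norm (3 - v)^3 * norm (1 + v) \<le> 1^3 * 5" using d b1 by (intro mult_mono power_mono) auto
  also have "\<dots> < 5^3 * 1" by simp
  also have "\<dots> \<le> norm (3 + v)^3 * norm (1 - v)" using b1 by (intro mult_mono power_mono) auto
  finally show ?thesis by (simp add: branch_sq_def norm_mult norm_power norm_divide)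
qed

text \<open>
  Near \<open>x = -1\<close> the number \<open>v\<close> is near \<open>1\<close>, and now
  \<open>A1\<close> and \<open>B1\<close> are the inner pair.
\<close>

lemma branch_compare_tangency:
  assumes "norm (x + 1) \<le> 1/160"
  defines "v \<equiv> csqrt (8 * x + 9)"
  shows "norm (branch_sq (- v)) < norm (branch_sq v)"
proof -
  have re: "Re v \<ge> 0" unfolding v_def by (rule Re_csqrt_nonneg)
  have v2: "v^2 = 8 * x + 9" by (simp add: v_def)
  have "(1 - v) * (1 + v) = - 8 * (x + 1)" using v2 by (simp add: algebra_simps power2_eq_square)
  then have "norm (1 - v) * norm (1 + v) = 8 * norm (x + 1)" by (metis norm_mult norm_minus_cancel norm_numeral mult_minus_left)
  moreover have n3: "norm (1 + v) \<ge> 1" using complex_Re_le_cmod[of "1 + v"] re by simp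
  then have "norm (1 - v) * 1 \<le> norm (1 - v) * norm (1 + v)" by (intro mult_left_mono) auto
  ultimately have d: "norm (1 - v) \<le> 1/20" using assms by simp
  have b1: "norm (3 + v) \<le> 41/10" "norm (1 + v) \<ge> 19/10" "norm (3 - v) \<ge> 19/10"
    using d norm_triangle_ineq4[of 4 "1 - v"] norm_triangle_ineq2[of 2 "1 - v"] norm_triangle_ineq2[of 2 "v - 1"]
    by (simp_all add: norm_minus_commute algebra_simps)
  have "norm (3 + v)^3 * norm (1 - v) \<le> (41/10)^3 * (1/20)" using d b1 by (intro mult_mono power_mono) auto
  also have "\<dots> < (19/10)^3 * (19/10)" by (simp add: power3_eq_cube)
  also have "\<dots> \<le> norm (3 - v)^3 * norm (1 + v)" using b1 by (intro mult_mono power_mono) auto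
  finally show ?thesis by (simp add: branch_sq_def norm_mult norm_power norm_divide)
qed

lemma branch_compare_real:
  fixes x :: real
  defines "v \<equiv> csqrt (8 * complex_of_real x + 9)"
  shows "0 < x \<Longrightarrow> norm (branch_sq v) < norm (branch_sq (- v))"
    and "-9/8 < x \<Longrightarrow> x < -1 \<Longrightarrow> norm (branch_sq (- v)) < norm (branch_sq v)"
proof -
  define s where "s = sqrt (8 * x + 9)"
  define F where "F u = (3 - u)^3 * (1 + u) / 64" for u :: real
  have F: "branch_sq (of_real u) = of_real (F u)" for u by (simp add: branch_sq_def F_def)
  have FF: "F s - F (- s) = s^3 / 4" by (simp add: F_def field_simps power3_eq_cube)
  show "norm (branch_sq v) < norm (branch_sq (- v))" if "0 < x"
  proof -
    have v: "v = of_real s" using that by (simp add: v_def s_def csqrt_real_shift)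
    have "sqrt (3^2) < s" unfolding s_def using that by (intro real_sqrt_less_mono) simp
    then have s: "s > 3" by simp
    then have "(3 - s)^3 \<le> 0" by (simp add: power_less_zero_eq less_imp_le)
    then have "F s \<le> 0" using s by (simp add: F_def mult_nonpos_nonneg)
    moreover have "s^3 > 0" using s by simp
    then have "F s - F (-s) > 0" using FF by linarith
    ultimately show ?thesis unfolding v F using F[of "-s"] by simp
  qed
  show "norm (branch_sq (- v)) < norm (branch_sq v)" if "-9/8 < x" "x < -1"
  proof -
    have v: "v = of_real s" using that by (simp add: v_def s_def csqrt_real_shift)
    have s: "s > 0" "s < 1" using that by (simp_all add: s_def)
    then have "F (-s) \<ge> 0" by (simp add: F_def)
    moreover have "s^3 > 0" using s by simp
    then have "F s - F (-s) > 0" using FF by linarith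
    ultimately show ?thesis unfolding v F using F[of "-s"] by simp
  qed
qed

lemma upper_chart_less:
  assumes "x \<in> upper" "norm x \<le> 1/16 \<or> (Im x = 0 \<and> 0 < Re x)"
  shows "Re (snd (upper_branches x)) < Re (fst (upper_branches x))"
  unfolding upper_branches_def
proof (rule branches_Re(1)[OF upper_logs[OF assms(1)]])
  show "norm (branch_sq (csqrt (8 * x + 9))) < norm (branch_sq (- csqrt (8 * x + 9)))"
    using assms(2) branch_compare_origin[of x] branch_compare_real(1)[of "Re x"]
    by (metis complex_is_Real_iff of_real_Re)
qed

lemma upper_chart_greater:
  assumes "x \<in> upper" "norm (x + 1) \<le> 1/160 \<or> (Im x = 0 \<and> Re x < -1)"
  shows "Re (fst (upper_branches x)) < Re (snd (upper_branches x))"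
  unfolding upper_branches_def
proof (rule branches_Re(2)[OF upper_logs[OF assms(1)]])
  show "norm (branch_sq (- csqrt (8 * x + 9))) < norm (branch_sq (csqrt (8 * x + 9)))"
    using assms branch_compare_tangency[of x] branch_compare_real(2)[of "Re x"]
    by (metis (no_types, lifting) complex_is_Real_iff of_real_Re upper_def mem_Collect_eq)
qed

section \<open>Homotopies in logarithmic coordinates\<close>

lemma chart_homotopic:
  fixes p :: "real \<Rightarrow> complex \<times> complex"
  assumes "convex C" "C \<subseteq> S" "path p" "path_image p \<subseteq> C" "a = pathstart p" "b = pathfinish p"
  shows "homotopic_paths S p (linepath a b)"
proof -
  have "closed_segment a b \<subseteq> C"
    using assms by (intro closed_segment_subset) (auto simp: path_image_def pathstart_def pathfinish_def)
  then have "homotopic_paths C p (linepath a b)"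
    using assms by (intro homotopic_paths_through_convex) auto
  then show ?thesis using assms(2) homotopic_paths_subset by blast
qed

lemma chart_subset:
  "{q. Re (snd q) < Re (fst q)} \<subseteq> log_config" "{q. Re (fst q) < Re (snd q)} \<subseteq> log_config"
  "{q. 0 < Im (snd q - fst q) \<and> Im (snd q - fst q) < pi} \<subseteq> log_config"
  using charts_subset by (auto simp: charts_def)

lemma half_turn_image:
  fixes c \<rho> :: real
  assumes "c = 0 \<or> c = -1" "0 < \<rho>" "\<rho> \<le> 1/160"
  shows "path_image (linepath (of_real (c + \<rho>)) (of_real c + \<i> * of_real \<rho>) +++
      linepath (of_real c + \<i> * of_real \<rho>) (of_real (c - \<rho>))) \<subseteq> upper \<inter> cball (of_real c) \<rho>"
proof -
  let ?C = "{x. 0 \<le> Im x} \<inter> {x. Re x + Im x \<ge> c + \<rho>} \<inter> cball (complex_of_real c) \<rho>"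
  let ?D = "{x. 0 \<le> Im x} \<inter> {x. Im x - Re x \<ge> \<rho> - c} \<inter> cball (complex_of_real c) \<rho>"
  have "convex {x. Re x + Im x \<ge> c + \<rho>}" "convex {x. Im x - Re x \<ge> \<rho> - c}" "convex {x. 0 \<le> Im x}"
    using convex_halfspace_ge[of "c + \<rho>" "Complex 1 1"] convex_halfspace_ge[of "\<rho> - c" "Complex (-1) 1"]
      convex_halfspace_ge[of 0 \<i>] by (simp_all add: inner_complex_def algebra_simps)
  then have cv: "convex ?C" "convex ?D" by (auto intro: convex_Int)
  have pts: "complex_of_real (c + \<rho>) \<in> ?C" "of_real c + \<i> * of_real \<rho> \<in> ?C"
    "of_real c + \<i> * of_real \<rho> \<in> ?D" "complex_of_real (c - \<rho>) \<in> ?D"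
    using assms by (auto simp: dist_norm norm_mult)
  have bd: "\<bar>Re x - c\<bar> \<le> \<rho>" if "x \<in> cball (complex_of_real c) \<rho>" for x
    using that abs_Re_le_cmod[of "of_real c - x"] by (simp add: dist_norm)
  have "?C \<subseteq> upper \<inter> cball (of_real c) \<rho>" "?D \<subseteq> upper \<inter> cball (of_real c) \<rho>"
    using assms by (auto simp: upper_def dest!: bd simp: abs_le_iff)
  then show ?thesis
    using closed_segment_subset[OF pts(1,2) cv(1)] closed_segment_subset[OF pts(3,4) cv(2)]
    by (intro subset_path_image_join) (auto simp del: of_real_add of_real_diff)
qed

lemma real_segment_image:
  fixes x y :: real
  assumes "z \<in> path_image (linepath (of_real x) (complex_of_real y))"
  obtains t where "z = of_real t" "min x y \<le> t" "t \<le> max x y"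
  using assms by (auto simp: closed_segment_of_real closed_segment_eq_real_ivl split: if_splits)

lemma upper_to_log_config:
  assumes "path g" "path_image g \<subseteq> upper"
  shows "path (upper_branches \<circ> g)" "path_image (upper_branches \<circ> g) \<subseteq> log_config"
  using assms upper_log_config
  by (auto intro!: path_continuous_image continuous_on_subset[OF continuous_on_upper_branches] simp: path_image_compose)

lemma upper_branches_homotopic:
  assumes "path g" "path_image g \<subseteq> upper" "path h" "path_image h \<subseteq> upper"
    "pathstart g = pathstart h" "pathfinish g = pathfinish h"
  shows "homotopic_paths log_config (upper_branches \<circ> g) (upper_branches \<circ> h)"
  using homotopic_paths_continuous_image[OF upper_homotopic[OF assms] continuous_on_upper_branches]
    upper_log_config by blast

text \<open>
  Over the positive axis and around the origin \<open>A2\<close> is closer to \<open>0\<close>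
  than \<open>A1\<close>: the whole path stays in one convex chart.
\<close>

lemma route_to_origin:
  fixes b \<rho> :: real
  assumes "0 < b" "0 < \<rho>" "\<rho> \<le> 1/160" "path g" "path_image g \<subseteq> upper"
    "pathstart g = of_real b" "pathfinish g = of_real (- \<rho>)"
  shows "homotopic_paths log_config (upper_branches \<circ> g)
    (linepath (upper_branches (of_real b)) (upper_branches (of_real (- \<rho>))))"
proof -
  let ?h = "linepath (of_real \<rho>) (\<i> * of_real \<rho>) +++ linepath (\<i> * of_real \<rho>) (of_real (- \<rho>))"
  let ?g = "linepath (of_real b) (of_real \<rho>) +++ ?h"
  have h: "path_image ?h \<subseteq> upper \<inter> cball 0 \<rho>"
    using half_turn_image[of 0 \<rho>] assms by simp
  have im: "x \<in> upper \<and> (norm x \<le> 1/16 \<or> (Im x = 0 \<and> 0 < Re x))" if "x \<in> path_image ?g" for x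
  proof -
    from that consider "x \<in> path_image (linepath (of_real b) (complex_of_real \<rho>))" | "x \<in> path_image ?h"
      by (auto simp del: path_image_linepath dest: subsetD[OF path_image_join_subset])
    then show ?thesis
    proof cases
      case 1
      then obtain t where "x = of_real t" "min b \<rho> \<le> t" by (rule real_segment_image)
      then show ?thesis using assms by (auto simp: upper_def min_def complex_eq_iff split: if_splits)
    next
      case 2
      then show ?thesis using h assms by (auto simp: dist_norm)
    qed
  qed
  have pg: "path ?g" by simp
  have "homotopic_paths log_config (upper_branches \<circ> g) (upper_branches \<circ> ?g)"
    by (rule upper_branches_homotopic) (use assms im pg in \<open>auto simp del: of_real_minus\<close>)
  also have "homotopic_paths log_config (upper_branches \<circ> ?g)
     (linepath (upper_branches (of_real b)) (upper_branches (of_real (- \<rho>))))"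
    by (rule chart_homotopic[OF convex_chart(1) chart_subset(1)])
      (use im pg upper_chart_less in \<open>auto simp: path_image_compose pathstart_compose pathfinish_compose
         simp del: of_real_minus path_image_join intro!: upper_to_log_config(1)\<close>)
  finally show ?thesis .
qed

lemma real_chart_between:
  fixes x :: real
  assumes "-1 < x" "x < 0"
  shows "of_real x \<in> upper" "Im (snd (upper_branches x) - fst (upper_branches x)) = pi / 2"
  using assms upper_branches_real_Im[of x] by (auto simp: upper_def complex_eq_iff)

text \<open>
  Between \<open>0\<close> and \<open>-1\<close> the two pairs lie on different axes. There the
  order of the moduli changes, so the path is followed through a second convex chart.
\<close>

lemma route_to_tangency:
  fixes b \<rho> :: real
  assumes "0 < b" "0 < \<rho>" "\<rho> \<le> 1/160" "path g" "path_image g \<subseteq> upper"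
    "pathstart g = of_real b" "pathfinish g = of_real (-1 + \<rho>)"
  shows "homotopic_paths log_config (upper_branches \<circ> g)
    (linepath (upper_branches (of_real b)) (upper_branches (of_real (- \<rho>))) +++
     linepath (upper_branches (of_real (- \<rho>))) (upper_branches (of_real (-1 + \<rho>))))"
proof -
  define l where "l = linepath (complex_of_real (- \<rho>)) (of_real (-1 + \<rho>))"
  let ?l = l and ?g = "g +++ reversepath l"
  have l: "x \<in> upper \<and> Im (snd (upper_branches x) - fst (upper_branches x)) = pi / 2"
    if "x \<in> path_image ?l" for x
    using that unfolding l_def
  proof (rule real_segment_image)
    fix t assume "x = of_real t" "min (- \<rho>) (-1 + \<rho>) \<le> t" "t \<le> max (- \<rho>) (-1 + \<rho>)"
    then show ?thesis using real_chart_between[of t] assms by (auto simp: min_def max_def split: if_splits)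
  qed
  have pl: "path ?l" "path_image ?l \<subseteq> upper" using l by (auto simp: l_def simp del: path_image_linepath)
  have ends: "pathstart ?l = of_real (- \<rho>)" "pathfinish ?l = of_real (-1 + \<rho>)" by (simp_all add: l_def)
  have pg: "path ?g" "path_image ?g \<subseteq> upper"
    using assms pl ends by (simp_all add: subset_path_image_join del: of_real_minus of_real_add)
  have 1: "homotopic_paths log_config (upper_branches \<circ> ?g)
      (linepath (upper_branches (of_real b)) (upper_branches (of_real (- \<rho>))))"
    by (rule route_to_origin) (use assms pg ends in \<open>simp_all del: of_real_minus of_real_add\<close>)
  have 2: "homotopic_paths log_config (upper_branches \<circ> ?l)
      (linepath (upper_branches (of_real (- \<rho>))) (upper_branches (of_real (-1 + \<rho>))))"
  proof (rule chart_homotopic[OF convex_chart(3) chart_subset(3)])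
    show "path_image (upper_branches \<circ> ?l) \<subseteq> {q. 0 < Im (snd q - fst q) \<and> Im (snd q - fst q) < pi}"
      unfolding path_image_compose
    proof (rule image_subsetI, rule CollectI)
      fix x assume "x \<in> path_image ?l"
      from l[OF this] pi_gt_zero
      show "0 < Im (snd (upper_branches x) - fst (upper_branches x)) \<and>
          Im (snd (upper_branches x) - fst (upper_branches x)) < pi" by linarith
    qed
  qed (use ends pl in \<open>simp_all add: upper_to_log_config pathstart_compose pathfinish_compose\<close>)
  have "homotopic_paths log_config (upper_branches \<circ> g) (upper_branches \<circ> (?g +++ ?l))"
    by (rule upper_branches_homotopic)
      (use assms pl pg ends in \<open>simp_all add: subset_path_image_join del: of_real_minus of_real_add\<close>)
  also have "homotopic_paths log_config \<dots> (linepath (upper_branches (of_real b)) (upper_branches (of_real (- \<rho>))) +++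
     linepath (upper_branches (of_real (- \<rho>))) (upper_branches (of_real (-1 + \<rho>))))"
    unfolding path_compose_join[of upper_branches ?g ?l]
    by (rule homotopic_paths_join[OF 1 2]) (use ends in \<open>simp add: pathfinish_compose pathstart_compose\<close>)
  finally show ?thesis .
qed

text \<open>
  After the half circle around \<open>-1\<close> all points are real, and \<open>A1\<close> is
  closer to \<open>0\<close> than \<open>A2\<close>, which gives a third convex chart.
\<close>

lemma route_to_cusps:
  fixes b \<rho> r :: real
  assumes "0 < b" "0 < \<rho>" "\<rho> \<le> 1/160" "0 < r" "r < 1/8" "path g" "path_image g \<subseteq> upper"
    "pathstart g = of_real b" "pathfinish g = of_real (-9/8 + r)"
  shows "homotopic_paths log_config (upper_branches \<circ> g)
    ((linepath (upper_branches (of_real b)) (upper_branches (of_real (- \<rho>))) +++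
      linepath (upper_branches (of_real (- \<rho>))) (upper_branches (of_real (-1 + \<rho>)))) +++
      linepath (upper_branches (of_real (-1 + \<rho>))) (upper_branches (of_real (-9/8 + r))))"
proof -
  let ?h = "linepath (of_real (-1 + \<rho>)) (-1 + \<i> * of_real \<rho>) +++ linepath (-1 + \<i> * of_real \<rho>) (of_real (-1 - \<rho>))"
  define l where "l = ?h +++ linepath (of_real (-1 - \<rho>)) (complex_of_real (-9/8 + r))"
  let ?l = l and ?g = "g +++ reversepath l"
  have h: "path_image ?h \<subseteq> upper \<inter> cball (-1) \<rho>"
    using half_turn_image[of "-1" \<rho>] assms by simp
  have l: "x \<in> upper \<and> (norm (x + 1) \<le> 1/160 \<or> (Im x = 0 \<and> Re x < -1))"
    if "x \<in> path_image ?l" for x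
  proof -
    from that consider "x \<in> path_image (linepath (of_real (-1 - \<rho>)) (complex_of_real (-9/8 + r)))" | "x \<in> path_image ?h"
      unfolding l_def
      by (auto simp del: path_image_linepath of_real_minus of_real_add of_real_diff dest: subsetD[OF path_image_join_subset])
    then show ?thesis
    proof cases
      case 1
      then obtain t where "x = of_real t" "min (-1 - \<rho>) (-9/8 + r) \<le> t" "t \<le> max (-1 - \<rho>) (-9/8 + r)"
        by (rule real_segment_image)
      then show ?thesis using assms by (auto simp: upper_def min_def max_def complex_eq_iff split: if_splits)
    next
      case 2
      then have "x \<in> upper" "dist (-1) x \<le> \<rho>" using h by auto
      moreover have "dist (-1) x = norm (x + 1)" by (metis add.commute dist_commute dist_norm diff_minus_eq_add)
      ultimately show ?thesis using assms by auto
    qed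
  qed
  have pl: "path ?l" "path_image ?l \<subseteq> upper" using l by (auto simp: l_def simp del: of_real_minus of_real_add of_real_diff path_image_join)
  have ends: "pathstart ?l = of_real (-1 + \<rho>)" "pathfinish ?l = of_real (-9/8 + r)" by (simp_all add: l_def)
  have pg: "path ?g" "path_image ?g \<subseteq> upper"
    using assms pl ends by (simp_all add: subset_path_image_join del: of_real_minus of_real_add)
  have 1: "homotopic_paths log_config (upper_branches \<circ> ?g)
    (linepath (upper_branches (of_real b)) (upper_branches (of_real (- \<rho>))) +++
     linepath (upper_branches (of_real (- \<rho>))) (upper_branches (of_real (-1 + \<rho>))))"
    by (rule route_to_tangency) (use assms pg ends in \<open>simp_all del: of_real_minus of_real_add\<close>)
  have 2: "homotopic_paths log_config (upper_branches \<circ> ?l)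
      (linepath (upper_branches (of_real (-1 + \<rho>))) (upper_branches (of_real (-9/8 + r))))"
  proof (rule chart_homotopic[OF convex_chart(2) chart_subset(2)])
    show "path_image (upper_branches \<circ> ?l) \<subseteq> {q. Re (fst q) < Re (snd q)}"
      using l upper_chart_greater by (auto simp: path_image_compose simp del: path_image_join)
  qed (use ends pl in \<open>simp_all add: upper_to_log_config pathstart_compose pathfinish_compose\<close>)
  have "homotopic_paths log_config (upper_branches \<circ> g) (upper_branches \<circ> (?g +++ ?l))"
  proof (rule upper_branches_homotopic)
    show "path_image (?g +++ ?l) \<subseteq> upper" using pg pl subset_path_image_join by blast
    show "path (?g +++ ?l)" by (rule path_join_imp[OF pg(1) pl(1)]) simp
  qed (use assms ends in auto)
  also have "homotopic_paths log_config \<dots> ((linepath (upper_branches (of_real b)) (upper_branches (of_real (- \<rho>))) +++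
      linepath (upper_branches (of_real (- \<rho>))) (upper_branches (of_real (-1 + \<rho>)))) +++
      linepath (upper_branches (of_real (-1 + \<rho>))) (upper_branches (of_real (-9/8 + r))))"
    unfolding path_compose_join[of upper_branches ?g ?l]
    by (rule homotopic_paths_join[OF 1 2]) (use ends in \<open>simp add: pathfinish_compose pathstart_compose\<close>)
  finally show ?thesis .
qed

section \<open>Half circles and the arcs\<close>

text \<open>The circle with diameter from \<open>\<i> * p\<close> to \<open>\<i> * q\<close>.\<close>

definition diam_circle :: "real \<Rightarrow> real \<Rightarrow> complex set" where
  "diam_circle p q = {z. (norm z)^2 = (p + q) * Im z - p * q}"

lemma diam_circle_iff:
  "z \<in> diam_circle p q \<longleftrightarrow> norm (z - \<i> * of_real ((p + q) / 2)) = \<bar>p - q\<bar> / 2"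
proof -
  have "norm (z - \<i> * of_real ((p + q) / 2)) = \<bar>p - q\<bar> / 2 \<longleftrightarrow>
      (norm (z - \<i> * of_real ((p + q) / 2)))^2 = (\<bar>p - q\<bar> / 2)^2"
    by (intro power_eq_iff_eq_base[symmetric]) auto
  also have "(norm (z - \<i> * of_real ((p + q) / 2)))^2 = (norm z)^2 - (p + q) * Im z + ((p + q) / 2)^2"
    by (simp add: cmod_power2 power2_diff algebra_simps)
  also have "(\<bar>p - q\<bar> / 2)^2 = ((p + q) / 2)^2 - p * q"
    by (simp add: power_divide power2_sum power2_diff field_simps)
  finally show ?thesis by (auto simp: diam_circle_def)
qed

lemma diam_circle_uminus: "- z \<in> diam_circle p q \<longleftrightarrow> z \<in> diam_circle (- p) (- q)"
  by (auto simp: diam_circle_def algebra_simps)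

lemma half_circle_uminus:
  "uminus ` (diam_circle p q \<inter> {z. 0 \<le> Re z}) = diam_circle (- p) (- q) \<inter> {z. Re z \<le> 0}"
  "uminus ` (diam_circle p q \<inter> {z. Re z \<le> 0}) = diam_circle (- p) (- q) \<inter> {z. 0 \<le> Re z}"
proof -
  have um: "uminus ` A = {z. - z \<in> A}" for A :: "complex set"
  proof (intro equalityI subsetI)
    fix z assume "z \<in> {z. - z \<in> A}"
    then show "z \<in> uminus ` A" by (intro image_eqI[of _ _ "- z"]) auto
  qed auto
  show "uminus ` (diam_circle p q \<inter> {z. 0 \<le> Re z}) = diam_circle (- p) (- q) \<inter> {z. Re z \<le> 0}"
    "uminus ` (diam_circle p q \<inter> {z. Re z \<le> 0}) = diam_circle (- p) (- q) \<inter> {z. 0 \<le> Re z}"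
    unfolding um by (simp_all add: diam_circle_uminus set_eq_iff)
qed

lemma diam_circle_commute: "diam_circle p q = diam_circle q p"
  by (simp add: diam_circle_def add.commute mult.commute)

lemma diam_circle_Im:
  assumes "z \<in> diam_circle p q" "q \<le> p"
  shows "q \<le> Im z" "Im z \<le> p"
proof -
  have "(Im z)^2 \<le> (norm z)^2" by (simp add: cmod_power2)
  then have "(Im z - p) * (Im z - q) \<le> 0"
    using assms(1) by (simp add: diam_circle_def power2_eq_square algebra_simps)
  then show "q \<le> Im z" "Im z \<le> p" using assms(2) by (auto simp: mult_le_0_iff)
qed

lemma diam_circle_Re_0:
  assumes "z \<in> diam_circle p q" "Re z = 0"
  shows "Im z = p \<or> Im z = q"
proof -
  have "(norm z)^2 = Im z * Im z" by (subst cmod_power2) (simp add: assms(2) power2_eq_square)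
  then have "(Im z - p) * (Im z - q) = 0"
    using assms(1) by (simp add: diam_circle_def algebra_simps)
  then show ?thesis by simp
qed

lemma part_circle_right:
  assumes "r > 0"
  shows "(\<lambda>x. z + of_real r * exp (\<i> * complex_of_real x)) ` {-(pi/2)..pi/2} = {w. norm (w - z) = r \<and> 0 \<le> Re (w - z)}"
proof (intro equalityI subsetI)
  fix w assume "w \<in> (\<lambda>x. z + of_real r * exp (\<i> * complex_of_real x)) ` {-(pi/2)..pi/2}"
  then obtain x where x: "-(pi/2) \<le> x" "x \<le> pi/2" and w: "w = z + of_real r * exp (\<i> * complex_of_real x)" by auto
  then show "w \<in> {w. norm (w - z) = r \<and> 0 \<le> Re (w - z)}"
    using assms cos_ge_zero[OF x] by (simp add: norm_mult Re_exp)
next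
  fix w assume w: "w \<in> {w. norm (w - z) = r \<and> 0 \<le> Re (w - z)}"
  then have nz: "w - z \<noteq> 0" using assms by auto
  have "\<bar>Im (Ln (w - z))\<bar> \<le> pi/2" using w Re_Ln_pos_le[OF nz] by simp
  moreover have "w = z + of_real r * exp (\<i> * complex_of_real (Im (Ln (w - z))))"
  proof -
    have "w - z = of_real (norm (w - z)) * exp (\<i> * of_real (Im (Ln (w - z))))"
      using Arg_eq[OF nz] Arg_eq_Im_Ln[OF nz] by simp
    then show ?thesis using w by (simp add: algebra_simps)
  qed
  ultimately show "w \<in> (\<lambda>x. z + of_real r * exp (\<i> * complex_of_real x)) ` {-(pi/2)..pi/2}"
    by (intro image_eqI[of _ _ "Im (Ln (w - z))"]) auto
qed

lemma right_arc:
  fixes p q :: real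
  assumes "p \<noteq> q"
  defines "g \<equiv> right_arc (\<i> * of_real p) (\<i> * of_real q)"
  shows "arc g" "pathstart g = \<i> * of_real p" "pathfinish g = \<i> * of_real q"
    "path_image g = diam_circle p q \<inter> {z. 0 \<le> Re z}"
proof -
  let ?m = "\<i> * complex_of_real ((p + q) / 2)" and ?r = "\<bar>p - q\<bar> / 2"
  have mid: "midpoint (\<i> * of_real p) (\<i> * of_real q) = ?m"
    by (simp add: midpoint_def scaleR_conv_of_real algebra_simps)
  have dist: "dist (\<i> * of_real p) (\<i> * of_real q) / 2 = ?r"
    by (simp add: dist_norm right_diff_distrib[symmetric] norm_mult flip: of_real_diff)
  have arg: "Arg (\<i> * of_real t) = (if t > 0 then pi/2 else - pi/2)" if "t \<noteq> 0" for t
    using Ln_i_real(1)[of t] Ln_i_real(2)[of "-t"] that by (auto simp: Arg_eq_Im_Ln)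
  have diff: "\<i> * of_real p - \<i> * of_real q = \<i> * complex_of_real (p - q)"
    "\<i> * of_real q - \<i> * of_real p = \<i> * complex_of_real (q - p)" by (simp_all add: algebra_simps)
  let ?s = "if p > q then pi/2 else - pi/2"
  have g: "g = part_circlepath ?m ?r ?s (- ?s)"
    unfolding g_def right_arc_def mid dist diff using arg[of "p - q"] arg[of "q - p"] assms(1) by auto
  have r: "?r > 0" using assms(1) by simp
  show "arc g" unfolding g using r by (intro arc_part_circlepath) auto
  have e: "exp (\<i> * (pi / 2)) = \<i>" "exp (- (\<i> * pi / 2)) = - \<i>"
    using cis_conv_exp[of "pi/2"] cis_conv_exp[of "-(pi/2)"] by (simp_all add: mult_ac)
  show "pathstart g = \<i> * of_real p" "pathfinish g = \<i> * of_real q"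
    using assms(1) e unfolding g pathstart_part_circlepath pathfinish_part_circlepath
    by (auto simp: complex_eq_iff field_simps)
  have "path_image g = (\<lambda>x. ?m + of_real ?r * exp (\<i> * complex_of_real x)) ` {-(pi/2)..pi/2}"
  proof (cases "p > q")
    case True
    have "path_image g = path_image (reversepath g)" by simp
    also have "reversepath g = part_circlepath ?m ?r (-(pi/2)) (pi/2)" using True by (simp add: g)
    also have "path_image \<dots> = (\<lambda>x. ?m + of_real ?r * exp (\<i> * complex_of_real x)) ` {-(pi/2)..pi/2}"
      by (subst path_image_part_circlepath) auto
    finally show ?thesis .
  next
    case False
    then have "g = part_circlepath ?m ?r (-(pi/2)) (pi/2)" by (simp add: g)
    then show ?thesis by (simp only:) (subst path_image_part_circlepath, auto)
  qed
  then show "path_image g = diam_circle p q \<inter> {z. 0 \<le> Re z}"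
    unfolding part_circle_right[OF r] set_eq_iff Int_iff diam_circle_iff mem_Collect_eq
    by (simp del: of_real_add of_real_divide)
qed

lemma left_arc:
  fixes p q :: real
  assumes "p \<noteq> q"
  defines "g \<equiv> left_arc (\<i> * of_real p) (\<i> * of_real q)"
  shows "arc g" "pathstart g = \<i> * of_real p" "pathfinish g = \<i> * of_real q"
    "path_image g = diam_circle p q \<inter> {z. Re z \<le> 0}"
proof -
  let ?h = "right_arc (\<i> * of_real p) (\<i> * of_real q)"
  let ?c = "\<lambda>z :: complex. - cnj z"
  note h = right_arc[OF assms(1)]
  have g: "g = ?c \<circ> ?h" by (simp add: g_def left_arc_def o_def)
  have "inj ?c" by (rule injI) simp
  then show "arc g" unfolding g arc_def using h(1)
    by (intro conjI comp_inj_on path_continuous_image)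
      (auto simp: arc_def intro!: continuous_intros intro: inj_on_subset)
  show "pathstart g = \<i> * of_real p" "pathfinish g = \<i> * of_real q"
    unfolding g pathstart_compose pathfinish_compose h by simp_all
  have "z \<in> path_image g \<longleftrightarrow> ?c z \<in> path_image ?h" for z
    unfolding g path_image_compose image_iff by (metis complex_cnj_cnj complex_cnj_minus minus_minus)
  then show "path_image g = diam_circle p q \<inter> {z. Re z \<le> 0}"
    unfolding h by (auto simp: diam_circle_def)
qed

text \<open>
  A half circle with diameter on the imaginary axis meets every circle around \<open>0\<close> at most once;
  this is its equation in polar coordinates.
\<close>

lemma half_circle_polar:
  assumes "0 \<le> \<beta>" "\<beta> < \<alpha>"
  shows "(\<lambda>r. of_real r * cis (arcsin ((r^2 - \<alpha> * \<beta>) / (r * (\<alpha> - \<beta>))))) ` {\<beta>..\<alpha>} =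
    diam_circle \<alpha> (- \<beta>) \<inter> {z. 0 \<le> Re z}"
proof -
  let ?w = "\<lambda>r. (r^2 - \<alpha> * \<beta>) / (r * (\<alpha> - \<beta>))"
  have w: "-1 \<le> ?w r \<and> ?w r \<le> 1 \<and> r * ?w r * (\<alpha> - \<beta>) = r^2 - \<alpha> * \<beta>" if "r \<in> {\<beta>..\<alpha>}" for r
  proof (cases "r = 0")
    case False
    then have r: "r > 0" using that assms by auto
    have pos: "0 < r * (\<alpha> - \<beta>)" using r assms by simp
    have "(r - \<alpha>) * (r + \<beta>) \<le> 0" "0 \<le> (r + \<alpha>) * (r - \<beta>)"
      using that assms r by (auto intro: mult_nonpos_nonneg)
    then have "r^2 - \<alpha> * \<beta> \<le> 1 * (r * (\<alpha> - \<beta>))" "-1 * (r * (\<alpha> - \<beta>)) \<le> r^2 - \<alpha> * \<beta>"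
      by (simp_all add: algebra_simps power2_eq_square)
    then show ?thesis using pos r assms by (simp add: pos_divide_le_eq pos_le_divide_eq)
  qed (use that assms in auto)
  show ?thesis
  proof (intro equalityI subsetI)
    fix z assume "z \<in> (\<lambda>r. of_real r * cis (arcsin (?w r))) ` {\<beta>..\<alpha>}"
    then obtain r where r: "r \<in> {\<beta>..\<alpha>}" and z: "z = of_real r * cis (arcsin (?w r))" by auto
    define W where "W = ?w r"
    have im: "Im z = r * W" using w[OF r] by (simp add: z W_def)
    have "0 \<le> cos (arcsin (?w r))" using w[OF r] arcsin_bounded[of "?w r"] by (intro cos_ge_zero) auto
    then have "Re z \<ge> 0" using r assms by (simp add: z)
    moreover have "(norm z)^2 = r^2" by (simp add: z norm_mult)
    moreover have "r * W * (\<alpha> - \<beta>) = r^2 - \<alpha> * \<beta>" using w[OF r] unfolding W_def by blast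
    ultimately show "z \<in> diam_circle \<alpha> (- \<beta>) \<inter> {z. 0 \<le> Re z}"
      by (simp add: diam_circle_def im algebra_simps)
  next
    fix z assume z: "z \<in> diam_circle \<alpha> (- \<beta>) \<inter> {z. 0 \<le> Re z}"
    define r where "r = norm z"
    have r2: "r^2 = (\<alpha> - \<beta>) * Im z + \<alpha> * \<beta>" using z by (simp add: diam_circle_def r_def)
    have im: "- \<beta> \<le> Im z" "Im z \<le> \<alpha>" using z diam_circle_Im[of z \<alpha> "- \<beta>"] assms by auto
    have "(\<alpha> - \<beta>) * (- \<beta>) \<le> (\<alpha> - \<beta>) * Im z" by (rule mult_left_mono) (use im assms in auto)
    moreover have "(\<alpha> - \<beta>) * Im z \<le> (\<alpha> - \<beta>) * \<alpha>" by (rule mult_left_mono) (use im assms in auto)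
    ultimately have "\<beta>^2 \<le> r^2" "r^2 \<le> \<alpha>^2" unfolding r2 by (simp_all add: power2_eq_square algebra_simps)
    then have r: "r \<in> {\<beta>..\<alpha>}" using assms by (auto simp: r_def intro: power2_le_imp_le)
    have "z = of_real r * cis (arcsin (?w r))"
    proof (cases "r = 0")
      case False
      then have r0: "r > 0" by (simp add: r_def)
      have wr: "?w r = Im z / r"
        using r0 assms by (simp add: r2 field_simps)
      have le: "-1 \<le> Im z / r" "Im z / r \<le> 1" using abs_Im_le_cmod[of z] r0 by (auto simp: r_def field_simps abs_le_iff)
      have e1: "r^2 * (1 - (Im z / r)^2) = r^2 - (Im z)^2"
        using r0 by (simp add: power_divide right_diff_distrib)
      have e2: "r^2 = (Re z)^2 + (Im z)^2" unfolding r_def by (rule cmod_power2)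
      have X: "r^2 * (1 - (Im z / r)^2) = (Re z)^2" unfolding e1 unfolding e2 by simp
      have "r * sqrt (1 - (Im z / r)^2) = sqrt (r^2 * (1 - (Im z / r)^2))"
        using r0 by (simp add: real_sqrt_mult)
      also have "\<dots> = Re z" unfolding X using z by simp
      finally have "r * sqrt (1 - (Im z / r)^2) = Re z" .
      then show ?thesis using r0 le by (simp add: complex_eq_iff wr cos_arcsin)
    qed (simp add: r_def)
    then show "z \<in> (\<lambda>r. of_real r * cis (arcsin (?w r))) ` {\<beta>..\<alpha>}" using r by blast
  qed
qed

text \<open>
  The angle by which the point at radius \<open>\<rho>\<close> of the half circle from \<open>\<i>
  * \<alpha>\<close> to \<open>- \<i> * \<beta>\<close> is turned against the upper imaginary
  axis, continued by constants to all radii.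
\<close>

definition turn :: "real \<Rightarrow> real \<Rightarrow> real \<Rightarrow> real" where
  "turn \<alpha> \<beta> \<rho> = (let r = max \<beta> (min \<alpha> \<rho>) in arcsin ((r^2 - \<alpha> * \<beta>) / (r * (\<alpha> - \<beta>))) - pi / 2)"

definition inner_turn :: "real \<Rightarrow> real \<Rightarrow> real" where
  "inner_turn \<mu> \<rho> = arcsin (max 0 (min 1 (\<rho> / \<mu>))) - pi / 2"

lemma turn_ends:
  assumes "0 < \<beta>" "\<beta> < \<alpha>"
  shows "\<rho> \<le> \<beta> \<Longrightarrow> turn \<alpha> \<beta> \<rho> = - pi" "\<alpha> \<le> \<rho> \<Longrightarrow> turn \<alpha> \<beta> \<rho> = 0"
proof -
  have sq: "\<beta>^2 - \<alpha> * \<beta> = - (\<beta> * (\<alpha> - \<beta>))" "\<alpha>^2 - \<alpha> * \<beta> = \<alpha> * (\<alpha> - \<beta>)"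
    by (simp_all add: power2_eq_square algebra_simps)
  have "(\<beta>^2 - \<alpha> * \<beta>) / (\<beta> * (\<alpha> - \<beta>)) = -1" "(\<alpha>^2 - \<alpha> * \<beta>) / (\<alpha> * (\<alpha> - \<beta>)) = 1"
    unfolding sq using assms by simp_all
  note q = this
  have m: "\<rho> \<le> \<beta> \<Longrightarrow> max \<beta> (min \<alpha> \<rho>) = \<beta>" "\<alpha> \<le> \<rho> \<Longrightarrow> max \<beta> (min \<alpha> \<rho>) = \<alpha>" using assms by auto
  show "turn \<alpha> \<beta> \<rho> = - pi" if "\<rho> \<le> \<beta>" unfolding turn_def Let_def m(1)[OF that] q by simp
  show "turn \<alpha> \<beta> \<rho> = 0" if "\<alpha> \<le> \<rho>" unfolding turn_def Let_def m(2)[OF that] q by simp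
qed

lemma continuous_on_turn:
  assumes "0 < \<beta>" "\<beta> < \<alpha>"
  shows "continuous_on UNIV (turn \<alpha> \<beta>)"
proof -
  have w: "(r^2 - \<alpha> * \<beta>) / (r * (\<alpha> - \<beta>)) \<in> {-1..1}" if r: "\<beta> \<le> r" "r \<le> \<alpha>" for r
  proof -
    have pos: "0 < r * (\<alpha> - \<beta>)" using r assms by simp
    have "(r - \<alpha>) * (r + \<beta>) \<le> 0" "0 \<le> (r + \<alpha>) * (r - \<beta>)"
      using assms r by (auto intro: mult_nonpos_nonneg)
    then have "r^2 - \<alpha> * \<beta> \<le> 1 * (r * (\<alpha> - \<beta>))" "-1 * (r * (\<alpha> - \<beta>)) \<le> r^2 - \<alpha> * \<beta>"
      by (simp_all add: algebra_simps power2_eq_square)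
    then show ?thesis using pos by (simp add: pos_divide_le_eq pos_le_divide_eq)
  qed
  have m: "\<beta> \<le> max \<beta> (min \<alpha> \<rho>)" "max \<beta> (min \<alpha> \<rho>) \<le> \<alpha>" for \<rho> using assms by auto
  have nz: "max \<beta> (min \<alpha> \<rho>) * (\<alpha> - \<beta>) \<noteq> 0" for \<rho> using m(1)[of \<rho>] assms by auto
  have "continuous_on UNIV (\<lambda>\<rho>. ((max \<beta> (min \<alpha> \<rho>))^2 - \<alpha> * \<beta>) / (max \<beta> (min \<alpha> \<rho>) * (\<alpha> - \<beta>)))"
    using nz by (intro continuous_intros) blast
  then have "continuous_on UNIV (\<lambda>\<rho>. arcsin (((max \<beta> (min \<alpha> \<rho>))^2 - \<alpha> * \<beta>) / (max \<beta> (min \<alpha> \<rho>) * (\<alpha> - \<beta>))))"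
    by (rule continuous_on_arcsin) (use w[OF m] in auto)
  from continuous_on_diff[OF this continuous_on_const] show ?thesis
    unfolding turn_def Let_def .
qed

lemma continuous_on_inner_turn: "\<mu> > 0 \<Longrightarrow> continuous_on UNIV (inner_turn \<mu>)"
  unfolding inner_turn_def by (intro continuous_intros continuous_on_arcsin) auto

lemma rot_uminus: "rot \<theta> s (- z) = - rot \<theta> s z"
  by (simp add: rot_def)

lemma rot_i: "0 \<le> r \<Longrightarrow> rot \<theta> 1 (\<i> * of_real r) = of_real r * cis (\<theta> r + pi / 2)"
  by (simp add: rot_def norm_mult flip: cis_mult)

lemma imag_segment: "closed_segment (\<i> * of_real p) (\<i> * of_real q) = (\<lambda>r. \<i> * of_real r) ` closed_segment p q"
proof -
  have "linear (\<lambda>r. \<i> * complex_of_real r)" by (auto intro!: linearI simp: scaleR_conv_of_real algebra_simps)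
  from closed_segment_linear_image[OF this, of p q] show ?thesis by simp
qed

lemma rot_turn_segment:
  assumes "0 < \<beta>" "\<beta> < \<alpha>"
  shows "rot (turn \<alpha> \<beta>) 1 ` closed_segment (\<i> * of_real \<alpha>) (\<i> * of_real \<beta>) =
    diam_circle \<alpha> (- \<beta>) \<inter> {z. 0 \<le> Re z}"
proof -
  have "rot (turn \<alpha> \<beta>) 1 ` closed_segment (\<i> * of_real \<alpha>) (\<i> * of_real \<beta>) =
      (\<lambda>r. rot (turn \<alpha> \<beta>) 1 (\<i> * of_real r)) ` {\<beta>..\<alpha>}"
    using assms by (simp add: imag_segment image_image closed_segment_eq_real_ivl)
  also have "\<dots> = (\<lambda>r. of_real r * cis (arcsin ((r^2 - \<alpha> * \<beta>) / (r * (\<alpha> - \<beta>))))) ` {\<beta>..\<alpha>}"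
    using assms by (intro image_cong) (auto simp: rot_i turn_def Let_def min_def max_def)
  finally show ?thesis using half_circle_polar[of \<beta> \<alpha>] assms by simp
qed

definition s_turn :: "real \<Rightarrow> real \<Rightarrow> real \<Rightarrow> real" where
  "s_turn \<alpha> \<mu> \<rho> = turn \<alpha> \<mu> \<rho> + inner_turn \<mu> \<rho>"

lemma rot_s_turn_segment:
  assumes "0 < \<mu>" "\<mu> < \<alpha>"
  shows "rot (s_turn \<alpha> \<mu>) 1 ` closed_segment (\<i> * of_real \<alpha>) (- (\<i> * of_real \<alpha>)) =
    (diam_circle \<alpha> (- \<mu>) \<inter> {z. 0 \<le> Re z}) \<union> (diam_circle (- \<mu>) 0 \<inter> {z. Re z \<le> 0}) \<union>
    (diam_circle 0 \<mu> \<inter> {z. 0 \<le> Re z}) \<union> (diam_circle \<mu> (- \<alpha>) \<inter> {z. Re z \<le> 0})"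
proof -
  let ?R = "\<lambda>r. rot (s_turn \<alpha> \<mu>) 1 (\<i> * of_real r)"
  have neg: "?R ` {-b..-a} = uminus ` ?R ` {a..b}" for a b
  proof -
    have "{-b..-a} = uminus ` {a..b}" by simp
    then have "?R ` {-b..-a} = (\<lambda>r. ?R (- r)) ` {a..b}" by (simp only: image_image)
    also have "\<dots> = (\<lambda>r. - ?R r) ` {a..b}" by (intro image_cong) (simp_all add: rot_uminus)
    finally show ?thesis by (simp only: image_image)
  qed
  note negc = half_circle_uminus
  have 1: "?R ` {\<mu>..\<alpha>} = diam_circle \<alpha> (- \<mu>) \<inter> {z. 0 \<le> Re z}"
  proof -
    have "?R ` {\<mu>..\<alpha>} = (\<lambda>r. rot (turn \<alpha> \<mu>) 1 (\<i> * of_real r)) ` {\<mu>..\<alpha>}"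
      using assms by (intro image_cong) (auto simp: rot_i s_turn_def inner_turn_def min_def max_def)
    also have "\<dots> = rot (turn \<alpha> \<mu>) 1 ` closed_segment (\<i> * of_real \<alpha>) (\<i> * of_real \<mu>)"
      using assms by (simp add: imag_segment image_image closed_segment_eq_real_ivl)
    finally show ?thesis using rot_turn_segment[OF assms] by simp
  qed
  have 2: "?R ` {0..\<mu>} = diam_circle (- \<mu>) 0 \<inter> {z. Re z \<le> 0}"
  proof -
    have "?R r = - (of_real r * cis (arcsin ((r^2 - \<mu> * 0) / (r * (\<mu> - 0)))))" if "r \<in> {0..\<mu>}" for r
    proof -
      have "max 0 (min 1 (r / \<mu>)) = (r^2 - \<mu> * 0) / (r * (\<mu> - 0))"
        using that assms by (cases "r = 0") (auto simp: min_def max_def power2_eq_square field_simps)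
      then have st: "s_turn \<alpha> \<mu> r + pi / 2 = arcsin ((r^2 - \<mu> * 0) / (r * (\<mu> - 0))) - pi"
        using turn_ends(1)[OF assms, of r] that unfolding s_turn_def inner_turn_def by (simp only: atLeastAtMost_iff)
      have "?R r = of_real r * cis (s_turn \<alpha> \<mu> r + pi / 2)" using that by (intro rot_i) simp
      also have "\<dots> = - (of_real r * cis (arcsin ((r^2 - \<mu> * 0) / (r * (\<mu> - 0)))))"
        unfolding st cis_divide[symmetric] by simp
      finally show ?thesis .
    qed
    then have "?R ` {0..\<mu>} = uminus ` (\<lambda>r. of_real r * cis (arcsin ((r^2 - \<mu> * 0) / (r * (\<mu> - 0))))) ` {0..\<mu>}"
      by (simp only: image_image cong: image_cong)
    also have "\<dots> = uminus ` (diam_circle \<mu> (- 0) \<inter> {z. 0 \<le> Re z})"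
      using half_circle_polar[of 0 \<mu>] assms by (simp only: order_refl)
    finally show ?thesis by (simp add: negc)
  qed
  have "{-\<alpha>..\<alpha>} = {\<mu>..\<alpha>} \<union> {0..\<mu>} \<union> {-\<mu>..-0} \<union> {-\<alpha>..-\<mu>}" using assms by auto
  then have "?R ` {-\<alpha>..\<alpha>} = ?R ` {\<mu>..\<alpha>} \<union> ?R ` {0..\<mu>} \<union> ?R ` {-\<mu>..-0} \<union> ?R ` {-\<alpha>..-\<mu>}"
    by (simp only: image_Un)
  also have "\<dots> = (diam_circle \<alpha> (- \<mu>) \<inter> {z. 0 \<le> Re z}) \<union> (diam_circle (- \<mu>) 0 \<inter> {z. Re z \<le> 0}) \<union>
    (diam_circle 0 \<mu> \<inter> {z. 0 \<le> Re z}) \<union> (diam_circle \<mu> (- \<alpha>) \<inter> {z. Re z \<le> 0})"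
    unfolding neg 1 2 negc by (simp add: diam_circle_commute)
  also have "?R ` {-\<alpha>..\<alpha>} = rot (s_turn \<alpha> \<mu>) 1 ` closed_segment (\<i> * of_real \<alpha>) (\<i> * of_real (- \<alpha>))"
    unfolding imag_segment image_image using assms by (simp add: closed_segment_eq_real_ivl)
  finally show ?thesis by simp
qed

lemma arc3_arc:
  fixes \<alpha> \<beta> :: real
  assumes "0 < \<beta>" "\<beta> < \<alpha>"
    and P: "P $ A1 = \<i> * of_real \<alpha>" "P $ A2 = - (\<i> * of_real \<beta>)" "P $ B1 = - (\<i> * of_real \<alpha>)" "P $ B2 = \<i> * of_real \<beta>"
  defines "\<mu> \<equiv> (\<alpha> + \<beta>) / 2"
  shows "arc (arc3 P)" "pathstart (arc3 P) = P $ A1" "pathfinish (arc3 P) = P $ B1"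
    "path_image (arc3 P) = (diam_circle \<alpha> (- \<mu>) \<inter> {z. 0 \<le> Re z}) \<union> (diam_circle (- \<mu>) 0 \<inter> {z. Re z \<le> 0}) \<union>
      (diam_circle 0 \<mu> \<inter> {z. 0 \<le> Re z}) \<union> (diam_circle \<mu> (- \<alpha>) \<inter> {z. Re z \<le> 0})"
proof -
  have \<mu>: "\<beta> < \<mu>" "\<mu> < \<alpha>" "0 < \<mu>" "2 * \<mu> = \<alpha> + \<beta>" using assms by (simp_all add: \<mu>_def)
  have mids: "midpoint (P $ A2) (P $ B1) = \<i> * of_real (- \<mu>)" "midpoint (P $ A2) (P $ B2) = \<i> * of_real 0"
    "midpoint (P $ B2) (P $ A1) = \<i> * of_real \<mu>" "P $ A1 = \<i> * of_real \<alpha>" "P $ B1 = \<i> * of_real (- \<alpha>)"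
    by (simp_all add: P midpoint_def scaleR_conv_of_real \<mu>_def algebra_simps add_divide_distrib)
  let ?r1 = "right_arc (\<i> * of_real \<alpha>) (\<i> * of_real (- \<mu>))" and ?l2 = "left_arc (\<i> * of_real (- \<mu>)) (\<i> * of_real 0)"
  let ?r3 = "right_arc (\<i> * of_real 0) (\<i> * of_real \<mu>)" and ?l4 = "left_arc (\<i> * of_real \<mu>) (\<i> * of_real (- \<alpha>))"
  have g: "arc3 P = ?r1 +++ ?l2 +++ ?r3 +++ ?l4" unfolding arc3_def mids(1-3) unfolding mids(4,5) ..
  have ne: "\<alpha> \<noteq> - \<mu>" "- \<mu> \<noteq> 0" "0 \<noteq> \<mu>" "\<mu> \<noteq> - \<alpha>" using \<mu> by auto
  note r1 = right_arc[OF ne(1)] and l2 = left_arc[OF ne(2)] and r3 = right_arc[OF ne(3)] and l4 = left_arc[OF ne(4)]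
  have eqI: "z = \<i> * of_real y" if "Re z = 0" "Im z = y" for z y using that by (simp add: complex_eq_iff)
  have c34: "z = \<i> * of_real \<mu>" if "z \<in> path_image ?r3" "z \<in> path_image ?l4" for z
  proof (rule eqI)
    show re: "Re z = 0" using that unfolding r3 l4 by simp
    show "Im z = \<mu>" using diam_circle_Re_0[of z 0 \<mu>] diam_circle_Re_0[of z \<mu> "- \<alpha>"] that re \<mu> unfolding r3 l4 by auto
  qed
  have c23: "z = \<i> * of_real 0" if "z \<in> path_image ?l2" "z \<in> path_image ?r3" for z
  proof (rule eqI)
    show re: "Re z = 0" using that unfolding r3 l2 by simp
    show "Im z = 0" using diam_circle_Re_0[of z 0 \<mu>] diam_circle_Re_0[of z "- \<mu>" 0] that re \<mu> unfolding r3 l2 by auto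
  qed
  have c12: "z = \<i> * of_real (- \<mu>)" if "z \<in> path_image ?r1" "z \<in> path_image ?l2" for z
  proof (rule eqI)
    show re: "Re z = 0" using that unfolding r1 l2 by simp
    show "Im z = - \<mu>" using diam_circle_Re_0[of z \<alpha> "- \<mu>"] diam_circle_Re_0[of z "- \<mu>" 0] that re \<mu> unfolding r1 l2 by auto
  qed
  have far: False if "y = \<alpha> * \<mu> / \<beta>" "y \<le> \<mu>" for y
  proof -
    have "\<beta> * y = \<alpha> * \<mu>" using that(1) assms(1) by simp
    moreover have "\<beta> * y \<le> \<beta> * \<mu>" using that(2) assms(1) by simp
    moreover have "\<beta> * \<mu> < \<alpha> * \<mu>" using assms(2) \<mu>(3) by simp
    ultimately show False by simp
  qed
  have c24: False if "z \<in> path_image ?l2" "z \<in> path_image ?l4" for z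
  proof (rule far)
    have "- \<mu> * Im z = (\<mu> - \<alpha>) * Im z + \<mu> * \<alpha>" using that unfolding l2 l4 by (simp add: diam_circle_def)
    then have "(2 * \<mu> - \<alpha>) * (- Im z) = \<alpha> * \<mu>" by (simp add: algebra_simps)
    then have "\<beta> * (- Im z) = \<alpha> * \<mu>" using \<mu>(4) by simp
    then show "- Im z = \<alpha> * \<mu> / \<beta>" using assms(1) by (simp add: field_simps)
    show "- Im z \<le> \<mu>" using diam_circle_Im(1)[of z 0 "- \<mu>"] that \<mu> unfolding l2 by (simp add: diam_circle_commute)
  qed
  have c13: False if "z \<in> path_image ?r1" "z \<in> path_image ?r3" for z
  proof (rule far)
    have "\<mu> * Im z = (\<alpha> - \<mu>) * Im z + \<alpha> * \<mu>" using that unfolding r1 r3 by (simp add: diam_circle_def)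
    then have "(2 * \<mu> - \<alpha>) * Im z = \<alpha> * \<mu>" by (simp add: algebra_simps)
    then have "\<beta> * Im z = \<alpha> * \<mu>" using \<mu>(4) by simp
    then show "Im z = \<alpha> * \<mu> / \<beta>" using assms(1) by (simp add: field_simps)
    show "Im z \<le> \<mu>" using diam_circle_Im(2)[of z \<mu> 0] that \<mu> unfolding r3 by (simp add: diam_circle_commute)
  qed
  have c14: False if "z \<in> path_image ?r1" "z \<in> path_image ?l4" for z
  proof -
    have re: "Re z = 0" using that unfolding r1 l4 by simp
    show False using diam_circle_Re_0[of z \<alpha> "- \<mu>"] diam_circle_Re_0[of z \<mu> "- \<alpha>"] that re \<mu> unfolding r1 l4 by auto
  qed
  have im34: "path_image (?r3 +++ ?l4) = path_image ?r3 \<union> path_image ?l4"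
    by (rule path_image_join) (simp only: r3(3) l4(2))
  have im234: "path_image (?l2 +++ ?r3 +++ ?l4) = path_image ?l2 \<union> path_image (?r3 +++ ?l4)"
    by (rule path_image_join) (simp only: pathstart_join l2(3) r3(2))
  have a34: "arc (?r3 +++ ?l4)"
  proof (rule arc_join[OF r3(1) l4(1)])
    show "path_image ?r3 \<inter> path_image ?l4 \<subseteq> {pathstart ?l4}" unfolding l4(2) using c34 by blast
  qed (simp only: r3(3) l4(2))
  have a234: "arc (?l2 +++ ?r3 +++ ?l4)"
  proof (rule arc_join[OF l2(1) a34])
    show "path_image ?l2 \<inter> path_image (?r3 +++ ?l4) \<subseteq> {pathstart (?r3 +++ ?l4)}"
      unfolding pathstart_join r3(2) im34 using c23 c24 by blast
  qed (simp only: pathstart_join l2(3) r3(2))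
  show "arc (arc3 P)" unfolding g
  proof (rule arc_join[OF r1(1) a234])
    show "path_image ?r1 \<inter> path_image (?l2 +++ ?r3 +++ ?l4) \<subseteq> {pathstart (?l2 +++ ?r3 +++ ?l4)}"
      unfolding pathstart_join l2(2) im234 im34 using c12 c13 c14 by blast
  qed (simp only: pathstart_join r1(3) l2(2))
  show "pathstart (arc3 P) = P $ A1" "pathfinish (arc3 P) = P $ B1"
    unfolding g pathstart_join pathfinish_join r1(2) l4(3) mids(4,5) by (rule refl)+
  have im: "path_image (?r1 +++ ?l2 +++ ?r3 +++ ?l4) = path_image ?r1 \<union> path_image (?l2 +++ ?r3 +++ ?l4)"
    by (rule path_image_join) (simp only: pathstart_join r1(3) l2(2))
  show "path_image (arc3 P) = (diam_circle \<alpha> (- \<mu>) \<inter> {z. 0 \<le> Re z}) \<union> (diam_circle (- \<mu>) 0 \<inter> {z. Re z \<le> 0}) \<union>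
      (diam_circle 0 \<mu> \<inter> {z. 0 \<le> Re z}) \<union> (diam_circle \<mu> (- \<alpha>) \<inter> {z. Re z \<le> 0})"
    unfolding g im im234 im34 r1(4) l2(4) r3(4) l4(4) by (simp only: Un_assoc)
qed

section \<open>The half-twists\<close>

lemma exp_on_imaginary_axis:
  "Im a = pi / 2 \<Longrightarrow> exp a = \<i> * of_real (exp (Re a))"
  "Im a = - pi / 2 \<Longrightarrow> exp a = - (\<i> * of_real (exp (Re a)))"
proof -
  assume "Im a = pi / 2"
  then have "cos (Im a) = 0" "sin (Im a) = 1" by (simp_all only: cos_pi_half sin_pi_half)
  then show "exp a = \<i> * of_real (exp (Re a))" by (simp add: complex_eq_iff Re_exp Im_exp)
next
  assume "Im a = - pi / 2"
  then have "Im a = - (pi / 2)" by simp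
  then have "cos (Im a) = 0" "sin (Im a) = -1" by (simp_all only: cos_minus sin_minus cos_pi_half sin_pi_half)
  then show "exp a = - (\<i> * of_real (exp (Re a)))" by (simp add: complex_eq_iff Re_exp Im_exp)
qed

lemma rot_conf:
  assumes "\<theta> (exp (Re a)) = 0" "\<theta> (exp (Re m)) = - \<tau>"
  shows "rot \<theta> (1 - s) (conf (a, m + \<i> * of_real \<tau>) $ k) =
    conf (linepath (a, m) (a, m + \<i> * of_real \<tau>) s) $ k"
proof -
  have l: "linepath (a, m) (a, m + \<i> * of_real \<tau>) s = (a, m + \<i> * of_real (s * \<tau>))"
    by (simp add: linepath_def scaleR_conv_of_real algebra_simps)
  have ra: "rot \<theta> (1 - s) (exp a) = exp a" using assms(1) by (simp add: rot_def norm_exp)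
  have rm: "rot \<theta> (1 - s) (exp (m + \<i> * of_real \<tau>)) = exp (m + \<i> * of_real (s * \<tau>))"
    using assms(2) by (simp add: rot_def norm_exp cis_conv_exp exp_add[symmetric] algebra_simps)
  show ?thesis unfolding l by (cases k) (simp_all add: rot_uminus ra rm del: of_real_mult)
qed

lemma negative_ratio:
  assumes "\<bar>Im (m - a)\<bar> < pi" "of_real c * exp a + of_real d * exp m = 0" "0 \<le> c" "0 \<le> d"
  shows "c = 0 \<and> d = 0"
proof -
  have "of_real c + of_real d * exp (m - a) = (of_real c * exp a + of_real d * exp m) / exp a"
    by (simp add: exp_diff add_divide_distrib)
  then have z: "of_real c + of_real d * exp (m - a) = 0" using assms(2) by simp
  have "Re (of_real c + of_real d * exp (m - a)) = 0" "Im (of_real c + of_real d * exp (m - a)) = 0"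
    unfolding z by simp_all
  then have re: "c + d * (exp (Re (m - a)) * cos (Im (m - a))) = 0"
    and im: "d * (exp (Re (m - a)) * sin (Im (m - a))) = 0" by (simp_all add: Re_exp Im_exp)
  show ?thesis
  proof (cases "d = 0")
    case False
    then have "sin (Im (m - a)) = 0" using im by simp
    moreover have "- pi < Im (m - a)" "Im (m - a) < pi" using assms(1) by linarith+
    ultimately have "Im (m - a) = 0" using sin_eq_0_pi by blast
    then have "c + d * exp (Re (m - a)) = 0" using re by simp
    moreover have "d * exp (Re (m - a)) > 0" using False assms(4) by simp
    ultimately show ?thesis using assms(3) by linarith
  qed (use re in simp)
qed

lemma segment_free_adjacent:
  assumes "\<bar>Im (m - a)\<bar> < pi"
  shows "- exp a \<notin> closed_segment (exp a) (exp m)" "- exp m \<notin> closed_segment (exp a) (exp m)"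
proof -
  show "- exp a \<notin> closed_segment (exp a) (exp m)"
  proof
    assume "- exp a \<in> closed_segment (exp a) (exp m)"
    then obtain u where u: "0 \<le> u" "u \<le> 1" "- exp a = (1 - u) *\<^sub>R exp a + u *\<^sub>R exp m" by (auto simp: in_segment)
    have "of_real (2 - u) * exp a + of_real u * exp m = exp a + ((1 - u) *\<^sub>R exp a + u *\<^sub>R exp m)"
      by (simp add: scaleR_conv_of_real algebra_simps)
    then have "of_real (2 - u) * exp a + of_real u * exp m = 0" unfolding u(3)[symmetric] by simp
    from negative_ratio[OF assms this] u show False by simp
  qed
  show "- exp m \<notin> closed_segment (exp a) (exp m)"
  proof
    assume "- exp m \<in> closed_segment (exp a) (exp m)"
    then obtain u where u: "0 \<le> u" "u \<le> 1" "- exp m = (1 - u) *\<^sub>R exp a + u *\<^sub>R exp m" by (auto simp: in_segment)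
    have "of_real (1 - u) * exp a + of_real (1 + u) * exp m = exp m + ((1 - u) *\<^sub>R exp a + u *\<^sub>R exp m)"
      by (simp add: scaleR_conv_of_real algebra_simps)
    then have "of_real (1 - u) * exp a + of_real (1 + u) * exp m = 0" unfolding u(3)[symmetric] by simp
    from negative_ratio[OF assms this] u show False by simp
  qed
qed

lemma segment_uminus: "- z \<in> closed_segment (- a) (- b) \<longleftrightarrow> z \<in> closed_segment a (b :: complex)"
proof -
  have "- z \<in> closed_segment (- a) (- b) \<longleftrightarrow> (\<exists>u. 0 \<le> u \<and> u \<le> 1 \<and> - z = - ((1 - u) *\<^sub>R a + u *\<^sub>R b))"
    by (simp add: in_segment)
  then show ?thesis unfolding in_segment by (simp only: neg_equal_iff_equal)
qed

lemma segment_free_opposite: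
  assumes "0 < Im (m - a)" "Im (m - a) < pi"
  shows "exp m \<notin> closed_segment (exp a) (- exp a)"
proof
  assume "exp m \<in> closed_segment (exp a) (- exp a)"
  then obtain u where "exp m = (1 - u) *\<^sub>R exp a + u *\<^sub>R (- exp a)" by (auto simp: in_segment)
  then have "exp m = of_real (1 - 2 * u) * exp a" by (simp add: scaleR_conv_of_real algebra_simps)
  then have "exp (m - a) = of_real (1 - 2 * u)" by (simp add: exp_diff)
  then have "Im (exp (m - a)) = 0" by simp
  then have "sin (Im (m - a)) = 0" by (simp add: Im_exp)
  then show False using sin_gt_zero[OF assms] by simp
qed

text \<open>
  In each of the following three lemmas \<open>(a, m)\<close> are logarithms of \<open>A1\<close> and \<open>A2\<close>, and \<open>q\<close> is
  the rest of a path in logarithmic coordinates which starts by turning \<open>A2\<close> and \<open>B2\<close> by a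
  suitable angle around \<open>0\<close>; this first part straightens the arc to a segment, and along \<open>q\<close> the
  segment stays free.
\<close>

context
  fixes a m :: complex
  assumes a: "Im a = pi / 2" and m: "Im m = - pi / 2" and am: "Re m < Re a"
begin

abbreviation (input) "al \<equiv> exp (Re a)"
abbreviation (input) "be \<equiv> exp (Re m)"

lemma base_points:
  "conf (a, m) $ A1 = \<i> * of_real al" "conf (a, m) $ A2 = - (\<i> * of_real be)"
  "conf (a, m) $ B1 = - (\<i> * of_real al)" "conf (a, m) $ B2 = \<i> * of_real be"
  using exp_on_imaginary_axis(1)[OF a] exp_on_imaginary_axis(2)[OF m] by simp_all

lemma base_lengths: "0 < be" "be < al"
  using am by simp_all

lemma shifted_exp: "exp (m + \<i> * of_real pi) = \<i> * of_real be"
  using exp_on_imaginary_axis(2)[OF m] by (simp add: exp_add)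

text \<open>
  Turning \<open>A2\<close> by half a turn takes the half circle \<open>arc1\<close> to a radial
  segment.
\<close>

lemma cusp_twist_A:
  assumes q: "path q" "path_image q \<subseteq> log_config" "pathstart q = (a, m + \<i> * of_real pi)"
    and free: "\<And>t. t \<in> {0..1} \<Longrightarrow> \<bar>Im (snd (q t) - fst (q t))\<bar> < pi"
  shows "\<exists>h e. half_twist (conf (a, m)) (arc1 (conf (a, m))) h \<and> 0 < e \<and> e \<le> 1 \<and>
    homotopic_paths config (braid_power h 3)
      (conj_path (swap_labels A1 A2) (conf \<circ> (linepath (a, m) (a, m + \<i> * of_real pi) +++ q))
        (\<lambda>t. twist (seg_disc e (conf (q 1) $ A1) (conf (q 1) $ A2)) A1 A2 (conf (q 1)) (3 * t)))"
proof -
  let ?V = "(a, m + \<i> * of_real pi)" and ?\<theta> = "turn al be"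
  define v where "v = conf \<circ> q"
  have v: "path v" "path_image v \<subseteq> config" "v 0 = conf ?V"
    using q conf_distinct by (auto simp: v_def path_image_compose pathstart_def
        intro!: path_continuous_image continuous_intros)
  have "v s $ k \<notin> closed_segment (v s $ A1) (v s $ A2)" if "s \<in> {0..1}" "k \<noteq> A1" "k \<noteq> A2" for s k
    using segment_free_adjacent[OF free[OF that(1)]] that(2,3) by (cases k) (simp_all add: v_def)
  then obtain e where e: "0 < e" "e \<le> 1" and avoid: "\<And>s k. s \<in> {0..1} \<Longrightarrow> k \<noteq> A1 \<Longrightarrow> k \<noteq> A2 \<Longrightarrow>
      v s $ k \<notin> seg_disc e (v s $ A1) (v s $ A2) ` cball 0 2"
    using seg_disc_avoids[OF v(1), of A1 A2] by metis
  have \<theta>: "continuous_on UNIV ?\<theta>" by (rule continuous_on_turn[OF base_lengths])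
  have rc: "rot ?\<theta> (1 - s) (conf ?V $ k) = conf (linepath (a, m) ?V s) $ k" for s k
    by (rule rot_conf) (simp_all add: turn_ends[OF base_lengths])
  have P: "conf (a, m) $ k = rot ?\<theta> 1 (v 0 $ k)" for k
    using rc[of 0 k] by (simp add: v(3) linepath_def)
  have ne: "al \<noteq> - be" using base_lengths by linarith
  have arc: "arc1 (conf (a, m)) = right_arc (\<i> * of_real al) (\<i> * of_real (- be))"
    by (simp add: arc1_def base_points del: conf_simps)
  note ra = right_arc[OF ne, folded arc]
  have "half_twist (conf (a, m)) (arc1 (conf (a, m)))
      (twist (rot ?\<theta> 1 \<circ> seg_disc e (v 0 $ A1) (v 0 $ A2)) A1 A2 (conf (a, m)))"
  proof (rule half_twist_rot_seg_disc[OF \<theta> e])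
    show "v 0 \<in> config" using v(2) by (auto simp: path_image_def)
    have "v 0 $ A1 = \<i> * of_real al" "v 0 $ A2 = \<i> * of_real be"
      using base_points(1) shifted_exp by (simp_all add: v(3))
    then show "path_image (arc1 (conf (a, m))) = rot ?\<theta> 1 ` closed_segment (v 0 $ A1) (v 0 $ A2)"
      using rot_turn_segment[OF base_lengths] ra(4) by simp
  qed (use avoid[of 0] P ra(1-3) base_points in \<open>simp_all del: conf_simps\<close>)
  moreover have "homotopic_paths config
      (braid_power (twist (rot ?\<theta> 1 \<circ> seg_disc e (v 0 $ A1) (v 0 $ A2)) A1 A2 (conf (a, m))) 3)
      (conj_path (swap_labels A1 A2) ((\<lambda>s. \<chi> k. rot ?\<theta> (1 - s) (v 0 $ k)) +++ v)
      (\<lambda>t. twist (seg_disc e (v 1 $ A1) (v 1 $ A2)) A1 A2 (v 1) (real 3 * t)))"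
    by (rule bent_twist_homotopic(1)[OF \<theta> e _ _ v(1,2) avoid P]) simp_all
  moreover have "(\<lambda>s. \<chi> k. rot ?\<theta> (1 - s) (v 0 $ k)) +++ v = conf \<circ> (linepath (a, m) ?V +++ q)"
    unfolding path_compose_join v(3) rc by (simp add: v_def o_def vec_nth_inverse)
  ultimately show ?thesis using e by (auto simp: v_def simp del: conf_simps)
qed


text \<open>
  By the symmetry \<open>y \<mapsto> -y\<close> of the fibre this is the same motion as for
  \<open>arc1\<close>, seen on the opposite pair.
\<close>

lemma cusp_twist_B:
  assumes q: "path q" "path_image q \<subseteq> log_config" "pathstart q = (a, m + \<i> * of_real pi)"
    and free: "\<And>t. t \<in> {0..1} \<Longrightarrow> \<bar>Im (snd (q t) - fst (q t))\<bar> < pi"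
  shows "\<exists>h e. half_twist (conf (a, m)) (arc2 (conf (a, m))) h \<and> 0 < e \<and> e \<le> 1 \<and>
    homotopic_paths config (braid_power h 3)
      (conj_path (swap_labels B2 B1) (conf \<circ> (linepath (a, m) (a, m + \<i> * of_real pi) +++ q))
        (\<lambda>t. twist (seg_disc e (conf (q 1) $ B2) (conf (q 1) $ B1)) B2 B1 (conf (q 1)) (3 * t)))"
proof -
  let ?V = "(a, m + \<i> * of_real pi)" and ?\<theta> = "turn al be"
  define v where "v = conf \<circ> q"
  have v: "path v" "path_image v \<subseteq> config" "v 0 = conf ?V"
    using q conf_distinct by (auto simp: v_def path_image_compose pathstart_def
        intro!: path_continuous_image continuous_intros)
  have "v s $ k \<notin> closed_segment (v s $ B2) (v s $ B1)" if "s \<in> {0..1}" "k \<noteq> B2" "k \<noteq> B1" for s k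
    using segment_free_adjacent[OF free[OF that(1)]] that(2,3)
      segment_uminus[of "- exp (fst (q s))" "exp (fst (q s))" "exp (snd (q s))"]
      segment_uminus[of "- exp (snd (q s))" "exp (fst (q s))" "exp (snd (q s))"]
    by (cases k) (simp_all add: v_def closed_segment_commute)
  then obtain e where e: "0 < e" "e \<le> 1" and avoid: "\<And>s k. s \<in> {0..1} \<Longrightarrow> k \<noteq> B2 \<Longrightarrow> k \<noteq> B1 \<Longrightarrow>
      v s $ k \<notin> seg_disc e (v s $ B2) (v s $ B1) ` cball 0 2"
    using seg_disc_avoids[OF v(1), of B2 B1] by metis
  have \<theta>: "continuous_on UNIV ?\<theta>" by (rule continuous_on_turn[OF base_lengths])
  have rc: "rot ?\<theta> (1 - s) (conf ?V $ k) = conf (linepath (a, m) ?V s) $ k" for s k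
    by (rule rot_conf) (simp_all add: turn_ends[OF base_lengths])
  have P: "conf (a, m) $ k = rot ?\<theta> 1 (v 0 $ k)" for k
    using rc[of 0 k] by (simp add: v(3) linepath_def)
  have ne: "be \<noteq> - al" using base_lengths by linarith
  have arc: "arc2 (conf (a, m)) = left_arc (\<i> * of_real be) (\<i> * of_real (- al))"
    by (simp add: arc2_def base_points del: conf_simps)
  note la = left_arc[OF ne, folded arc]
  have "half_twist (conf (a, m)) (arc2 (conf (a, m)))
      (twist (rot ?\<theta> 1 \<circ> seg_disc e (v 0 $ B2) (v 0 $ B1)) B2 B1 (conf (a, m)))"
  proof (rule half_twist_rot_seg_disc[OF \<theta> e])
    show "v 0 \<in> config" using v(2) by (auto simp: path_image_def)
    have vB: "v 0 $ B1 = - (\<i> * of_real al)" "v 0 $ B2 = - (\<i> * of_real be)"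
      using base_points(1) shifted_exp by (simp_all add: v(3))
    have "closed_segment (v 0 $ B2) (v 0 $ B1) = uminus ` closed_segment (\<i> * of_real al) (\<i> * of_real be)"
      unfolding vB using closed_segment_linear_image[of uminus "\<i> * of_real al" "\<i> * of_real be"]
      by (simp add: closed_segment_commute linear_iff)
    then have "rot ?\<theta> 1 ` closed_segment (v 0 $ B2) (v 0 $ B1) =
        uminus ` rot ?\<theta> 1 ` closed_segment (\<i> * of_real al) (\<i> * of_real be)"
      by (simp add: image_image rot_uminus)
    then show "path_image (arc2 (conf (a, m))) = rot ?\<theta> 1 ` closed_segment (v 0 $ B2) (v 0 $ B1)"
      using la(4) by (simp add: rot_turn_segment[OF base_lengths] half_circle_uminus diam_circle_commute)
  qed (use avoid[of 0] P la(1-3) base_points in \<open>simp_all del: conf_simps\<close>)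
  moreover have "homotopic_paths config
      (braid_power (twist (rot ?\<theta> 1 \<circ> seg_disc e (v 0 $ B2) (v 0 $ B1)) B2 B1 (conf (a, m))) 3)
      (conj_path (swap_labels B2 B1) ((\<lambda>s. \<chi> k. rot ?\<theta> (1 - s) (v 0 $ k)) +++ v)
      (\<lambda>t. twist (seg_disc e (v 1 $ B2) (v 1 $ B1)) B2 B1 (v 1) (real 3 * t)))"
    by (rule bent_twist_homotopic(1)[OF \<theta> e _ _ v(1,2) avoid P]) simp_all
  moreover have "(\<lambda>s. \<chi> k. rot ?\<theta> (1 - s) (v 0 $ k)) +++ v = conf \<circ> (linepath (a, m) ?V +++ q)"
    unfolding path_compose_join v(3) rc by (simp add: v_def o_def vec_nth_inverse)
  ultimately show ?thesis using e by (auto simp: v_def simp del: conf_simps)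
qed

definition s_angle :: real where
  "s_angle = 3 / 2 * pi - arcsin (be / ((al + be) / 2))"

lemma s_angle: "pi < s_angle" "s_angle < 3 / 2 * pi"
proof -
  have "0 < be / ((al + be) / 2)" "be / ((al + be) / 2) < 1" using base_lengths add_pos_pos[OF base_lengths(1) base_lengths(1)] by (auto simp: divide_less_eq zero_less_divide_iff add_pos_pos)
  then have "0 < arcsin (be / ((al + be) / 2))" "arcsin (be / ((al + be) / 2)) < pi / 2"
    using arcsin_lt_bounded[of "be / ((al + be) / 2)"] arcsin_less_mono[of 0 "be / ((al + be) / 2)"] by simp_all
  then show "pi < s_angle" "s_angle < 3 / 2 * pi" by (simp_all add: s_angle_def)
qed

text \<open>
  Here both halves of the S-shaped \<open>arc3\<close> have to be unwound: its outer and inner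
  half circles contribute separate angles, whose sum on the inner pair is \<open>s_angle\<close>
  up to sign.
\<close>

lemma tangency_twist:
  assumes q: "path q" "path_image q \<subseteq> log_config" "pathstart q = (a, m + \<i> * of_real s_angle)"
    and free: "\<And>t. t \<in> {0..1} \<Longrightarrow> 0 < Im (snd (q t) - fst (q t)) \<and> Im (snd (q t) - fst (q t)) < pi"
  shows "\<exists>h e. half_twist (conf (a, m)) (arc3 (conf (a, m))) h \<and> 0 < e \<and> e \<le> 1 \<and>
    homotopic_paths config h
      (conj_path (swap_labels A1 B1) (conf \<circ> (linepath (a, m) (a, m + \<i> * of_real s_angle) +++ q))
        (\<lambda>t. twist (seg_disc e (conf (q 1) $ A1) (conf (q 1) $ B1)) A1 B1 (conf (q 1)) t))"
proof -
  let ?mu = "(al + be) / 2"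
  let ?V = "(a, m + \<i> * of_real s_angle)" and ?\<theta> = "s_turn al ?mu"
  have mu: "0 < ?mu" "?mu < al" "be < ?mu" using base_lengths by (simp_all add: add_pos_pos)
  define v where "v = conf \<circ> q"
  have v: "path v" "path_image v \<subseteq> config" "v 0 = conf ?V"
    using q conf_distinct by (auto simp: v_def path_image_compose pathstart_def
        intro!: path_continuous_image continuous_intros)
  have "v s $ k \<notin> closed_segment (v s $ A1) (v s $ B1)" if "s \<in> {0..1}" "k \<noteq> A1" "k \<noteq> B1" for s k
    using segment_free_opposite[of "snd (q s)" "fst (q s)"] free[OF that(1)] that(2,3)
      segment_uminus[of "exp (snd (q s))" "exp (fst (q s))" "- exp (fst (q s))"]
    by (cases k) (simp_all add: v_def closed_segment_commute)
  then obtain e where e: "0 < e" "e \<le> 1" and avoid: "\<And>s k. s \<in> {0..1} \<Longrightarrow> k \<noteq> A1 \<Longrightarrow> k \<noteq> B1 \<Longrightarrow>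
      v s $ k \<notin> seg_disc e (v s $ A1) (v s $ B1) ` cball 0 2"
    using seg_disc_avoids[OF v(1), of A1 B1] by metis
  have \<theta>: "continuous_on UNIV ?\<theta>" unfolding s_turn_def
    by (intro continuous_on_add continuous_on_turn continuous_on_inner_turn mu)
  have \<theta>v: "?\<theta> al = 0" "?\<theta> be = - s_angle"
  proof -
    have "1 \<le> al / ?mu" using mu by (simp only: le_divide_eq_1_pos less_imp_le)
    then have "max 0 (min 1 (al / ?mu)) = 1" by simp
    then have "inner_turn ?mu al = 0" by (simp only: inner_turn_def arcsin_1)
    then show "?\<theta> al = 0" using turn_ends(2)[OF mu(1,2), of al] by (simp only: s_turn_def)
    have "0 \<le> be / ?mu" "be / ?mu \<le> 1" using mu base_lengths by (simp_all only: divide_le_eq_1_pos less_imp_le divide_nonneg_pos)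
    then have "max 0 (min 1 (be / ?mu)) = be / ?mu" by simp
    then have "inner_turn ?mu be = arcsin (be / ?mu) - pi / 2" by (simp only: inner_turn_def)
    then show "?\<theta> be = - s_angle" using turn_ends(1)[OF mu(1,2), of be] mu(3)
      by (simp only: s_turn_def s_angle_def less_imp_le)
  qed
  have rc: "rot ?\<theta> (1 - s) (conf ?V $ k) = conf (linepath (a, m) ?V s) $ k" for s k
    by (rule rot_conf) (simp_all add: \<theta>v)
  have P: "conf (a, m) $ k = rot ?\<theta> 1 (v 0 $ k)" for k
    using rc[of 0 k] by (simp add: v(3) linepath_def)
  note arc = arc3_arc[OF base_lengths base_points]
  have "half_twist (conf (a, m)) (arc3 (conf (a, m)))
      (twist (rot ?\<theta> 1 \<circ> seg_disc e (v 0 $ A1) (v 0 $ B1)) A1 B1 (conf (a, m)))"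
  proof (rule half_twist_rot_seg_disc[OF \<theta> e])
    show "v 0 \<in> config" using v(2) by (auto simp: path_image_def)
    have "v 0 $ A1 = \<i> * of_real al" "v 0 $ B1 = - (\<i> * of_real al)"
      using base_points(1) by (simp_all add: v(3))
    then show "path_image (arc3 (conf (a, m))) = rot ?\<theta> 1 ` closed_segment (v 0 $ A1) (v 0 $ B1)"
      using rot_s_turn_segment[OF mu(1,2)] arc(4) by simp
  qed (use avoid[of 0] P arc(1-3) in \<open>simp_all del: conf_simps\<close>)
  moreover have "homotopic_paths config
      (\<lambda>t. twist (rot ?\<theta> 1 \<circ> seg_disc e (v 0 $ A1) (v 0 $ B1)) A1 B1 (conf (a, m)) (real 1 * t))
      (conj_path (swap_labels A1 B1) ((\<lambda>s. \<chi> k. rot ?\<theta> (1 - s) (v 0 $ k)) +++ v)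
      (\<lambda>t. twist (seg_disc e (v 1 $ A1) (v 1 $ B1)) A1 B1 (v 1) (real 1 * t)))"
    by (rule bent_twist_homotopic(2)[OF \<theta> e _ _ v(1,2) avoid P]) simp_all
  moreover have "(\<lambda>s. \<chi> k. rot ?\<theta> (1 - s) (v 0 $ k)) +++ v = conf \<circ> (linepath (a, m) ?V +++ q)"
    unfolding path_compose_join v(3) rc by (simp add: v_def o_def vec_nth_inverse)
  ultimately show ?thesis using e by (auto simp: v_def simp del: conf_simps)
qed

lemma origin_twist:
  "\<exists>h e. half_twist (conf (a, m)) (arc4 (conf (a, m))) h \<and> 0 < e \<and> e \<le> 1 \<and>
    homotopic_paths config (braid_power h 3)
      (\<lambda>t. twist (seg_disc e (conf (a, m) $ A2) (conf (a, m) $ B2)) A2 B2 (conf (a, m)) (3 * t))"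
proof -
  let ?P = "conf (a, m)"
  have Pc: "?P \<in> config" using am conf_distinct chart_subset(1) by force
  have seg: "norm z \<le> be" if "z \<in> closed_segment (?P $ A2) (?P $ B2)" for z
  proof -
    have "closed_segment (?P $ A2) (?P $ B2) \<subseteq> cball 0 be"
      by (intro closed_segment_subset) (simp_all add: norm_exp)
    then show ?thesis using that by auto
  qed
  have out: "?P $ k \<notin> closed_segment (?P $ A2) (?P $ B2)" if "k \<noteq> A2" "k \<noteq> B2" for k
    using seg[of "?P $ k"] that base_lengths by (cases k) (auto simp: norm_exp)
  have "path (\<lambda>_ :: real. ?P)" by (simp add: path_def)
  from seg_disc_avoids[OF this, of A2 B2] out obtain e where e: "0 < e" "e \<le> 1" and
    "\<And>s k. s \<in> {0..1 :: real} \<Longrightarrow> k \<noteq> A2 \<Longrightarrow> k \<noteq> B2 \<Longrightarrow>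
      ?P $ k \<notin> seg_disc e (?P $ A2) (?P $ B2) ` cball 0 2" by metis
  then have avoid: "\<And>k. k \<noteq> A2 \<Longrightarrow> k \<noteq> B2 \<Longrightarrow>
      ?P $ k \<notin> seg_disc e (?P $ A2) (?P $ B2) ` cball 0 2"
    by (metis atLeastAtMost_iff le_numeral_extra(3) zero_le_one)
  have ne: "?P $ A2 \<noteq> ?P $ B2" using Pc by (simp add: config_def inj_eq del: conf_simps)
  let ?\<phi> = "seg_disc e (?P $ A2) (?P $ B2)" and ?h = "twist (seg_disc e (?P $ A2) (?P $ B2)) A2 B2 ?P"
  have id: "rot (\<lambda>_. 0) 1 = id" by (simp add: rot_def fun_eq_iff)
  have "half_twist ?P (arc4 ?P) (twist (rot (\<lambda>_. 0) 1 \<circ> ?\<phi>) A2 B2 ?P)"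
    by (rule half_twist_rot_seg_disc[OF _ e Pc])
      (use avoid ne in \<open>simp_all add: id arc4_def arc_linepath del: conf_simps\<close>)
  then have "half_twist ?P (arc4 ?P) ?h" by (simp add: id)
  moreover have "homotopic_paths config (braid_power ?h 3) (\<lambda>t. ?h (real 3 * t))"
  proof (rule braid_power_twist_homotopic[OF _ Pc])
    show "continuous_on (sphere 0 1) ?\<phi>" by (intro continuous_intros)
    show "inj_on ?\<phi> (sphere 0 1)" using inj_seg_disc[OF e ne] inj_on_subset by blast
    show "?P $ k \<notin> ?\<phi> ` sphere 0 1" if "k \<noteq> A2" "k \<noteq> B2" for k using avoid[OF that] by auto
  qed simp_all
  ultimately show ?thesis using e by (intro exI[of _ ?h] exI[of _ e]) (simp del: conf_simps)
qed

end

section \<open>The local monodromies\<close>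

text \<open>
  Two motions of a pair of points are homotopic if the direction from one point to the other
  always differs by less than a right angle from a common direction: then all motions on the
  straight line between them are motions in the configuration space.
\<close>

lemma pair_homotopic:
  fixes p q :: "real \<Rightarrow> complex ^ 'n::finite"
  assumes paths: "path p" "path q" "pathstart q = pathstart p" "pathfinish q = pathfinish p"
    and P: "P \<in> config" "i \<noteq> j" "convex K" "\<And>k. k \<noteq> i \<Longrightarrow> k \<noteq> j \<Longrightarrow> P $ k \<notin> K"
    and rest: "\<And>t k. t \<in> {0..1} \<Longrightarrow> k \<noteq> i \<Longrightarrow> k \<noteq> j \<Longrightarrow> p t $ k = P $ k \<and> q t $ k = P $ k"
    and K: "\<And>t. t \<in> {0..1} \<Longrightarrow> p t $ i \<in> K \<and> p t $ j \<in> K \<and> q t $ i \<in> K \<and> q t $ j \<in> K"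
    and dir: "\<And>t. t \<in> {0..1} \<Longrightarrow> 0 < Re ((p t $ j - p t $ i) / \<omega> t) \<and> 0 < Re ((q t $ j - q t $ i) / \<omega> t)"
  shows "homotopic_paths config p q"
proof (rule homotopic_paths_linear[OF paths])
  fix t :: real assume t: "t \<in> {0..1}"
  show "closed_segment (p t) (q t) \<subseteq> config"
  proof
    fix x assume "x \<in> closed_segment (p t) (q t)"
    then obtain u where u: "0 \<le> u" "u \<le> 1" and x: "x = (1 - u) *\<^sub>R p t + u *\<^sub>R q t" by (auto simp: in_segment)
    have xk: "x $ k = (1 - u) *\<^sub>R (p t $ k) + u *\<^sub>R (q t $ k)" for k by (simp add: x)
    have xK: "x $ i \<in> K" "x $ j \<in> K" using K[OF t] u unfolding xk by (auto intro!: convexD[OF P(3)])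
    have xr: "x $ k = P $ k" if "k \<noteq> i" "k \<noteq> j" for k
      using rest[OF t that] unfolding xk by (simp add: scaleR_left.add[symmetric])
    have "Re ((x $ j - x $ i) / \<omega> t) = (1 - u) * Re ((p t $ j - p t $ i) / \<omega> t) + u * Re ((q t $ j - q t $ i) / \<omega> t)"
    proof -
      have "(x $ j - x $ i) / \<omega> t = (1 - u) *\<^sub>R ((p t $ j - p t $ i) / \<omega> t) + u *\<^sub>R ((q t $ j - q t $ i) / \<omega> t)"
        unfolding xk by (simp add: scaleR_conv_of_real diff_divide_distrib add_divide_distrib algebra_simps)
      then show ?thesis by simp
    qed
    also have "\<dots> > 0"
      using dir[OF t] u by (cases "u = 0") (auto intro!: add_nonneg_pos mult_pos_pos mult_nonneg_nonneg)
    finally have ne: "x $ i \<noteq> x $ j" by auto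
    have "k = l" if "x $ k = x $ l" for k l
    proof -
      have Pkl: "P $ k = P $ l \<Longrightarrow> k = l" using P(1) by (simp add: config_def inj_eq)
      show ?thesis using that ne xK xr[of k] xr[of l] P(4)[of k] P(4)[of l] Pkl by metis
    qed
    then show "x \<in> config" by (simp add: config_def inj_def)
  qed
qed

lemma thin_cis: "0 < e \<Longrightarrow> 0 < Re (thin e (cis x) / cis x)"
proof -
  assume e: "0 < e"
  have "thin e (cis x) / cis x = thin e (cis x) * cis (- x)" by (simp add: divide_inverse cis_inverse)
  then have "Re (thin e (cis x) / cis x) = (cos x)^2 + e * (sin x)^2"
    by (simp add: thin_unit power2_eq_square)
  also have "\<dots> > 0"
  proof (cases "sin x = 0")
    case True
    then show ?thesis using sin_cos_squared_add[of x] by simp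
  qed (use e in \<open>auto intro: add_nonneg_pos\<close>)
  finally show ?thesis .
qed

lemma thin_cis_uminus: "thin e (- cis x) = - thin e (cis x)"
  by (simp add: thin_unit complex_eq_iff)

text \<open>
  A motion of two opposite points for which the direction from one to the other stays close to
  that of a uniform rotation is a twist in a squeezed disc around their segment.
\<close>

lemma seg_twist_homotopic:
  fixes p :: "real \<Rightarrow> complex ^ 'n::finite"
  assumes e: "0 < e" "e \<le> 1" and ij: "i \<noteq> j" and n: "odd n"
    and p: "path p" "pathstart p = P" "pathfinish p = swap_labels i j P"
    and P: "P \<in> config" "convex K" "\<And>k. k \<noteq> i \<Longrightarrow> k \<noteq> j \<Longrightarrow> P $ k \<notin> K"
    and rest: "\<And>t k. t \<in> {0..1} \<Longrightarrow> k \<noteq> i \<Longrightarrow> k \<noteq> j \<Longrightarrow> p t $ k = P $ k"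
    and K: "\<And>t. t \<in> {0..1} \<Longrightarrow> p t $ i \<in> K \<and> p t $ j \<in> K" "seg_disc e (P $ i) (P $ j) ` sphere 0 1 \<subseteq> K"
    and dir: "\<And>t. t \<in> {0..1} \<Longrightarrow> 0 < Re ((p t $ j - p t $ i) / ((P $ j - P $ i) * cis (pi * (real n * t))))"
  shows "homotopic_paths config p (\<lambda>t. twist (seg_disc e (P $ i) (P $ j)) i j P (real n * t))"
proof (rule pair_homotopic[OF p(1) _ _ _ P(1) ij P(2,3)])
  let ?\<phi> = "seg_disc e (P $ i) (P $ j)"
  let ?T = "twist ?\<phi> i j P"
  have ne: "P $ i \<noteq> P $ j" using P(1) ij by (simp add: config_def inj_eq)
  have c: "continuous_on (UNIV \<times> sphere 0 1) (\<lambda>(s :: real, z). ?\<phi> z)"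
    unfolding case_prod_unfold by (intro continuous_intros)
  have "continuous_on {0..1} (\<lambda>t. ?T (real n * t))"
    by (rule continuous_on_twist[OF c, of "\<lambda>_. P" _ _ "\<lambda>t. t"]) (auto intro!: continuous_intros)
  then show "path (\<lambda>t. ?T (real n * t))" by (simp add: path_def)
  have T0: "?T 0 = P" by (rule twist_0) simp_all
  then show "pathstart (\<lambda>t. ?T (real n * t)) = pathstart p" using p(2) by (simp add: pathstart_def)
  show "pathfinish (\<lambda>t. ?T (real n * t)) = pathfinish p"
    using p(3) n twist_add_nat[OF ij, of ?\<phi> P n 0] T0 by (simp add: pathfinish_def)
  fix t :: real assume t: "t \<in> {0..1}"
  show "p t $ k = P $ k \<and> ?T (real n * t) $ k = P $ k" if "k \<noteq> i" "k \<noteq> j" for k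
    using rest[OF t that] that by (simp add: twist_def)
  have Tij: "?T (real n * t) $ i = ?\<phi> (- cis (pi * (real n * t)))" "?T (real n * t) $ j = ?\<phi> (cis (pi * (real n * t)))"
    using ij by (simp_all add: twist_def)
  have "?\<phi> (- cis (pi * (real n * t))) \<in> K" "?\<phi> (cis (pi * (real n * t))) \<in> K"
    using K(2) by (auto simp: image_subset_iff)
  then show "p t $ i \<in> K \<and> p t $ j \<in> K \<and> ?T (real n * t) $ i \<in> K \<and> ?T (real n * t) $ j \<in> K"
    using K(1)[OF t] unfolding Tij by blast
  have "?T (real n * t) $ j - ?T (real n * t) $ i = (P $ j - P $ i) * thin e (cis (pi * (real n * t)))"
    unfolding Tij seg_disc_def thin_cis_uminus by (simp add: field_simps)
  then have "0 < Re ((?T (real n * t) $ j - ?T (real n * t) $ i) / ((P $ j - P $ i) * cis (pi * (real n * t))))"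
    using thin_cis[OF e(1), of "pi * (real n * t)"] ne by simp
  then show "0 < Re ((p t $ j - p t $ i) / ((P $ j - P $ i) * cis (pi * (real n * t)))) \<and>
      0 < Re ((?T (real n * t) $ j - ?T (real n * t) $ i) / ((P $ j - P $ i) * cis (pi * (real n * t))))"
    using dir[OF t] by blast
qed

lemma seg_disc_opposite_sphere:
  assumes "0 < e" "e \<le> 1"
  shows "seg_disc e a (- a) ` sphere 0 1 \<subseteq> cball 0 (norm a)"
proof clarsimp
  fix z :: complex assume "norm z = 1"
  then have "(norm (thin e z))^2 \<le> (norm z)^2"
  proof -
    have "(e * Im z)^2 \<le> 1 * (Im z)^2"
      unfolding power_mult_distrib using assms by (intro mult_right_mono power_le_one) auto
    then show ?thesis using \<open>norm z = 1\<close> unfolding cmod_power2 by (simp add: thin_unit)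
  qed
  then have "norm (thin e z) \<le> norm z" by (rule power2_le_imp_le) (rule norm_ge_zero)
  then have "norm a * norm (thin e z) \<le> norm a * 1"
    unfolding \<open>norm z = 1\<close> by (rule mult_left_mono) (rule norm_ge_zero)
  moreover have "norm (seg_disc e a (- a) z) = norm a * norm (thin e z)"
    by (simp add: seg_disc_def norm_mult)
  ultimately show "norm (seg_disc e a (- a) z) \<le> norm a" by simp
qed

lemma homotopic_log_config_conf:
  "homotopic_paths log_config p q \<Longrightarrow> homotopic_paths config (conf \<circ> p) (conf \<circ> q)"
  by (rule homotopic_paths_continuous_image) (auto intro: continuous_on_conf continuous_on_id conf_distinct)

lemma conf_shift:
  "conf (a + \<i> * of_real pi, m) = swap_labels A1 B1 (conf (a, m))"
  "conf (a, m + \<i> * of_real (3 * pi)) = swap_labels A2 B2 (conf (a, m))"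
proof -
  have "exp (\<i> * complex_of_real (3 * pi)) = -1"
  proof -
    have "exp (\<i> * complex_of_real (3 * pi)) = exp (\<i> * of_real pi) ^ 3"
      using exp_of_nat_mult[of 3 "\<i> * complex_of_real pi"] by (simp add: mult_ac)
    then show ?thesis by simp
  qed
  then have e: "exp (m + \<i> * of_real (3 * pi)) = - exp m" "exp (a + \<i> * of_real pi) = - exp a"
    unfolding exp_add by simp_all
  show "conf (a + \<i> * of_real pi, m) = swap_labels A1 B1 (conf (a, m))"
    unfolding vec_eq_iff
  proof
    show "conf (a + \<i> * of_real pi, m) $ k = swap_labels A1 B1 (conf (a, m)) $ k" for k
      by (cases k) (simp_all add: swap_labels_def e)
  qed
  show "conf (a, m + \<i> * of_real (3 * pi)) = swap_labels A2 B2 (conf (a, m))"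
    unfolding vec_eq_iff
  proof
    show "conf (a, m + \<i> * of_real (3 * pi)) $ k = swap_labels A2 B2 (conf (a, m)) $ k" for k
      by (cases k) (simp_all add: swap_labels_def e del: of_real_mult)
  qed
qed

definition tangency_loop :: "real \<Rightarrow> real \<Rightarrow> complex \<times> complex" where
  "tangency_loop \<rho> t = (let x = -1 + of_real \<rho> * cis (2 * pi * t) in
     branches (Ln (- x)) (of_real (ln \<rho>) + 2 * pi * \<i> * t) x)"

text \<open>
  The motion over a small circle around the origin: \<open>A2\<close> turns by the angle \<open>3
  * pi\<close>, because of the cube in \<open>branch_sq\<close>, while \<open>A1\<close> hardly
  moves.
\<close>

definition origin_loop :: "real \<Rightarrow> real \<Rightarrow> complex \<times> complex" where
  "origin_loop \<rho> t = (let x = - (of_real \<rho> * cis (2 * pi * t)) in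
     branches (of_real (ln \<rho>) + 2 * pi * \<i> * t) (Ln (x + 1)) x)"

lemma exp_log_circle: "0 < \<rho> \<Longrightarrow> exp (of_real (ln \<rho>) + 2 * pi * \<i> * complex_of_real t) = of_real \<rho> * cis (2 * pi * t)"
  unfolding exp_add exp_of_real by (simp add: cis_conv_exp mult_ac)

lemma small_circle_bounds:
  assumes "norm z \<le> 1/160"
  shows "Re (1 - z) > 0" "Re (1 + z) > 0" "8 * (-1 + z) + 9 \<notin> \<real>\<^sub>\<le>\<^sub>0" "8 * (- z) + 9 \<notin> \<real>\<^sub>\<le>\<^sub>0"
  using assms abs_Re_le_cmod[of z] by (auto simp: complex_nonpos_Reals_iff)

lemma tangency_loop:
  assumes \<rho>: "0 < \<rho>" "\<rho> \<le> 1/160"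
  shows "path (tangency_loop \<rho>)" "path_image (tangency_loop \<rho>) \<subseteq> {q. Re (fst q) < Re (snd q)}"
    "tangency_loop \<rho> 0 = upper_branches (of_real (-1 + \<rho>))"
    "tangency_loop \<rho> 1 = (fst (upper_branches (of_real (-1 + \<rho>))) + \<i> * of_real pi, snd (upper_branches (of_real (-1 + \<rho>))))"
    "follows (fibre deltoid) (\<lambda>t. ((1, 0), -1 + of_real \<rho> * cis (2 * pi * t))) (conf \<circ> tangency_loop \<rho>)"
proof -
  let ?z = "\<lambda>t. complex_of_real \<rho> * cis (2 * pi * t)"
  let ?x = "\<lambda>t. -1 + ?z t"
  have z: "norm (?z t) \<le> 1/160" for t using \<rho> by (simp add: norm_mult)
  note b = small_circle_bounds[OF z]
  have re: "0 < Re (- ?x t)" for t using b(1)[of t] by simp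
  have nz: "- ?x t \<noteq> 0" for t using re[of t] by (metis zero_complex.sel(1) less_irrefl)
  have ex: "exp (Ln (- ?x t)) = - ?x t" "exp (of_real (ln \<rho>) + 2 * pi * \<i> * complex_of_real t) = ?x t + 1" for t
    using nz[of t] exp_log_circle[OF \<rho>(1), of t] by simp_all
  have "continuous_on UNIV (\<lambda>t. branches (Ln (- ?x t)) (of_real (ln \<rho>) + 2 * pi * \<i> * t) (?x t))"
  proof (rule continuous_on_branches)
    show "continuous_on UNIV (\<lambda>t. Ln (- ?x t))"
      using re by (intro continuous_intros) (auto simp: complex_nonpos_Reals_iff not_le)
    show "8 * ?x t + 9 \<notin> \<real>\<^sub>\<le>\<^sub>0" for t by (rule b(3))
  qed (intro continuous_intros)+
  then have cont: "continuous_on UNIV (tangency_loop \<rho>)" by (simp add: tangency_loop_def[abs_def] Let_def)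
  then show pt: "path (tangency_loop \<rho>)" unfolding path_def by (rule continuous_on_subset) simp
  show "path_image (tangency_loop \<rho>) \<subseteq> {q. Re (fst q) < Re (snd q)}"
  proof (clarsimp simp: path_image_def)
    fix t
    show "Re (fst (tangency_loop \<rho> t)) < Re (snd (tangency_loop \<rho> t))"
      unfolding tangency_loop_def Let_def
      by (rule branches_Re(2)[OF ex], rule branch_compare_tangency) (use z[of t] in simp)
  qed
  have pos: "1 - \<rho> > 0" using \<rho> by simp
  have l0: "Ln (- (-1 + complex_of_real \<rho>)) = of_real (ln (1 - \<rho>))"
    using Ln_of_real[OF pos] by simp
  have u0: "Ln (- \<i> * complex_of_real (-1 + \<rho>)) - \<i> * pi / 2 = of_real (ln (1 - \<rho>))"
  proof -
    have "- \<i> * complex_of_real (-1 + \<rho>) = \<i> * of_real (1 - \<rho>)" by (simp add: algebra_simps)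
    then show ?thesis using Ln_i_real(1)[OF pos] by simp
  qed
  have u1: "Ln (- \<i> * (complex_of_real (-1 + \<rho>) + 1)) + \<i> * pi / 2 = of_real (ln \<rho>)"
  proof -
    have "- \<i> * (complex_of_real (-1 + \<rho>) + 1) = - (\<i> * of_real \<rho>)" by (simp add: algebra_simps)
    then show ?thesis using Ln_i_real(2)[OF \<rho>(1)] by simp
  qed
  have ub: "upper_branches (of_real (-1 + \<rho>)) = branches (of_real (ln (1 - \<rho>))) (of_real (ln \<rho>)) (of_real (-1 + \<rho>))"
    unfolding upper_branches_def u0 u1 ..
  show "tangency_loop \<rho> 0 = upper_branches (of_real (-1 + \<rho>))"
    unfolding ub tangency_loop_def Let_def using l0 by simp
  have x1: "-1 + complex_of_real \<rho> * cis (2 * pi * 1) = of_real (-1 + \<rho>)" by simp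
  have "tangency_loop \<rho> 1 = branches (of_real (ln (1 - \<rho>))) (of_real (ln \<rho>) + 2 * pi * \<i>) (of_real (-1 + \<rho>))"
    unfolding tangency_loop_def Let_def x1 using l0 by simp
  then show "tangency_loop \<rho> 1 = (fst (upper_branches (of_real (-1 + \<rho>))) + \<i> * of_real pi, snd (upper_branches (of_real (-1 + \<rho>))))"
    unfolding ub by (simp add: branches_def Let_def add_divide_distrib)
  have "enumerates (conf (tangency_loop \<rho> t)) (fibre deltoid ((1, 0), ?x t))" for t
    unfolding tangency_loop_def Let_def
  proof (rule enumerates_branches[OF ex])
    show "?x t \<noteq> -9/8"
    proof
      assume "?x t = -9/8"
      then have "?z t = -1/8" by (simp add: algebra_simps)
      then have "norm (?z t) = norm (-1/8 :: complex)" by (rule arg_cong)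
      then have "norm (?z t) = 1/8" by simp
      then show False using z[of t] by linarith
    qed
  qed
  then show "follows (fibre deltoid) (\<lambda>t. ((1, 0), ?x t)) (conf \<circ> tangency_loop \<rho>)"
    using pt unfolding follows_def
    by (auto intro!: path_continuous_image continuous_on_conf continuous_on_id)
qed

lemma origin_loop:
  assumes \<rho>: "0 < \<rho>" "\<rho> \<le> 1/160"
  shows "path (origin_loop \<rho>)" "path_image (origin_loop \<rho>) \<subseteq> {q. Re (snd q) < Re (fst q)}"
    "origin_loop \<rho> 0 = upper_branches (of_real (- \<rho>))"
    "origin_loop \<rho> 1 = (fst (upper_branches (of_real (- \<rho>))), snd (upper_branches (of_real (- \<rho>))) + \<i> * of_real (3 * pi))"
    "follows (fibre deltoid) (\<lambda>t. ((1, 0), - (of_real \<rho> * cis (2 * pi * t)))) (conf \<circ> origin_loop \<rho>)"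
proof -
  let ?z = "\<lambda>t. complex_of_real \<rho> * cis (2 * pi * t)"
  let ?x = "\<lambda>t. - ?z t"
  have z: "norm (?z t) \<le> 1/160" for t using \<rho> by (simp add: norm_mult)
  note b = small_circle_bounds[OF z]
  have re: "0 < Re (?x t + 1)" for t using b(1)[of t] by simp
  have nz: "?x t + 1 \<noteq> 0" for t using re[of t] by (metis zero_complex.sel(1) less_irrefl)
  have ex: "exp (of_real (ln \<rho>) + 2 * pi * \<i> * complex_of_real t) = - ?x t" "exp (Ln (?x t + 1)) = ?x t + 1" for t
    using nz[of t] exp_log_circle[OF \<rho>(1), of t] by simp_all
  have "continuous_on UNIV (\<lambda>t. branches (of_real (ln \<rho>) + 2 * pi * \<i> * t) (Ln (?x t + 1)) (?x t))"
  proof (rule continuous_on_branches)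
    show "continuous_on UNIV (\<lambda>t. Ln (?x t + 1))"
      using re by (intro continuous_intros) (auto simp: complex_nonpos_Reals_iff not_le)
    show "8 * ?x t + 9 \<notin> \<real>\<^sub>\<le>\<^sub>0" for t by (rule b(4))
  qed (intro continuous_intros)+
  then have cont: "continuous_on UNIV (origin_loop \<rho>)" by (simp add: origin_loop_def[abs_def] Let_def)
  then show pt: "path (origin_loop \<rho>)" unfolding path_def by (rule continuous_on_subset) simp
  show "path_image (origin_loop \<rho>) \<subseteq> {q. Re (snd q) < Re (fst q)}"
  proof (clarsimp simp: path_image_def)
    fix t
    show "Re (snd (origin_loop \<rho> t)) < Re (fst (origin_loop \<rho> t))"
      unfolding origin_loop_def Let_def
      by (rule branches_Re(1)[OF ex], rule branch_compare_origin) (use z[of t] in simp)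
  qed
  have pos: "1 - \<rho> > 0" using \<rho> by simp
  have l1: "Ln (- complex_of_real \<rho> + 1) = of_real (ln (1 - \<rho>))"
    using Ln_of_real[OF pos] by simp
  have u0: "Ln (- \<i> * complex_of_real (- \<rho>)) - \<i> * pi / 2 = of_real (ln \<rho>)"
    using Ln_i_real(1)[OF \<rho>(1)] by simp
  have u1: "Ln (- \<i> * (complex_of_real (- \<rho>) + 1)) + \<i> * pi / 2 = of_real (ln (1 - \<rho>))"
  proof -
    have "- \<i> * (complex_of_real (- \<rho>) + 1) = - (\<i> * of_real (1 - \<rho>))" by (simp add: algebra_simps)
    then show ?thesis using Ln_i_real(2)[OF pos] by simp
  qed
  have ub: "upper_branches (of_real (- \<rho>)) = branches (of_real (ln \<rho>)) (of_real (ln (1 - \<rho>))) (of_real (- \<rho>))"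
    unfolding upper_branches_def u0 u1 ..
  show "origin_loop \<rho> 0 = upper_branches (of_real (- \<rho>))"
    unfolding ub origin_loop_def Let_def using l1 by simp
  have x1: "- (complex_of_real \<rho> * cis (2 * pi * 1)) = of_real (- \<rho>)" by simp
  have "origin_loop \<rho> 1 = branches (of_real (ln \<rho>) + 2 * pi * \<i>) (of_real (ln (1 - \<rho>))) (of_real (- \<rho>))"
    unfolding origin_loop_def Let_def x1 using l1 by simp
  then show "origin_loop \<rho> 1 = (fst (upper_branches (of_real (- \<rho>))), snd (upper_branches (of_real (- \<rho>))) + \<i> * of_real (3 * pi))"
    unfolding ub by (simp add: branches_def Let_def algebra_simps)
  have "enumerates (conf (origin_loop \<rho> t)) (fibre deltoid ((1, 0), ?x t))" for t
    unfolding origin_loop_def Let_def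
  proof (rule enumerates_branches[OF ex])
    show "?x t \<noteq> -9/8"
    proof
      assume "?x t = -9/8"
      then have "norm (- ?z t) = norm (-9/8 :: complex)" by (rule arg_cong)
      then have "norm (?z t) = 9/8" unfolding norm_minus_cancel by simp
      then show False using z[of t] by linarith
    qed
  qed
  then show "follows (fibre deltoid) (\<lambda>t. ((1, 0), ?x t)) (conf \<circ> origin_loop \<rho>)"
    using pt unfolding follows_def
    by (auto intro!: path_continuous_image continuous_on_conf continuous_on_id)
qed

section \<open>The monodromy of the projection to \<open>x\<close>\<close>

lemma swap_labels_maps: "swap_labels i j \<in> config \<rightarrow> config"
  by (rule funcsetI) (rule swap_labels_config)

lemma base_branch:
  fixes b :: real
  assumes "0 < b"
  defines "V \<equiv> upper_branches (of_real b)"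
  shows "Im (fst V) = pi / 2" "Im (snd V) = - pi / 2" "Re (snd V) < Re (fst V)"
  using upper_branches_real_Im[of b] upper_chart_less[of "of_real b"] assms
  by (auto simp: V_def upper_def complex_eq_iff)

lemma vertex_origin:
  fixes \<rho> :: real
  assumes "0 < \<rho>" "\<rho> \<le> 1/160"
  defines "Y \<equiv> upper_branches (of_real (- \<rho>))"
  shows "Re (snd Y) < Re (fst Y)" "Im (snd Y - fst Y) = pi / 2"
  unfolding Y_def using upper_chart_less[of "of_real (- \<rho>)"] real_chart_between[of "- \<rho>"] assms by simp_all

lemma vertex_tangency:
  fixes \<rho> :: real
  assumes "0 < \<rho>" "\<rho> \<le> 1/160"
  defines "Y \<equiv> upper_branches (of_real (-1 + \<rho>))"
  shows "Re (fst Y) < Re (snd Y)" "Im (snd Y - fst Y) = pi / 2"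
  unfolding Y_def using upper_chart_greater[of "of_real (-1 + \<rho>)"] real_chart_between[of "-1 + \<rho>"] assms by simp_all

lemma vertex_cusp:
  fixes r :: real
  assumes "0 < r" "r < 1/20"
  defines "X \<equiv> upper_branches (of_real (-9/8 + r))"
  shows "Re (fst X) < Re (snd X)" "Im (fst X) = pi" "Im (snd X) = pi"
proof -
  have "complex_of_real (-9/8 + r) \<in> upper" using assms by (auto simp: upper_def complex_eq_iff)
  then show "Re (fst X) < Re (snd X)" "Im (fst X) = pi" "Im (snd X) = pi"
    unfolding X_def using upper_chart_greater[of "of_real (-9/8 + r)"] upper_branches_real_Im[of "-9/8 + r"] assms
    by simp_all
qed

lemma linepath_shift: "(\<lambda>q. q + c) \<circ> linepath x y = linepath (x + c) (y + c)" for c :: "'a::real_normed_vector"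
  by (auto simp: linepath_def fun_eq_iff algebra_simps)

lemma origin_monodromy:
  fixes b \<rho> :: real
  assumes b: "0 < b" and \<rho>: "0 < \<rho>" "\<rho> \<le> 1/160"
  defines "V \<equiv> upper_branches (of_real b)"
  shows "\<exists>h. half_twist (conf V) (arc4 (conf V)) h \<and>
    (\<forall>g. path g \<longrightarrow> path_image g \<subseteq> upper \<longrightarrow> pathstart g = of_real b \<longrightarrow> pathfinish g = of_real (- \<rho>) \<longrightarrow>
      homotopic_paths config
        (conj_path (swap_labels A2 B2) (conf \<circ> (upper_branches \<circ> g)) (conf \<circ> origin_loop \<rho>)) (braid_power h 3))"
proof -
  note V = base_branch[OF b, folded V_def]
  let ?C = "{q :: complex \<times> complex. Re (snd q) < Re (fst q)}"
  let ?Y = "upper_branches (of_real (- \<rho>))" and ?c = "(0, \<i> * complex_of_real (3 * pi))"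
  let ?S = "\<lambda>q. q + ?c" and ?\<sigma> = "swap_labels A2 B2"
  note loop = origin_loop[OF \<rho>]
  obtain h e where h: "half_twist (conf V) (arc4 (conf V)) h" and e: "0 < e" "e \<le> 1"
    and hom: "homotopic_paths config (braid_power h 3)
      (\<lambda>t. twist (seg_disc e (conf V $ A2) (conf V $ B2)) A2 B2 (conf V) (3 * t))"
    using origin_twist[OF V] by auto
  have S\<sigma>: "conf (?S q) = ?\<sigma> (conf q)" for q
    using conf_shift(2)[of "fst q" "snd q"] by (cases q) simp
  have exp3: "exp (\<i> * complex_of_real (3 * pi)) = -1"
    using S\<sigma>[of "(0, 0)", THEN arg_cong[where f = "\<lambda>v. v $ A2"]] by (simp add: swap_labels_def)
  have Slog: "?S \<in> log_config \<rightarrow> log_config" by (auto simp: log_config_def exp_add exp3 simp del: of_real_mult)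
  have tw: "homotopic_paths config (conf \<circ> linepath V (?S V))
      (\<lambda>t. twist (seg_disc e (conf V $ A2) (conf V $ B2)) A2 B2 (conf V) (real 3 * t))"
  proof (rule seg_twist_homotopic[OF e, where K = "cball 0 (norm (conf V $ A2))"])
    have "linepath V (?S V) t = (fst V, snd V + \<i> * of_real (3 * pi * t))" for t
      by (simp add: linepath_def scaleR_conv_of_real algebra_simps prod_eq_iff)
    then have lp: "(conf \<circ> linepath V (?S V)) t = conf (fst V, snd V + \<i> * of_real (3 * pi * t))" for t
      by (simp only: o_apply)
    show "path (conf \<circ> linepath V (?S V))"
      by (intro path_continuous_image) (auto intro!: continuous_intros)
    show "pathstart (conf \<circ> linepath V (?S V)) = conf V"
      "pathfinish (conf \<circ> linepath V (?S V)) = ?\<sigma> (conf V)"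
      by (simp_all only: pathstart_compose pathfinish_compose pathstart_linepath pathfinish_linepath S\<sigma>)
    show "conf V \<in> config" using V(3) chart_subset(1) by (intro conf_distinct) auto
    show "conf V $ k \<notin> cball 0 (norm (conf V $ A2))" if "k \<noteq> A2" "k \<noteq> B2" for k
      using V(3) that by (cases k) (simp_all add: norm_exp)
    show "seg_disc e (conf V $ A2) (conf V $ B2) ` sphere 0 1 \<subseteq> cball 0 (norm (conf V $ A2))"
      using seg_disc_opposite_sphere[OF e, of "exp (snd V)"] by simp
    fix t :: real
    show "(conf \<circ> linepath V (?S V)) t $ k = conf V $ k" if "k \<noteq> A2" "k \<noteq> B2" for k
      unfolding lp using that by (cases k) simp_all
    show "(conf \<circ> linepath V (?S V)) t $ A2 \<in> cball 0 (norm (conf V $ A2)) \<and>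
        (conf \<circ> linepath V (?S V)) t $ B2 \<in> cball 0 (norm (conf V $ A2))"
      unfolding lp by (simp add: norm_exp)
    have "exp (snd V + \<i> * of_real (3 * pi * t)) = exp (snd V) * cis (pi * (real 3 * t))"
      by (simp add: exp_add cis_conv_exp mult_ac)
    then show "0 < Re (((conf \<circ> linepath V (?S V)) t $ B2 - (conf \<circ> linepath V (?S V)) t $ A2) /
        ((conf V $ B2 - conf V $ A2) * cis (pi * (real 3 * t))))"
      unfolding lp by (simp del: of_real_mult)
  qed simp_all
  show ?thesis
  proof (intro exI[of _ h] conjI h allI impI)
    fix g assume g: "path g" "path_image g \<subseteq> upper" "pathstart g = of_real b" "pathfinish g = of_real (- \<rho>)"
    let ?l = "upper_branches \<circ> g"
    have l: "homotopic_paths log_config ?l (linepath V ?Y)"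
      unfolding V_def by (rule route_to_origin[OF b \<rho> g])
    have lends: "pathfinish ?l = ?Y" "pathstart ?l = V" using g by (simp_all add: pathfinish_compose pathstart_compose V_def)
    have loop_ends: "pathstart (origin_loop \<rho>) = ?Y" "pathfinish (origin_loop \<rho>) = ?S ?Y"
      using loop(3,4) by (simp_all add: pathstart_def pathfinish_def prod_eq_iff)
    have m: "homotopic_paths log_config (origin_loop \<rho>) (linepath ?Y (?S ?Y))"
      by (rule chart_homotopic[OF convex_chart(1) chart_subset(1) loop(1,2)]) (simp_all add: loop_ends)
    have Sl: "homotopic_paths log_config (?S \<circ> ?l) (linepath (?S V) (?S ?Y))"
    proof -
      have "continuous_on log_config ?S" by (intro continuous_intros)
      from homotopic_paths_continuous_image[OF l this Slog] show ?thesis unfolding linepath_shift .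
    qed
    have e0: "conj_path ?\<sigma> (conf \<circ> ?l) (conf \<circ> origin_loop \<rho>) =
        conf \<circ> (?l +++ origin_loop \<rho> +++ reversepath (?S \<circ> ?l))"
      unfolding conj_path_def path_compose_join path_compose_reversepath by (simp only: o_def S\<sigma>)
    have h1: "homotopic_paths log_config (?l +++ origin_loop \<rho> +++ reversepath (?S \<circ> ?l))
        (linepath V ?Y +++ linepath ?Y (?S ?Y) +++ reversepath (linepath (?S V) (?S ?Y)))"
      by (rule homotopic_paths_join[OF l homotopic_paths_join[OF m homotopic_paths_reversepath_D[OF Sl]]])
        (use g(4) in \<open>simp_all add: loop_ends pathfinish_compose\<close>)
    have h2: "homotopic_paths log_config
        (linepath V ?Y +++ linepath ?Y (?S ?Y) +++ reversepath (linepath (?S V) (?S ?Y))) (linepath V (?S V))"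
    proof (rule chart_homotopic[OF convex_chart(1) chart_subset(1)])
      have "closed_segment x y \<subseteq> ?C" if "x \<in> ?C" "y \<in> ?C" for x y
        by (rule closed_segment_subset[OF that convex_chart(1)])
      then show "path_image (linepath V ?Y +++ linepath ?Y (?S ?Y) +++ reversepath (linepath (?S V) (?S ?Y))) \<subseteq> ?C"
        using V(3) vertex_origin(1)[OF \<rho>]
        by (intro subset_path_image_join) (simp_all del: of_real_minus of_real_mult)
    qed simp_all
    have "homotopic_paths config (conj_path ?\<sigma> (conf \<circ> ?l) (conf \<circ> origin_loop \<rho>)) (conf \<circ> linepath V (?S V))"
      unfolding e0 by (rule homotopic_log_config_conf[OF homotopic_paths_trans[OF h1 h2]])
    also have "homotopic_paths config \<dots> (\<lambda>t. twist (seg_disc e (conf V $ A2) (conf V $ B2)) A2 B2 (conf V) (3 * t))"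
      using tw by simp
    also have "homotopic_paths config \<dots> (braid_power h 3)" by (rule homotopic_paths_sym[OF hom])
    finally show "homotopic_paths config (conj_path ?\<sigma> (conf \<circ> ?l) (conf \<circ> origin_loop \<rho>)) (braid_power h 3)" .
  qed
qed

lemma two_segments:
  assumes "convex C" "x \<in> C" "y \<in> C" "z \<in> C"
  shows "path_image (linepath x y +++ linepath y z) \<subseteq> C"
  by (rule subset_path_image_join) (simp_all add: assms closed_segment_subset)

text \<open>Corners of polygons inside a convex chart may be inserted and removed.\<close>

lemma through_vertex:
  fixes x y z :: "complex \<times> complex"
  assumes "convex C" "C \<subseteq> S" "x \<in> C" "y \<in> C" "z \<in> C" "path p" "path_image p \<subseteq> S" "pathstart p = z"
  shows "homotopic_paths S (linepath x z +++ p) (linepath x y +++ (linepath y z +++ p))"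
proof -
  have seg: "closed_segment u v \<subseteq> C" if "u \<in> C" "v \<in> C" for u v using assms that by (intro closed_segment_subset)
  then have im: "path_image (linepath u v) \<subseteq> S" if "u \<in> C" "v \<in> C" for u v using that assms(2) by fastforce
  have "homotopic_paths S (linepath x y +++ linepath y z) (linepath x z)"
    by (rule chart_homotopic[OF assms(1,2) _ two_segments[OF assms(1,3-5)]]) simp_all
  then have "homotopic_paths S ((linepath x y +++ linepath y z) +++ p) (linepath x z +++ p)"
    by (rule homotopic_paths_join_right) (use assms in auto)
  moreover have "homotopic_paths S (linepath x y +++ (linepath y z +++ p)) ((linepath x y +++ linepath y z) +++ p)"
    by (rule homotopic_paths_assoc) (use assms im in auto)
  ultimately show ?thesis using homotopic_paths_sym homotopic_paths_trans by blast
qed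

lemma tangency_monodromy:
  fixes b \<rho> :: real
  assumes b: "0 < b" and \<rho>: "0 < \<rho>" "\<rho> \<le> 1/160"
  defines "V \<equiv> upper_branches (of_real b)"
  shows "\<exists>h. half_twist (conf V) (arc3 (conf V)) h \<and>
    (\<forall>g. path g \<longrightarrow> path_image g \<subseteq> upper \<longrightarrow> pathstart g = of_real b \<longrightarrow> pathfinish g = of_real (-1 + \<rho>) \<longrightarrow>
      homotopic_paths config
        (conj_path (swap_labels A1 B1) (conf \<circ> (upper_branches \<circ> g)) (conf \<circ> tangency_loop \<rho>)) h)"
proof -
  note V = base_branch[OF b, folded V_def]
  let ?C = "{q :: complex \<times> complex. Re (snd q) < Re (fst q)}"
  let ?D = "{q :: complex \<times> complex. 0 < Im (snd q - fst q) \<and> Im (snd q - fst q) < pi}"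
  define Y where "Y = upper_branches (of_real (- \<rho>))"
  define Z where "Z = upper_branches (of_real (-1 + \<rho>))"
  define W where "W = (fst V, snd V + \<i> * of_real (s_angle (fst V) (snd V)))"
  let ?\<sigma> = "swap_labels A1 B1" and ?Z' = "(fst Z + \<i> * of_real pi, snd Z)"
  note Y = vertex_origin[OF \<rho>, folded Y_def] and Z = vertex_tangency[OF \<rho>, folded Z_def]
  note loop = tangency_loop[OF \<rho>, folded Z_def]
  have W: "W \<in> ?C" "W \<in> ?D"
    using s_angle[OF V] V by (simp_all add: W_def field_simps)
  have half: "0 < pi / 2 \<and> pi / 2 < pi" using pi_gt_zero by linarith
  have mem: "V \<in> ?C" "Y \<in> ?C" "Y \<in> ?D" "Z \<in> ?D" unfolding mem_Collect_eq Y(2) Z(2) by (fact V Y half)+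
  define q where "q = linepath W Y +++ linepath Y Z"
  have seg: "closed_segment x y \<subseteq> ?D" if "x \<in> ?D" "y \<in> ?D" for x y
    by (rule closed_segment_subset[OF that convex_chart(3)])
  have q: "path q" "pathstart q = W" "path_image q \<subseteq> ?D"
    using two_segments[OF convex_chart(3) W(2) mem(3,4)] by (simp_all add: q_def)
  have "pathfinish q = Z" by (simp add: q_def)
  then have q1: "q 1 = Z" by (simp add: pathfinish_def)
  have qD: "q t \<in> ?D" if "t \<in> {0..1}" for t
    by (rule subsetD[OF q(3)]) (use that in \<open>simp add: path_image_def\<close>)
  obtain h e where h: "half_twist (conf V) (arc3 (conf V)) h" and e: "0 < e" "e \<le> 1"
    and hom: "homotopic_paths config h
      (conj_path ?\<sigma> (conf \<circ> (linepath V W +++ q)) (\<lambda>t. twist (seg_disc e (conf Z $ A1) (conf Z $ B1)) A1 B1 (conf Z) t))"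
    using tangency_twist[OF V, of q] q qD chart_subset(3) unfolding W_def q1
    by (auto simp del: minus_complex.sel conf_simps) blast
  have tw: "homotopic_paths config (conf \<circ> linepath Z ?Z')
      (\<lambda>t. twist (seg_disc e (conf Z $ A1) (conf Z $ B1)) A1 B1 (conf Z) (real 1 * t))"
  proof (rule seg_twist_homotopic[OF e, where K = "cball 0 (norm (conf Z $ A1))"])
    have "linepath Z ?Z' t = (fst Z + \<i> * of_real (pi * t), snd Z)" for t
      by (simp add: linepath_def scaleR_conv_of_real algebra_simps prod_eq_iff)
    then have lp: "(conf \<circ> linepath Z ?Z') t = conf (fst Z + \<i> * of_real (pi * t), snd Z)" for t
      by (simp only: o_apply)
    show "path (conf \<circ> linepath Z ?Z')"
      by (intro path_continuous_image) (auto intro!: continuous_intros)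
    show "pathstart (conf \<circ> linepath Z ?Z') = conf Z" by (simp add: pathstart_compose)
    show "pathfinish (conf \<circ> linepath Z ?Z') = ?\<sigma> (conf Z)"
      using conf_shift(1)[of "fst Z" "snd Z"] by (simp add: pathfinish_compose)
    show "conf Z \<in> config" using Z(1) chart_subset(2) by (intro conf_distinct) auto
    show "conf Z $ k \<notin> cball 0 (norm (conf Z $ A1))" if "k \<noteq> A1" "k \<noteq> B1" for k
      using Z(1) that by (cases k) (simp_all add: norm_exp)
    show "seg_disc e (conf Z $ A1) (conf Z $ B1) ` sphere 0 1 \<subseteq> cball 0 (norm (conf Z $ A1))"
      using seg_disc_opposite_sphere[OF e, of "exp (fst Z)"] by simp
    fix t :: real
    show "(conf \<circ> linepath Z ?Z') t $ k = conf Z $ k" if "k \<noteq> A1" "k \<noteq> B1" for k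
      unfolding lp using that by (cases k) simp_all
    show "(conf \<circ> linepath Z ?Z') t $ A1 \<in> cball 0 (norm (conf Z $ A1)) \<and>
        (conf \<circ> linepath Z ?Z') t $ B1 \<in> cball 0 (norm (conf Z $ A1))"
      unfolding lp by (simp add: norm_exp)
    have "exp (fst Z + \<i> * of_real (pi * t)) = exp (fst Z) * cis (pi * (real 1 * t))"
      by (simp add: exp_add cis_conv_exp mult_ac)
    then show "0 < Re (((conf \<circ> linepath Z ?Z') t $ B1 - (conf \<circ> linepath Z ?Z') t $ A1) /
        ((conf Z $ B1 - conf Z $ A1) * cis (pi * (real 1 * t))))"
      unfolding lp by (simp del: of_real_mult)
  qed simp_all
  have loop_ends: "pathstart (tangency_loop \<rho>) = Z" "pathfinish (tangency_loop \<rho>) = ?Z'"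
    using loop(3,4) by (simp_all add: pathstart_def pathfinish_def)
  have "homotopic_paths log_config (tangency_loop \<rho>) (linepath Z ?Z')"
    by (rule chart_homotopic[OF convex_chart(2) chart_subset(2) loop(1,2)]) (simp_all add: loop_ends)
  from homotopic_paths_trans[OF homotopic_log_config_conf[OF this] tw]
  have M: "homotopic_paths config (conf \<circ> tangency_loop \<rho>)
      (\<lambda>t. twist (seg_disc e (conf Z $ A1) (conf Z $ B1)) A1 B1 (conf Z) t)" by simp
  have pYZ: "path_image (linepath Y Z) \<subseteq> log_config" using seg[OF mem(3,4)] chart_subset(3) by auto
  show ?thesis
  proof (intro exI[of _ h] conjI h allI impI)
    fix g assume g: "path g" "path_image g \<subseteq> upper" "pathstart g = of_real b" "pathfinish g = of_real (-1 + \<rho>)"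
    let ?l = "upper_branches \<circ> g"
    have "homotopic_paths log_config ?l (linepath V Y +++ linepath Y Z)"
      unfolding V_def Y_def Z_def by (rule route_to_tangency[OF b \<rho> g])
    also have "homotopic_paths log_config \<dots> (linepath V W +++ q)"
      unfolding q_def by (rule through_vertex[OF convex_chart(1) chart_subset(1) mem(1) W(1) mem(2) _ pYZ]) simp_all
    finally have l: "homotopic_paths config (conf \<circ> ?l) (conf \<circ> (linepath V W +++ q))"
      by (rule homotopic_log_config_conf)
    have ends: "pathfinish (conf \<circ> ?l) = conf Z" "pathstart (conf \<circ> tangency_loop \<rho>) = conf Z"
      "pathfinish (conf \<circ> tangency_loop \<rho>) = ?\<sigma> (conf Z)"
      using conf_shift(1)[of "fst Z" "snd Z"]
      by (simp_all only: pathfinish_compose pathstart_compose loop_ends g(4) Z_def prod.collapse)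
    have "homotopic_paths config (conj_path ?\<sigma> (conf \<circ> ?l) (conf \<circ> tangency_loop \<rho>))
      (conj_path ?\<sigma> (conf \<circ> (linepath V W +++ q)) (\<lambda>t. twist (seg_disc e (conf Z $ A1) (conf Z $ B1)) A1 B1 (conf Z) t))"
      by (rule homotopic_conj_path[OF l M _ _ continuous_on_swap_labels swap_labels_maps])
        (simp_all only: ends)
    also have "homotopic_paths config \<dots> h" by (rule homotopic_paths_sym[OF hom])
    finally show "homotopic_paths config (conj_path ?\<sigma> (conf \<circ> ?l) (conf \<circ> tangency_loop \<rho>)) h" .
  qed
qed

section \<open>Near the two cusps in one fibre\<close>

lemma Re_branch_sq_pos:
  assumes "norm v ^ 2 \<le> 2/5"
  shows "0 < Re (branch_sq v)"
proof -
  have "64 * branch_sq v = (3 - v)^3 * (1 + v)" by (simp add: branch_sq_def)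
  then have "64 * branch_sq v = 27 - (18 * v^2 - 8 * v^3 + v^4)"
    by (simp add: power2_eq_square power3_eq_cube power4_eq_xxxx algebra_simps)
  moreover have "norm (18 * v^2 - 8 * v^3 + v^4) < 27"
  proof -
    have n1: "norm v \<le> 1"
      using assms power2_le_imp_le[of "norm v" 1] by simp
    have "norm v ^ 3 \<le> norm v ^ 2" "norm v ^ 4 \<le> norm v ^ 2" by (rule power_decreasing; use n1 in simp)+
    then have "18 * norm v ^ 2 + 8 * norm v ^ 3 + norm v ^ 4 \<le> 27 * (2/5)" using assms by linarith
    moreover have "norm (18 * v^2 - 8 * v^3 + v^4) \<le> 18 * norm v ^ 2 + 8 * norm v ^ 3 + norm v ^ 4"
      using norm_triangle_ineq[of "18 * v^2 - 8 * v^3" "v^4"] norm_triangle_ineq4[of "18 * v^2" "8 * v^3"]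
      by (simp add: norm_mult norm_power)
    ultimately show ?thesis by linarith
  qed
  ultimately have "0 < Re (64 * branch_sq v)"
    using complex_Re_le_cmod[of "18 * v^2 - 8 * v^3 + v^4"] by simp
  then show ?thesis by simp
qed

lemma Re_csqrt_pos: "0 < Re z \<Longrightarrow> 0 < Re (csqrt z)"
proof -
  assume z: "0 < Re z"
  have "Re (csqrt z) \<noteq> 0"
  proof
    assume 0: "Re (csqrt z) = 0"
    have "Re z = Re ((csqrt z)^2)" by simp
    also have "\<dots> = (Re (csqrt z))^2 - (Im (csqrt z))^2" by (simp only: power2_eq_square times_complex.sel)
    finally show False using z unfolding 0 by (simp del: csqrt.simps)
  qed
  then show ?thesis using Re_csqrt_nonneg[of z] by linarith
qed

lemma cusp_fibre:
  assumes "norm v ^ 2 \<le> 2/5" "v^2 = 8 * x + 9"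
  shows "{y \<in> fibre deltoid ((1, 0), x). Re y < 0} = {- csqrt (branch_sq v), - csqrt (branch_sq (- v))}"
    "{y \<in> fibre deltoid ((1, 0), x). 0 < Re y} = {csqrt (branch_sq v), csqrt (branch_sq (- v))}"
    "\<And>y. y \<in> fibre deltoid ((1, 0), x) \<Longrightarrow> Re y \<noteq> 0"
    "v \<noteq> 0 \<Longrightarrow> csqrt (branch_sq v) \<noteq> csqrt (branch_sq (- v))"
proof -
  let ?s = "csqrt (branch_sq v)" and ?s' = "csqrt (branch_sq (- v))"
  have pos: "0 < Re ?s" "0 < Re ?s'"
    using assms Re_branch_sq_pos[of v] Re_branch_sq_pos[of "- v"] by (simp_all add: Re_csqrt_pos del: csqrt.simps)
  have y: "y \<in> fibre deltoid ((1, 0), x) \<longleftrightarrow> y = ?s \<or> y = - ?s \<or> y = ?s' \<or> y = - ?s'" for y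
  proof -
    have "y \<in> fibre deltoid ((1, 0), x) \<longleftrightarrow> y^2 = ?s^2 \<or> y^2 = ?s'^2"
      unfolding fibre_x mem_Collect_eq deltoid_factor[OF assms(2)] by simp
    then show ?thesis unfolding power2_eq_iff by blast
  qed
  have neg: "Re (- ?s) < 0" "Re (- ?s') < 0" using pos by (simp_all del: csqrt.simps)
  show "{y \<in> fibre deltoid ((1, 0), x). Re y < 0} = {- ?s, - ?s'}"
    unfolding y using pos neg by (auto simp del: csqrt.simps uminus_complex.sel)
  show "{y \<in> fibre deltoid ((1, 0), x). 0 < Re y} = {?s, ?s'}"
    unfolding y using pos neg by (auto simp del: csqrt.simps uminus_complex.sel)
  show "Re y \<noteq> 0" if "y \<in> fibre deltoid ((1, 0), x)" for y
    using that pos neg unfolding y by (auto simp del: csqrt.simps)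
  show "?s \<noteq> ?s'" if "v \<noteq> 0"
  proof
    assume "?s = ?s'"
    then have "?s^2 = ?s'^2" by (rule arg_cong)
    then have "branch_sq v = branch_sq (- v)" unfolding power2_csqrt .
    then show False using branch_sq_diff[of v] that by simp
  qed
qed

definition cusp_turn :: "real \<Rightarrow> real \<Rightarrow> complex" where
  "cusp_turn r t = of_real (sqrt (8 * r)) * cis (pi * t)"

text \<open>
  The two points on the left belong to one square root \<open>v\<close> and the two points on the
  right to another one, \<open>w\<close>: the two cusps are independent of each other.
\<close>

definition cusp_conf :: "complex \<Rightarrow> complex \<Rightarrow> complex ^ point_name" where
  "cusp_conf v w = (\<chi> k. case k of A1 \<Rightarrow> - csqrt (branch_sq (- v)) | A2 \<Rightarrow> - csqrt (branch_sq v)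
                          | B1 \<Rightarrow> csqrt (branch_sq (- w)) | B2 \<Rightarrow> csqrt (branch_sq w))"

lemma cusp_conf_simps:
  "cusp_conf v w $ A1 = - csqrt (branch_sq (- v))" "cusp_conf v w $ A2 = - csqrt (branch_sq v)"
  "cusp_conf v w $ B1 = csqrt (branch_sq (- w))" "cusp_conf v w $ B2 = csqrt (branch_sq w)"
  by (simp_all add: cusp_conf_def)

context
  fixes r :: real
  assumes r: "0 < r" "r < 1/20"
begin

lemma norm_cusp_turn: "norm (cusp_turn r t) ^ 2 \<le> 2/5" "cusp_turn r t \<noteq> 0"
  using r by (simp_all add: cusp_turn_def norm_mult)

lemma continuous_on_cusp_root:
  "continuous_on S (\<lambda>t. csqrt (branch_sq (cusp_turn r t)))"
  "continuous_on S (\<lambda>t. csqrt (branch_sq (- cusp_turn r t)))"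
proof -
  have pos: "0 < Re (branch_sq (cusp_turn r t))" "0 < Re (branch_sq (- cusp_turn r t))" for t
    using Re_branch_sq_pos[of "cusp_turn r t"] Re_branch_sq_pos[of "- cusp_turn r t"] norm_cusp_turn by simp_all
  have c: "continuous_on S (\<lambda>t. branch_sq (cusp_turn r t))" "continuous_on S (\<lambda>t. branch_sq (- cusp_turn r t))"
    unfolding branch_sq_def cusp_turn_def by (intro continuous_intros; simp)+
  show "continuous_on S (\<lambda>t. csqrt (branch_sq (cusp_turn r t)))"
    by (rule continuous_on_compose2[OF continuous_on_csqrt c(1)], rule image_subsetI)
      (use pos in \<open>simp add: complex_nonpos_Reals_iff not_le\<close>)
  show "continuous_on S (\<lambda>t. csqrt (branch_sq (- cusp_turn r t)))"
    by (rule continuous_on_compose2[OF continuous_on_csqrt c(2)], rule image_subsetI)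
      (use pos in \<open>simp add: complex_nonpos_Reals_iff not_le\<close>)
qed

text \<open>
  Near a cusp the difference of the two points behaves like \<open>v^3\<close> up to a factor
  close to a constant, so its direction makes three half turns while \<open>v\<close> makes one.
\<close>

lemma cusp_direction:
  "0 < Re ((csqrt (branch_sq (- cusp_turn r t)) - csqrt (branch_sq (cusp_turn r t))) /
    ((csqrt (branch_sq (- cusp_turn r 0)) - csqrt (branch_sq (cusp_turn r 0))) * cis (pi * (real 3 * t))))"
proof -
  let ?a = "\<lambda>t. csqrt (branch_sq (cusp_turn r t))" and ?b = "\<lambda>t. csqrt (branch_sq (- cusp_turn r t))"
  let ?s = "sqrt (8 * r)"
  have pos: "0 < Re (?a t + ?b t)" for t
    using Re_branch_sq_pos[of "cusp_turn r t"] Re_branch_sq_pos[of "- cusp_turn r t"] norm_cusp_turn[of t]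
    by (simp add: Re_csqrt_pos add_pos_pos del: csqrt.simps)
  then have nz: "?a t + ?b t \<noteq> 0" for t by (metis zero_complex.sel(1) less_irrefl)
  have d: "?b t - ?a t = - (cusp_turn r t ^ 3 / 4) / (?a t + ?b t)" for t
  proof -
    have "(?b t - ?a t) * (?a t + ?b t) = ?b t ^ 2 - ?a t ^ 2" by (simp add: algebra_simps power2_eq_square del: csqrt.simps)
    also have "\<dots> = - (branch_sq (cusp_turn r t) - branch_sq (- cusp_turn r t))" by simp
    also have "\<dots> = - (cusp_turn r t ^ 3 / 4)" unfolding branch_sq_diff ..
    finally show ?thesis by (rule nonzero_eq_divide_eq[OF nz, THEN iffD2])
  qed
  have v3: "cusp_turn r t ^ 3 = of_real (?s ^ 3) * cis (pi * (real 3 * t))" for t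
  proof -
    have "cis (pi * t) ^ 3 = cis (pi * (real 3 * t))" using Complex.DeMoivre[of "pi * t" 3] by (simp add: mult_ac)
    then show ?thesis unfolding cusp_turn_def power_mult_distrib by simp
  qed
  have s: "?s > 0" using r by simp
  have F: "branch_sq (of_real u) = of_real ((3 - u)^3 * (1 + u) / 64)" for u :: real by (simp add: branch_sq_def)
  have v0: "cusp_turn r 0 = of_real ?s" by (simp add: cusp_turn_def)
  have nn: "0 \<le> (3 - u)^3 * (1 + u) / 64" if "\<bar>u\<bar> \<le> 1" for u :: real
    using that by (intro divide_nonneg_nonneg mult_nonneg_nonneg zero_le_power) auto
  have s1: "\<bar>?s\<bar> \<le> 1" using r by simp
  have s2: "\<bar>- ?s\<bar> \<le> 1" using s1 by simp
  have "?a 0 = of_real (sqrt ((3 - ?s)^3 * (1 + ?s) / 64))"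
    unfolding v0 F of_real_sqrt[OF nn[OF s1]] ..
  moreover have "?b 0 = of_real (sqrt ((3 - (- ?s))^3 * (1 + (- ?s)) / 64))"
    unfolding v0 of_real_minus[symmetric] F of_real_sqrt[OF nn[OF s2]] ..
  ultimately have "?a 0 + ?b 0 \<in> \<real>" by (simp only: Reals_add Reals_of_real)
  then obtain u where u: "?a 0 + ?b 0 = of_real u" by (auto elim: Reals_cases)
  then have u0: "u > 0" using pos[of 0] by simp
  have alg: "(- (k * c / 4) / S) / ((- (k * 1 / 4) / u) * c) = u / S" if "k \<noteq> 0" "c \<noteq> 0" "S \<noteq> 0" "u \<noteq> 0"
    for k c S u :: complex using that by (simp add: field_simps)
  define S where "S = ?a t + ?b t"
  have S: "0 < Re S" "S \<noteq> 0" unfolding S_def by (rule pos, rule nz)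
  have c0: "cis (pi * (real 3 * 0)) = 1" by simp
  have "(?b t - ?a t) / ((?b 0 - ?a 0) * cis (pi * (real 3 * t))) = of_real u / S"
    unfolding d v3 u S_def[symmetric] c0 by (rule alg) (use s u0 S(2) in simp_all)
  also have "Re \<dots> = u * (Re S / (norm S)^2)" by (simp add: Re_divide cmod_power2)
  also have "\<dots> > 0" using u0 S by (intro mult_pos_pos divide_pos_pos) simp_all
  finally show ?thesis .
qed


lemma cusp_conf_upper:
  "conf (upper_branches (of_real (-9/8 + r))) = cusp_conf (cusp_turn r 0) (cusp_turn r 0)"
  "\<exists>p q. 0 < p \<and> 0 < q \<and> exp (fst (upper_branches (of_real (-9/8 + r)))) = of_real (- p) \<and>
    exp (snd (upper_branches (of_real (-9/8 + r)))) = of_real (- q)"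
proof -
  let ?x = "complex_of_real (-9/8 + r)"
  define X where "X = upper_branches ?x"
  note X = vertex_cusp[OF r, folded X_def]
  have neg: "exp (fst X) = of_real (- exp (Re (fst X)))" "exp (snd X) = of_real (- exp (Re (snd X)))"
    using X(2,3) by (simp_all add: complex_eq_iff Re_exp Im_exp)
  then show "\<exists>p q. 0 < p \<and> 0 < q \<and> exp (fst (upper_branches ?x)) = of_real (- p) \<and>
    exp (snd (upper_branches ?x)) = of_real (- q)"
    unfolding X_def[symmetric] by (intro exI[of _ "exp (Re (fst X))"] exI[of _ "exp (Re (snd X))"]) simp
  have v: "csqrt (8 * ?x + 9) = cusp_turn r 0"
    using csqrt_real_shift[of "-9/8 + r"] r by (simp add: cusp_turn_def algebra_simps del: csqrt.simps)
  have up: "?x \<in> upper" using r by (auto simp: upper_def complex_eq_iff)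
  have cs: "csqrt (branch_sq (- cusp_turn r 0)) = - exp (fst X)" "csqrt (branch_sq (cusp_turn r 0)) = - exp (snd X)"
  proof -
    have "(- exp (fst X))^2 = branch_sq (- cusp_turn r 0)" "(- exp (snd X))^2 = branch_sq (cusp_turn r 0)"
      unfolding power2_minus using branches_sq[OF upper_logs[OF up]] unfolding X_def upper_branches_def v by simp_all
    moreover have "0 < Re (- exp (fst X))" "0 < Re (- exp (snd X))" unfolding neg by simp_all
    ultimately show "csqrt (branch_sq (- cusp_turn r 0)) = - exp (fst X)"
      "csqrt (branch_sq (cusp_turn r 0)) = - exp (snd X)" using csqrt_unique by blast+
  qed
  show "conf (upper_branches ?x) = cusp_conf (cusp_turn r 0) (cusp_turn r 0)"
    unfolding X_def[symmetric] vec_eq_iff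
  proof
    show "conf X $ k = cusp_conf (cusp_turn r 0) (cusp_turn r 0) $ k" for k
      by (cases k) (simp_all add: cusp_conf_simps cs del: csqrt.simps)
  qed
qed

lemma seg_disc_real:
  assumes "norm z = 1"
  shows "p < 0 \<Longrightarrow> q < 0 \<Longrightarrow> Re (seg_disc e (of_real p) (of_real q) z) < 0"
    and "0 < p \<Longrightarrow> 0 < q \<Longrightarrow> 0 < Re (seg_disc e (of_real p) (of_real q) z)"
proof -
  have re: "Re (seg_disc e (of_real p) (of_real q) z) = (1 - (1 + Re z) / 2) * p + ((1 + Re z) / 2) * q"
    using assms by (simp add: seg_disc_def thin_unit field_simps)
  have x: "0 \<le> (1 + Re z) / 2" "(1 + Re z) / 2 \<le> 1" using abs_Re_le_cmod[of z] assms by auto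
  show "Re (seg_disc e (of_real p) (of_real q) z) < 0" if "p < 0" "q < 0"
    unfolding re using convex_bound_lt[of p 0 q "1 - (1 + Re z) / 2" "(1 + Re z) / 2"] that x by simp
  show "0 < Re (seg_disc e (of_real p) (of_real q) z)" if "0 < p" "0 < q"
    unfolding re using convex_bound_lt[of "- p" 0 "- q" "1 - (1 + Re z) / 2" "(1 + Re z) / 2"] that x by simp
qed

lemma continuous_on_cusp_conf:
  "continuous_on S (\<lambda>t. cusp_conf (cusp_turn r t) w)" "continuous_on S (\<lambda>t. cusp_conf w (cusp_turn r t))"
proof -
  show "continuous_on S (\<lambda>t. cusp_conf (cusp_turn r t) w)"
    unfolding cusp_conf_def
  proof (intro continuous_on_vec_lambda)
    show "continuous_on S (\<lambda>t. case k of A1 \<Rightarrow> - csqrt (branch_sq (- cusp_turn r t))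
      | A2 \<Rightarrow> - csqrt (branch_sq (cusp_turn r t)) | B1 \<Rightarrow> csqrt (branch_sq (- w)) | B2 \<Rightarrow> csqrt (branch_sq w))" for k
      by (cases k) (auto intro!: continuous_on_minus continuous_on_cusp_root simp del: csqrt.simps)
  qed
  show "continuous_on S (\<lambda>t. cusp_conf w (cusp_turn r t))"
    unfolding cusp_conf_def
  proof (intro continuous_on_vec_lambda)
    show "continuous_on S (\<lambda>t. case k of A1 \<Rightarrow> - csqrt (branch_sq (- w))
      | A2 \<Rightarrow> - csqrt (branch_sq w) | B1 \<Rightarrow> csqrt (branch_sq (- cusp_turn r t)) | B2 \<Rightarrow> csqrt (branch_sq (cusp_turn r t)))" for k
      by (cases k) (auto intro!: continuous_on_cusp_root simp del: csqrt.simps)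
  qed
qed

lemma cusp_turn_1: "cusp_turn r 1 = - cusp_turn r 0"
  by (simp add: cusp_turn_def)

lemma cusp_conf_swap:
  "cusp_conf (- v) w = swap_labels A1 A2 (cusp_conf v w)" "cusp_conf v (- w) = swap_labels B2 B1 (cusp_conf v w)"
proof -
  have "cusp_conf (- v) w $ k = swap_labels A1 A2 (cusp_conf v w) $ k"
    "cusp_conf v (- w) $ k = swap_labels B2 B1 (cusp_conf v w) $ k" for k
    by (cases k; simp add: swap_labels_def cusp_conf_simps del: csqrt.simps)+
  then show "cusp_conf (- v) w = swap_labels A1 A2 (cusp_conf v w)" "cusp_conf v (- w) = swap_labels B2 B1 (cusp_conf v w)"
    by (simp_all add: vec_eq_iff)
qed

lemma Re_cusp_root: "0 < Re (csqrt (branch_sq (cusp_turn r t)))" "0 < Re (csqrt (branch_sq (- cusp_turn r t)))"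
  using Re_branch_sq_pos[of "cusp_turn r t"] Re_branch_sq_pos[of "- cusp_turn r t"] norm_cusp_turn[of t]
  by (simp_all add: Re_csqrt_pos del: csqrt.simps)

lemma cusp_loop_homotopic:
  fixes X defines "X \<equiv> conf (upper_branches (of_real (-9/8 + r)))"
  assumes e: "0 < e" "e \<le> 1"
  shows "homotopic_paths config (\<lambda>t. cusp_conf (cusp_turn r t) (cusp_turn r 0))
      (\<lambda>t. twist (seg_disc e (X $ A1) (X $ A2)) A1 A2 X (real 3 * t))"
    and "homotopic_paths config (\<lambda>t. cusp_conf (cusp_turn r 0) (cusp_turn r t))
      (\<lambda>t. twist (seg_disc e (X $ B2) (X $ B1)) B2 B1 X (real 3 * t))"
proof -
  let ?v = "cusp_turn r"
  have X: "X = cusp_conf (?v 0) (?v 0)" unfolding X_def by (rule cusp_conf_upper(1))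
  have Xc: "X \<in> config" unfolding X_def using vertex_cusp(1)[OF r] chart_subset(2) by (intro conf_distinct) auto
  obtain p q where pq: "0 < p" "0 < q" "X $ A1 = of_real (- p)" "X $ A2 = of_real (- q)"
    "X $ B1 = of_real p" "X $ B2 = of_real q"
    using cusp_conf_upper(2) unfolding X_def by auto
  have neg: "convex {z. Re z < 0}" "convex {z. 0 < Re z}"
    using convex_halfspace_Re_lt[of 0] convex_halfspace_Re_gt[of 0] by simp_all
  show "homotopic_paths config (\<lambda>t. cusp_conf (?v t) (?v 0)) (\<lambda>t. twist (seg_disc e (X $ A1) (X $ A2)) A1 A2 X (real 3 * t))"
  proof (rule seg_twist_homotopic[OF e _ _ _ _ _ Xc neg(1)])
    show "path (\<lambda>t. cusp_conf (?v t) (?v 0))" unfolding path_def by (rule continuous_on_cusp_conf)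
    show "pathstart (\<lambda>t. cusp_conf (?v t) (?v 0)) = X" by (simp add: pathstart_def X)
    show "pathfinish (\<lambda>t. cusp_conf (?v t) (?v 0)) = swap_labels A1 A2 X"
      by (simp add: pathfinish_def X cusp_turn_1 cusp_conf_swap)
    show "X $ k \<notin> {z. Re z < 0}" if "k \<noteq> A1" "k \<noteq> A2" for k using that pq by (cases k) simp_all
    show "seg_disc e (X $ A1) (X $ A2) ` sphere 0 1 \<subseteq> {z. Re z < 0}"
      unfolding pq using seg_disc_real(1)[of _ "-p" "-q" e] pq(1,2) by (auto simp del: of_real_minus)
    fix t :: real
    show "cusp_conf (?v t) (?v 0) $ k = X $ k" if "k \<noteq> A1" "k \<noteq> A2" for k
      using that by (cases k) (simp_all add: X cusp_conf_simps del: csqrt.simps)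
    show "cusp_conf (?v t) (?v 0) $ A1 \<in> {z. Re z < 0} \<and> cusp_conf (?v t) (?v 0) $ A2 \<in> {z. Re z < 0}"
      using Re_cusp_root[of t] by (simp add: cusp_conf_simps del: csqrt.simps)
    show "0 < Re ((cusp_conf (?v t) (?v 0) $ A2 - cusp_conf (?v t) (?v 0) $ A1) / ((X $ A2 - X $ A1) * cis (pi * (real 3 * t))))"
      using cusp_direction[of t] unfolding X cusp_conf_simps minus_diff_minus minus_diff_eq .
  qed simp_all
  show "homotopic_paths config (\<lambda>t. cusp_conf (?v 0) (?v t)) (\<lambda>t. twist (seg_disc e (X $ B2) (X $ B1)) B2 B1 X (real 3 * t))"
  proof (rule seg_twist_homotopic[OF e _ _ _ _ _ Xc neg(2)])
    show "path (\<lambda>t. cusp_conf (?v 0) (?v t))" unfolding path_def by (rule continuous_on_cusp_conf)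
    show "pathstart (\<lambda>t. cusp_conf (?v 0) (?v t)) = X" by (simp add: pathstart_def X)
    show "pathfinish (\<lambda>t. cusp_conf (?v 0) (?v t)) = swap_labels B2 B1 X"
      by (simp add: pathfinish_def X cusp_turn_1 cusp_conf_swap)
    show "X $ k \<notin> {z. 0 < Re z}" if "k \<noteq> B2" "k \<noteq> B1" for k using that pq by (cases k) simp_all
    show "seg_disc e (X $ B2) (X $ B1) ` sphere 0 1 \<subseteq> {z. 0 < Re z}"
      unfolding pq using seg_disc_real(2)[of _ q p e] pq(1,2) by auto
    fix t :: real
    show "cusp_conf (?v 0) (?v t) $ k = X $ k" if "k \<noteq> B2" "k \<noteq> B1" for k
      using that by (cases k) (simp_all add: X cusp_conf_simps del: csqrt.simps)
    show "cusp_conf (?v 0) (?v t) $ B2 \<in> {z. 0 < Re z} \<and> cusp_conf (?v 0) (?v t) $ B1 \<in> {z. 0 < Re z}"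
      using Re_cusp_root[of t] by (simp add: cusp_conf_simps del: csqrt.simps)
    show "0 < Re ((cusp_conf (?v 0) (?v t) $ B1 - cusp_conf (?v 0) (?v t) $ B2) / ((X $ B1 - X $ B2) * cis (pi * (real 3 * t))))"
      using cusp_direction[of t] unfolding X cusp_conf_simps .
  qed simp_all
qed

lemma cusp_monodromy:
  fixes b :: real
  assumes b: "0 < b"
  defines "V \<equiv> upper_branches (of_real b)"
  shows "\<exists>h. half_twist (conf V) (arc1 (conf V)) h \<and>
    (\<forall>g. path g \<longrightarrow> path_image g \<subseteq> upper \<longrightarrow> pathstart g = of_real b \<longrightarrow> pathfinish g = of_real (-9/8 + r) \<longrightarrow>
      homotopic_paths config (conj_path (swap_labels A1 A2) (conf \<circ> (upper_branches \<circ> g))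
        (\<lambda>t. cusp_conf (cusp_turn r t) (cusp_turn r 0))) (braid_power h 3))"
    and "\<exists>h. half_twist (conf V) (arc2 (conf V)) h \<and>
    (\<forall>g. path g \<longrightarrow> path_image g \<subseteq> upper \<longrightarrow> pathstart g = of_real b \<longrightarrow> pathfinish g = of_real (-9/8 + r) \<longrightarrow>
      homotopic_paths config (conj_path (swap_labels B2 B1) (conf \<circ> (upper_branches \<circ> g))
        (\<lambda>t. cusp_conf (cusp_turn r 0) (cusp_turn r t))) (braid_power h 3))"
proof -
  define \<rho> :: real where "\<rho> = 1/160"
  have \<rho>: "0 < \<rho>" "\<rho> \<le> 1/160" by (simp_all add: \<rho>_def)
  note V = base_branch[OF b, folded V_def]
  let ?C = "{q :: complex \<times> complex. Re (snd q) < Re (fst q)}"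
  let ?D = "{q :: complex \<times> complex. 0 < Im (snd q - fst q) \<and> Im (snd q - fst q) < pi}"
  let ?E = "{q :: complex \<times> complex. Re (fst q) < Re (snd q)}"
  let ?F = "{q :: complex \<times> complex. \<bar>Im (snd q - fst q)\<bar> < pi}"
  define Y where "Y = upper_branches (of_real (- \<rho>))"
  define Z where "Z = upper_branches (of_real (-1 + \<rho>))"
  define X where "X = upper_branches (of_real (-9/8 + r))"
  define W where "W = (fst V, snd V + \<i> * of_real pi)"
  note Y = vertex_origin[OF \<rho>, folded Y_def] and Z = vertex_tangency[OF \<rho>, folded Z_def]
    and X = vertex_cusp[OF r, folded X_def]
  have half: "0 < pi / 2 \<and> pi / 2 < pi" "\<bar>pi / 2\<bar> < pi" using pi_gt_zero by linarith+
  have C: "V \<in> ?C" "W \<in> ?C" "Y \<in> ?C" using V Y by (simp_all add: W_def)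
  have D: "Y \<in> ?D" "Z \<in> ?D" unfolding mem_Collect_eq Y(2) Z(2) by (fact half)+
  have E: "Z \<in> ?E" "X \<in> ?E" using Z X by simp_all
  have Fd: "Y \<in> ?F" "Z \<in> ?F" unfolding mem_Collect_eq Y(2) Z(2) by (fact half)+
  have "Im (snd W - fst W) = 0" unfolding W_def fst_conv snd_conv minus_complex.sel plus_complex.sel V(1,2) by simp
  then have Fe: "W \<in> ?F" "X \<in> ?F" using X by simp_all
  define q where "q = linepath W Y +++ linepath Y Z +++ linepath Z X"
  have q: "path q" "pathstart q = W" by (simp_all add: q_def)
  have "pathfinish q = X" by (simp add: q_def)
  then have q1: "q 1 = X" by (simp add: pathfinish_def)
  have sub: "path_image (linepath x y) \<subseteq> T" if "x \<in> S" "y \<in> S" "convex S" "S \<subseteq> T"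
    for x y and S T :: "(complex \<times> complex) set"
    using closed_segment_subset[OF that(1-3)] that(4) by simp
  have YX: "path_image (linepath Y Z +++ linepath Z X) \<subseteq> log_config"
    by (intro subset_path_image_join sub[OF D convex_chart(3) chart_subset(3)] sub[OF E convex_chart(2) chart_subset(2)])
  have ql: "path_image q \<subseteq> log_config" unfolding q_def
    by (rule subset_path_image_join[OF sub[OF C(2,3) convex_chart(1) chart_subset(1)] YX])
  have "path_image q \<subseteq> ?F" unfolding q_def
    by (intro subset_path_image_join sub[OF Fe(1) Fd(1) convex_chart(4) order_refl]
        sub[OF Fd convex_chart(4) order_refl] sub[OF Fd(2) Fe(2) convex_chart(4) order_refl])
  then have "q t \<in> ?F" if "t \<in> {0..1}" for t
    by (rule subsetD) (use that in \<open>simp add: path_image_def\<close>)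
  then have qF: "\<bar>Im (snd (q t) - fst (q t))\<bar> < pi" if "t \<in> {0..1}" for t using that by blast
  have l: "homotopic_paths config (conf \<circ> (upper_branches \<circ> g)) (conf \<circ> (linepath V W +++ q))"
    if g: "path g" "path_image g \<subseteq> upper" "pathstart g = of_real b" "pathfinish g = of_real (-9/8 + r)" for g
  proof (rule homotopic_log_config_conf)
    have "homotopic_paths log_config (upper_branches \<circ> g) ((linepath V Y +++ linepath Y Z) +++ linepath Z X)"
      unfolding V_def Y_def Z_def X_def by (rule route_to_cusps[OF b \<rho> _ _ g]) (use r in auto)
    also have "homotopic_paths log_config \<dots> (linepath V Y +++ linepath Y Z +++ linepath Z X)"
      by (rule homotopic_paths_sym, rule homotopic_paths_assoc[OF path_linepath
            sub[OF C(1,3) convex_chart(1) chart_subset(1)] path_linepath sub[OF D convex_chart(3) chart_subset(3)]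
            path_linepath sub[OF E convex_chart(2) chart_subset(2)]])
        (simp_all only: pathstart_linepath pathfinish_linepath)
    also have "homotopic_paths log_config \<dots> (linepath V W +++ q)"
      unfolding q_def by (rule through_vertex[OF convex_chart(1) chart_subset(1) C(1,2,3) _ YX]) simp_all
    finally show "homotopic_paths log_config (upper_branches \<circ> g) (linepath V W +++ q)" .
  qed
  have start: "cusp_conf (cusp_turn r 0) (cusp_turn r 0) = conf X" unfolding X_def by (rule cusp_conf_upper(1)[symmetric])
  show "\<exists>h. half_twist (conf V) (arc1 (conf V)) h \<and>
    (\<forall>g. path g \<longrightarrow> path_image g \<subseteq> upper \<longrightarrow> pathstart g = of_real b \<longrightarrow> pathfinish g = of_real (-9/8 + r) \<longrightarrow>
      homotopic_paths config (conj_path (swap_labels A1 A2) (conf \<circ> (upper_branches \<circ> g))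
        (\<lambda>t. cusp_conf (cusp_turn r t) (cusp_turn r 0))) (braid_power h 3))"
  proof -
    let ?\<sigma> = "swap_labels A1 A2" and ?M = "\<lambda>t. cusp_conf (cusp_turn r t) (cusp_turn r 0)"
    obtain h e where h: "half_twist (conf V) (arc1 (conf V)) h" and e: "0 < e" "e \<le> 1"
      and hom: "homotopic_paths config (braid_power h 3) (conj_path ?\<sigma> (conf \<circ> (linepath V W +++ q))
        (\<lambda>t. twist (seg_disc e (conf X $ A1) (conf X $ A2)) A1 A2 (conf X) (3 * t)))"
      using cusp_twist_A[OF V q(1) ql q(2)[unfolded W_def] qF] unfolding W_def q1
      by (auto simp del: conf_simps)
    show ?thesis
    proof (intro exI[of _ h] conjI h allI impI)
      fix g assume g: "path g" "path_image g \<subseteq> upper" "pathstart g = of_real b" "pathfinish g = of_real (-9/8 + r)"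
      have ends: "pathfinish (conf \<circ> (upper_branches \<circ> g)) = conf X" "pathstart ?M = conf X" "pathfinish ?M = ?\<sigma> (conf X)"
        by (simp_all only: pathfinish_compose g(4) X_def[symmetric]) (simp_all only: pathstart_def pathfinish_def start cusp_turn_1 cusp_conf_swap)
      have "homotopic_paths config (conj_path ?\<sigma> (conf \<circ> (upper_branches \<circ> g)) ?M) (conj_path ?\<sigma> (conf \<circ> (linepath V W +++ q))
        (\<lambda>t. twist (seg_disc e (conf X $ A1) (conf X $ A2)) A1 A2 (conf X) (real 3 * t)))"
        by (rule homotopic_conj_path[OF l[OF g] cusp_loop_homotopic(1)[OF e, folded X_def] _ _
              continuous_on_swap_labels swap_labels_maps])
          (simp_all only: ends)
      from homotopic_paths_trans[OF this[simplified of_nat_numeral] homotopic_paths_sym[OF hom]]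
      show "homotopic_paths config (conj_path ?\<sigma> (conf \<circ> (upper_branches \<circ> g)) ?M) (braid_power h 3)" .
    qed
  qed
  show "\<exists>h. half_twist (conf V) (arc2 (conf V)) h \<and>
    (\<forall>g. path g \<longrightarrow> path_image g \<subseteq> upper \<longrightarrow> pathstart g = of_real b \<longrightarrow> pathfinish g = of_real (-9/8 + r) \<longrightarrow>
      homotopic_paths config (conj_path (swap_labels B2 B1) (conf \<circ> (upper_branches \<circ> g))
        (\<lambda>t. cusp_conf (cusp_turn r 0) (cusp_turn r t))) (braid_power h 3))"
  proof -
    let ?\<sigma> = "swap_labels B2 B1" and ?M = "\<lambda>t. cusp_conf (cusp_turn r 0) (cusp_turn r t)"
    obtain h e where h: "half_twist (conf V) (arc2 (conf V)) h" and e: "0 < e" "e \<le> 1"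
      and hom: "homotopic_paths config (braid_power h 3) (conj_path ?\<sigma> (conf \<circ> (linepath V W +++ q))
        (\<lambda>t. twist (seg_disc e (conf X $ B2) (conf X $ B1)) B2 B1 (conf X) (3 * t)))"
      using cusp_twist_B[OF V q(1) ql q(2)[unfolded W_def] qF] unfolding W_def q1
      by (auto simp del: conf_simps)
    show ?thesis
    proof (intro exI[of _ h] conjI h allI impI)
      fix g assume g: "path g" "path_image g \<subseteq> upper" "pathstart g = of_real b" "pathfinish g = of_real (-9/8 + r)"
      have ends: "pathfinish (conf \<circ> (upper_branches \<circ> g)) = conf X" "pathstart ?M = conf X" "pathfinish ?M = ?\<sigma> (conf X)"
        by (simp_all only: pathfinish_compose g(4) X_def[symmetric]) (simp_all only: pathstart_def pathfinish_def start cusp_turn_1 cusp_conf_swap)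
      have "homotopic_paths config (conj_path ?\<sigma> (conf \<circ> (upper_branches \<circ> g)) ?M) (conj_path ?\<sigma> (conf \<circ> (linepath V W +++ q))
        (\<lambda>t. twist (seg_disc e (conf X $ B2) (conf X $ B1)) B2 B1 (conf X) (real 3 * t)))"
        by (rule homotopic_conj_path[OF l[OF g] cusp_loop_homotopic(2)[OF e, folded X_def] _ _
              continuous_on_swap_labels swap_labels_maps])
          (simp_all only: ends)
      from homotopic_paths_trans[OF this[simplified of_nat_numeral] homotopic_paths_sym[OF hom]]
      show "homotopic_paths config (conj_path ?\<sigma> (conf \<circ> (upper_branches \<circ> g)) ?M) (braid_power h 3)" .
    qed
  qed
qed

end

section \<open>Fibres of nearby projections\<close>

definition slanted :: "(complex \<times> complex) set" where
  "slanted = {p. fst p \<noteq> 0 \<and> 1 + (snd p / fst p)^2 \<noteq> 0}"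

definition fib_poly :: "(complex \<times> complex) \<times> complex \<Rightarrow> complex poly" where
  "fib_poly s = (let k = snd s / fst (fst s); m = snd (fst s) / fst (fst s) in
     [: k^4 + k^3, - 4 * k^3 * m - 3 * k^2 * m,
        2 * k^2 * (1 + m^2) + 4 * k^2 * m^2 + 3 * k * m^2 + 9 * k + 27/4,
        - 4 * k * m * (1 + m^2) - m^3 - 9 * m, (1 + m^2)^2 :])"

lemma poly_fib_poly:
  "poly (fib_poly s) y = deltoid (snd s / fst (fst s) - snd (fst s) / fst (fst s) * y) y"
proof -
  define k where "k = snd s / fst (fst s)"
  define m where "m = snd (fst s) / fst (fst s)"
  show ?thesis unfolding fib_poly_def Let_def k_def[symmetric] m_def[symmetric] deltoid_def
    by (simp add: power2_eq_square power3_eq_cube power4_eq_xxxx algebra_simps)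
qed

lemma fib_poly_degree:
  assumes "fst s \<in> slanted"
  shows "degree (fib_poly s) = 4" "lead_coeff (fib_poly s) = (1 + (snd (fst s) / fst (fst s))^2)^2"
    "lead_coeff (fib_poly s) \<noteq> 0"
  using assms by (simp_all add: fib_poly_def Let_def slanted_def)

lemma fibre_fib_poly:
  assumes "fst s \<in> slanted"
  shows "fibre deltoid s = {y. poly (fib_poly s) y = 0}"
proof -
  obtain p1 p2 c where s: "s = ((p1, p2), c)" by (metis prod.collapse)
  have p1: "p1 \<noteq> 0" using assms by (simp add: s slanted_def)
  have "proj (p1, p2) (x, y) = c \<longleftrightarrow> x = c / p1 - p2 / p1 * y" for x y
    using p1 by (auto simp: proj_def field_simps)
  then show ?thesis
    by (force simp: fibre_def curve_def poly_fib_poly s image_iff)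
qed

lemma finite_fibre:
  assumes "fst s \<in> slanted"
  shows "finite (fibre deltoid s)" "card (fibre deltoid s) \<le> 4"
proof -
  have "fib_poly s \<noteq> 0" using fib_poly_degree[OF assms] by auto
  then show "finite (fibre deltoid s)" "card (fibre deltoid s) \<le> 4"
    using poly_roots_finite[of "fib_poly s"] card_poly_roots_bound[of "fib_poly s"]
    by (simp_all add: fibre_fib_poly[OF assms] fib_poly_degree[OF assms])
qed

text \<open>
  If all roots have distance at least \<open>e\<close> from \<open>y\<close>, each linear factor
  has modulus at least \<open>e\<close> at \<open>y\<close>. This yields the continuity of the
  roots.
\<close>

lemma poly_lower_bound:
  fixes q :: "complex poly"
  assumes "0 \<le> e" "\<And>z. poly q z = 0 \<Longrightarrow> e \<le> dist z y"
  shows "norm (lead_coeff q) * e ^ degree q \<le> norm (poly q y)"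
proof -
  obtain root where q: "smult (lead_coeff q) (\<Prod>i<degree q. [:- root i, 1:]) = q"
    by (rule complex_poly_decompose')
  have pq: "poly q z = lead_coeff q * (\<Prod>i<degree q. z - root i)" for z
    by (subst q[symmetric]) (simp add: poly_prod)
  have "poly q (root i) = 0" if "i < degree q" for i
    using that by (auto simp: pq)
  then have "e \<le> norm (y - root i)" if "i < degree q" for i
    using assms(2) that by (metis dist_commute dist_norm)
  then have "(\<Prod>i<degree q. e) \<le> (\<Prod>i<degree q. norm (y - root i))"
    using assms(1) by (intro prod_mono) auto
  then show ?thesis
    unfolding pq norm_mult prod_norm[symmetric] by (intro mult_left_mono) simp_all
qed

lemma open_slanted: "open slanted"
proof -
  have eq: "slanted = {p. fst p \<noteq> 0} \<inter> {p. (fst p)^2 + (snd p)^2 \<noteq> 0}"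
    by (auto simp: slanted_def power_divide add_divide_eq_if_simps)
  have op: "open {p :: complex \<times> complex. fst p \<noteq> 0}" "open {p :: complex \<times> complex. (fst p)^2 + (snd p)^2 \<noteq> 0}"
    by (intro open_Collect_neq continuous_intros)+
  from op show ?thesis unfolding eq by (rule open_Int)
qed

lemma slanted_x: "(1, 0) \<in> slanted"
  by (simp add: slanted_def)

lemma eventually_slanted: "fst s \<in> slanted \<Longrightarrow> \<forall>\<^sub>F s' in nhds s. fst s' \<in> slanted"
  using open_slanted by (intro eventually_nhds_in_open[of "fst -` slanted", simplified] open_vimage_fst) auto

lemma fibre_persists:
  assumes s: "fst s \<in> slanted" and y: "y \<in> fibre deltoid s" and e: "e > 0"
  shows "\<forall>\<^sub>F s' in nhds s. \<exists>y'\<in>fibre deltoid s'. dist y' y < e"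
proof -
  let ?h = "\<lambda>s'. norm ((1 + (snd (fst s') / fst (fst s'))^2)^2) * e^4 -
    norm (deltoid (snd s' / fst (fst s') - snd (fst s') / fst (fst s') * y) y)"
  have "isCont ?h s"
    using s unfolding deltoid_def slanted_def by (intro continuous_intros) simp_all
  then have "(?h \<longlongrightarrow> ?h s) (nhds s)" by (simp add: isCont_def tendsto_nhds_iff)
  moreover have "?h s > 0"
  proof -
    have "deltoid (snd s / fst (fst s) - snd (fst s) / fst (fst s) * y) y = 0"
      using y by (simp add: fibre_fib_poly[OF s] poly_fib_poly)
    then show ?thesis using s e by (simp add: slanted_def)
  qed
  ultimately have "\<forall>\<^sub>F s' in nhds s. ?h s' > 0" by (rule order_tendstoD(1))
  with eventually_slanted[OF s] show ?thesis
  proof eventually_elim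
    case (elim s')
    show ?case
    proof (rule ccontr)
      assume "\<not> (\<exists>y'\<in>fibre deltoid s'. dist y' y < e)"
      then have "norm (lead_coeff (fib_poly s')) * e ^ degree (fib_poly s') \<le> norm (poly (fib_poly s') y)"
        using e by (intro poly_lower_bound) (auto simp: fibre_fib_poly[OF elim(1)] not_less)
      then show False using elim(2) unfolding fib_poly_degree(2)[OF elim(1)] poly_fib_poly by (simp only: fib_poly_degree(1)[OF elim(1)])
    qed
  qed
qed

text \<open>Distinct points of a fibre in an open set \<open>G\<close> persist as distinct points in \<open>G\<close>.\<close>

lemma fibre_count_persists:
  assumes s: "fst s \<in> slanted" and G: "open G"
  shows "\<forall>\<^sub>F s' in nhds s. card (fibre deltoid s \<inter> G) \<le> card (fibre deltoid s' \<inter> G)"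
proof -
  let ?A = "fibre deltoid s \<inter> G"
  have fin: "finite ?A" using finite_fibre(1)[OF s] by simp
  have "\<exists>e>0. ball y e \<subseteq> G \<and> (\<forall>z\<in>?A. z \<noteq> y \<longrightarrow> e \<le> dist y z / 2)" if y: "y \<in> ?A" for y
  proof -
    obtain e1 where e1: "e1 > 0" "ball y e1 \<subseteq> G" using G y by (meson IntD2 openE)
    define e where "e = Min (insert e1 ((\<lambda>z. dist y z / 2) ` (?A - {y})))"
    have fin': "finite (insert e1 ((\<lambda>z. dist y z / 2) ` (?A - {y})))" using fin by simp
    have "e > 0" unfolding e_def using fin' e1(1) by (subst Min_gr_iff) auto
    moreover have "e \<le> e1" unfolding e_def by (rule Min_le[OF fin']) simp
    moreover have "e \<le> dist y z / 2" if "z \<in> ?A - {y}" for z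
      unfolding e_def by (rule Min_le[OF fin']) (use that in blast)
    ultimately show ?thesis using e1(2) by (intro exI[of _ e]) (auto simp: subset_iff)
  qed
  then obtain e where e: "\<And>y. y \<in> ?A \<Longrightarrow> e y > 0" "\<And>y. y \<in> ?A \<Longrightarrow> ball y (e y) \<subseteq> G"
    "\<And>y z. y \<in> ?A \<Longrightarrow> z \<in> ?A \<Longrightarrow> z \<noteq> y \<Longrightarrow> e y \<le> dist y z / 2" by metis
  have "\<forall>\<^sub>F s' in nhds s. \<forall>y\<in>?A. \<exists>y'\<in>fibre deltoid s'. dist y' y < e y"
    using fin e(1) by (intro eventually_ball_finite ballI fibre_persists[OF s]) auto
  with eventually_slanted[OF s] show ?thesis
  proof eventually_elim
    case (elim s')
    then obtain f where f: "\<And>y. y \<in> ?A \<Longrightarrow> f y \<in> fibre deltoid s'" "\<And>y. y \<in> ?A \<Longrightarrow> dist (f y) y < e y" by metis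
    have "inj_on f ?A"
    proof (rule inj_onI, rule ccontr)
      fix y z assume yz: "y \<in> ?A" "z \<in> ?A" "f y = f z" "y \<noteq> z"
      have "dist y z \<le> dist (f y) y + dist (f z) z" using yz(3) by (metis dist_commute dist_triangle)
      also have "\<dots> < e y + e z" using f(2)[OF yz(1)] f(2)[OF yz(2)] by (rule add_strict_mono)
      also have "\<dots> \<le> dist y z / 2 + dist z y / 2" using e(3) yz by (intro add_mono) auto
      finally show False by (simp add: dist_commute)
    qed
    moreover have "f ` ?A \<subseteq> fibre deltoid s' \<inter> G"
    proof (rule image_subsetI)
      fix y assume y: "y \<in> ?A"
      then have "f y \<in> ball y (e y)" using f(2)[OF y] by (simp add: dist_commute)
      then show "f y \<in> fibre deltoid s' \<inter> G" using f(1)[OF y] e(2)[OF y] by blast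
    qed
    moreover have "finite (fibre deltoid s' \<inter> G)" using finite_fibre(1)[OF elim(1)] by simp
    ultimately show ?case by (metis card_image card_mono)
  qed
qed

definition regular :: "((complex \<times> complex) \<times> complex) set" where
  "regular = {s. fst s \<in> slanted \<and> card (fibre deltoid s) = 4}"

lemma open_regular: "open regular"
proof (subst open_subopen, rule ballI)
  fix s assume s: "s \<in> regular"
  then have sl: "fst s \<in> slanted" by (simp add: regular_def)
  have "\<forall>\<^sub>F s' in nhds s. s' \<in> regular"
    using eventually_slanted[OF sl] fibre_count_persists[OF sl open_UNIV]
  proof eventually_elim
    case (elim s')
    then show ?case using finite_fibre(2)[OF elim(1)] s by (simp add: regular_def)
  qed
  then show "\<exists>T. open T \<and> s \<in> T \<and> T \<subseteq> regular" unfolding eventually_nhds by blast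
qed

lemma moving_regular: "moving_set 4 regular (fibre deltoid)"
  unfolding moving_set_def
proof (intro conjI ballI allI impI)
  fix s y and e :: real assume "s \<in> regular" "y \<in> fibre deltoid s" "0 < e"
  then have "\<forall>\<^sub>F s' in nhds s. \<exists>y'\<in>fibre deltoid s'. dist y' y < e"
    by (intro fibre_persists) (simp_all add: regular_def)
  then show "\<forall>\<^sub>F s' in at s within regular. \<exists>y'\<in>fibre deltoid s'. dist y' y < e"
    unfolding eventually_at_filter by eventually_elim simp
qed (simp add: regular_def)

lemma card_point_name: "CARD(point_name) = 4"
  by (simp add: UNIV_point_name)

lemma card_enumerates: "enumerates (v :: complex ^ point_name) A \<Longrightarrow> card A = 4"
  unfolding enumerates_def by (metis card_image card_point_name)

lemma regular_x:
  assumes "x \<noteq> 0" "x \<noteq> -1" "x \<noteq> -9/8"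
  shows "((1, 0), x) \<in> regular"
proof -
  have "enumerates (conf (branches (Ln (- x)) (Ln (x + 1)) x)) (fibre deltoid ((1, 0), x))"
    using assms by (intro enumerates_branches exp_Ln) (auto simp: add_eq_0_iff2)
  then show ?thesis using card_enumerates by (simp add: regular_def slanted_x)
qed

section \<open>Critical points\<close>

lemma deltoid_partial_x: "partial_x deltoid (x, y) = 4 * x * (x^2 + y^2) + 3 * x^2 + 9 * y^2"
  unfolding partial_x_def deltoid_def
  by (rule DERIV_imp_deriv) (auto intro!: derivative_eq_intros simp: algebra_simps)

lemma deltoid_partial_y: "partial_y deltoid (x, y) = 4 * y * (x^2 + y^2) + 18 * x * y + 27/2 * y"
  unfolding partial_y_def deltoid_def
  by (rule DERIV_imp_deriv) (auto intro!: derivative_eq_intros simp: algebra_simps)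

lemma pderiv_fib_poly:
  defines "m s \<equiv> snd (fst s) / fst (fst s)"
  shows "poly (pderiv (fib_poly s)) y =
    partial_y deltoid (snd s / fst (fst s) - m s * y, y) - m s * partial_x deltoid (snd s / fst (fst s) - m s * y, y)"
proof -
  define k where "k = snd s / fst (fst s)"
  have "((\<lambda>y. deltoid (k - m s * y) y) has_field_derivative
     partial_y deltoid (k - m s * y, y) - m s * partial_x deltoid (k - m s * y, y)) (at y)"
    unfolding deltoid_def deltoid_partial_x deltoid_partial_y
    by (auto intro!: derivative_eq_intros simp: algebra_simps power2_eq_square power3_eq_cube)
  moreover have "(\<lambda>y. deltoid (k - m s * y) y) = poly (fib_poly s)"
    by (simp add: fun_eq_iff poly_fib_poly k_def m_def)
  ultimately show ?thesis using DERIV_unique[OF poly_DERIV[of "fib_poly s" y]] by (simp add: k_def)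
qed

lemma critical_points_iff:
  assumes "p \<in> slanted" and "y \<in> fibre deltoid (p, c)"
  shows "((c - snd p * y) / fst p, y) \<in> critical_points deltoid p \<longleftrightarrow> poly (pderiv (fib_poly (p, c))) y = 0"
proof -
  obtain p1 p2 where p: "p = (p1, p2)" by (cases p)
  have p1: "p1 \<noteq> 0" using assms(1) by (simp add: p slanted_def)
  define x where "x = (c - p2 * y) / p1"
  have x: "x = c / p1 - p2 / p1 * y" by (simp add: x_def diff_divide_distrib)
  define fx where "fx = partial_x deltoid (x, y)"
  define fy where "fy = partial_y deltoid (x, y)"
  have on: "(x, y) \<in> curve deltoid"
    using assms(2) fibre_fib_poly[of "(p, c)"] assms(1) by (simp add: curve_def poly_fib_poly p x)
  have d: "poly (pderiv (fib_poly (p, c))) y = fy - p2 / p1 * fx"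
    unfolding pderiv_fib_poly fx_def fy_def by (simp add: p x)
  show ?thesis
  proof
    assume "((c - snd p * y) / fst p, y) \<in> critical_points deltoid p"
    then consider "fx = 0" "fy = 0" | "tangent_line deltoid (x, y) \<subseteq> {q'. proj p q' = proj p (x, y)}"
      by (auto simp: critical_points_def singular_point_def p x_def fx_def fy_def)
    then have "p1 * fy = p2 * fx"
    proof cases
      case 2
      have "(x - fy, y + fx) \<in> tangent_line deltoid (x, y)"
        by (simp add: tangent_line_def fx_def fy_def)
      then have "proj p (x - fy, y + fx) = proj p (x, y)" using 2 by blast
      then show ?thesis by (simp add: proj_def p algebra_simps)
    qed simp
    then show "poly (pderiv (fib_poly (p, c))) y = 0" unfolding d using p1 by (simp add: field_simps)
  next
    assume "poly (pderiv (fib_poly (p, c))) y = 0"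
    then have fy: "fy = p2 / p1 * fx" unfolding d by simp
    have "(x, y) \<in> critical_points deltoid p"
    proof (cases "fx = 0")
      case True
      then show ?thesis using on fy by (simp add: critical_points_def singular_point_def fx_def fy_def)
    next
      case False
      have "tangent_line deltoid (x, y) \<subseteq> {q'. proj p q' = proj p (x, y)}"
      proof clarify
        fix x' y' assume "(x', y') \<in> tangent_line deltoid (x, y)"
        then have "fx * (x' - x) + fy * (y' - y) = 0" by (simp add: tangent_line_def fx_def fy_def)
        then have "fx * (p1 * (x' - x) + p2 * (y' - y)) = 0" using p1 unfolding fy by (simp add: field_simps)
        then have "p1 * (x' - x) + p2 * (y' - y) = 0" using False by simp
        then show "proj p (x', y') = proj p (x, y)" by (simp add: proj_def p algebra_simps)
      qed
      then show ?thesis using on by (simp add: critical_points_def)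
    qed
    then show "((c - snd p * y) / fst p, y) \<in> critical_points deltoid p" by (simp add: p x_def)
  qed
qed

lemma rsquarefree_iff_card_roots:
  fixes q :: "complex poly"
  assumes "q \<noteq> 0"
  shows "rsquarefree q \<longleftrightarrow> card {z. poly q z = 0} = degree q"
proof
  assume "rsquarefree q"
  then have q: "smult (lead_coeff q) (\<Prod>z|poly q z = 0. [:- z, 1:]) = q" by (rule complex_poly_decompose_rsquarefree)
  have "degree (\<Prod>z|poly q z = 0. [:- z, 1:]) = card {z. poly q z = 0}"
    by (subst degree_prod_eq_sum_degree) simp_all
  then show "card {z. poly q z = 0} = degree q" using assms by (metis degree_smult_eq leading_coeff_0_iff q)
next
  assume card: "card {z. poly q z = 0} = degree q"
  show "rsquarefree q"
  proof (rule ccontr)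
    assume "\<not> rsquarefree q"
    then obtain a where "order a q \<noteq> 0" "order a q \<noteq> 1" using assms by (auto simp: rsquarefree_def)
    then have "2 \<le> order a q" by linarith
    then have "[:- a, 1:] ^ 2 dvd q" by (simp add: order_divides)
    then obtain u where u: "q = [:- a, 1:] ^ 2 * u" by (rule dvdE)
    then have "u \<noteq> 0" using assms by auto
    have "degree q = 2 + degree u" unfolding u using \<open>u \<noteq> 0\<close> by (subst degree_mult_eq) (simp_all add: degree_power_eq)
    moreover have "card {z. poly q z = 0} \<le> Suc (card {z. poly u z = 0})"
    proof -
      have fin: "finite {z. poly u z = 0}" using \<open>u \<noteq> 0\<close> by (rule poly_roots_finite)
      have "{z. poly q z = 0} \<subseteq> insert a {z. poly u z = 0}" unfolding u by auto
      then have "card {z. poly q z = 0} \<le> card (insert a {z. poly u z = 0})" using fin by (intro card_mono) auto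
      also have "\<dots> \<le> Suc (card {z. poly u z = 0})" using fin by (simp add: card_insert_if)
      finally show ?thesis .
    qed
    moreover have "card {z. poly u z = 0} \<le> degree u" using \<open>u \<noteq> 0\<close> by (rule card_poly_roots_bound)
    ultimately show False using card by simp
  qed
qed

text \<open>
  The fibre has four points iff the restricted equation is squarefree, and its multiple roots are
  the critical points of the projection.
\<close>

lemma regular_iff_not_critical:
  assumes "p \<in> slanted"
  shows "(p, c) \<in> regular \<longleftrightarrow> c \<notin> critical_values deltoid p"
proof -
  let ?q = "fib_poly (p, c)"
  have q: "degree ?q = 4" "?q \<noteq> 0" using fib_poly_degree[of "(p, c)"] assms by auto
  have fst: "fst p \<noteq> 0" using assms by (simp add: slanted_def)
  have F: "fibre deltoid (p, c) = {y. poly ?q y = 0}" using fibre_fib_poly[of "(p, c)"] assms by simp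
  have "(p, c) \<in> regular \<longleftrightarrow> rsquarefree ?q"
    using rsquarefree_iff_card_roots[OF q(2)] by (auto simp: regular_def assms F q(1))
  also have "\<dots> \<longleftrightarrow> (\<forall>y \<in> fibre deltoid (p, c). ((c - snd p * y) / fst p, y) \<notin> critical_points deltoid p)"
    unfolding rsquarefree_roots using critical_points_iff[OF assms] F by auto
  also have "\<dots> \<longleftrightarrow> c \<notin> critical_values deltoid p"
  proof -
    have "(x, y) \<in> critical_points deltoid p \<and> proj p (x, y) = c \<longleftrightarrow>
        y \<in> fibre deltoid (p, c) \<and> (x, y) \<in> critical_points deltoid p \<and> x = (c - snd p * y) / fst p" for x y
    proof -
      have "proj p (x, y) = c \<longleftrightarrow> x = (c - snd p * y) / fst p" using fst by (auto simp: proj_def field_simps)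
      moreover have "(x, y) \<in> critical_points deltoid p \<Longrightarrow> proj p (x, y) = c \<Longrightarrow> y \<in> fibre deltoid (p, c)"
        by (force simp: critical_points_def fibre_def)
      ultimately show ?thesis by blast
    qed
    then show ?thesis unfolding critical_values_def image_iff by (metis surj_pair)
  qed
  finally show ?thesis .
qed

section \<open>The two clusters of points near the cusps\<close>

definition clusters :: "(complex \<times> complex) \<times> complex \<times> complex \<Rightarrow> complex set" where
  "clusters s = (fibre deltoid (fst s, fst (snd s)) \<inter> {y. Re y < 0}) \<union>
     (fibre deltoid (fst s, snd (snd s)) \<inter> {y. 0 < Re y})"

definition split_pairs :: "((complex \<times> complex) \<times> complex \<times> complex) set" where
  "split_pairs = {s. fst s \<in> slanted \<and> card (fibre deltoid (fst s, fst (snd s)) \<inter> {y. Re y < 0}) = 2 \<and>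
     card (fibre deltoid (fst s, snd (snd s)) \<inter> {y. 0 < Re y}) = 2}"

lemma open_halfplanes: "open {y. Re y < 0}" "open {y. 0 < Re y}"
  by (simp_all add: open_halfspace_Re_lt open_halfspace_Re_gt)

lemma moving_clusters: "moving_set 4 split_pairs clusters"
  unfolding moving_set_def
proof (intro conjI ballI allI impI)
  fix s assume s: "s \<in> split_pairs"
  let ?L = "fibre deltoid (fst s, fst (snd s)) \<inter> {y. Re y < 0}"
  let ?R = "fibre deltoid (fst s, snd (snd s)) \<inter> {y. 0 < Re y}"
  have sl: "fst s \<in> slanted" using s by (simp add: split_pairs_def)
  have "card (?L \<union> ?R) = card ?L + card ?R"
    by (rule card_Un_disjoint) (use finite_fibre(1)[of "(fst s, _)"] sl in auto)
  then show "card (clusters s) = 4" using s by (simp add: clusters_def split_pairs_def)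
  fix y and e :: real assume y: "y \<in> clusters s" and e: "0 < e"
  define e' where "e' = min e \<bar>Re y\<bar>"
  have e': "e' > 0" using y e by (auto simp: e'_def clusters_def)
  have near: "Re y < 0 \<Longrightarrow> Re y' < 0" "0 < Re y \<Longrightarrow> 0 < Re y'" "dist y' y < e" if "dist y' y < e'" for y'
    using that abs_Re_le_cmod[of "y' - y"] by (auto simp: e'_def dist_norm)
  have tend: "filterlim (\<lambda>s'. (fst s', fst (snd s'))) (nhds (fst s, fst (snd s))) (at s within split_pairs)"
    "filterlim (\<lambda>s'. (fst s', snd (snd s'))) (nhds (fst s, snd (snd s))) (at s within split_pairs)"
    by (intro tendsto_intros)+
  show "\<forall>\<^sub>F s' in at s within split_pairs. \<exists>y'\<in>clusters s'. dist y' y < e"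
  proof (cases "Re y < 0")
    case True
    then have "y \<in> fibre deltoid (fst s, fst (snd s))" using y by (auto simp: clusters_def)
    then have "\<forall>\<^sub>F s' in nhds (fst s, fst (snd s)). \<exists>y'\<in>fibre deltoid s'. dist y' y < e'"
      by (intro fibre_persists e') (simp_all add: sl)
    from eventually_compose_filterlim[OF this tend(1)] show ?thesis
      by eventually_elim (use near(1,3) True in \<open>force simp: clusters_def\<close>)
  next
    case False
    then have "y \<in> fibre deltoid (fst s, snd (snd s))" "0 < Re y" using y by (auto simp: clusters_def)
    then have "\<forall>\<^sub>F s' in nhds (fst s, snd (snd s)). \<exists>y'\<in>fibre deltoid s'. dist y' y < e'"
      by (intro fibre_persists e') (simp_all add: sl)
    from eventually_compose_filterlim[OF this tend(2)] show ?thesis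
      by eventually_elim (use near(2,3) \<open>0 < Re y\<close> in \<open>force simp: clusters_def\<close>)
  qed
qed

text \<open>
  Both counts are lower semicontinuous and their sum is \<open>4\<close>, so each of them is
  locally constant.
\<close>

lemma connected_cluster_count:
  assumes "connected S" "S \<subseteq> regular" "\<And>s y. s \<in> S \<Longrightarrow> y \<in> fibre deltoid s \<Longrightarrow> Re y \<noteq> 0"
    and "s0 \<in> S" "card (fibre deltoid s0 \<inter> {y. Re y < 0}) = 2" "s \<in> S"
  shows "card (fibre deltoid s \<inter> {y. Re y < 0}) = 2" "card (fibre deltoid s \<inter> {y. 0 < Re y}) = 2"
proof -
  let ?L = "\<lambda>s. card (fibre deltoid s \<inter> {y. Re y < 0})" and ?R = "\<lambda>s. card (fibre deltoid s \<inter> {y. 0 < Re y})"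
  have sl: "fst s \<in> slanted" if "s \<in> S" for s using assms(2) that by (auto simp: regular_def)
  have sum: "?L s + ?R s = 4" if "s \<in> S" for s
  proof -
    have "fibre deltoid s = (fibre deltoid s \<inter> {y. Re y < 0}) \<union> (fibre deltoid s \<inter> {y. 0 < Re y})"
      using assms(3)[OF that] by force
    moreover have "card ((fibre deltoid s \<inter> {y. Re y < 0}) \<union> (fibre deltoid s \<inter> {y. 0 < Re y})) = ?L s + ?R s"
      by (rule card_Un_disjoint) (use finite_fibre(1)[OF sl[OF that]] in auto)
    ultimately show ?thesis using assms(2) that by (auto simp: regular_def)
  qed
  have "?L constant_on S"
  proof (rule locally_constant_imp_constant[OF assms(1)])
    fix s assume s: "s \<in> S"
    have "\<forall>\<^sub>F s' in nhds s. ?L s \<le> ?L s' \<and> ?R s \<le> ?R s'"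
      using fibre_count_persists[OF sl[OF s] open_halfplanes(1)] fibre_count_persists[OF sl[OF s] open_halfplanes(2)]
      by eventually_elim simp
    then obtain T where T: "open T" "s \<in> T" "\<forall>s'\<in>T. ?L s \<le> ?L s' \<and> ?R s \<le> ?R s'" unfolding eventually_nhds by blast
    have "?L s' = ?L s" if "s' \<in> S \<inter> T" for s'
      using T(3) that sum[OF s] sum[of s'] by force
    then show "\<exists>T. openin (top_of_set S) T \<and> s \<in> T \<and> (\<forall>x\<in>T. ?L x = ?L s)"
      using T(2) s by (intro exI[of _ "S \<inter> T"] conjI ballI openin_open_Int[OF T(1)]) blast+
  qed
  then obtain k where "?L s' = k" if "s' \<in> S" for s' unfolding constant_on_def by blast
  then show L: "?L s = 2" using assms(4-6) by simp
  then show "?R s = 2" using sum[OF assms(6)] by simp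
qed

lemma regular_near_x:
  assumes "compact C" "0 \<notin> C" "-1 \<notin> C" "-9/8 \<notin> C"
  shows "\<exists>\<delta>>0. \<forall>p. dist p (1, 0) < \<delta> \<longrightarrow> (\<forall>x\<in>C. (p, x) \<in> regular)"
proof -
  have "((1, 0), x) \<in> regular" if "x \<in> C" for x by (rule regular_x) (use that assms(2-4) in auto)
  then have "{(1, 0)} \<times> C \<subseteq> regular" by auto
  from Elementary_Topology.tube_lemma[OF assms(1) open_regular this]
  obtain X0 where X0: "(1, 0) \<in> X0" "open X0" "X0 \<times> C \<subseteq> regular" by blast
  then obtain \<delta> where "\<delta> > 0" "ball (1, 0) \<delta> \<subseteq> X0" by (meson openE)
  then show ?thesis using X0(3) by (intro exI[of _ \<delta>]) (auto simp: dist_commute subset_iff)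
qed

text \<open>
  The restricted equation in the coordinate \<open>1 / y\<close>; with it the imaginary axis is
  covered by two compact pieces.
\<close>

definition fib_poly_at_infinity :: "(complex \<times> complex) \<times> complex \<Rightarrow> complex \<Rightarrow> complex" where
  "fib_poly_at_infinity s t = (let x = snd s / fst (fst s) * t - snd (fst s) / fst (fst s) in
     (x^2 + 1)^2 + t * x^3 + 9 * x * t + 27/4 * t^2)"

lemma fib_poly_at_infinity:
  "y \<noteq> 0 \<Longrightarrow> deltoid (snd s / fst (fst s) - snd (fst s) / fst (fst s) * y) y = y^4 * fib_poly_at_infinity s (1 / y)"
proof -
  assume y: "y \<noteq> 0"
  define x where "x = snd s / fst (fst s) * (1 / y) - snd (fst s) / fst (fst s)"
  have "snd s / fst (fst s) - snd (fst s) / fst (fst s) * y = x * y" using y by (simp add: x_def field_simps)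
  then show ?thesis using y unfolding fib_poly_at_infinity_def Let_def x_def[symmetric] deltoid_def
    by (simp add: field_simps power2_eq_square power3_eq_cube power4_eq_xxxx)
qed

text \<open>
  By compactness, after adding the point at infinity to the imaginary axis. So the left and the
  right points remain separated over the disc.
\<close>

lemma no_imaginary_points_near_cusps:
  fixes r :: real
  assumes r: "0 < r" "r < 1/20"
  shows "\<exists>\<delta>>0. \<forall>p. dist p (1, 0) < \<delta> \<longrightarrow> p \<in> slanted \<and>
    (\<forall>x\<in>cball (-9/8) r. \<forall>y\<in>fibre deltoid (p, x). Re y \<noteq> 0)"
proof -
  let ?K = "cball (-9/8) r \<times> {-1..1} :: (complex \<times> real) set"
  let ?W1 = "{s. fst (fst s) \<noteq> 0} \<inter> {s :: (complex \<times> complex) \<times> complex \<times> real.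
    deltoid (fst (snd s) / fst (fst s) - snd (fst s) / fst (fst s) * (\<i> * of_real (snd (snd s)))) (\<i> * of_real (snd (snd s))) \<noteq> 0}"
  let ?W2 = "{s. fst (fst s) \<noteq> 0} \<inter> {s :: (complex \<times> complex) \<times> complex \<times> real.
    fib_poly_at_infinity (fst s, fst (snd s)) (\<i> * of_real (snd (snd s))) \<noteq> 0}"
  have "compact ?K" by (intro compact_Times) auto
  have op: "open {s :: (complex \<times> complex) \<times> complex \<times> real. fst (fst s) \<noteq> 0}"
    by (intro open_Collect_neq continuous_intros)
  have cont: "continuous_on {s :: (complex \<times> complex) \<times> complex \<times> real. fst (fst s) \<noteq> 0}
      (\<lambda>s. deltoid (fst (snd s) / fst (fst s) - snd (fst s) / fst (fst s) * (\<i> * of_real (snd (snd s)))) (\<i> * of_real (snd (snd s))))"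
      "continuous_on {s :: (complex \<times> complex) \<times> complex \<times> real. fst (fst s) \<noteq> 0}
      (\<lambda>s. fib_poly_at_infinity (fst s, fst (snd s)) (\<i> * of_real (snd (snd s))))"
      unfolding deltoid_def fib_poly_at_infinity_def Let_def fst_conv snd_conv
      by (intro continuous_intros; simp)+
  have "{s. fst (fst s) \<noteq> 0} \<inter> {s. f s \<noteq> 0} = f -` (- {0}) \<inter> {s. fst (fst s) \<noteq> 0}" for f :: "(complex \<times> complex) \<times> complex \<times> real \<Rightarrow> complex"
    by auto
  then have W: "open ?W1" "open ?W2"
    using cont[THEN continuous_on_open_vimage[OF op, THEN iffD1], rule_format, of "- {0}"] by (simp_all only: open_Compl closed_singleton simp_thms)
  have im: "deltoid x (\<i> * of_real u) \<noteq> 0" if x: "x \<in> cball (-9/8) r" for x and u :: real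
  proof
    assume "deltoid x (\<i> * of_real u) = 0"
    then have y: "\<i> * of_real u \<in> fibre deltoid ((1, 0), x)" by (simp add: fibre_x)
    let ?v = "csqrt (8 * x + 9)"
    have "norm ?v ^ 2 = norm (8 * x + 9)" by (simp only: norm_power[symmetric] power2_csqrt)
    also have "\<dots> = norm (8 * (x - (-9/8)))" by (rule arg_cong[of _ _ norm]) simp
    also have "\<dots> = 8 * norm (x - (-9/8))" by (simp only: norm_mult norm_numeral)
    also have "\<dots> \<le> 2/5" using x r by (simp add: dist_norm norm_minus_commute)
    finally show False using cusp_fibre(3)[OF _ _ y, of ?v] by simp
  qed
  have K1: "{(1, 0)} \<times> ?K \<subseteq> ?W1" using im by auto
  have "fib_poly_at_infinity ((1, 0), x) (\<i> * of_real u) \<noteq> 0" if x: "x \<in> cball (-9/8) r" for x and u :: real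
  proof
    assume 0: "fib_poly_at_infinity ((1, 0), x) (\<i> * of_real u) = 0"
    show False
    proof (cases "u = 0")
      case True
      then show ?thesis using 0 by (simp add: fib_poly_at_infinity_def)
    next
      case False
      have "1 / (\<i> * of_real (- 1 / u)) = \<i> * complex_of_real u" using False by (simp add: field_simps)
      then have "deltoid x (\<i> * of_real (- 1 / u)) = 0"
        using fib_poly_at_infinity[of "\<i> * of_real (- 1 / u)" "((1, 0), x)"] 0 False by simp
      then show False using im[of x "- 1 / u"] x by simp
    qed
  qed
  then have K2: "{(1, 0)} \<times> ?K \<subseteq> ?W2" by auto
  from Elementary_Topology.tube_lemma[OF \<open>compact ?K\<close> W(1) K1] Elementary_Topology.tube_lemma[OF \<open>compact ?K\<close> W(2) K2]
  obtain X1 X2 where X: "(1, 0) \<in> X1" "open X1" "X1 \<times> ?K \<subseteq> ?W1" "(1, 0) \<in> X2" "open X2" "X2 \<times> ?K \<subseteq> ?W2"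
    by (elim exE conjE) (rule that)
  then have "open (X1 \<inter> X2 \<inter> slanted)" "(1, 0) \<in> X1 \<inter> X2 \<inter> slanted" using open_slanted slanted_x by auto
  then obtain \<delta> where \<delta>: "\<delta> > 0" "ball (1, 0) \<delta> \<subseteq> X1 \<inter> X2 \<inter> slanted" by (meson openE)
  show ?thesis
  proof (intro exI[of _ \<delta>] conjI \<delta>(1) allI impI ballI)
    fix p :: "complex \<times> complex" assume "dist p (1, 0) < \<delta>"
    then have "p \<in> ball (1, 0) \<delta>" by (simp add: dist_commute)
    then have "p \<in> X1 \<inter> X2 \<inter> slanted" using \<delta>(2) by (rule subsetD[rotated])
    then have p: "p \<in> X1" "p \<in> X2" "p \<in> slanted" by blast+
    then show "p \<in> slanted" by simp
    fix x y assume x: "x \<in> cball (-9/8) r" and y: "y \<in> fibre deltoid (p, x)"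
    have 0: "deltoid (x / fst p - snd p / fst p * y) y = 0"
      using y fibre_fib_poly[of "(p, x)"] p(3) by (simp add: poly_fib_poly)
    show "Re y \<noteq> 0"
    proof
      assume re: "Re y = 0"
      then have yi: "y = \<i> * of_real (Im y)" by (simp add: complex_eq_iff)
      show False
      proof (cases "\<bar>Im y\<bar> \<le> 1")
        case True
        then have "(p, x, Im y) \<in> ?W1" using X(3) p(1) x by (intro subsetD[OF X(3)]) auto
        then show False using 0 yi by auto
      next
        case False
        have "1 / y = \<i> * of_real (- 1 / Im y)" using False by (subst yi) (simp add: field_simps)
        moreover have "(p, x, - 1 / Im y) \<in> ?W2" using p(2) x False by (intro subsetD[OF X(6)]) (auto simp: field_simps abs_le_iff)
        moreover have "y \<noteq> 0" using False by auto
        ultimately show False using 0 fib_poly_at_infinity[of y "(p, x)"] by auto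
      qed
    qed
  qed
qed

section \<open>Loops around the end of a path\<close>

lemma winding_number_turn:
  assumes "norm (\<kappa> - c) < norm d"
  shows "winding_number (\<lambda>t. c + d * cis (2 * pi * t)) \<kappa> = 1"
proof -
  define a where "a = Arg2pi d / (2 * pi)"
  have a: "a \<in> {0..1}" using Arg2pi_ge_0[of d] Arg2pi_lt_2pi[of d] by (simp add: a_def)
  have d: "d = of_real (norm d) * cis (2 * pi * a)"
    using Arg2pi_eq[of d] by (simp add: a_def cis_conv_exp)
  have "cis (x - 2 * pi) = cis x" for x by (simp add: cis_divide[symmetric])
  then have "cis (2 * pi * a) * cis (2 * pi * t) = cis (2 * pi * (a + t))"
    "cis (2 * pi * (a + t)) = cis (2 * pi * (a + t - 1))" for t
    by (simp_all add: cis_mult algebra_simps)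
  moreover have "circlepath c (norm d) t = c + of_real (norm d) * cis (2 * pi * t)" for t
    by (simp add: circlepath cis_conv_exp mult_ac)
  ultimately have "(\<lambda>t. c + d * cis (2 * pi * t)) = shiftpath a (circlepath c (norm d))"
    by (subst d) (auto simp: shiftpath_def fun_eq_iff mult.assoc add.commute)
  moreover have "\<kappa> \<notin> path_image (circlepath c (norm d))"
    using assms by (auto simp: dist_norm norm_minus_commute)
  ultimately show ?thesis
    using winding_number_circlepath[OF assms] a by (simp add: winding_number_shiftpath)
qed

text \<open>
  The winding number classifies loops in the punctured plane; the nearest point projection to the
  disc makes the homotopies stay in the disc.
\<close>

lemma loops_homotopic_in_disc:
  fixes c :: complex
  assumes "\<kappa> \<in> ball c r" "path p" "path q" "path_image p \<subseteq> cball c r - {\<kappa>}" "path_image q \<subseteq> cball c r - {\<kappa>}"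
    "pathstart p = pathstart q" "pathfinish p = pathfinish q" "winding_number p \<kappa> = winding_number q \<kappa>"
  shows "homotopic_paths (cball c r - {\<kappa>}) p q"
proof -
  let ?D = "cball c r" and ?f = "closest_point (cball c r)"
  have "0 < r" using assms(1) zero_le_dist[of c \<kappa>] by (simp del: zero_le_dist)
  then have ne: "?D \<noteq> {}" by auto
  have "homotopic_paths (- {\<kappa>}) p q"
    using assms by (subst winding_number_homotopic_paths_eq[symmetric]) auto
  moreover have "continuous_on (- {\<kappa>}) ?f"
    using ne by (intro continuous_on_closest_point) auto
  moreover have "?f \<in> - {\<kappa>} \<rightarrow> ?D - {\<kappa>}"
  proof (rule funcsetI)
    fix x assume x: "x \<in> - {\<kappa>}"
    have "?f x \<in> ?D" using ne by (intro closest_point_in_set) auto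
    moreover have "?f x \<noteq> \<kappa>"
    proof (cases "x \<in> ?D")
      case True
      then show ?thesis using x by (simp add: closest_point_self)
    next
      case False
      have "rel_interior ?D = ball c r"
        using \<open>0 < r\<close> by (subst rel_interior_nonempty_interior) simp_all
      moreover have "?f x \<in> rel_interior ?D \<longleftrightarrow> x \<in> rel_interior ?D"
        using ne \<open>0 < r\<close> by (intro closest_point_in_rel_interior) (auto simp: affine_hull_nonempty_interior)
      ultimately show ?thesis using assms(1) False by auto
    qed
    ultimately show "?f x \<in> ?D - {\<kappa>}" by simp
  qed
  ultimately have *: "homotopic_paths (?D - {\<kappa>}) (?f \<circ> p) (?f \<circ> q)"
    by (rule homotopic_paths_continuous_image)
  have "(?f \<circ> p) t = p t" "(?f \<circ> q) t = q t" if "t \<in> {0..1}" for t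
    using that assms(4,5) by (auto simp: path_image_def image_subset_iff intro!: closest_point_self)
  then have "homotopic_paths (?D - {\<kappa>}) p (?f \<circ> p)" "homotopic_paths (?D - {\<kappa>}) q (?f \<circ> q)"
    using assms(2-5) by (auto intro!: homotopic_paths_eq simp del: o_apply)
  then show ?thesis using * homotopic_paths_trans homotopic_paths_sym by blast
qed

text \<open>The homotopy behind a displacement, as a function on the square.\<close>

lemma displaced_homotopy:
  assumes "displaced K g \<gamma>"
  obtains h :: "real \<times> real \<Rightarrow> complex" where "continuous_on ({0..1} \<times> {0..1}) h" "\<And>t. h (0, t) = g t" "\<And>t. h (1, t) = \<gamma> t"
    "\<And>s. s \<in> {0..1} \<Longrightarrow> h (s, 0) = pathstart g" "\<And>s. s \<in> {0..1} \<Longrightarrow> h (s, 1) = pathfinish g"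
    "\<And>s t. s \<in> {0..1} \<Longrightarrow> t \<in> {0..<1} \<Longrightarrow> h (s, t) \<notin> K"
proof -
  from assms obtain h :: "real \<times> real \<Rightarrow> complex" where c: "continuous_map (prod_topology (top_of_set {0..1}) (top_of_set {0..1})) (top_of_set UNIV) h"
    and h': "\<forall>t. h (0, t) = g t" "\<forall>t. h (1, t) = \<gamma> t"
    "\<forall>s\<in>{0..1}. pathstart (\<lambda>t. h (s, t)) = pathstart g \<and> pathfinish (\<lambda>t. h (s, t)) = pathfinish g \<and> (\<forall>t\<in>{0..<1}. h (s, t) \<notin> K)"
    unfolding displaced_def homotopic_with_def by (elim exE conjE) (rule that; assumption)
  note h = h'[rule_format]
  from c have cont: "continuous_on ({0..1} \<times> {0..1}) h" by (simp add: prod_topology_subtopology_eu)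
  show ?thesis
  proof (rule that[of h])
    show "h (s, 0) = pathstart g" "h (s, 1) = pathfinish g" if "s \<in> {0..1}" for s
      using h(3)[OF that] by (simp_all add: pathstart_def pathfinish_def)
    show "h (s, t) \<notin> K" if "s \<in> {0..1}" "t \<in> {0..<1}" for s t using h(3)[OF that(1)] that(2) by blast
  qed (use cont h in simp_all)
qed

text \<open>
  A displacement changes an initial piece of a path by a homotopy in the complement of \<open>K\<close> which
  moves only its end point; near the end of the paths this motion takes place close to the end
  point, since a homotopy is uniformly continuous.
\<close>

lemma ends_near_initial_piece:
  fixes G \<gamma> :: "real \<Rightarrow> complex"
  assumes "ends_near K G c r \<gamma>" "path G" and \<kappa>: "\<kappa> = pathfinish \<gamma>" "0 < \<eta>" "K \<inter> cball \<kappa> \<eta> = {\<kappa>}" "cball \<kappa> \<eta> \<subseteq> cball c r"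
  obtains \<tau> e where "0 < \<tau>" "\<tau> < 1" "\<gamma> ` {\<tau>..1} \<subseteq> cball \<kappa> \<eta>" "\<gamma> \<tau> \<notin> K"
    "path e" "pathstart e = pathfinish G" "pathfinish e = \<gamma> \<tau>" "path_image e \<subseteq> cball c r - K"
    "homotopic_paths (- K) (subpath 0 \<tau> \<gamma>) (G +++ e)"
proof -
  from assms(1) obtain e where e: "path e" "pathstart e = pathfinish G" "path_image e \<subseteq> cball c r"
    "\<forall>t\<in>{0..<1}. e t \<notin> K" and disp: "displaced K (G +++ e) \<gamma>" unfolding ends_near_def by blast
  define g where "g = G +++ e"
  obtain h :: "real \<times> real \<Rightarrow> complex" where h: "continuous_on ({0..1} \<times> {0..1}) h" "\<And>t. h (0, t) = g t" "\<And>t. h (1, t) = \<gamma> t"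
    "\<And>s. s \<in> {0..1} \<Longrightarrow> h (s, 0) = pathstart g" "\<And>s. s \<in> {0..1} \<Longrightarrow> h (s, 1) = pathfinish g"
    "\<And>s t. s \<in> {0..1} \<Longrightarrow> t \<in> {0..<1} \<Longrightarrow> h (s, t) \<notin> K" by (rule displaced_homotopy[OF disp[folded g_def]]) (rule that; assumption)
  have h1: "h (s, 1) = \<kappa>" if "s \<in> {0..1}" for s
  proof -
    have "pathfinish \<gamma> = pathfinish g" using h(5)[of 1] h(3)[of 1] by (simp add: pathfinish_def[of \<gamma>])
    then show ?thesis using h(5)[OF that] \<kappa>(1) by simp
  qed
  have "uniformly_continuous_on ({0..1} \<times> {0..1}) h"
    using h(1) by (rule compact_uniformly_continuous) (intro compact_Times compact_Icc)
  then obtain d where d: "d > 0" "\<And>a b. a \<in> {0..1} \<times> {0..1} \<Longrightarrow> b \<in> {0..1} \<times> {0..1} \<Longrightarrow> dist b a < d \<Longrightarrow> dist (h b) (h a) < \<eta>"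
    using \<kappa>(2) unfolding uniformly_continuous_on_def by blast
  define \<tau> where "\<tau> = max (1 - d / 2) (3/4)"
  have \<tau>: "3/4 \<le> \<tau>" "\<tau> < 1" "1 - \<tau> < d" using d(1) by (auto simp: \<tau>_def)
  have near: "h (s, t) \<in> cball \<kappa> \<eta>" if "s \<in> {0..1}" "t \<in> {\<tau>..1}" for s t
  proof -
    have "dist (s, t) (s, 1) < d" using that \<tau> by (simp add: dist_Pair_Pair dist_real_def)
    then have "dist (h (s, t)) (h (s, 1)) < \<eta>" using that \<tau> by (intro d(2)) auto
    then show ?thesis using h1[OF that(1)] by (simp add: dist_commute)
  qed
  have cont: "continuous_on {0..1} (\<lambda>x. h (u x, v x))"
    if "continuous_on {0..1} u" "continuous_on {0..1} v" "\<And>x. x \<in> {0..1} \<Longrightarrow> u x \<in> {0..1}" "\<And>x. x \<in> {0..1} \<Longrightarrow> v x \<in> {0..1}"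
    for u v :: "real \<Rightarrow> real"
    by (rule continuous_on_compose2[OF h(1)]) (use that in \<open>auto intro!: continuous_intros\<close>)
  have unit: "u * x \<in> {0..<1}" if "0 \<le> u" "u < 1" "x \<in> {0..1}" for u x :: real
    using that mult_left_le[of x u] by (auto intro: le_less_trans)
  define g' where "g' = subpath 0 \<tau> g"
  define \<sigma> where "\<sigma> = (\<lambda>s. h (s, \<tau>))"
  have \<sigma>: "path \<sigma>" "path_image \<sigma> \<subseteq> cball \<kappa> \<eta> - K" "pathstart \<sigma> = g \<tau>" "pathfinish \<sigma> = \<gamma> \<tau>"
    using \<tau> cont[of "\<lambda>s. s" "\<lambda>_. \<tau>"] near[of _ \<tau>] h(2)[of \<tau>] h(3)[of \<tau>] h(6)[of _ \<tau>]
    by (auto simp: \<sigma>_def path_def path_image_def pathstart_def pathfinish_def)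
  have g': "path g'" "path_image g' \<subseteq> - K" "pathfinish g' = g \<tau>" "pathstart g' = pathstart g"
  proof -
    have "g' = (\<lambda>x. h (0, \<tau> * x))" by (simp add: g'_def subpath_def h(2))
    moreover have "\<tau> * x \<in> {0..<1}" if "x \<in> {0..1}" for x
      using that \<tau> by (intro unit) auto
    ultimately show "path g'" "path_image g' \<subseteq> - K"
      using cont[of "\<lambda>_. 0" "\<lambda>x. \<tau> * x"] h(6)[of 0] unfolding path_def path_image_def
      by (force intro: continuous_intros)+
  qed (simp_all add: g'_def subpath_def pathstart_def pathfinish_def)
  have "homotopic_paths (- K) (subpath 0 \<tau> \<gamma>)
    (linepath (pathstart g') (pathstart g') +++ g' +++ reversepath (\<lambda>s. h (1 - s, \<tau>)))"
  proof (rule homotopic_paths_square'[where f = "\<lambda>x. h (1 - fst x, \<tau> * snd x)"])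
    have \<tau>1: "\<tau> * x \<in> {0..<1}" if "x \<in> {0..1}" for x
      using that \<tau> by (intro unit) auto
    then show "continuous_on ({0..1} \<times> {0..1}) (\<lambda>x. h (1 - fst x, \<tau> * snd x))"
      by (intro continuous_on_compose2[OF h(1)]) (force intro!: continuous_intros)+
    show "h (1 - fst (s, t), \<tau> * snd (s, t)) \<in> - K" if "s \<in> {0..1}" "t \<in> {0..1}" for s t
      using h(6)[of "1 - s" "\<tau> * t"] \<tau>1[OF that(2)] that(1) by simp
  qed (use h(2-4) in \<open>simp_all add: subpath_def g'_def linepath_def pathstart_def algebra_simps\<close>)
  moreover have "reversepath (\<lambda>s. h (1 - s, \<tau>)) = \<sigma>" by (simp add: reversepath_def \<sigma>_def)
  moreover have "homotopic_paths (- K) (linepath (pathstart (g' +++ \<sigma>)) (pathstart (g' +++ \<sigma>)) +++ (g' +++ \<sigma>)) (g' +++ \<sigma>)"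
    using g' \<sigma> by (intro homotopic_paths_lid path_join_imp) (auto simp: path_image_join)
  ultimately have 1: "homotopic_paths (- K) (subpath 0 \<tau> \<gamma>) (g' +++ \<sigma>)"
    using homotopic_paths_trans by fastforce
  define e' where "e' = subpath 0 (2 * \<tau> - 1) e"
  define a where "a = 1 / (2 * \<tau>)"
  have a: "a \<in> {0..1}" "\<tau> * a = 1/2" using \<tau> by (auto simp: a_def)
  have e': "path e'" "path_image e' \<subseteq> cball c r - K" "pathstart e' = pathfinish G" "pathfinish e' = g \<tau>"
  proof -
    have im: "(2 * \<tau> - 1) * x \<in> {0..<1}" if "x \<in> {0..1}" for x
      using that \<tau> by (intro unit) auto
    show "path e'" unfolding e'_def using \<tau> e(1) by (intro path_subpath) auto
    show "path_image e' \<subseteq> cball c r - K"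
    proof
      fix y assume "y \<in> path_image e'"
      then obtain x where x: "x \<in> {0..1}" "y = e ((2 * \<tau> - 1) * x)" by (auto simp: path_image_def e'_def subpath_def)
      then have "y \<notin> K" "y \<in> path_image e" using im[OF x(1)] e(4) by (auto simp: path_image_def)
      then show "y \<in> cball c r - K" using e(3) by blast
    qed
    show "pathstart e' = pathfinish G" using e(2) by (simp add: e'_def pathstart_def subpath_def)
    show "pathfinish e' = g \<tau>" using \<tau> by (simp add: e'_def g_def joinpaths_def subpath_def pathfinish_def)
  qed
  have "homotopic_paths (- K) (subpath 0 a g' +++ subpath a 1 g') (subpath 0 1 g')"
    using g' a by (intro homotopic_join_subpaths) auto
  moreover have "homotopic_paths (- K) (subpath 0 a g' +++ subpath a 1 g') (G +++ e')"
  proof (rule homotopic_paths_eq)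
    show "path (subpath 0 a g' +++ subpath a 1 g')" "path_image (subpath 0 a g' +++ subpath a 1 g') \<subseteq> - K"
      using g' a path_image_subpath_subset[of 0 a g'] path_image_subpath_subset[of a 1 g']
      by (auto intro!: path_join_imp path_subpath simp: path_image_join)
    fix t :: real assume t: "t \<in> {0..1}"
    have l: "subpath 0 a g' x = G x" if "x \<in> {0..1}" for x
    proof -
      have "\<tau> * (a * x) = (\<tau> * a) * x" by simp
      then have *: "\<tau> * (a * x) = x / 2" unfolding a(2) by simp
      have "subpath 0 a g' x = g (\<tau> * (a * x))" by (simp add: subpath_def g'_def)
      also have "\<dots> = G x" unfolding * using that by (simp add: g_def joinpaths_def)
      finally show ?thesis .
    qed
    have r: "subpath a 1 g' x = e' x" if "x \<in> {0..1}" for x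
    proof -
      have "\<tau> * ((1 - a) * x + a) = \<tau> * a + (\<tau> - \<tau> * a) * x" by (simp add: algebra_simps)
      then have eq: "\<tau> * ((1 - a) * x + a) = 1/2 + (\<tau> - 1/2) * x" unfolding a(2) .
      have "subpath a 1 g' x = g (\<tau> * ((1 - a) * x + a))" by (simp add: subpath_def g'_def)
      also have "\<dots> = g (1/2 + (\<tau> - 1/2) * x)" unfolding eq ..
      also have "\<dots> = e' x"
      proof (cases "x = 0")
        case True
        then show ?thesis using e(2) by (simp add: subpath_def e'_def g_def joinpaths_def pathfinish_def pathstart_def)
      next
        case False
        then have "0 < (\<tau> - 1/2) * x" using that \<tau> by simp
        then show ?thesis by (simp add: subpath_def e'_def g_def joinpaths_def) (simp add: algebra_simps)
      qed
      finally show ?thesis .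
    qed
    show "(subpath 0 a g' +++ subpath a 1 g') t = (G +++ e') t"
      using l[of "2 * t"] r[of "2 * t - 1"] t by (auto simp: joinpaths_def)
  qed
  ultimately have "homotopic_paths (- K) g' (G +++ e')"
    using homotopic_paths_trans homotopic_paths_sym by (metis subpath_trivial)
  then have "homotopic_paths (- K) (g' +++ \<sigma>) ((G +++ e') +++ \<sigma>)"
    using \<sigma> g'(3) by (intro homotopic_paths_join_right) auto
  moreover have "path_image G \<subseteq> - K"
  proof
    fix y assume "y \<in> path_image G"
    then obtain x where "x \<in> {0..1}" "y = G x" by (auto simp: path_image_def)
    then have "y = h (0, x / 2)" by (simp add: h(2) g_def joinpaths_def)
    then show "y \<in> - K" using h(6)[of 0 "x / 2"] \<open>x \<in> {0..1}\<close> by simp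
  qed
  then have "homotopic_paths (- K) ((G +++ e') +++ \<sigma>) (G +++ (e' +++ \<sigma>))"
    using assms(2) e' \<sigma> \<kappa>(4) by (intro homotopic_paths_assoc[THEN homotopic_paths_sym]) auto
  ultimately have 2: "homotopic_paths (- K) (subpath 0 \<tau> \<gamma>) (G +++ (e' +++ \<sigma>))"
    using 1 homotopic_paths_trans by blast
  show ?thesis
  proof (rule that[of \<tau> "e' +++ \<sigma>"])
    show "0 < \<tau>" "\<tau> < 1" using \<tau> by auto
    show "\<gamma> ` {\<tau>..1} \<subseteq> cball \<kappa> \<eta>" using near[of 1] h(3) by auto
    show "\<gamma> \<tau> \<notin> K" using h(3)[of \<tau>] h(6)[of 1 \<tau>] \<tau> by simp
    show "path (e' +++ \<sigma>)" "pathstart (e' +++ \<sigma>) = pathfinish G" "pathfinish (e' +++ \<sigma>) = \<gamma> \<tau>"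
      using e' \<sigma> by auto
    show "path_image (e' +++ \<sigma>) \<subseteq> cball c r - K"
      using e' \<sigma> \<kappa>(4) by (auto simp: path_image_join)
  qed (rule 2)
qed

lemma winding_number_conj_path:
  assumes "path e" "path k" "pathfinish e = pathstart k" "pathfinish k = pathstart k"
    "\<kappa> \<notin> path_image e" "\<kappa> \<notin> path_image k"
  shows "winding_number (conj_path id e k) \<kappa> = winding_number k \<kappa>"
  using assms by (simp add: conj_path_def winding_number_join winding_number_reversepath not_in_path_image_join)

text \<open>
  The loop belonging to a path consists of the route and a loop in the disc at its end, about
  which only the winding numbers have to be remembered.
\<close>

lemma ends_near_loop:
  fixes G \<gamma> :: "real \<Rightarrow> complex"
  assumes "ends_near K G c r \<gamma>" "path G" and \<kappa>: "\<kappa> = pathfinish \<gamma>" "0 < \<eta>" "K \<inter> cball \<kappa> \<eta> = {\<kappa>}" "cball \<kappa> \<eta> \<subseteq> cball c r"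
  obtains \<tau> e l where "close_to_end K \<gamma> \<tau>" "\<gamma> ` {\<tau>..1} \<subseteq> cball \<kappa> \<eta>"
    "path e" "pathstart e = pathfinish G" "pathfinish e = \<gamma> \<tau>" "path_image e \<subseteq> cball c r - K"
    "homotopic_paths (- K) (subpath 0 \<tau> \<gamma>) (G +++ e)"
    "path l" "pathstart l = pathfinish G" "pathfinish l = pathfinish G" "path_image l \<subseteq> cball c r - K"
    "winding_number l \<kappa> = 1" "\<And>\<kappa>'. \<kappa>' \<in> K \<Longrightarrow> \<kappa>' \<noteq> \<kappa> \<Longrightarrow> winding_number l \<kappa>' = 0"
    "homotopic_paths (- K) (loop_around \<gamma> \<tau>) (conj_path id G l)"
proof -
  obtain \<tau> e where \<tau>: "0 < \<tau>" "\<tau> < 1" "\<gamma> ` {\<tau>..1} \<subseteq> cball \<kappa> \<eta>" "\<gamma> \<tau> \<notin> K"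
    and e: "path e" "pathstart e = pathfinish G" "pathfinish e = \<gamma> \<tau>" "path_image e \<subseteq> cball c r - K"
    and hom: "homotopic_paths (- K) (subpath 0 \<tau> \<gamma>) (G +++ e)" by (rule ends_near_initial_piece[OF assms])
  define k where "k t = \<kappa> + (\<gamma> \<tau> - \<kappa>) * cis (2 * pi * t)" for t
  have "\<gamma> \<tau> \<noteq> \<kappa>" "norm (\<gamma> \<tau> - \<kappa>) \<le> \<eta>" using \<tau> \<kappa>(3) by (auto simp: dist_norm norm_minus_commute image_subset_iff)
  have kp: "path k" unfolding path_def k_def by (intro continuous_intros)
  have kends: "pathstart k = \<gamma> \<tau>" "pathfinish k = \<gamma> \<tau>" by (simp_all add: k_def pathstart_def pathfinish_def)
  have "norm (k t - \<kappa>) = norm (\<gamma> \<tau> - \<kappa>)" for t by (simp add: k_def norm_mult)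
  then have kim: "k t \<in> cball \<kappa> \<eta> - {\<kappa>}" for t
    using \<open>\<gamma> \<tau> \<noteq> \<kappa>\<close> \<open>norm (\<gamma> \<tau> - \<kappa>) \<le> \<eta>\<close> by (auto simp: dist_norm norm_minus_commute) (metis norm_eq_zero right_minus_eq)
  then have kim': "path_image k \<subseteq> cball \<kappa> \<eta> - {\<kappa>}" by (auto simp: path_image_def)
  then have kK: "path_image k \<subseteq> cball c r - K" using \<kappa>(3,4) by blast
  have wk: "winding_number k \<kappa> = 1" unfolding k_def using \<open>\<gamma> \<tau> \<noteq> \<kappa>\<close> by (intro winding_number_turn) simp
  have wk': "winding_number k \<kappa>' = 0" if "\<kappa>' \<in> K" "\<kappa>' \<noteq> \<kappa>" for \<kappa>'
    using kp kends kim' that \<kappa>(3) by (intro winding_number_zero_outside[OF _ convex_cball]) auto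
  define l where "l = conj_path id e k"
  have l: "path l" "pathstart l = pathfinish G" "pathfinish l = pathfinish G" "path_image l \<subseteq> cball c r - K"
    using e kp kends kK by (auto simp: l_def conj_path_def path_image_join)
  have Gim: "path_image G \<subseteq> - K" "path_image e \<subseteq> - K"
    using homotopic_paths_imp_subset[OF hom] e assms(2) by (auto simp: path_image_join)
  have "loop_around \<gamma> \<tau> = conj_path id (subpath 0 \<tau> \<gamma>) k"
    by (simp add: loop_around_def conj_path_def k_def[abs_def] \<kappa>(1) reversepath_subpath)
  moreover have "homotopic_paths (- K) (conj_path id (subpath 0 \<tau> \<gamma>) k) (conj_path id (G +++ e) k)"
    using hom kp kK kends by (intro homotopic_conj_path) auto
  moreover have "homotopic_paths (- K) (conj_path id G l) (conj_path id (G +++ e) k)"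
    unfolding l_def using assms(2) e kp kK kends Gim by (intro conj_path_conj_path) auto
  ultimately have "homotopic_paths (- K) (loop_around \<gamma> \<tau>) (conj_path id G l)"
    using homotopic_paths_sym homotopic_paths_trans by metis
  moreover have "close_to_end K \<gamma> \<tau>" unfolding close_to_end_def using \<tau> \<kappa>(1,3) by auto
  moreover have "\<kappa> \<in> K" using \<kappa>(3) by blast
  moreover have "\<kappa>' \<notin> path_image e" "\<kappa>' \<notin> path_image k" if "\<kappa>' \<in> K" for \<kappa>' using that e(4) kK by auto
  then have "winding_number l \<kappa>' = winding_number k \<kappa>'" if "\<kappa>' \<in> K" for \<kappa>'
    unfolding l_def using that e kp kends by (intro winding_number_conj_path) auto
  then have "winding_number l \<kappa> = 1" "\<And>\<kappa>'. \<kappa>' \<in> K \<Longrightarrow> \<kappa>' \<noteq> \<kappa> \<Longrightarrow> winding_number l \<kappa>' = 0"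
    using wk wk' \<open>\<kappa> \<in> K\<close> by simp_all
  ultimately show ?thesis using that \<tau> e l hom by blast
qed

section \<open>From a loop near the end of a route to its braid\<close>

lemma deform_eq: "deform x p t = (linepath (1, 0) p t, x)"
  by (simp add: deform_def linepath_def scaleR_left_distrib[symmetric])

lemma deform_simps: "path (deform x p)" "pathstart (deform x p) = ((1, 0), x)" "pathfinish (deform x p) = (p, x)"
  "path_image (deform x p) = closed_segment (1, 0) p \<times> {x}"
proof -
  have gen: "(\<lambda>q. (q, x)) ` A = A \<times> {x}" for A :: "(complex \<times> complex) set" by auto
  have "path_image (deform x p) = (\<lambda>q. (q, x)) ` (linepath (1, 0) p ` {0..1})"
    unfolding path_image_def image_image deform_eq ..
  then show "path_image (deform x p) = closed_segment (1, 0) p \<times> {x}"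
    unfolding linepath_image_01 by (simp only: gen)
qed (simp_all add: deform_def)

lemma conj_path_Pair:
  "(\<lambda>t. (p, conj_path id g k t)) = conj_path id (\<lambda>t. (p, g t)) (\<lambda>t. (p, k t))"
  by (auto simp: conj_path_def joinpaths_def reversepath_def)

lemma path_PairI: "path g \<Longrightarrow> path (\<lambda>t. (q, g t))"
  unfolding path_def by (intro continuous_intros)

lemma pathstart_Pair: "pathstart (\<lambda>t. (q, g t)) = (q, pathstart g)" "pathfinish (\<lambda>t. (q, g t)) = (q, pathfinish g)"
  "path_image (\<lambda>t. (q, g t)) = {q} \<times> path_image g"
  by (auto simp: pathstart_def pathfinish_def path_image_def)

lemma homotopic_paths_at_projection:
  assumes "p \<in> slanted" "homotopic_paths (- critical_values deltoid p) g h"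
  shows "homotopic_paths regular (\<lambda>t. (p, g t)) (\<lambda>t. (p, h t))"
proof -
  have "Pair p \<in> - critical_values deltoid p \<rightarrow> regular"
    using regular_iff_not_critical[OF assms(1)] by auto
  from homotopic_paths_continuous_image[OF assms(2) _ this]
  show ?thesis by (simp add: o_def continuous_intros)
qed

lemma projection_path_square:
  fixes G :: "real \<Rightarrow> complex"
  assumes "path G"
  shows "continuous_on ({0..1} \<times> {0..1}) (\<lambda>x. (linepath (1, 0) p (fst x), G (snd x)))"
    "\<And>s t. s \<in> {0..1} \<Longrightarrow> t \<in> {0..1} \<Longrightarrow> linepath (1, 0) p s \<in> closed_segment (1, 0) p \<and> G t \<in> path_image G"
proof -
  have "continuous_on ({0..1} \<times> {0..1}) (\<lambda>x :: real \<times> real. G (snd x))"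
    by (rule continuous_on_compose2[OF assms[unfolded path_def] continuous_on_snd[OF continuous_on_id]]) force
  moreover have "continuous_on ({0..1} \<times> {0..1}) (\<lambda>x :: real \<times> real. linepath (1, 0) p (fst x))"
    by (rule continuous_on_compose2[OF continuous_on_linepath[of UNIV] continuous_on_fst[OF continuous_on_id]]) simp
  ultimately show "continuous_on ({0..1} \<times> {0..1}) (\<lambda>x. (linepath (1, 0) p (fst x), G (snd x)))"
    by (intro continuous_on_Pair)
qed (simp add: linepath_in_path path_image_def)

text \<open>
  Both paths are images of paths in the square, the product of the segment of projections with
  the time interval of \<open>G\<close>.
\<close>

lemma deform_along_path:
  assumes "path G" and reg: "closed_segment (1, 0) p \<times> path_image G \<subseteq> regular"
  shows "homotopic_paths regular (deform (pathstart G) p +++ (\<lambda>t. (p, G t))) ((\<lambda>t. ((1, 0), G t)) +++ deform (pathfinish G) p)"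
proof -
  let ?Q = "{0..1} \<times> {0..1} :: (real \<times> real) set"
  let ?f = "\<lambda>x. (linepath (1, 0) p (fst x), G (snd x))"
  let ?u = "linepath (0, 0) (1, 0) +++ linepath (1, 0) (1, 1) :: real \<Rightarrow> real \<times> real"
  let ?v = "linepath (0, 0) (0, 1) +++ linepath (0, 1) (1, 1) :: real \<Rightarrow> real \<times> real"
  have Q: "convex ?Q" by (intro convex_Times convex_real_interval)
  have seg: "closed_segment a b \<subseteq> ?Q" if "a \<in> ?Q" "b \<in> ?Q" for a b
    using that Q by (rule closed_segment_subset)
  have "homotopic_paths ?Q ?u ?v"
    by (rule homotopic_paths_through_convex[OF Q])
      (use seg[of "(0, 0)" "(1, 0)"] seg[of "(1, 0)" "(1, 1)"] seg[of "(0, 0)" "(0, 1)"] seg[of "(0, 1)" "(1, 1)"]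
        in \<open>simp_all add: path_image_join\<close>)
  moreover have "continuous_on ?Q ?f" by (rule projection_path_square(1)[OF assms(1)])
  moreover have "?f \<in> ?Q \<rightarrow> regular"
  proof (rule funcsetI)
    fix x assume "x \<in> ?Q"
    then have "?f x \<in> closed_segment (1, 0) p \<times> path_image G"
      using projection_path_square(2)[OF assms(1), of "fst x" "snd x" p] by (simp only: mem_Times_iff fst_conv snd_conv simp_thms)
    then show "?f x \<in> regular" using reg by blast
  qed
  ultimately have "homotopic_paths regular (?f \<circ> ?u) (?f \<circ> ?v)" by (rule homotopic_paths_continuous_image)
  moreover have "?f \<circ> ?u = deform (pathstart G) p +++ (\<lambda>t. (p, G t))"
    by (simp add: path_compose_join) (simp add: fun_eq_iff joinpaths_def deform_eq linepath_def pathstart_def o_def zero_prod_def)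
  moreover have "?f \<circ> ?v = (\<lambda>t. ((1, 0), G t)) +++ deform (pathfinish G) p"
    by (simp add: path_compose_join) (simp add: fun_eq_iff joinpaths_def deform_eq linepath_def pathfinish_def o_def zero_prod_def)
  ultimately show ?thesis by simp
qed

text \<open>Instead of at the base point, the projection may be changed at the end of the route.\<close>

lemma deform_at_end:
  assumes p: "p \<in> slanted" and G: "path G" "closed_segment (1, 0) p \<times> path_image G \<subseteq> regular"
    and l: "path l" "pathstart l = pathfinish G" "pathfinish l = pathfinish G" "path_image l \<subseteq> - critical_values deltoid p"
  shows "homotopic_paths regular
    (conj_path id (deform (pathstart G) p) (\<lambda>t. (p, conj_path id G l t)))
    (conj_path id (\<lambda>t. ((1, 0), G t)) (conj_path id (deform (pathfinish G) p) (\<lambda>t. (p, l t))))"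
proof -
  let ?a = "deform (pathstart G) p" and ?b = "\<lambda>t. (p, G t)" and ?c = "\<lambda>t. ((1, 0), G t)"
    and ?d = "deform (pathfinish G) p" and ?k = "\<lambda>t. (p, l t)"
  have k: "path ?k" "path_image ?k \<subseteq> regular"
    using l p regular_iff_not_critical[OF p] by (auto simp: path_PairI pathstart_Pair)
  have ends: "pathstart G \<in> path_image G" "pathfinish G \<in> path_image G" by auto
  have im: "path_image ?a \<subseteq> regular" "path_image ?d \<subseteq> regular" "path_image ?b \<subseteq> regular" "path_image ?c \<subseteq> regular"
    using G(2) ends by (auto simp: deform_simps pathstart_Pair)
  have 1: "homotopic_paths regular (conj_path id ?a (conj_path id ?b ?k)) (conj_path id (?a +++ ?b) ?k)"
    using im k l G(1) by (intro conj_path_conj_path) (simp_all add: deform_simps pathstart_Pair path_PairI)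
  have 2: "homotopic_paths regular (conj_path id (?a +++ ?b) ?k) (conj_path id (?c +++ ?d) ?k)"
    using k l G(1) by (intro homotopic_conj_path deform_along_path[OF G]) (simp_all add: deform_simps pathstart_Pair path_PairI)
  have 3: "homotopic_paths regular (conj_path id ?c (conj_path id ?d ?k)) (conj_path id (?c +++ ?d) ?k)"
    using im k l G(1) by (intro conj_path_conj_path) (simp_all add: deform_simps pathstart_Pair path_PairI)
  show ?thesis
    unfolding conj_path_Pair
    by (rule homotopic_paths_trans[OF homotopic_paths_trans[OF 1 2] homotopic_paths_sym[OF 3]])
qed

lemma follows_swap: "follows E s z \<Longrightarrow> follows E (id \<circ> s) (swap_labels i j \<circ> z)"
  by (auto simp: follows_def enumerates_swap_labels intro!: path_continuous_image continuous_on_swap_labels)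

lemma follows_conj_path:
  assumes "follows E w W" "follows E k Z" "pathfinish W = pathstart Z" "pathfinish Z = swap_labels i j (pathfinish W)"
  shows "follows E (conj_path id w k) (conj_path (swap_labels i j) W Z)"
  unfolding conj_path_def using assms
  by (intro follows_join follows_reverse follows_swap) (simp_all add: pathfinish_compose)

lemma follows_path: "follows E s z \<Longrightarrow> path z"
  by (simp add: follows_def)

text \<open>
  The braid is obtained by carrying the ordered fibre along the route for the projection to
  \<open>x\<close>, and changing the projection only at the end of the route.
\<close>

lemma monodromy_of_local_loop:
  fixes W k k' h :: "real \<Rightarrow> complex ^ point_name"
  assumes p: "p \<in> slanted" and G: "path G" "closed_segment (1, 0) p \<times> path_image G \<subseteq> regular"
    and W: "follows (fibre deltoid) (\<lambda>t. ((1, 0), G t)) W"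
    and \<gamma>: "close_to_end (critical_values deltoid p) \<gamma> \<tau>"
      "homotopic_paths (- critical_values deltoid p) (loop_around \<gamma> \<tau>) (conj_path id G l)"
    and l: "path l" "pathstart l = pathfinish G" "pathfinish l = pathfinish G" "path_image l \<subseteq> - critical_values deltoid p"
    and k': "follows (fibre deltoid) (conj_path id (deform (pathfinish G) p) (\<lambda>t. (p, l t))) k'" "pathstart k' = pathfinish W"
    and k: "homotopic_paths config k' k" "pathfinish k = swap_labels i j (pathfinish W)"
    and h: "homotopic_paths config (conj_path (swap_labels i j) W k) h"
  shows "monodromy_braid deltoid p (pathstart G) (pathstart W) \<gamma> h"
proof -
  let ?s = "conj_path id (deform (pathstart G) p) (\<lambda>t. (p, loop_around \<gamma> \<tau> t))"
  let ?s' = "conj_path id (\<lambda>t. ((1, 0), G t)) (conj_path id (deform (pathfinish G) p) (\<lambda>t. (p, l t)))"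
  have ends: "pathstart G \<in> path_image G" by auto
  have *: "homotopic_paths regular (\<lambda>t. (p, loop_around \<gamma> \<tau> t)) (\<lambda>t. (p, conj_path id G l t))"
    by (rule homotopic_paths_at_projection[OF p \<gamma>(2)])
  have "pathstart (conj_path id G l) = pathstart G" "pathfinish (conj_path id G l) = pathstart G"
    by (simp_all add: conj_path_def)
  then have st: "pathstart (loop_around \<gamma> \<tau>) = pathstart G" "pathfinish (loop_around \<gamma> \<tau>) = pathstart G"
    using homotopic_paths_imp_pathstart[OF \<gamma>(2)] homotopic_paths_imp_pathfinish[OF \<gamma>(2)] by simp_all
  have "homotopic_paths regular (deform (pathstart G) p) (deform (pathstart G) p)"
    using G(2) ends by (subst homotopic_paths_refl) (auto simp: deform_simps)
  then have "homotopic_paths regular ?s (conj_path id (deform (pathstart G) p) (\<lambda>t. (p, conj_path id G l t)))"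
    using st by (intro homotopic_conj_path[OF _ *]) (simp_all add: deform_simps pathstart_Pair)
  then have hom: "homotopic_paths regular ?s ?s'"
    using deform_at_end[OF p G l] by (rule homotopic_paths_trans)
  have mv: "moving_set CARD(point_name) regular (fibre deltoid)" by (simp add: card_point_name moving_regular)
  have "pathstart ?s = ((1, 0), pathstart G)" by (simp add: conj_path_def deform_simps)
  moreover have "enumerates (pathstart W) (fibre deltoid ((1, 0), pathstart G))"
    using W by (simp add: follows_def pathstart_def)
  ultimately obtain z where z: "follows (fibre deltoid) ?s z" "pathstart z = pathstart W"
    using follows_exists[OF mv homotopic_paths_imp_path[OF hom, THEN conjunct1] homotopic_paths_imp_subset[OF hom, THEN conjunct1]] by metis
  have pk: "pathfinish k' = swap_labels i j (pathfinish W)"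
    using homotopic_paths_imp_pathfinish[OF k(1)] k(2) by simp
  have "follows (fibre deltoid) ?s' (conj_path (swap_labels i j) W k')"
    using W k' pk by (intro follows_conj_path) simp_all
  from follows_homotopic[OF mv hom z(1) this]
  have 1: "homotopic_paths config z (conj_path (swap_labels i j) W k')"
    using z(2) by (simp add: conj_path_def)
  have W1: "homotopic_paths config W W"
    using follows_path[OF W] follows_path_image_config[OF W] by simp
  have 2: "homotopic_paths config (conj_path (swap_labels i j) W k') (conj_path (swap_labels i j) W k)"
    using W1 k(1) pk k'(2) by (intro homotopic_conj_path continuous_on_swap_labels swap_labels_maps) simp_all
  have 3: "homotopic_paths config z h" by (rule homotopic_paths_trans[OF homotopic_paths_trans[OF 1 2] h])
  have s: "?s = deform (pathstart G) p +++ (\<lambda>t. (p, loop_around \<gamma> \<tau> t)) +++ reversepath (deform (pathstart G) p)"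
    by (simp add: conj_path_def)
  show ?thesis
    unfolding monodromy_braid_def follows_fibres_def
    by (rule exI, rule exI, rule conjI[OF \<gamma>(1) conjI[OF z(2) conjI[OF z(1)[unfolded s follows_def] 3]]])
qed

section \<open>The tangency and the cusp at the origin\<close>

lemma follows_upper_branches:
  assumes "path g" "path_image g \<subseteq> upper"
  shows "follows (fibre deltoid) (\<lambda>t. ((1, 0), g t)) (conf \<circ> (upper_branches \<circ> g))"
proof -
  have "path (conf \<circ> (upper_branches \<circ> g))"
    using upper_to_log_config(1)[OF assms] continuous_on_conf[of "{0..1}" "upper_branches \<circ> g"]
    by (simp add: path_def o_def)
  moreover have "g t \<in> upper" if "t \<in> {0..1}" for t using assms(2) that by (auto simp: path_image_def)
  ultimately show ?thesis unfolding follows_def o_def by (auto intro: enumerates_upper)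
qed

lemma segment_near_x:
  fixes p q :: "complex \<times> complex"
  assumes "dist p (1, 0) < \<delta>" "q \<in> closed_segment (1, 0) p"
  shows "dist q (1, 0) < \<delta>"
proof -
  have "closed_segment (1, 0) p \<subseteq> ball (1, 0) \<delta>"
    using assms(1) zero_le_dist[of p "(1, 0)"] by (intro closed_segment_subset convex_ball) (simp_all add: dist_commute del: zero_le_dist)
  then show ?thesis using assms(2) by (auto simp: dist_commute)
qed

text \<open>
  The only critical value in the disc lies in its inner part, so the loop may be deformed in the
  disc to the circle through \<open>x1\<close>, along which the projection may be changed back to \<open>x\<close>.
\<close>

lemma simple_monodromy:
  fixes b r :: real and h Z :: "real \<Rightarrow> complex ^ point_name"
  assumes G: "path G" "path_image G \<subseteq> upper" "pathstart G = of_real b"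
    and seg: "closed_segment (pathfinish G) x1 \<subseteq> upper" "closed_segment (pathfinish G) x1 \<subseteq> cball c r - ball c (dist x1 c)"
    and x1: "0 < dist x1 c" "dist x1 c \<le> r" "0 \<notin> cball c r - ball c (dist x1 c / 2)"
      "-1 \<notin> cball c r - ball c (dist x1 c / 2)" "-9/8 \<notin> cball c r - ball c (dist x1 c / 2)"
    and Z: "follows (fibre deltoid) (\<lambda>t. ((1, 0), c + (x1 - c) * cis (2 * pi * t))) Z"
      "pathstart Z = conf (upper_branches x1)" "pathfinish Z = swap_labels i j (conf (upper_branches x1))"
    and h: "\<And>g. path g \<Longrightarrow> path_image g \<subseteq> upper \<Longrightarrow> pathstart g = of_real b \<Longrightarrow> pathfinish g = x1 \<Longrightarrow>
      homotopic_paths config (conj_path (swap_labels i j) (conf \<circ> (upper_branches \<circ> g)) Z) h"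
  shows "\<exists>\<delta>>0. \<forall>p \<gamma>. dist p (1, 0) < \<delta> \<longrightarrow> ends_near (critical_values deltoid p) G c r \<gamma> \<longrightarrow>
    critical_values deltoid p \<inter> cball c r = {pathfinish \<gamma>} \<longrightarrow>
    monodromy_braid deltoid p (of_real b) (conf (upper_branches (of_real b))) \<gamma> h"
proof -
  define \<rho> where "\<rho> = dist x1 c"
  let ?A = "cball c r - ball c (\<rho> / 2)"
  have "compact (path_image G \<union> ?A)" using G(1) by (intro compact_Un compact_path_image compact_diff) auto
  moreover have "0 \<notin> path_image G" "-1 \<notin> path_image G" "-9/8 \<notin> path_image G"
    using G(2) by (auto simp: upper_def)
  ultimately obtain \<delta> where \<delta>: "\<delta> > 0" "\<And>p x. dist p (1, 0) < \<delta> \<Longrightarrow> x \<in> path_image G \<union> ?A \<Longrightarrow> (p, x) \<in> regular"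
    using regular_near_x[of "path_image G \<union> ?A"] x1(3-5) unfolding \<rho>_def by (metis Un_iff)
  show ?thesis
  proof (intro exI[of _ \<delta>] conjI \<delta>(1) allI impI)
    fix p \<gamma> assume p: "dist p (1, 0) < \<delta>" and near: "ends_near (critical_values deltoid p) G c r \<gamma>"
      and K: "critical_values deltoid p \<inter> cball c r = {pathfinish \<gamma>}"
    let ?K = "critical_values deltoid p"
    define \<kappa> where "\<kappa> = pathfinish \<gamma>"
    have reg: "(q, x) \<in> regular" if "q \<in> closed_segment (1, 0) p" "x \<in> path_image G \<union> ?A" for q x
      using \<delta>(2)[OF segment_near_x[OF p that(1)] that(2)] .
    have "(p, pathfinish G) \<in> regular" by (intro reg) auto
    then have sl: "p \<in> slanted" by (simp add: regular_def)
    have \<kappa>K: "\<kappa> \<in> ?K" "\<kappa> \<in> cball c r" using K by (auto simp: \<kappa>_def)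
    then have "\<kappa> \<notin> ?A" using reg[of p \<kappa>] regular_iff_not_critical[OF sl] by auto
    then have \<kappa>: "dist c \<kappa> < \<rho> / 2" using \<kappa>K(2) by simp
    have sub: "cball \<kappa> (\<rho> / 2) \<subseteq> cball c r"
    proof
      fix x assume "x \<in> cball \<kappa> (\<rho> / 2)"
      then show "x \<in> cball c r" using \<kappa> x1(2) dist_triangle[of c x \<kappa>] by (simp add: \<rho>_def)
    qed
    have K': "?K \<inter> cball \<kappa> (\<rho> / 2) = {\<kappa>}" using sub K \<kappa>K x1(1) by (auto simp: \<kappa>_def \<rho>_def)
    obtain \<tau> e l where \<gamma>: "close_to_end ?K \<gamma> \<tau>" "homotopic_paths (- ?K) (loop_around \<gamma> \<tau>) (conj_path id G l)"
      and l: "path l" "pathstart l = pathfinish G" "pathfinish l = pathfinish G" "path_image l \<subseteq> cball c r - ?K" "winding_number l \<kappa> = 1"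
      by (rule ends_near_loop[OF near G(1) \<kappa>_def _ K' sub]) (use x1(1) in \<open>simp add: \<rho>_def\<close>, rule that, assumption+)
    define T where "T = (\<lambda>t. c + (x1 - c) * cis (2 * pi * t))"
    define w where "w = linepath (pathfinish G) x1"
    have T: "path T" "pathstart T = x1" "pathfinish T = x1" "path_image T \<subseteq> sphere c \<rho>"
      unfolding T_def path_def
      by (auto intro!: continuous_intros simp: pathstart_def pathfinish_def path_image_def dist_norm norm_mult \<rho>_def norm_minus_commute)
    have w: "path w" "path_image w \<subseteq> cball c r - ball c \<rho>" "path_image w \<subseteq> upper" "pathstart w = pathfinish G" "pathfinish w = x1"
      using seg by (simp_all add: w_def \<rho>_def)
    define l' where "l' = conj_path id w T"
    have l': "path l'" "pathstart l' = pathfinish G" "pathfinish l' = pathfinish G" "path_image l' \<subseteq> cball c r - ball c \<rho>"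
      using w T x1(1,2) by (auto simp: l'_def conj_path_def path_image_join \<rho>_def)
    have \<rho>: "0 < \<rho>" "\<rho> \<le> r" using x1(1,2) by (simp_all add: \<rho>_def)
    have sub': "cball c r - ball c \<rho> \<subseteq> ?A" "sphere c \<rho> \<subseteq> cball c r - ball c \<rho>" using \<rho> by auto
    have "\<kappa> \<notin> cball c r - ball c \<rho>" using \<kappa> \<rho> by auto
    then have \<kappa>n: "\<kappa> \<notin> path_image w" "\<kappa> \<notin> path_image T" "\<kappa> \<notin> path_image l'" using w(2) T(4) l'(4) sub'(2) by blast+
    have "winding_number T \<kappa> = 1"
      unfolding T_def using \<kappa> \<rho>(1) norm_minus_commute[of c \<kappa>]
      by (intro winding_number_turn) (unfold \<rho>_def dist_norm, linarith)
    then have wl': "winding_number l' \<kappa> = 1"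
      unfolding l'_def using w T \<kappa>n by (subst winding_number_conj_path) auto
    have "homotopic_paths (cball c r - {\<kappa>}) l l'"
    proof (rule loops_homotopic_in_disc)
      show "\<kappa> \<in> ball c r" using \<kappa> \<rho> by simp
      show "path_image l \<subseteq> cball c r - {\<kappa>}" using l(4) \<kappa>K(1) by blast
      show "path_image l' \<subseteq> cball c r - {\<kappa>}" using l'(4) \<kappa>n(3) by blast
    qed (use l l' wl' in simp_all)
    then have "homotopic_paths (- ?K) l l'"
      by (rule homotopic_paths_subset) (use K in \<open>auto simp: \<kappa>_def\<close>)
    then have 1: "homotopic_paths regular (\<lambda>t. (p, l t)) (\<lambda>t. (p, l' t))" by (rule homotopic_paths_at_projection[OF sl])
    have start: "(q, pathfinish G) \<in> regular" if "q \<in> closed_segment (1, 0) p" for q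
      using that by (intro reg) auto
    have dref: "homotopic_paths regular (deform (pathfinish G) p) (deform (pathfinish G) p)"
      using start by (subst homotopic_paths_refl) (auto simp: deform_simps)
    have 2: "homotopic_paths regular (conj_path id (deform (pathfinish G) p) (\<lambda>t. (p, l t))) (conj_path id (deform (pathfinish G) p) (\<lambda>t. (p, l' t)))"
      by (rule homotopic_conj_path[OF dref 1]) (use l in \<open>simp_all add: deform_simps pathstart_Pair\<close>)
    have 3: "homotopic_paths regular (\<lambda>t. ((1, 0), l' t)) (deform (pathfinish G) p +++ (\<lambda>t. (p, l' t)) +++ reversepath (deform (pathfinish G) p))"
    proof (rule homotopic_paths_square'[where f = "\<lambda>x. (linepath (1, 0) p (fst x), l' (snd x))"])
      show "continuous_on ({0..1} \<times> {0..1}) (\<lambda>x. (linepath (1, 0) p (fst x), l' (snd x)))"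
        by (rule projection_path_square(1)[OF l'(1)])
      show "(linepath (1, 0) p (fst (s, t)), l' (snd (s, t))) \<in> regular" if "s \<in> {0..1}" "t \<in> {0..1}" for s t
      proof (rule reg)
        show "linepath (1, 0) p (fst (s, t)) \<in> closed_segment (1, 0) p" using projection_path_square(2)[OF l'(1) that, of p] by simp
        have "l' t \<in> path_image l'" using that by (simp add: path_image_def)
        then show "l' (snd (s, t)) \<in> path_image G \<union> ?A" using l'(4) sub'(1) by auto
      qed
    qed (use l'(2,3) in \<open>simp_all add: deform_eq linepath_def pathstart_def pathfinish_def zero_prod_def\<close>)
    have 3: "homotopic_paths regular (\<lambda>t. ((1, 0), l' t)) (conj_path id (deform (pathfinish G) p) (\<lambda>t. (p, l' t)))"
      using 3 by (simp add: conj_path_def)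
    have hom: "homotopic_paths regular (conj_path id (deform (pathfinish G) p) (\<lambda>t. (p, l t))) (\<lambda>t. ((1, 0), l' t))"
      by (rule homotopic_paths_trans[OF 2 homotopic_paths_sym[OF 3]])
    let ?w = "conf \<circ> (upper_branches \<circ> w)" and ?W = "conf \<circ> (upper_branches \<circ> G)"
    have W: "follows (fibre deltoid) (\<lambda>t. ((1, 0), G t)) ?W" "follows (fibre deltoid) (\<lambda>t. ((1, 0), w t)) ?w"
      using G w by (simp_all add: follows_upper_branches)
    have We: "pathstart ?W = conf (upper_branches (of_real b))" "pathfinish ?W = conf (upper_branches (pathfinish G))"
      "pathstart ?w = conf (upper_branches (pathfinish G))" "pathfinish ?w = conf (upper_branches x1)"
      using G(3) w by (simp_all add: pathstart_compose pathfinish_compose)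
    define k where "k = conj_path (swap_labels i j) ?w Z"
    have k: "follows (fibre deltoid) (\<lambda>t. ((1, 0), l' t)) k"
      unfolding k_def l'_def conj_path_Pair by (intro follows_conj_path W) (use Z We in \<open>simp_all add: T_def\<close>)
    have kends: "pathstart k = pathfinish ?W" "pathfinish k = swap_labels i j (pathfinish ?W)"
      using We by (simp_all add: k_def conj_path_def pathstart_compose pathfinish_compose)
    have mv: "moving_set CARD(point_name) regular (fibre deltoid)" by (simp add: card_point_name moving_regular)
    have "enumerates (pathfinish ?W) (fibre deltoid (pathstart (conj_path id (deform (pathfinish G) p) (\<lambda>t. (p, l t)))))"
      using W(1) by (simp add: conj_path_def deform_simps follows_def pathfinish_def)
    then obtain k' where k': "follows (fibre deltoid) (conj_path id (deform (pathfinish G) p) (\<lambda>t. (p, l t))) k'" "pathstart k' = pathfinish ?W"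
      using follows_exists[OF mv homotopic_paths_imp_path[OF hom, THEN conjunct1] homotopic_paths_imp_subset[OF hom, THEN conjunct1]] by metis
    have kk: "homotopic_paths config k' k"
      using follows_homotopic[OF mv hom k'(1) k] k'(2) kends(1) by simp
    have Ww: "?W +++ ?w = conf \<circ> (upper_branches \<circ> (G +++ w))" by (simp add: path_compose_join)
    have 4: "homotopic_paths config (conj_path (swap_labels i j) ?W k) (conj_path (swap_labels i j) (?W +++ ?w) Z)"
      unfolding k_def
      by (intro conj_path_conj_path continuous_on_swap_labels swap_labels_maps)
        (use We Z(2,3) W[THEN follows_path] W[THEN follows_path_image_config] Z(1)[THEN follows_path] Z(1)[THEN follows_path_image_config]
          in \<open>simp_all only:\<close>)
    have 5: "homotopic_paths config (conj_path (swap_labels i j) (conf \<circ> (upper_branches \<circ> (G +++ w))) Z) h"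
      using G w by (intro h) (auto simp: path_image_join)
    have 6: "homotopic_paths config (conj_path (swap_labels i j) ?W k) h"
      by (rule homotopic_paths_trans[OF 4 5[folded Ww]])
    have 7: "closed_segment (1, 0) p \<times> path_image G \<subseteq> regular" using reg by auto
    have 8: "path_image l \<subseteq> - ?K" using l(4) by blast
    have "monodromy_braid deltoid p (pathstart G) (pathstart ?W) \<gamma> h"
      by (rule monodromy_of_local_loop[OF sl G(1) 7 W(1) \<gamma> l(1-3) 8 k' kk kends(2) 6])
    then show "monodromy_braid deltoid p (of_real b) (conf (upper_branches (of_real b))) \<gamma> h"
      unfolding G(3) We(1) .
  qed
qed

section \<open>The two cusps near the projection's critical value -9/8\<close>

lemma homotopic_paths_pair:
  assumes "homotopic_paths A f f'" "homotopic_paths B g g'"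
  shows "homotopic_paths (A \<times> B) (\<lambda>t. (f t, g t)) (\<lambda>t. (f' t, g' t))"
proof -
  obtain h :: "real \<times> real \<Rightarrow> _" where h: "continuous_on ({0..1} \<times> {0..1}) h" "h \<in> {0..1} \<times> {0..1} \<rightarrow> A"
    "\<forall>x\<in>{0..1}. h (0, x) = f x" "\<forall>x\<in>{0..1}. h (1, x) = f' x"
    "\<forall>t\<in>{0..1}. pathstart (h \<circ> Pair t) = pathstart f \<and> pathfinish (h \<circ> Pair t) = pathfinish f"
    using assms(1) unfolding homotopic_paths by blast
  obtain k :: "real \<times> real \<Rightarrow> _" where k: "continuous_on ({0..1} \<times> {0..1}) k" "k \<in> {0..1} \<times> {0..1} \<rightarrow> B"
    "\<forall>x\<in>{0..1}. k (0, x) = g x" "\<forall>x\<in>{0..1}. k (1, x) = g' x"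
    "\<forall>t\<in>{0..1}. pathstart (k \<circ> Pair t) = pathstart g \<and> pathfinish (k \<circ> Pair t) = pathfinish g"
    using assms(2) unfolding homotopic_paths by blast
  show ?thesis
    unfolding homotopic_paths
    by (intro exI[of _ "\<lambda>x. (h x, k x)"] conjI continuous_on_Pair h(1) k(1))
      (use h(2-) k(2-) in \<open>auto simp: pathstart_def pathfinish_def\<close>)
qed

lemma enumerates_mem: "enumerates v A \<Longrightarrow> v $ m \<in> A"
  by (auto simp: enumerates_def)

text \<open>Used for real parts of points that never cross the imaginary axis.\<close>

lemma sign_constant:
  fixes f :: "real \<Rightarrow> real"
  assumes "a \<le> b" "continuous_on {a..b} f" "\<And>t. t \<in> {a..b} \<Longrightarrow> f t \<noteq> 0"
  shows "0 < f b \<longleftrightarrow> 0 < f a"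
proof (rule ccontr)
  assume "\<not> ?thesis"
  then have "f a \<le> 0 \<and> 0 \<le> f b \<or> f b \<le> 0 \<and> 0 \<le> f a" by linarith
  then obtain x where "a \<le> x" "x \<le> b" "f x = 0"
    using IVT'[OF _ _ assms(1,2), of 0] IVT2'[OF _ _ assms(1,2), of 0] by blast
  then show False using assms(3)[of x] by simp
qed

lemma Re_component_sign:
  fixes y :: "real \<Rightarrow> complex ^ 'n::finite"
  assumes "a \<le> b" "continuous_on {a..b} y" "\<And>t. t \<in> {a..b} \<Longrightarrow> Re (y t $ m) \<noteq> 0"
  shows "0 < Re (y b $ m) \<longleftrightarrow> 0 < Re (y a $ m)"
  by (rule sign_constant[OF assms(1) _ assms(3)])
    (intro continuous_on_Re continuous_on_component assms(2))

lemma cusp_turn_sq: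
  assumes "0 < r"
  shows "(cusp_turn r t)^2 = 8 * (-9/8 + of_real r * cis (2 * pi * t)) + 9"
proof -
  have "(complex_of_real (sqrt (8 * r)))^2 = of_real (8 * r)"
    using assms by (simp only: of_real_power[symmetric] real_sqrt_pow2)
  moreover have "(cis (pi * t))^2 = cis (2 * pi * t)" by (simp add: Complex.DeMoivre mult.assoc)
  ultimately show ?thesis by (simp add: cusp_turn_def power_mult_distrib)
qed

text \<open>
  With this factorisation coincidences of points can be followed to the limit at a critical value.
\<close>

lemma fib_poly_enumerated:
  fixes v :: "complex ^ point_name"
  assumes "fst s \<in> slanted" "enumerates v (fibre deltoid s)"
  shows "fib_poly s = smult (lead_coeff (fib_poly s)) (\<Prod>m\<in>UNIV. [:- (v $ m), 1:])"
proof -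
  let ?q = "fib_poly s"
  have q: "?q \<noteq> 0" "degree ?q = 4" using fib_poly_degree[OF assms(1)] by auto
  have roots: "{z. poly ?q z = 0} = range (vec_nth v)" and inj: "inj (vec_nth v)"
    using assms(2) fibre_fib_poly[OF assms(1)] by (simp_all add: enumerates_def)
  have "card {z. poly ?q z = 0} = degree ?q"
    using card_enumerates[OF assms(2)] fibre_fib_poly[OF assms(1)] q(2) by simp
  then have "rsquarefree ?q" using rsquarefree_iff_card_roots[OF q(1)] by simp
  then have "smult (lead_coeff ?q) (\<Prod>z|poly ?q z = 0. [:- z, 1:]) = ?q" by (rule complex_poly_decompose_rsquarefree)
  moreover have "(\<Prod>z|poly ?q z = 0. [:- z, 1:]) = (\<Prod>m\<in>UNIV. [:- (v $ m), 1:])"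
    unfolding roots by (subst prod.reindex[OF inj]) simp
  ultimately show ?thesis by simp
qed

context
  fixes b r :: real and G :: "real \<Rightarrow> complex" and p :: "complex \<times> complex"
  assumes r: "0 < r" "r < 1/20"
    and G: "path G" "path_image G \<subseteq> upper" "pathstart G = of_real b" "pathfinish G = of_real (-9/8 + r)"
    and p: "p \<in> slanted"
    and reg: "\<And>q x. q \<in> closed_segment (1, 0) p \<Longrightarrow> x \<in> path_image G \<union> (cball (-9/8) r - ball (-9/8) (r / 2)) \<Longrightarrow> (q, x) \<in> regular"
    and im: "\<And>q x y. q \<in> closed_segment (1, 0) p \<Longrightarrow> x \<in> cball (-9/8) r \<Longrightarrow> y \<in> fibre deltoid (q, x) \<Longrightarrow> Re y \<noteq> 0"
begin

lemma route_lift: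
  shows "follows (fibre deltoid) (\<lambda>t. ((1, 0), G t)) (conf \<circ> (upper_branches \<circ> G))"
    "pathfinish (conf \<circ> (upper_branches \<circ> G)) = cusp_conf (cusp_turn r 0) (cusp_turn r 0)"
  using follows_upper_branches[OF G(1,2)] cusp_conf_upper(1)[OF r] G(4) by (simp_all add: pathfinish_compose)

lemma route_sides:
  defines "Q \<equiv> cusp_conf (cusp_turn r 0) (cusp_turn r 0)"
  shows "Re (Q $ A1) < 0" "Re (Q $ A2) < 0" "0 < Re (Q $ B1)" "0 < Re (Q $ B2)"
  using Re_cusp_root[OF r, of 0] by (simp_all add: Q_def cusp_conf_simps del: csqrt.simps)

lemma route_end_annulus: "pathfinish G \<in> cball (-9/8) r - ball (-9/8) (r / 2)"
proof -
  have "dist (-9/8) (pathfinish G) = norm (complex_of_real r)" unfolding G(4) dist_norm by (subst norm_minus_commute) simp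
  then show ?thesis using r by simp
qed

lemma move_at_route_end: "path_image (deform (pathfinish G) p) \<subseteq> regular"
  using reg by (auto simp: deform_simps)

text \<open>
  Where two points of one side meet, the two points of the other side stay apart: otherwise two
  critical points would have the same value.
\<close>

lemma other_pair_distinct:
  fixes \<sigma> :: real
  defines "K \<equiv> critical_values deltoid p" and "Q \<equiv> cusp_conf (cusp_turn r 0) (cusp_turn r 0)"
  assumes near: "ends_near K G (-9/8) r \<gamma>" and gen: "generic_projection deltoid p"
    and \<kappa>: "\<kappa> = pathfinish \<gamma>" "0 < \<eta>" "K \<inter> cball \<kappa> \<eta> = {\<kappa>}" "cball \<kappa> \<eta> \<subseteq> cball (-9/8) r"
    and meet: "meet_at_end deltoid p (of_real b) (conf (upper_branches (of_real b))) \<gamma> i j"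
    and labels: "UNIV = {i, j, k, l}" "i \<noteq> j" "k \<noteq> l" and \<sigma>: "\<sigma> = 1 \<or> \<sigma> = -1"
    and sides: "\<sigma> * Re (Q $ i) < 0" "\<sigma> * Re (Q $ j) < 0" "0 < \<sigma> * Re (Q $ k)" "0 < \<sigma> * Re (Q $ l)"
  shows "card (fibre deltoid (p, \<kappa>) \<inter> {y. 0 < \<sigma> * Re y}) = 2"
proof -
  let ?W = "conf \<circ> (upper_branches \<circ> G)" and ?E = "fibre deltoid"
  have mv: "moving_set CARD(point_name) regular ?E" by (simp add: card_point_name moving_regular)
  obtain \<tau> e where \<tau>: "0 < \<tau>" "\<tau> < 1" "\<gamma> ` {\<tau>..1} \<subseteq> cball \<kappa> \<eta>" "\<gamma> \<tau> \<notin> K"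
    and e: "path e" "pathstart e = pathfinish G" "pathfinish e = \<gamma> \<tau>" "path_image e \<subseteq> cball (-9/8) r - K"
    and hom: "homotopic_paths (- K) (subpath 0 \<tau> \<gamma>) (G +++ e)"
    by (rule ends_near_initial_piece[OF near G(1) \<kappa>]) (rule that; assumption)
  obtain u where u: "path u" "pathstart u = conf (upper_branches (of_real b))" "pathfinish u $ i = pathfinish u $ j"
    and enum: "\<And>t. t \<in> {0..<1} \<Longrightarrow> enumerates (u t) (?E ((deform (of_real b) p +++ (\<lambda>t. (p, \<gamma> t))) t))"
    using meet unfolding meet_at_end_def by blast
  have \<gamma>0: "\<gamma> 0 = of_real b"
    using homotopic_paths_imp_pathstart[OF hom] G(3) by (simp add: subpath_def pathstart_def joinpaths_def)
  have pb: "deform (of_real b) p 1 = (p, of_real b)" by (simp add: deform_eq linepath_def zero_prod_def)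
  define a where "a = (1 + \<tau>) / 2"
  have a: "1/2 < a" "a < 1" using \<tau> by (auto simp: a_def)
  define ua where "ua = subpath 0 (1/2) u"
  define ub where "ub = subpath (1/2) a u"
  have "path ua" "path ub" unfolding ua_def ub_def using u(1) a by (auto intro!: path_subpath)
  have uab: "pathfinish ua = pathstart ub" "pathstart ua = pathstart ?W" "pathfinish ub = u a"
    using u(2) G(3) by (simp_all add: ua_def ub_def pathstart_compose) (simp_all add: pathstart_def subpath_def)
  have fa: "follows ?E (deform (of_real b) p) ua"
    unfolding follows_def
  proof (intro conjI ballI \<open>path ua\<close>)
    fix t :: real assume t: "t \<in> {0..1}"
    then have "enumerates (u (t / 2)) (?E (deform (of_real b) p t))"
      using enum[of "t / 2"] by (simp add: joinpaths_def)
    then show "enumerates (ua t) (?E (deform (of_real b) p t))" by (simp add: ua_def subpath_def)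
  qed
  have fb: "follows ?E (\<lambda>t. (p, subpath 0 \<tau> \<gamma> t)) ub"
    unfolding follows_def
  proof (intro conjI ballI \<open>path ub\<close>)
    fix t :: real assume t: "t \<in> {0..1}"
    have ut: "ub t = u (1/2 + \<tau> * t / 2)" unfolding ub_def subpath_def a_def by (rule arg_cong[of _ _ u]) (simp add: field_simps)
    have "\<tau> * t \<le> \<tau>" using t \<tau> by (intro mult_left_le) auto
    then have "\<tau> * t < 1" using \<tau>(2) by linarith
    with t \<tau> have t1: "0 \<le> \<tau> * t" "\<tau> * t < 1" by simp_all
    have "(deform (of_real b) p +++ (\<lambda>t. (p, \<gamma> t))) (1/2 + \<tau> * t / 2) = (p, \<gamma> (\<tau> * t))"
    proof (cases "\<tau> * t = 0")
      case True
      show ?thesis unfolding joinpaths_def True using \<gamma>0 pb by simp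
    next
      case False
      then show ?thesis using t1 by (simp add: joinpaths_def)
    qed
    then show "enumerates (ub t) (?E (p, subpath 0 \<tau> \<gamma> t))"
      using enum[of "1/2 + \<tau> * t / 2"] t1 by (simp add: ut subpath_def)
  qed
  have bG: "pathstart G \<in> path_image G" by auto
  have regG: "closed_segment (1, 0) p \<times> path_image G \<subseteq> regular" using reg by auto
  have da: "path_image (deform (of_real b) p) \<subseteq> regular" using regG bG unfolding G(3) by (auto simp: deform_simps)
  have Gp: "path (\<lambda>t. (p, G t))" "path_image (\<lambda>t. (p, G t)) \<subseteq> regular"
    using regG G(1) by (auto simp: path_PairI pathstart_Pair)
  have ep: "path (\<lambda>t. (p, e t))" "path_image (\<lambda>t. (p, e t)) \<subseteq> regular"
    using e regular_iff_not_critical[OF p] by (auto simp: path_PairI pathstart_Pair K_def)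
  have split: "(\<lambda>t. (p, (G +++ e) t)) = (\<lambda>t. (p, G t)) +++ (\<lambda>t. (p, e t))" by (auto simp: joinpaths_def)
  have 1: "homotopic_paths regular (deform (of_real b) p +++ (\<lambda>t. (p, subpath 0 \<tau> \<gamma> t))) (deform (of_real b) p +++ ((\<lambda>t. (p, G t)) +++ (\<lambda>t. (p, e t))))"
    unfolding split[symmetric]
    by (rule homotopic_paths_join_left[OF homotopic_paths_at_projection[OF p hom[unfolded K_def]] _ da])
      (simp_all add: deform_simps pathstart_Pair \<gamma>0)
  have 2: "homotopic_paths regular (deform (of_real b) p +++ ((\<lambda>t. (p, G t)) +++ (\<lambda>t. (p, e t)))) ((deform (of_real b) p +++ (\<lambda>t. (p, G t))) +++ (\<lambda>t. (p, e t)))"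
    by (rule homotopic_paths_assoc) (use da Gp ep e G in \<open>simp_all add: deform_simps pathstart_Pair\<close>)
  have 3: "homotopic_paths regular ((deform (of_real b) p +++ (\<lambda>t. (p, G t))) +++ (\<lambda>t. (p, e t)))
      (((\<lambda>t. ((1, 0), G t)) +++ deform (pathfinish G) p) +++ (\<lambda>t. (p, e t)))"
    by (rule homotopic_paths_join_right[OF deform_along_path[OF G(1) regG, unfolded G(3)] ep])
      (simp add: pathstart_Pair e(2))
  note hom3 = homotopic_paths_trans[OF homotopic_paths_trans[OF 1 2] 3]
  have "enumerates (pathfinish ?W) (?E (pathstart (deform (pathfinish G) p)))"
    using route_lift(1) by (simp add: follows_def pathfinish_def deform_eq pathstart_def linepath_def zero_prod_def)
  then obtain y1 where y1: "follows ?E (deform (pathfinish G) p) y1" "pathstart y1 = pathfinish ?W"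
    using follows_exists[OF mv _ move_at_route_end] by (metis deform_simps(1))
  have "enumerates (pathfinish y1) (?E (pathfinish (deform (pathfinish G) p)))"
    using y1(1) by (simp add: follows_def pathfinish_def)
  then have "enumerates (pathfinish y1) (?E (pathstart (\<lambda>t. (p, e t))))"
    by (simp only: deform_simps pathstart_Pair e(2))
  then obtain y2 where y2: "follows ?E (\<lambda>t. (p, e t)) y2" "pathstart y2 = pathfinish y1"
    using follows_exists[OF mv ep] by metis
  have fu: "follows ?E (deform (of_real b) p +++ (\<lambda>t. (p, subpath 0 \<tau> \<gamma> t))) (ua +++ ub)"
    by (rule follows_join[OF fa fb uab(1)])
  have fy: "follows ?E (((\<lambda>t. ((1, 0), G t)) +++ deform (pathfinish G) p) +++ (\<lambda>t. (p, e t))) ((?W +++ y1) +++ y2)"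
    by (intro follows_join route_lift(1) y1(1) y2(1)) (simp_all add: y1(2) y2(2))
  have "homotopic_paths config (ua +++ ub) ((?W +++ y1) +++ y2)"
    by (rule follows_homotopic[OF mv hom3 fu fy]) (simp add: uab(2))
  from homotopic_paths_imp_pathfinish[OF this] have ua: "u a = pathfinish y2" by (simp add: uab(3))
  have D: "pathfinish G \<in> cball (-9/8) r" using route_end_annulus by blast
  have s1: "0 < Re (pathfinish y1 $ m) \<longleftrightarrow> 0 < Re (Q $ m)" for m
  proof -
    have "Re (y1 t $ m) \<noteq> 0" if "t \<in> {0..1}" for t
    proof (rule im[OF _ D])
      show "linepath (1, 0) p t \<in> closed_segment (1, 0) p" using that by (rule linepath_in_path)
      show "y1 t $ m \<in> ?E (linepath (1, 0) p t, pathfinish G)"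
        using y1(1) that unfolding follows_def deform_eq by (intro enumerates_mem) blast
    qed
    then show ?thesis
      using Re_component_sign[of 0 1 y1 m] y1 route_lift(2) by (simp add: follows_def path_def pathstart_def pathfinish_def Q_def)
  qed
  have s2: "0 < Re (u a $ m) \<longleftrightarrow> 0 < Re (Q $ m)" for m
  proof -
    have "Re (y2 t $ m) \<noteq> 0" if "t \<in> {0..1}" for t
    proof (rule im[of p])
      have "e t \<in> path_image e" using that by (simp add: path_image_def)
      then show "e t \<in> cball (-9/8) r" using e(4) by blast
      show "y2 t $ m \<in> ?E (p, e t)"
        using y2(1) that unfolding follows_def by (intro enumerates_mem) blast
    qed simp
    then show ?thesis
      using Re_component_sign[of 0 1 y2 m] y2 s1[of m] ua by (simp add: follows_def path_def pathstart_def pathfinish_def)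
  qed
  define v where "v = u 1"
  define L where "L = (1 + (snd p / fst p)^2)^2"
  have "continuous_on {0..1} \<gamma>"
  proof -
    from near obtain h where "displaced K h \<gamma>" unfolding ends_near_def by blast
    then obtain f :: "real \<times> real \<Rightarrow> complex" where f: "continuous_on ({0..1} \<times> {0..1}) f" "\<And>t. f (1, t) = \<gamma> t"
      by (rule displaced_homotopy) (rule that; assumption)
    have "continuous_on {0..1} (\<lambda>t. f (1, t))" by (rule continuous_on_compose2[OF f(1)]) (auto intro!: continuous_intros)
    then show ?thesis by (simp add: f(2))
  qed
  moreover have "continuous_on {a..1} (\<lambda>t. 2 * t - 1)" by (intro continuous_intros)
  moreover have "(\<lambda>t. 2 * t - 1) ` {a..1} \<subseteq> {0..1}" using a(1) by auto
  ultimately have \<gamma>c: "continuous_on {a..1} (\<lambda>t. \<gamma> (2 * t - 1))"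
    by (rule continuous_on_compose2)
  have uc: "continuous_on {a..1} u"
    by (rule continuous_on_subset[OF u(1)[unfolded path_def]]) (use a(1) in auto)
  have cl: "closure {a..<1} = {a..1}" using a(2) by (rule closure_atLeastLessThan)
  have fp0: "fst p \<noteq> 0" using p by (simp add: slanted_def)
  have cont: "continuous_on {a..1} (\<lambda>t. poly (fib_poly (p, \<gamma> (2 * t - 1))) y - L * (\<Prod>m\<in>UNIV. y - u t $ m))" for y
  proof -
    have c1: "continuous_on {a..1} (\<lambda>t. \<gamma> (2 * t - 1) / fst p - snd p / fst p * y)"
      using fp0 by (intro continuous_on_diff continuous_on_divide \<gamma>c continuous_on_const) simp
    have c2: "continuous_on {a..1} (\<lambda>t. deltoid (\<gamma> (2 * t - 1) / fst p - snd p / fst p * y) y)"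
      unfolding deltoid_def by (intro continuous_on_add continuous_on_mult continuous_on_power continuous_on_const c1)
    have c3: "continuous_on {a..1} (\<lambda>t. \<Prod>m\<in>UNIV. y - u t $ m)"
      by (intro continuous_on_prod continuous_on_diff continuous_on_const continuous_on_component uc)
    show ?thesis unfolding poly_fib_poly fst_conv snd_conv
      by (intro continuous_on_diff continuous_on_mult continuous_on_const c2 c3)
  qed
  have prod: "poly (fib_poly (p, \<gamma> (2 * t - 1))) y - L * (\<Prod>m\<in>UNIV. y - u t $ m) = 0" if "t \<in> {a..1}" for t y
  proof (rule continuous_constant_on_closure[of "{a..<1}"])
    show "continuous_on (closure {a..<1}) (\<lambda>t. poly (fib_poly (p, \<gamma> (2 * t - 1))) y - L * (\<Prod>m\<in>UNIV. y - u t $ m))"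
      unfolding cl by (rule cont)
    show "t \<in> closure {a..<1}" unfolding cl by (rule that)
    fix t assume t: "t \<in> {a..<1}"
    then have "(deform (of_real b) p +++ (\<lambda>t. (p, \<gamma> t))) t = (p, \<gamma> (2 * t - 1))" using a by (simp add: joinpaths_def)
    then have "enumerates (u t) (?E (p, \<gamma> (2 * t - 1)))" using enum[of t] t a by simp
    from fib_poly_enumerated[OF _ this] p
    have fp: "fib_poly (p, \<gamma> (2 * t - 1)) = smult L (\<Prod>m\<in>UNIV. [:- (u t $ m), 1:])"
      using fib_poly_degree(2)[of "(p, \<gamma> (2 * t - 1))"] by (simp add: L_def)
    show "poly (fib_poly (p, \<gamma> (2 * t - 1))) y - L * (\<Prod>m\<in>UNIV. y - u t $ m) = 0"
      unfolding fp by (simp add: poly_prod)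
  qed
  have L0: "L \<noteq> 0" using p by (simp add: L_def slanted_def)
  have root: "u t $ m \<in> ?E (p, \<gamma> (2 * t - 1))" if "t \<in> {a..1}" for t m
  proof -
    have "(\<Prod>n\<in>UNIV. u t $ m - u t $ n) = 0" by (rule prod_zero[OF finite]) (rule bexI[of _ m], simp_all)
    then have "poly (fib_poly (p, \<gamma> (2 * t - 1))) (u t $ m) = 0" using prod[OF that, of "u t $ m"] by simp
    then show ?thesis using fibre_fib_poly[of "(p, \<gamma> (2 * t - 1))"] p by simp
  qed
  have \<kappa>1: "\<gamma> (2 * 1 - 1) = \<kappa>" by (simp add: \<kappa>(1) pathfinish_def)
  define q where "q = fib_poly (p, \<kappa>)"
  have q: "q = smult L (\<Prod>m\<in>UNIV. [:- (v $ m), 1:])"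
  proof -
    have "poly q y = poly (smult L (\<Prod>m\<in>UNIV. [:- (v $ m), 1:])) y" for y
      using prod[of 1 y] a unfolding \<kappa>1 by (simp add: q_def v_def poly_prod)
    then show ?thesis by (intro poly_eq_poly_eq_iff[THEN iffD1]) (simp add: fun_eq_iff)
  qed
  have E\<kappa>: "?E (p, \<kappa>) = range (vec_nth v)"
  proof -
    have "poly q y = 0 \<longleftrightarrow> y \<in> range (vec_nth v)" for y
      unfolding q using L0 by (auto simp: poly_prod prod_zero_iff)
    then show ?thesis using fibre_fib_poly[of "(p, \<kappa>)"] p by (simp add: q_def)
  qed
  have s3: "0 < Re (v $ m) \<longleftrightarrow> 0 < Re (Q $ m)" "Re (v $ m) \<noteq> 0" for m
  proof -
    have nz: "Re (u t $ m) \<noteq> 0" if t: "t \<in> {a..1}" for t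
    proof (rule im[of p])
      have "2 * t - 1 \<in> {\<tau>..1}" using t by (auto simp: a_def)
      then show "\<gamma> (2 * t - 1) \<in> cball (-9/8) r" using \<tau>(3) \<kappa>(4) by blast
      show "u t $ m \<in> ?E (p, \<gamma> (2 * t - 1))" by (rule root[OF t])
    qed simp
    then show "0 < Re (v $ m) \<longleftrightarrow> 0 < Re (Q $ m)"
      using Re_component_sign[of a 1 u m] a uc s2[of m] by (simp add: v_def)
    show "Re (v $ m) \<noteq> 0" using nz[of 1] a by (simp add: v_def)
  qed
  have side: "0 < \<sigma> * Re (v $ m) \<longleftrightarrow> 0 < \<sigma> * Re (Q $ m)" if "\<sigma> * Re (Q $ m) \<noteq> 0" for m
    using \<sigma> s3[of m] that by auto
  have vs: "\<not> 0 < \<sigma> * Re (v $ i)" "\<not> 0 < \<sigma> * Re (v $ j)" "0 < \<sigma> * Re (v $ k)" "0 < \<sigma> * Re (v $ l)"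
    using side[OF less_imp_neq[OF sides(1)]] side[OF less_imp_neq[OF sides(2)]] sides
      side[OF less_imp_neq[OF sides(3), symmetric]] side[OF less_imp_neq[OF sides(4), symmetric]]
    by (metis order.asym)+
  have crit: "((\<kappa> - snd p * (v $ m)) / fst p, v $ m) \<in> critical_points deltoid p" if mm: "m \<noteq> m'" "v $ m = v $ m'" for m m'
  proof -
    have "(\<Prod>n\<in>UNIV. [:- (v $ n), 1:]) = [:- (v $ m), 1:] * (\<Prod>n\<in>UNIV - {m}. [:- (v $ n), 1:])"
      by (subst prod.remove[of _ m]) auto
    also have "(\<Prod>n\<in>UNIV - {m}. [:- (v $ n), 1:]) = [:- (v $ m), 1:] * (\<Prod>n\<in>UNIV - {m} - {m'}. [:- (v $ n), 1:])"
      using mm by (subst prod.remove[of _ m']) auto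
    finally have "poly (pderiv q) (v $ m) = 0"
      unfolding q by (simp only: pderiv_smult pderiv_mult poly_smult poly_add poly_mult) simp
    moreover have "v $ m \<in> ?E (p, \<kappa>)" by (simp add: E\<kappa>)
    ultimately show ?thesis using critical_points_iff[OF p, of "v $ m" \<kappa>] by (simp add: q_def)
  qed
  have "v $ k \<noteq> v $ l"
  proof
    assume "v $ k = v $ l"
    then have ck: "((\<kappa> - snd p * (v $ k)) / fst p, v $ k) \<in> critical_points deltoid p" using labels(3) by (rule crit[rotated])
    have "v $ i = v $ j" using u(3) by (simp add: v_def pathfinish_def)
    then have ci: "((\<kappa> - snd p * (v $ i)) / fst p, v $ i) \<in> critical_points deltoid p" using labels(2) by (rule crit[rotated])
    have "proj p ((\<kappa> - snd p * y) / fst p, y) = \<kappa>" for y using p by (simp add: proj_def slanted_def)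
    then have "((\<kappa> - snd p * (v $ i)) / fst p, v $ i) = ((\<kappa> - snd p * (v $ k)) / fst p, v $ k)"
      by (intro inj_onD[OF gen[unfolded generic_projection_def] _ ci ck]) simp
    then have "v $ i = v $ k" by simp
    then show False using vs by simp
  qed
  moreover have "?E (p, \<kappa>) \<inter> {y. 0 < \<sigma> * Re y} = {v $ k, v $ l}"
    unfolding E\<kappa> labels(1) using vs by auto
  ultimately show ?thesis by simp
qed

text \<open>
  Near the cusps the left and the right points of the fibre may be moved independently, each pair
  over its own point of the disc: this replaces the loop \<open>l\<close> by one loop for each pair, and these
  only have to avoid the one critical value where their own pair meets.
\<close>

lemma local_loop_clusters:
  fixes k k' :: "real \<Rightarrow> complex ^ point_name"
  defines "D \<equiv> cball (-9/8 :: complex) r" and "A \<equiv> cball (-9/8 :: complex) r - ball (-9/8) (r / 2)" and "x0 \<equiv> pathfinish G"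
  assumes left: "\<And>x. x \<in> D - {\<kappa>L} \<Longrightarrow> card (fibre deltoid (p, x) \<inter> {y. Re y < 0}) = 2"
    and right: "\<And>x. x \<in> D - {\<kappa>R} \<Longrightarrow> card (fibre deltoid (p, x) \<inter> {y. 0 < Re y}) = 2"
    and ann: "\<And>q x. q \<in> closed_segment (1, 0) p \<Longrightarrow> x \<in> A \<Longrightarrow>
      card (fibre deltoid (q, x) \<inter> {y. Re y < 0}) = 2 \<and> card (fibre deltoid (q, x) \<inter> {y. 0 < Re y}) = 2"
    and \<kappa>: "\<kappa>L \<in> ball (-9/8) (r / 2)" "\<kappa>R \<in> ball (-9/8) (r / 2)"
    and \<mu>: "path \<mu>" "pathstart \<mu> = x0" "pathfinish \<mu> = x0" "path_image \<mu> \<subseteq> A"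
    and \<nu>: "path \<nu>" "pathstart \<nu> = x0" "pathfinish \<nu> = x0" "path_image \<nu> \<subseteq> A"
    and l: "path l" "pathstart l = x0" "pathfinish l = x0" "path_image l \<subseteq> D - {\<kappa>L, \<kappa>R}"
      "winding_number l \<kappa>L = winding_number \<mu> \<kappa>L" "winding_number l \<kappa>R = winding_number \<nu> \<kappa>R"
    and k: "follows clusters (\<lambda>t. ((1, 0), \<mu> t, \<nu> t)) k" "pathstart k = Q"
    and k': "follows (fibre deltoid) (conj_path id (deform x0 p) (\<lambda>t. (p, l t))) k'" "pathstart k' = Q"
  shows "homotopic_paths config k' k"
proof -
  define \<Delta> where "\<Delta> = (\<lambda>t. (linepath (1, 0) p t, x0, x0))"
  have mv: "moving_set CARD(point_name) split_pairs clusters" by (simp add: card_point_name moving_clusters)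
  have x0: "x0 \<in> A" "x0 \<in> D" using route_end_annulus by (simp_all add: x0_def A_def D_def)
  have A: "A \<subseteq> D - {\<kappa>L}" "A \<subseteq> D - {\<kappa>R}" using \<kappa> by (auto simp: A_def D_def)
  have \<kappa>r: "\<kappa>L \<in> ball (-9/8) r" "\<kappa>R \<in> ball (-9/8) r" using \<kappa> r by auto
  have "homotopic_paths (D - {\<kappa>L}) l \<mu>"
    unfolding D_def by (rule loops_homotopic_in_disc) (use \<kappa>r l \<mu> A in \<open>auto simp: D_def\<close>)
  moreover have "homotopic_paths (D - {\<kappa>R}) l \<nu>"
    unfolding D_def by (rule loops_homotopic_in_disc) (use \<kappa>r l \<nu> A in \<open>auto simp: D_def\<close>)
  ultimately have "homotopic_paths ((D - {\<kappa>L}) \<times> (D - {\<kappa>R})) (\<lambda>t. (l t, l t)) (\<lambda>t. (\<mu> t, \<nu> t))"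
    by (rule homotopic_paths_pair)
  moreover have "continuous_on ((D - {\<kappa>L}) \<times> (D - {\<kappa>R})) (Pair p)"
    by (intro continuous_on_Pair continuous_on_const continuous_on_id)
  moreover have "Pair p \<in> (D - {\<kappa>L}) \<times> (D - {\<kappa>R}) \<rightarrow> split_pairs"
  proof (rule funcsetI)
    fix x assume "x \<in> (D - {\<kappa>L}) \<times> (D - {\<kappa>R})"
    then have "fst x \<in> D - {\<kappa>L}" "snd x \<in> D - {\<kappa>R}" by auto
    from left[OF this(1)] right[OF this(2)] show "(p, x) \<in> split_pairs" using p by (simp add: split_pairs_def)
  qed
  ultimately have "homotopic_paths split_pairs (Pair p \<circ> (\<lambda>t. (l t, l t))) (Pair p \<circ> (\<lambda>t. (\<mu> t, \<nu> t)))"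
    by (rule homotopic_paths_continuous_image)
  then have hp: "homotopic_paths split_pairs (\<lambda>t. (p, l t, l t)) (\<lambda>t. (p, \<mu> t, \<nu> t))" by (simp only: o_def)
  have sl: "q \<in> slanted" if "q \<in> closed_segment (1, 0) p" for q
    using reg[OF that, of x0] x0(1) by (simp add: regular_def A_def)
  have sp: "(q, x, x') \<in> split_pairs" if "q \<in> closed_segment (1, 0) p" "x \<in> A" "x' \<in> A" for q x x'
    using ann[OF that(1,2)] ann[OF that(1,3)] sl[OF that(1)] by (simp add: split_pairs_def)
  have "path \<Delta>" unfolding path_def \<Delta>_def by (intro continuous_on_Pair continuous_on_linepath continuous_on_const)
  moreover have "path_image \<Delta> \<subseteq> split_pairs"
    unfolding path_image_def \<Delta>_def by (intro image_subsetI sp x0(1) linepath_in_path)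
  ultimately have dd: "homotopic_paths split_pairs \<Delta> \<Delta>" by simp
  have \<Delta>e: "pathstart \<Delta> = ((1, 0), x0, x0)" "pathfinish \<Delta> = (p, x0, x0)" by (simp_all add: \<Delta>_def pathstart_def pathfinish_def linepath_def zero_prod_def)
  have le: "pathstart (\<lambda>t. (p, l t, l t)) = (p, x0, x0)" "pathfinish (\<lambda>t. (p, l t, l t)) = (p, x0, x0)"
    using l(2,3) by (simp_all add: pathstart_def pathfinish_def)
  have 4: "homotopic_paths split_pairs (conj_path id \<Delta> (\<lambda>t. (p, l t, l t))) (conj_path id \<Delta> (\<lambda>t. (p, \<mu> t, \<nu> t)))"
    by (rule homotopic_conj_path[OF dd hp]) (simp_all add: \<Delta>e le)
  have 5: "homotopic_paths split_pairs (\<lambda>t. ((1, 0), \<mu> t, \<nu> t)) (\<Delta> +++ (\<lambda>t. (p, \<mu> t, \<nu> t)) +++ reversepath \<Delta>)"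
  proof (rule homotopic_paths_square'[where f = "\<lambda>x. (linepath (1, 0) p (fst x), \<mu> (snd x), \<nu> (snd x))"])
    note c1 = projection_path_square(1)[OF \<mu>(1), of p] and c2 = projection_path_square(1)[OF \<nu>(1), of p]
    show "continuous_on ({0..1} \<times> {0..1}) (\<lambda>x. (linepath (1, 0) p (fst x), \<mu> (snd x), \<nu> (snd x)))"
      using continuous_on_Pair[OF continuous_on_fst[OF c1] continuous_on_Pair[OF continuous_on_snd[OF c1] continuous_on_snd[OF c2]]]
      by (simp only: fst_conv snd_conv)
    show "(linepath (1, 0) p (fst (s, t)), \<mu> (snd (s, t)), \<nu> (snd (s, t))) \<in> split_pairs" if "s \<in> {0..1}" "t \<in> {0..1}" for s t
      unfolding fst_conv snd_conv
      using projection_path_square(2)[OF \<mu>(1) that, of p] projection_path_square(2)[OF \<nu>(1) that, of p] \<mu>(4) \<nu>(4)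
      by (intro sp) blast+
  qed (use \<mu>(2,3) \<nu>(2,3) in \<open>simp_all add: \<Delta>_def pathstart_def pathfinish_def linepath_def zero_prod_def\<close>)
  have 5: "homotopic_paths split_pairs (\<lambda>t. ((1, 0), \<mu> t, \<nu> t)) (conj_path id \<Delta> (\<lambda>t. (p, \<mu> t, \<nu> t)))"
    using 5 by (simp add: conj_path_def)
  note hom = homotopic_paths_trans[OF 4 homotopic_paths_sym[OF 5]]
  let ?s0 = "conj_path id (deform x0 p) (\<lambda>t. (p, l t))" and ?s1 = "conj_path id \<Delta> (\<lambda>t. (p, l t, l t))"
  have s1: "?s1 t = (fst (?s0 t), snd (?s0 t), snd (?s0 t))" for t
    by (simp add: conj_path_def joinpaths_def reversepath_def \<Delta>_def deform_eq)
  have s0: "?s0 t \<in> closed_segment (1, 0) p \<times> D" if "t \<in> {0..1}" for t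
  proof -
    have "?s0 t \<in> path_image ?s0" using that by (simp add: path_image_def)
    also have "path_image ?s0 \<subseteq> path_image (deform x0 p) \<union> path_image (\<lambda>t. (p, l t)) \<union> path_image (deform x0 p)"
      using path_image_join_subset[of "deform x0 p" "(\<lambda>t. (p, l t)) +++ reversepath (deform x0 p)"]
        path_image_join_subset[of "\<lambda>t. (p, l t)" "reversepath (deform x0 p)"]
      by (simp add: conj_path_def) blast
    also have "\<dots> \<subseteq> closed_segment (1, 0) p \<times> D"
      unfolding deform_simps pathstart_Pair using l(4) x0(2) by auto
    finally show ?thesis .
  qed
  have cl: "clusters (?s1 t) = fibre deltoid (?s0 t)" if "t \<in> {0..1}" for t
  proof -
    have "Re y \<noteq> 0" if "y \<in> fibre deltoid (?s0 t)" for y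
      using im[of "fst (?s0 t)" "snd (?s0 t)" y] s0[OF \<open>t \<in> {0..1}\<close>] that unfolding mem_Times_iff D_def by simp
    then show ?thesis unfolding s1 clusters_def fst_conv snd_conv prod.collapse by force
  qed
  have "follows clusters ?s1 k'" by (rule follows_cong[OF k'(1)]) (rule cl)
  from follows_homotopic[OF mv hom this k(1)] show ?thesis using k(2) k'(2) by simp
qed

lemma enumerates_cusp_conf:
  assumes "norm v ^ 2 \<le> 2/5" "v \<noteq> 0" "v^2 = 8 * x + 9" "norm w ^ 2 \<le> 2/5" "w \<noteq> 0" "w^2 = 8 * x' + 9"
  shows "enumerates (cusp_conf v w) (clusters ((1, 0), x, x'))"
proof -
  have L: "fibre deltoid ((1, 0), x) \<inter> {y. Re y < 0} = {- csqrt (branch_sq v), - csqrt (branch_sq (- v))}"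
    unfolding cusp_fibre(1)[OF assms(1,3), symmetric] by blast
  have R: "fibre deltoid ((1, 0), x') \<inter> {y. 0 < Re y} = {csqrt (branch_sq w), csqrt (branch_sq (- w))}"
    unfolding cusp_fibre(2)[OF assms(4,6), symmetric] by blast
  have d: "csqrt (branch_sq v) \<noteq> csqrt (branch_sq (- v))" "csqrt (branch_sq w) \<noteq> csqrt (branch_sq (- w))"
    using cusp_fibre(4)[OF assms(1,3,2)] cusp_fibre(4)[OF assms(4,6,5)] by simp_all
  have s: "Re (- csqrt (branch_sq v)) < 0" "Re (- csqrt (branch_sq (- v))) < 0"
    "0 < Re (csqrt (branch_sq w))" "0 < Re (csqrt (branch_sq (- w)))"
    using L R by blast+
  have rng: "range (vec_nth (cusp_conf v w)) = clusters ((1, 0), x, x')"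
    unfolding clusters_def fst_conv snd_conv L R UNIV_point_name by (simp add: cusp_conf_simps del: csqrt.simps) blast
  have inj: "m = n" if "cusp_conf v w $ m = cusp_conf v w $ n" for m n
    using that d s by (cases m; cases n) (auto simp: cusp_conf_simps simp del: csqrt.simps)
  show ?thesis unfolding enumerates_def using rng inj by (auto simp: inj_def)
qed

text \<open>
  In the application one of \<open>\<mu>\<close> and \<open>\<nu>\<close> is a circle and the
  other one is constant: only the pair which meets at the end of the path has to move.
\<close>

lemma cusp_braid:
  fixes k h :: "real \<Rightarrow> complex ^ point_name"
  defines "K \<equiv> critical_values deltoid p" and "D \<equiv> cball (-9/8 :: complex) r"
    and "A \<equiv> cball (-9/8 :: complex) r - ball (-9/8) (r / 2)" and "x0 \<equiv> pathfinish G"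
    and "Q \<equiv> cusp_conf (cusp_turn r 0) (cusp_turn r 0)"
  assumes near: "ends_near K G (-9/8) r \<gamma>"
    and \<kappa>: "\<kappa> = pathfinish \<gamma>" "0 < \<eta>" "K \<inter> cball \<kappa> \<eta> = {\<kappa>}" "cball \<kappa> \<eta> \<subseteq> cball (-9/8) r"
    and left: "\<And>x. x \<in> D - {\<kappa>L} \<Longrightarrow> card (fibre deltoid (p, x) \<inter> {y. Re y < 0}) = 2"
    and right: "\<And>x. x \<in> D - {\<kappa>R} \<Longrightarrow> card (fibre deltoid (p, x) \<inter> {y. 0 < Re y}) = 2"
    and ann: "\<And>q x. q \<in> closed_segment (1, 0) p \<Longrightarrow> x \<in> A \<Longrightarrow>
      card (fibre deltoid (q, x) \<inter> {y. Re y < 0}) = 2 \<and> card (fibre deltoid (q, x) \<inter> {y. 0 < Re y}) = 2"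
    and LR: "\<kappa>L \<in> ball (-9/8) (r / 2)" "\<kappa>R \<in> ball (-9/8) (r / 2)" "\<kappa>L \<in> K" "\<kappa>R \<in> K"
    and \<mu>: "path \<mu>" "pathstart \<mu> = x0" "pathfinish \<mu> = x0" "path_image \<mu> \<subseteq> A" "winding_number \<mu> \<kappa>L = of_bool (\<kappa>L = \<kappa>)"
    and \<nu>: "path \<nu>" "pathstart \<nu> = x0" "pathfinish \<nu> = x0" "path_image \<nu> \<subseteq> A" "winding_number \<nu> \<kappa>R = of_bool (\<kappa>R = \<kappa>)"
    and k: "follows clusters (\<lambda>t. ((1, 0), \<mu> t, \<nu> t)) k" "pathstart k = Q" "pathfinish k = swap_labels i j Q"
    and h: "homotopic_paths config (conj_path (swap_labels i j) (conf \<circ> (upper_branches \<circ> G)) k) h"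
  shows "monodromy_braid deltoid p (of_real b) (conf (upper_branches (of_real b))) \<gamma> h"
proof -
  let ?W = "conf \<circ> (upper_branches \<circ> G)"
  have mv: "moving_set CARD(point_name) regular (fibre deltoid)" by (simp add: card_point_name moving_regular)
  obtain \<tau> e l where \<gamma>: "close_to_end K \<gamma> \<tau>" "homotopic_paths (- K) (loop_around \<gamma> \<tau>) (conj_path id G l)"
    and l: "path l" "pathstart l = pathfinish G" "pathfinish l = pathfinish G" "path_image l \<subseteq> cball (-9/8) r - K"
      "winding_number l \<kappa> = 1" "\<And>\<kappa>'. \<kappa>' \<in> K \<Longrightarrow> \<kappa>' \<noteq> \<kappa> \<Longrightarrow> winding_number l \<kappa>' = 0"
    by (rule ends_near_loop[OF near G(1) \<kappa>]) (rule that; assumption)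
  have lK: "path_image l \<subseteq> - critical_values deltoid p" using l(4) by (auto simp: K_def)
  have wl: "winding_number l \<kappa>' = of_bool (\<kappa>' = \<kappa>)" if "\<kappa>' \<in> K" for \<kappa>' using l(5) l(6)[OF that] by auto
  let ?s = "conj_path id (deform x0 p) (\<lambda>t. (p, l t))"
  have "path (\<lambda>t. (p, l t))" "path_image (\<lambda>t. (p, l t)) \<subseteq> regular"
    using l(1) lK regular_iff_not_critical[OF p] by (auto simp: path_PairI pathstart_Pair)
  then have s: "path ?s" "path_image ?s \<subseteq> regular"
    using l(2,3) move_at_route_end
    by (simp_all add: conj_path_def x0_def deform_simps(1-3) pathstart_Pair(1,2) path_image_join)
  have "enumerates (pathfinish ?W) (fibre deltoid ((1, 0), pathfinish G))"
    using route_lift(1)[unfolded follows_def, THEN conjunct2, THEN bspec, of 1] by (simp add: pathfinish_def del: o_apply)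
  then have "enumerates Q (fibre deltoid (pathstart ?s))"
    unfolding route_lift(2) Q_def by (simp add: conj_path_def deform_simps x0_def)
  then obtain k' where k': "follows (fibre deltoid) ?s k'" "pathstart k' = Q"
    using follows_exists[OF mv s] by metis
  have lLR: "path_image l \<subseteq> cball (-9/8) r - {\<kappa>L, \<kappa>R}" using l(4) LR(3,4) by blast
  have w: "winding_number l \<kappa>L = winding_number \<mu> \<kappa>L" "winding_number l \<kappa>R = winding_number \<nu> \<kappa>R"
    using wl[OF LR(3)] wl[OF LR(4)] \<mu>(5) \<nu>(5) by simp_all
  have kk: "homotopic_paths config k' k"
    by (rule local_loop_clusters[OF left[unfolded D_def] right[unfolded D_def] ann[unfolded A_def] LR(1,2)
          \<mu>(1-4)[unfolded A_def x0_def] \<nu>(1-4)[unfolded A_def x0_def] l(1-3) lLR w k(1,2) k'[unfolded x0_def]])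
  have regG: "closed_segment (1, 0) p \<times> path_image G \<subseteq> regular" using reg by auto
  have "monodromy_braid deltoid p (pathstart G) (pathstart ?W) \<gamma> h"
    by (rule monodromy_of_local_loop[OF p G(1) regG route_lift(1) \<gamma>[unfolded K_def] l(1-3) lK _ _ kk _ h])
      (use k' k(3) route_lift(2) in \<open>simp_all only: x0_def Q_def\<close>)
  then show ?thesis using G(3) by (simp add: pathstart_compose)
qed

text \<open>
  The counts of left and right points are propagated over the annulus and the punctured disc; at
  each of the two critical values it is known which pair stays apart.
\<close>

lemma cusps_monodromy:
  fixes h1 h2 :: "real \<Rightarrow> complex ^ point_name"
  defines "K \<equiv> critical_values deltoid p" and "P \<equiv> conf (upper_branches (of_real b))"
  assumes gen: "generic_projection deltoid p" and K: "K \<inter> cball (-9/8) r = {pathfinish \<gamma>1, pathfinish \<gamma>2}" "pathfinish \<gamma>1 \<noteq> pathfinish \<gamma>2"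
    and near: "ends_near K G (-9/8) r \<gamma>1" "ends_near K G (-9/8) r \<gamma>2"
    and meet: "meet_at_end deltoid p (of_real b) P \<gamma>1 A1 A2" "meet_at_end deltoid p (of_real b) P \<gamma>2 B1 B2"
    and h: "homotopic_paths config (conj_path (swap_labels A1 A2) (conf \<circ> (upper_branches \<circ> G))
        (\<lambda>t. cusp_conf (cusp_turn r t) (cusp_turn r 0))) h1"
      "homotopic_paths config (conj_path (swap_labels B2 B1) (conf \<circ> (upper_branches \<circ> G))
        (\<lambda>t. cusp_conf (cusp_turn r 0) (cusp_turn r t))) h2"
  shows "monodromy_braid deltoid p (of_real b) P \<gamma>1 h1" "monodromy_braid deltoid p (of_real b) P \<gamma>2 h2"
proof -
  let ?D = "cball (-9/8 :: complex) r" and ?A = "cball (-9/8 :: complex) r - ball (-9/8) (r / 2)"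
  let ?x0 = "pathfinish G" and ?Q = "cusp_conf (cusp_turn r 0) (cusp_turn r 0)" and ?seg = "closed_segment (1, 0) p"
  let ?L = "\<lambda>s. card (fibre deltoid s \<inter> {y. Re y < 0})" and ?R = "\<lambda>s. card (fibre deltoid s \<inter> {y. 0 < Re y})"
  define \<kappa>1 \<kappa>2 where "\<kappa>1 = pathfinish \<gamma>1" and "\<kappa>2 = pathfinish \<gamma>2"
  have \<kappa>K: "\<kappa>1 \<in> K" "\<kappa>2 \<in> K" "\<kappa>1 \<noteq> \<kappa>2" "K \<inter> ?D = {\<kappa>1, \<kappa>2}" using K by (auto simp: \<kappa>1_def \<kappa>2_def)
  have inner: "\<kappa> \<in> ball (-9/8) (r / 2)" if "\<kappa> \<in> K" "\<kappa> \<in> ?D" for \<kappa>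
    using that reg[of p \<kappa>] regular_iff_not_critical[OF p] by (auto simp: K_def)
  have \<kappa>b: "\<kappa>1 \<in> ball (-9/8) (r / 2)" "\<kappa>2 \<in> ball (-9/8) (r / 2)" using inner \<kappa>K by blast+
  define \<eta> where "\<eta> = min (r / 2) (dist \<kappa>1 \<kappa>2 / 2)"
  have \<eta>: "0 < \<eta>" using \<kappa>K(3) r by (simp add: \<eta>_def)
  have sub: "cball \<kappa> \<eta> \<subseteq> ?D" if "\<kappa> \<in> ball (-9/8) (r / 2)" for \<kappa>
  proof
    fix x assume "x \<in> cball \<kappa> \<eta>"
    then show "x \<in> ?D" using that dist_triangle[of "-9/8" x \<kappa>] by (simp add: \<eta>_def)
  qed
  have far: "\<kappa>2 \<notin> cball \<kappa>1 \<eta>" "\<kappa>1 \<notin> cball \<kappa>2 \<eta>" 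
  proof -
    have "\<eta> \<le> dist \<kappa>1 \<kappa>2 / 2" "0 < dist \<kappa>1 \<kappa>2" using \<kappa>K(3) by (simp_all add: \<eta>_def)
    then show "\<kappa>2 \<notin> cball \<kappa>1 \<eta>" "\<kappa>1 \<notin> cball \<kappa>2 \<eta>"
      unfolding mem_cball using dist_commute[of \<kappa>1 \<kappa>2] by linarith+
  qed
  have K1: "K \<inter> cball \<kappa>1 \<eta> = {\<kappa>1}" "K \<inter> cball \<kappa>2 \<eta> = {\<kappa>2}"
    using sub[OF \<kappa>b(1)] sub[OF \<kappa>b(2)] far \<kappa>K \<eta> by auto
  have U: "(UNIV :: point_name set) = {B1, B2, A1, A2}" by (simp add: UNIV_point_name insert_commute)
  have "card (fibre deltoid (p, \<kappa>1) \<inter> {y. 0 < 1 * Re y}) = 2"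
    by (rule other_pair_distinct[OF near(1)[unfolded K_def] gen \<kappa>1_def \<eta> K1(1)[unfolded K_def] sub[OF \<kappa>b(1)]
          meet(1)[unfolded P_def] UNIV_point_name]) (use route_sides in simp_all)
  then have right1: "?R (p, \<kappa>1) = 2" by simp
  have "card (fibre deltoid (p, \<kappa>2) \<inter> {y. 0 < -1 * Re y}) = 2"
    by (rule other_pair_distinct[OF near(2)[unfolded K_def] gen \<kappa>2_def \<eta> K1(2)[unfolded K_def] sub[OF \<kappa>b(2)]
          meet(2)[unfolded P_def] U]) (use route_sides in simp_all)
  then have left2: "?L (p, \<kappa>2) = 2" by simp
  let ?S = "?seg \<times> ?A \<union> {p} \<times> (?D - {\<kappa>1, \<kappa>2})"
  have "?A = {x. r / 2 \<le> norm (x - (-9/8)) \<and> norm (x - (-9/8)) \<le> r}" by (auto simp: dist_norm norm_minus_commute)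
  moreover have "connected {x. r / 2 \<le> norm (x - (-9/8 :: complex)) \<and> norm (x - (-9/8)) \<le> r}"
    by (intro connected_annulus) simp
  ultimately have "connected ?A" by simp
  moreover have "\<not> collinear ?D" using r(1) by (simp add: collinear_aff_dim aff_dim_cball)
  then have "connected (?D - {\<kappa>1, \<kappa>2})"
    by (intro path_connected_imp_connected path_connected_convex_diff_countable) auto
  moreover have "(p, ?x0) \<in> ?seg \<times> ?A" "(p, ?x0) \<in> {p} \<times> (?D - {\<kappa>1, \<kappa>2})"
    using route_end_annulus \<kappa>b by auto
  then have "(?seg \<times> ?A) \<inter> ({p} \<times> (?D - {\<kappa>1, \<kappa>2})) \<noteq> {}" by blast
  ultimately have "connected ?S"
    by (intro connected_Un connected_Times connected_segment connected_sing)
  moreover have "?S \<subseteq> regular"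
  proof
    fix s assume "s \<in> ?S"
    then have "fst s \<in> ?seg \<and> snd s \<in> ?A \<or> fst s \<in> {p} \<and> snd s \<in> ?D - {\<kappa>1, \<kappa>2}"
      by (simp only: Un_iff mem_Times_iff)
    then consider "fst s \<in> ?seg" "snd s \<in> ?A" | "fst s = p" "snd s \<in> ?D - {\<kappa>1, \<kappa>2}" by blast
    then have "(fst s, snd s) \<in> regular"
    proof cases
      case 1
      then show ?thesis by (intro reg UnI2)
    next
      case 2
      then have "snd s \<notin> K" using \<kappa>K(4) by blast
      then show ?thesis using 2(1) regular_iff_not_critical[OF p] by (simp add: K_def)
    qed
    then show "s \<in> regular" by simp
  qed
  moreover have "Re y \<noteq> 0" if "s \<in> ?S" "y \<in> fibre deltoid s" for s y
  proof (rule im[of "fst s" "snd s"])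
    have "fst s \<in> ?seg \<and> snd s \<in> ?A \<or> fst s \<in> {p} \<and> snd s \<in> ?D - {\<kappa>1, \<kappa>2}"
      using that(1) by (simp only: Un_iff mem_Times_iff)
    moreover have "p \<in> ?seg" by simp
    ultimately show "fst s \<in> ?seg" "snd s \<in> ?D" by blast+
  qed (simp add: that(2))
  moreover have "((1, 0), ?x0) \<in> ?S" by (intro UnI1 SigmaI route_end_annulus) simp
  moreover have "?L ((1, 0), ?x0) = 2"
  proof -
    have v: "(cusp_turn r 0)^2 = 8 * ?x0 + 9" using cusp_turn_sq[OF r(1), of 0] by (simp add: G(4))
    note n = norm_cusp_turn[OF r, of 0]
    have "fibre deltoid ((1, 0), ?x0) \<inter> {y. Re y < 0} = {- csqrt (branch_sq (cusp_turn r 0)), - csqrt (branch_sq (- cusp_turn r 0))}"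
      unfolding cusp_fibre(1)[OF n(1) v, symmetric] by blast
    then show ?thesis using cusp_fibre(4)[OF n(1) v n(2)] by (simp del: csqrt.simps)
  qed
  ultimately have count: "?L s = 2 \<and> ?R s = 2" if "s \<in> ?S" for s
    using connected_cluster_count[of ?S "((1, 0), ?x0)" s] that by blast
  have left: "?L (p, x) = 2" if "x \<in> ?D - {\<kappa>1}" for x using left2 count[of "(p, x)"] that by (cases "x = \<kappa>2") auto
  have right: "?R (p, x) = 2" if "x \<in> ?D - {\<kappa>2}" for x using right1 count[of "(p, x)"] that by (cases "x = \<kappa>1") auto
  have ann: "?L (q, x) = 2 \<and> ?R (q, x) = 2" if "q \<in> ?seg" "x \<in> ?A" for q x using count[of "(q, x)"] that by blast
  define T where "T = (\<lambda>t. -9/8 + complex_of_real r * cis (2 * pi * t))"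
  have T: "path T" "pathstart T = ?x0" "pathfinish T = ?x0" "path_image T \<subseteq> ?A"
    using r(1) unfolding T_def path_def G(4)
    by (auto intro!: continuous_intros simp: pathstart_def pathfinish_def path_image_def dist_norm norm_mult)
  have T1: "winding_number T \<kappa> = 1" if "\<kappa> \<in> ball (-9/8) (r / 2)" for \<kappa>
    unfolding T_def using that r(1) norm_minus_commute[of \<kappa> "-9/8"] by (intro winding_number_turn) (simp add: dist_norm)
  let ?c = "linepath ?x0 ?x0"
  have C: "path ?c" "pathstart ?c = ?x0" "pathfinish ?c = ?x0" "path_image ?c \<subseteq> ?A"
    using route_end_annulus by simp_all
  have C0: "winding_number ?c \<kappa> = 0" if "\<kappa> \<in> ball (-9/8) (r / 2)" for \<kappa>
    by (rule winding_number_trivial) (use that route_end_annulus in auto)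
  have ct: "?c t = ?x0" for t by (simp add: linepath_refl)
  note n = norm_cusp_turn[OF r]
  have v0: "(cusp_turn r 0)^2 = 8 * ?x0 + 9" using cusp_turn_sq[OF r(1), of 0] by (simp add: G(4))
  have v: "(cusp_turn r t)^2 = 8 * T t + 9" for t unfolding T_def by (rule cusp_turn_sq[OF r(1)])
  have f1: "follows clusters (\<lambda>t. ((1, 0), T t, ?c t)) (\<lambda>t. cusp_conf (cusp_turn r t) (cusp_turn r 0))"
    "follows clusters (\<lambda>t. ((1, 0), ?c t, T t)) (\<lambda>t. cusp_conf (cusp_turn r 0) (cusp_turn r t))"
    unfolding follows_def path_def ct
    by (intro conjI ballI continuous_on_cusp_conf[OF r] enumerates_cusp_conf n v v0)+
  show "monodromy_braid deltoid p (of_real b) P \<gamma>1 h1"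
    unfolding P_def
    by (rule cusp_braid[where \<kappa> = \<kappa>1 and \<eta> = \<eta> and \<kappa>L = \<kappa>1 and \<kappa>R = \<kappa>2 and \<mu> = T and \<nu> = ?c and i = A1 and j = A2,
          OF near(1)[unfolded K_def] \<kappa>1_def \<eta> K1(1)[unfolded K_def] sub[OF \<kappa>b(1)] left right ann \<kappa>b \<kappa>K(1,2)[unfolded K_def]
          T _ C _ f1(1) _ _ h(1)])
      (use r T1[OF \<kappa>b(1)] C0[OF \<kappa>b(2)] \<kappa>K(3) in \<open>simp_all add: pathstart_def pathfinish_def cusp_turn_1 flip: cusp_conf_swap\<close>)
  show "monodromy_braid deltoid p (of_real b) P \<gamma>2 h2"
    unfolding P_def
    by (rule cusp_braid[where \<kappa> = \<kappa>2 and \<eta> = \<eta> and \<kappa>L = \<kappa>1 and \<kappa>R = \<kappa>2 and \<mu> = ?c and \<nu> = T and i = B2 and j = B1,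
          OF near(2)[unfolded K_def] \<kappa>2_def \<eta> K1(2)[unfolded K_def] sub[OF \<kappa>b(2)] left right ann \<kappa>b \<kappa>K(1,2)[unfolded K_def]
          C _ T _ f1(2) _ _ h(2)])
      (use r T1[OF \<kappa>b(2)] C0[OF \<kappa>b(1)] \<kappa>K(3) in \<open>simp_all add: pathstart_def pathfinish_def cusp_turn_1 flip: cusp_conf_swap\<close>)
qed

end

section \<open>The routes and the naming of the points\<close>

lemma aux_base_bounds: "-1 < aux_base" "aux_base < 0" "aux_base + 1 < 1/20"
proof -
  have l: "5/3 < sqrt 3" by (rule real_less_rsqrt) (simp add: power2_eq_square)
  have u: "sqrt 3 < 26/15" by (rule real_less_lsqrt) (simp_all add: power2_eq_square)
  show "-1 < aux_base" "aux_base < 0" using l u by (simp_all add: aux_base_def)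
  have eq: "3/4 * (26/15 - 3) = (-19/20 :: real)" by simp
  have "3/4 * (sqrt 3 - 3) < 3/4 * (26/15 - 3)" using u by (intro mult_strict_left_mono) simp_all
  then have "aux_base < -19/20" unfolding aux_base_def eq .
  then show "aux_base + 1 < 1/20" by simp
qed

lemma real_segment_upper:
  fixes x y :: real
  assumes "\<And>t. min x y \<le> t \<Longrightarrow> t \<le> max x y \<Longrightarrow> -9/8 < t \<and> t \<noteq> 0 \<and> t \<noteq> -1"
  shows "path_image (linepath (of_real x) (of_real y)) \<subseteq> upper"
proof
  fix z assume "z \<in> path_image (linepath (of_real x) (complex_of_real y))"
  then obtain t where "z = of_real t" "min x y \<le> t" "t \<le> max x y" by (rule real_segment_image)
  then show "z \<in> upper" using assms[of t] by (auto simp: upper_def complex_eq_iff)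
qed

lemma half_circle_upper:
  fixes c r :: real
  assumes c: "c = 0 \<or> c = -1" and r: "0 < r" "r < 1/20" and st: "s \<in> {0..pi}" "t \<in> {0..pi}"
  shows "path_image (part_circlepath (of_real c) r s t) \<subseteq> upper"
proof
  fix z assume "z \<in> path_image (part_circlepath (of_real c) r s t)"
  then obtain u where u: "u \<in> {0..1}" "z = of_real c + of_real r * exp (\<i> * of_real (linepath s t u))"
    by (auto simp: path_image_def part_circlepath_def)
  define \<theta> where "\<theta> = linepath s t u"
  have "linepath s t u \<in> closed_segment s t" using u(1) by (rule linepath_in_path)
  then have \<theta>: "0 \<le> \<theta>" "\<theta> \<le> pi" using st unfolding \<theta>_def closed_segment_eq_real_ivl by (auto split: if_splits)
  have z: "z = of_real c + of_real r * cis \<theta>" unfolding u(2) \<theta>_def cis_conv_exp ..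
  have Re: "Re z = c + r * cos \<theta>" and Im: "Im z = r * sin \<theta>" by (simp_all add: z)
  have "\<bar>r * cos \<theta>\<bar> \<le> r" using r(1) abs_cos_le_one[of \<theta>] by (simp add: abs_mult mult_le_cancel_left1)
  then have 1: "c - r \<le> Re z" "Re z \<le> c + r" unfolding Re by linarith+
  have 2: "0 \<le> Im z" unfolding Im using r(1) \<theta> by (simp add: sin_ge_zero)
  have "z - of_real c \<noteq> 0" using r(1) by (simp add: z)
  then have 3: "z \<noteq> of_real c" by simp
  have "z \<noteq> 0 \<and> z \<noteq> -1"
  proof (cases "c = 0")
    case True
    then have "z \<noteq> -1" using 1 r(2) by auto
    then show ?thesis using 3 True by simp
  next
    case False
    then have "c = -1" using c by simp
    then have "z \<noteq> 0" using 1 r(2) by auto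
    then show ?thesis using 3 \<open>c = -1\<close> by simp
  qed
  moreover have "-9/8 < Re z" using 1(1) c r(2) by auto
  ultimately show "z \<in> upper" using 2 by (simp add: upper_def)
qed

context
  fixes b r :: real
  assumes b: "0 < r" "r < b" "r < aux_base + 1"
begin

lemma r_small: "r < 1/20" "0 < b"
  using b aux_base_bounds by simp_all

lemma base_move:
  "path (base_move r b)" "path_image (base_move r b) \<subseteq> upper"
  "pathstart (base_move r b) = of_real aux_base" "pathfinish (base_move r b) = of_real b"
proof -
  have e: "exp (\<i> * complex_of_real pi) = -1" by (rule exp_pi_i')
  show "path (base_move r b)" "pathstart (base_move r b) = of_real aux_base" "pathfinish (base_move r b) = of_real b"
    by (simp_all add: base_move_def e)
  have "path_image (linepath (of_real aux_base) (complex_of_real (- r))) \<subseteq> upper"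
    "path_image (linepath (of_real r) (complex_of_real b)) \<subseteq> upper"
    by (rule real_segment_upper; use b aux_base_bounds r_small in \<open>auto simp: min_def max_def split: if_splits\<close>)+
  moreover have "path_image (part_circlepath 0 r pi 0) \<subseteq> upper"
    using half_circle_upper[of 0 r pi 0] b(1) r_small by simp
  ultimately show "path_image (base_move r b) \<subseteq> upper"
    unfolding base_move_def by (intro subset_path_image_join) simp_all
qed

lemma route_tangency:
  "path (route_tangency r b)" "path_image (route_tangency r b) \<subseteq> upper"
  "pathstart (route_tangency r b) = of_real b" "pathfinish (route_tangency r b) = of_real (-1 + r)"
proof -
  show "path (route_tangency r b)" "pathstart (route_tangency r b) = of_real b" "pathfinish (route_tangency r b) = of_real (-1 + r)"
    using base_move by (simp_all add: route_tangency_def)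
  have "path_image (linepath (of_real aux_base) (complex_of_real (-1 + r))) \<subseteq> upper"
    by (rule real_segment_upper; use b aux_base_bounds r_small in \<open>auto simp: min_def max_def split: if_splits\<close>)
  then show "path_image (route_tangency r b) \<subseteq> upper"
    unfolding route_tangency_def using base_move(2) by (intro subset_path_image_join) simp_all
qed

lemma route_origin:
  "path (route_origin r b)" "path_image (route_origin r b) \<subseteq> upper"
  "pathstart (route_origin r b) = of_real b" "pathfinish (route_origin r b) = of_real (- r)"
proof -
  show "path (route_origin r b)" "pathstart (route_origin r b) = of_real b" "pathfinish (route_origin r b) = of_real (- r)"
    using base_move by (simp_all add: route_origin_def)
  have "path_image (linepath (of_real aux_base) (complex_of_real (- r))) \<subseteq> upper"
    by (rule real_segment_upper; use b aux_base_bounds r_small in \<open>auto simp: min_def max_def split: if_splits\<close>)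
  then show "path_image (route_origin r b) \<subseteq> upper"
    unfolding route_origin_def using base_move(2) by (intro subset_path_image_join) simp_all
qed

lemma route_cusps:
  "path (route_cusps r b)" "path_image (route_cusps r b) \<subseteq> upper"
  "pathstart (route_cusps r b) = of_real b" "pathfinish (route_cusps r b) = of_real (-9/8 + r)"
proof -
  have e: "exp (\<i> * complex_of_real pi) = -1" by (rule exp_pi_i')
  show "path (route_cusps r b)" "pathstart (route_cusps r b) = of_real b" "pathfinish (route_cusps r b) = of_real (-9/8 + r)"
    using base_move by (simp_all add: route_cusps_def e)
  have "path_image (linepath (of_real aux_base) (complex_of_real (-1 + r))) \<subseteq> upper"
    "path_image (linepath (of_real (-1 - r)) (complex_of_real (-9/8 + r))) \<subseteq> upper"
    by (rule real_segment_upper; use b aux_base_bounds r_small in \<open>auto simp: min_def max_def split: if_splits\<close>)+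
  moreover have "path_image (part_circlepath (-1) r 0 pi) \<subseteq> upper"
    using half_circle_upper[of "-1" r 0 pi] b(1) r_small by simp
  ultimately show "path_image (route_cusps r b) \<subseteq> upper"
    unfolding route_cusps_def using base_move(2) by (intro subset_path_image_join) simp_all
qed

text \<open>The signs at the auxiliary base point determine the names, since exactly one point lies on each half axis.\<close>

lemma transported_names:
  fixes w :: "real \<Rightarrow> complex ^ point_name"
  assumes w: "follows_fibres deltoid (\<lambda>t. ((1, 0), base_move r b t)) w"
    and s: "Im (pathstart w $ A2) = 0" "Re (pathstart w $ A2) < 0"
      "Im (pathstart w $ B2) = 0" "0 < Re (pathstart w $ B2)"
      "Re (pathstart w $ A1) = 0" "0 < Im (pathstart w $ A1)"
      "Re (pathstart w $ B1) = 0" "Im (pathstart w $ B1) < 0"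
  shows "pathfinish w = conf (upper_branches (of_real b))"
proof -
  let ?s = "\<lambda>t. ((1 :: complex, 0 :: complex), base_move r b t)"
  define q where "q = upper_branches (of_real aux_base)"
  have wf: "follows (fibre deltoid) ?s w" using w by (simp add: follows_fibres_def follows_def)
  have au: "complex_of_real aux_base \<in> upper" using real_chart_between(1)[of aux_base] aux_base_bounds by simp
  have e: "enumerates (pathstart w) (fibre deltoid ((1, 0), of_real aux_base))"
    using wf[unfolded follows_def, THEN conjunct2, THEN bspec, of 0] base_move(3) by (simp add: pathstart_def)
  have e': "enumerates (conf q) (fibre deltoid ((1, 0), of_real aux_base))"
    unfolding q_def by (rule enumerates_upper[OF au])
  have i: "Im (fst q) = pi / 2" "Im (snd q) = pi"
    using upper_branches_real_Im[of aux_base] aux_base_bounds by (simp_all add: q_def)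
  have c: "conf q $ A1 = \<i> * of_real (exp (Re (fst q)))" "conf q $ A2 = - of_real (exp (Re (snd q)))"
    "conf q $ B1 = - (\<i> * of_real (exp (Re (fst q))))" "conf q $ B2 = of_real (exp (Re (snd q)))"
    by (simp_all add: conf_def complex_eq_iff Re_exp Im_exp i)
  have e12: "exp (fst q) = \<i> * of_real (exp (Re (fst q)))" "exp (snd q) = - of_real (exp (Re (snd q)))"
    using c(1,2) by simp_all
  have mem: "pathstart w $ m \<in> {conf q $ A1, conf q $ A2, conf q $ B1, conf q $ B2}" for m
  proof -
    have "pathstart w $ m \<in> range (vec_nth (conf q))" using enumerates_mem[OF e] e' by (simp add: enumerates_def)
    then show ?thesis by (simp add: UNIV_point_name)
  qed
  have "pathstart w $ m = conf q $ m" for m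
    using mem[of m] s exp_gt_zero[of "Re (fst q)"] exp_gt_zero[of "Re (snd q)"] unfolding c
    by (cases m) (auto simp: e12 simp del: exp_gt_zero)
  then have start: "pathstart w = conf q" by (simp add: vec_eq_iff)
  have mv: "moving_set CARD(point_name) regular (fibre deltoid)" by (simp add: card_point_name moving_regular)
  have "path_image ?s \<subseteq> regular"
  proof
    fix y assume "y \<in> path_image ?s"
    then obtain x where x: "x \<in> upper" "y = ((1, 0), x)" using base_move(2) by (auto simp: pathstart_Pair)
    have "((1, 0), x) \<in> regular" by (rule regular_x) (use x(1) in \<open>auto simp: upper_def\<close>)
    then show "y \<in> regular" by (simp add: x(2))
  qed
  from follows_unique[OF mv path_PairI[OF base_move(1)] this wf follows_upper_branches[OF base_move(1,2)]]
  show ?thesis using start base_move(3,4) by (simp add: pathstart_compose pathfinish_compose q_def)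
qed

text \<open>
  Over \<open>b\<close> both logarithms lie over the imaginary axis, with \<open>A2\<close> closer
  to the origin.
\<close>

lemma base_order:
  defines "P \<equiv> conf (upper_branches (of_real b))"
  shows "Re (P $ i) = 0" "Im (P $ B1) < Im (P $ A2)" "Im (P $ A2) < Im (P $ B2)" "Im (P $ B2) < Im (P $ A1)"
proof -
  define q where "q = upper_branches (of_real b)"
  have q: "Im (fst q) = pi / 2" "Im (snd q) = - pi / 2" "Re (snd q) < Re (fst q)"
    using base_branch[OF r_small(2)] by (simp_all add: q_def)
  have c: "conf q $ A1 = \<i> * of_real (exp (Re (fst q)))" "conf q $ A2 = - (\<i> * of_real (exp (Re (snd q))))"
    "conf q $ B1 = - (\<i> * of_real (exp (Re (fst q))))" "conf q $ B2 = \<i> * of_real (exp (Re (snd q)))"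
    by (simp_all add: conf_def complex_eq_iff Re_exp Im_exp q(1,2))
  have e12: "exp (fst q) = \<i> * of_real (exp (Re (fst q)))" "exp (snd q) = - (\<i> * of_real (exp (Re (snd q))))"
    using c(1,2) by simp_all
  have m: "0 < exp (Re (snd q))" "exp (Re (snd q)) < exp (Re (fst q))" using q(3) by simp_all
  show "Re (P $ i) = 0" by (cases i) (simp_all add: P_def q_def[symmetric] e12)
  show "Im (P $ B1) < Im (P $ A2)" "Im (P $ A2) < Im (P $ B2)" "Im (P $ B2) < Im (P $ A1)"
    unfolding P_def q_def[symmetric] c using m by simp_all
qed

end

lemma ends_near_pathfinish:
  assumes "ends_near K g c r \<gamma>" shows "pathfinish \<gamma> \<in> K \<inter> cball c r"
proof -
  from assms obtain e where e: "path_image e \<subseteq> cball c r" "pathfinish e \<in> K" and d: "displaced K (g +++ e) \<gamma>"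
    unfolding ends_near_def by blast
  obtain h :: "real \<times> real \<Rightarrow> complex" where h: "\<And>t. h (1, t) = \<gamma> t" "\<And>s. s \<in> {0..1} \<Longrightarrow> h (s, 1) = pathfinish (g +++ e)"
    by (rule displaced_homotopy[OF d]) (rule that; assumption)
  have "\<gamma> 1 = pathfinish (g +++ e)" using h(2)[of 1] unfolding h(1) by simp
  then have "pathfinish \<gamma> = pathfinish e" by (simp add: pathfinish_def joinpaths_def)
  then show ?thesis using e pathfinish_in_path_image[of e] by auto
qed

lemma real_segment_annulus:
  fixes c \<rho> r \<epsilon> :: real
  assumes "0 < \<rho>" "\<rho> \<le> r" "\<epsilon> = 1 \<or> \<epsilon> = -1"
  shows "closed_segment (of_real (c + \<epsilon> * r)) (complex_of_real (c + \<epsilon> * \<rho>)) \<subseteq> cball (of_real c) r - ball (of_real c) \<rho>"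
proof
  fix z assume "z \<in> closed_segment (of_real (c + \<epsilon> * r)) (complex_of_real (c + \<epsilon> * \<rho>))"
  then obtain t where "z = of_real t" "min (c + \<epsilon> * r) (c + \<epsilon> * \<rho>) \<le> t" "t \<le> max (c + \<epsilon> * r) (c + \<epsilon> * \<rho>)"
    using real_segment_image[of z "c + \<epsilon> * r" "c + \<epsilon> * \<rho>"] by auto
  then show "z \<in> cball (of_real c) r - ball (of_real c) \<rho>"
    using assms by (auto simp: dist_of_real dist_real_def min_def max_def split: if_splits)
qed

lemma tangency_braid:
  fixes b r \<rho> :: real
  assumes br: "0 < r" "r < b" "r < aux_base + 1" and \<rho>: "0 < \<rho>" "\<rho> \<le> 1/160" "\<rho> \<le> r"
    and h: "\<And>g. path g \<Longrightarrow> path_image g \<subseteq> upper \<Longrightarrow> pathstart g = of_real b \<Longrightarrow> pathfinish g = of_real (-1 + \<rho>) \<Longrightarrow>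
      homotopic_paths config (conj_path (swap_labels A1 B1) (conf \<circ> (upper_branches \<circ> g)) (conf \<circ> tangency_loop \<rho>)) h"
  shows "\<exists>\<delta>>0. \<forall>p \<gamma>. dist p (1, 0) < \<delta> \<longrightarrow> ends_near (critical_values deltoid p) (route_tangency r b) (-1) r \<gamma> \<longrightarrow>
    critical_values deltoid p \<inter> cball (-1) r = {pathfinish \<gamma>} \<longrightarrow>
    monodromy_braid deltoid p (of_real b) (conf (upper_branches (of_real b))) \<gamma> h"
proof (rule simple_monodromy[OF route_tangency(1-3)[OF br]])
  note rs = r_small[OF br]
  have d: "dist (complex_of_real (-1 + \<rho>)) (-1) = \<rho>" using \<rho>(1) by (simp add: dist_norm)
  have "path_image (linepath (of_real (-1 + r)) (complex_of_real (-1 + \<rho>))) \<subseteq> upper"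
    by (rule real_segment_upper; use br \<rho> rs in \<open>auto simp: min_def max_def split: if_splits\<close>)
  then show "closed_segment (pathfinish (route_tangency r b)) (of_real (-1 + \<rho>)) \<subseteq> upper"
    by (simp only: route_tangency(4)[OF br] path_image_linepath)
  show "closed_segment (pathfinish (route_tangency r b)) (of_real (-1 + \<rho>)) \<subseteq> cball (-1) r - ball (-1) (dist (complex_of_real (-1 + \<rho>)) (-1))"
    unfolding d route_tangency(4)[OF br] using real_segment_annulus[OF \<rho>(1,3), of 1 "-1"] by simp
  show "0 < dist (complex_of_real (-1 + \<rho>)) (-1)" "dist (complex_of_real (-1 + \<rho>)) (-1) \<le> r" unfolding d using \<rho> by simp_all
  show "0 \<notin> cball (-1 :: complex) r - ball (-1) (dist (complex_of_real (-1 + \<rho>)) (-1) / 2)"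
    "-1 \<notin> cball (-1 :: complex) r - ball (-1) (dist (complex_of_real (-1 + \<rho>)) (-1) / 2)"
    "-9/8 \<notin> cball (-1 :: complex) r - ball (-1) (dist (complex_of_real (-1 + \<rho>)) (-1) / 2)"
    unfolding d using \<rho> rs by (simp_all add: dist_norm)
  show "follows (fibre deltoid) (\<lambda>t. ((1, 0), -1 + (of_real (-1 + \<rho>) - (-1)) * cis (2 * pi * t))) (conf \<circ> tangency_loop \<rho>)"
    using tangency_loop(5)[OF \<rho>(1,2)] by simp
  show "pathstart (conf \<circ> tangency_loop \<rho>) = conf (upper_branches (of_real (-1 + \<rho>)))"
    unfolding pathstart_def o_def tangency_loop(3)[OF \<rho>(1,2)] ..
  show "pathfinish (conf \<circ> tangency_loop \<rho>) = swap_labels A1 B1 (conf (upper_branches (of_real (-1 + \<rho>))))"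
    unfolding pathfinish_def o_def tangency_loop(4)[OF \<rho>(1,2)] conf_shift prod.collapse ..
qed (rule h; assumption)

lemma origin_braid:
  fixes b r \<rho> :: real
  assumes br: "0 < r" "r < b" "r < aux_base + 1" and \<rho>: "0 < \<rho>" "\<rho> \<le> 1/160" "\<rho> \<le> r"
    and h: "\<And>g. path g \<Longrightarrow> path_image g \<subseteq> upper \<Longrightarrow> pathstart g = of_real b \<Longrightarrow> pathfinish g = of_real (- \<rho>) \<Longrightarrow>
      homotopic_paths config (conj_path (swap_labels A2 B2) (conf \<circ> (upper_branches \<circ> g)) (conf \<circ> origin_loop \<rho>)) h"
  shows "\<exists>\<delta>>0. \<forall>p \<gamma>. dist p (1, 0) < \<delta> \<longrightarrow> ends_near (critical_values deltoid p) (route_origin r b) 0 r \<gamma> \<longrightarrow>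
    critical_values deltoid p \<inter> cball 0 r = {pathfinish \<gamma>} \<longrightarrow>
    monodromy_braid deltoid p (of_real b) (conf (upper_branches (of_real b))) \<gamma> h"
proof (rule simple_monodromy[OF route_origin(1-3)[OF br]])
  note rs = r_small[OF br]
  have d: "dist (complex_of_real (- \<rho>)) 0 = \<rho>" using \<rho>(1) by simp
  have "path_image (linepath (of_real (- r)) (complex_of_real (- \<rho>))) \<subseteq> upper"
    by (rule real_segment_upper; use br \<rho> rs in \<open>auto simp: min_def max_def split: if_splits\<close>)
  then show "closed_segment (pathfinish (route_origin r b)) (of_real (- \<rho>)) \<subseteq> upper"
    by (simp only: route_origin(4)[OF br] path_image_linepath)
  show "closed_segment (pathfinish (route_origin r b)) (of_real (- \<rho>)) \<subseteq> cball 0 r - ball 0 (dist (complex_of_real (- \<rho>)) 0)"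
    unfolding d route_origin(4)[OF br] using real_segment_annulus[OF \<rho>(1,3), of "-1" 0] by simp
  show "0 < dist (complex_of_real (- \<rho>)) 0" "dist (complex_of_real (- \<rho>)) 0 \<le> r" unfolding d using \<rho> by simp_all
  show "0 \<notin> cball (0 :: complex) r - ball 0 (dist (complex_of_real (- \<rho>)) 0 / 2)"
    "-1 \<notin> cball (0 :: complex) r - ball 0 (dist (complex_of_real (- \<rho>)) 0 / 2)"
    "-9/8 \<notin> cball (0 :: complex) r - ball 0 (dist (complex_of_real (- \<rho>)) 0 / 2)"
    unfolding d using \<rho> rs by simp_all
  show "follows (fibre deltoid) (\<lambda>t. ((1, 0), 0 + (of_real (- \<rho>) - 0) * cis (2 * pi * t))) (conf \<circ> origin_loop \<rho>)"
    using origin_loop(5)[OF \<rho>(1,2)] by simp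
  show "pathstart (conf \<circ> origin_loop \<rho>) = conf (upper_branches (of_real (- \<rho>)))"
    unfolding pathstart_def o_def origin_loop(3)[OF \<rho>(1,2)] ..
  show "pathfinish (conf \<circ> origin_loop \<rho>) = swap_labels A2 B2 (conf (upper_branches (of_real (- \<rho>))))"
    unfolding pathfinish_def o_def origin_loop(4)[OF \<rho>(1,2)] conf_shift prod.collapse ..
qed (rule h; assumption)

lemma cusps_braids:
  fixes b r :: real and h1 h2 :: "real \<Rightarrow> complex ^ point_name"
  assumes br: "0 < r" "r < b" "r < aux_base + 1"
  defines "P \<equiv> conf (upper_branches (of_real b))"
  assumes h: "homotopic_paths config (conj_path (swap_labels A1 A2) (conf \<circ> (upper_branches \<circ> route_cusps r b))
        (\<lambda>t. cusp_conf (cusp_turn r t) (cusp_turn r 0))) h1"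
      "homotopic_paths config (conj_path (swap_labels B2 B1) (conf \<circ> (upper_branches \<circ> route_cusps r b))
        (\<lambda>t. cusp_conf (cusp_turn r 0) (cusp_turn r t))) h2"
  shows "\<exists>\<delta>>0. \<forall>p \<gamma>1 \<gamma>2. dist p (1, 0) < \<delta> \<longrightarrow> generic_projection deltoid p \<longrightarrow>
    critical_values deltoid p \<inter> cball (-9/8) r = {pathfinish \<gamma>1, pathfinish \<gamma>2} \<longrightarrow> pathfinish \<gamma>1 \<noteq> pathfinish \<gamma>2 \<longrightarrow>
    ends_near (critical_values deltoid p) (route_cusps r b) (-9/8) r \<gamma>1 \<longrightarrow> meet_at_end deltoid p (of_real b) P \<gamma>1 A1 A2 \<longrightarrow>
    ends_near (critical_values deltoid p) (route_cusps r b) (-9/8) r \<gamma>2 \<longrightarrow> meet_at_end deltoid p (of_real b) P \<gamma>2 B1 B2 \<longrightarrow>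
    monodromy_braid deltoid p (of_real b) P \<gamma>1 h1 \<and> monodromy_braid deltoid p (of_real b) P \<gamma>2 h2"
proof -
  note rs = r_small[OF br] and G = route_cusps[OF br]
  let ?C = "path_image (route_cusps r b) \<union> (cball (-9/8) r - ball (-9/8) (r / 2))"
  have "compact ?C" using G(1) by (intro compact_Un compact_path_image compact_diff) auto
  moreover have "0 \<notin> path_image (route_cusps r b)" "-1 \<notin> path_image (route_cusps r b)" "-9/8 \<notin> path_image (route_cusps r b)"
    using G(2) by (auto simp: upper_def)
  moreover have "0 \<notin> cball (-9/8 :: complex) r" "-1 \<notin> cball (-9/8 :: complex) r" "-9/8 \<in> ball (-9/8 :: complex) (r / 2)"
    using rs br by (simp_all add: dist_norm)
  ultimately obtain \<delta>1 where \<delta>1: "0 < \<delta>1" "\<And>p x. dist p (1, 0) < \<delta>1 \<Longrightarrow> x \<in> ?C \<Longrightarrow> (p, x) \<in> regular"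
    using regular_near_x[of ?C] by blast
  obtain \<delta>2 where \<delta>2: "0 < \<delta>2" "\<And>p. dist p (1, 0) < \<delta>2 \<Longrightarrow> p \<in> slanted \<and>
    (\<forall>x\<in>cball (-9/8) r. \<forall>y\<in>fibre deltoid (p, x). Re y \<noteq> 0)"
    using no_imaginary_points_near_cusps[OF br(1) rs(1)] by blast
  show ?thesis
  proof (intro exI[of _ "min \<delta>1 \<delta>2"] conjI allI impI)
    show "0 < min \<delta>1 \<delta>2" using \<delta>1(1) \<delta>2(1) by simp
    fix p \<gamma>1 \<gamma>2 assume p: "dist p (1, 0) < min \<delta>1 \<delta>2" and A: "generic_projection deltoid p"
      "critical_values deltoid p \<inter> cball (-9/8) r = {pathfinish \<gamma>1, pathfinish \<gamma>2}" "pathfinish \<gamma>1 \<noteq> pathfinish \<gamma>2"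
      "ends_near (critical_values deltoid p) (route_cusps r b) (-9/8) r \<gamma>1" "meet_at_end deltoid p (of_real b) P \<gamma>1 A1 A2"
      "ends_near (critical_values deltoid p) (route_cusps r b) (-9/8) r \<gamma>2" "meet_at_end deltoid p (of_real b) P \<gamma>2 B1 B2"
    have 1: "p \<in> slanted" using \<delta>2(2)[of p] p by simp
    have 2: "(q, x) \<in> regular" if "q \<in> closed_segment (1, 0) p" "x \<in> ?C" for q x
      using \<delta>1(2)[OF _ that(2), of q] segment_near_x[OF p that(1)] by simp
    have 3: "Re y \<noteq> 0" if "q \<in> closed_segment (1, 0) p" "x \<in> cball (-9/8) r" "y \<in> fibre deltoid (q, x)" for q x y
      using \<delta>2(2)[of q] segment_near_x[OF p that(1)] that(2,3) by simp
    note X = cusps_monodromy[OF br(1) rs(1) G 1 2 3 A(1-3) A(4,6) A(5,7)[unfolded P_def] h]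
    show "monodromy_braid deltoid p (of_real b) P \<gamma>1 h1" unfolding P_def by (rule X(1))
    show "monodromy_braid deltoid p (of_real b) P \<gamma>2 h2" unfolding P_def by (rule X(2))
  qed
qed

theorem theorem5p1:
  fixes b r :: real and w :: "real \<Rightarrow> complex ^ point_name" and P :: "complex ^ point_name"
  assumes "0 < b" and "0 < r" and "r < b" and "r < aux_base + 1"
    and "follows_fibres deltoid (\<lambda>t. ((1, 0), base_move r b t)) w"
    and "Im (pathstart w $ A2) = 0" and "Re (pathstart w $ A2) < 0"
    and "Im (pathstart w $ B2) = 0" and "0 < Re (pathstart w $ B2)"
    and "Re (pathstart w $ A1) = 0" and "0 < Im (pathstart w $ A1)"
    and "Re (pathstart w $ B1) = 0" and "Im (pathstart w $ B1) < 0"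
    and "P = pathfinish w"
  shows "(\<forall>i. Re (P $ i) = 0) \<and>
    Im (P $ B1) < Im (P $ A2) \<and> Im (P $ A2) < Im (P $ B2) \<and> Im (P $ B2) < Im (P $ A1) \<and>
    (\<exists>h1 h2 h3 h4.
       half_twist P (arc1 P) h1 \<and> half_twist P (arc2 P) h2 \<and>
       half_twist P (arc3 P) h3 \<and> half_twist P (arc4 P) h4 \<and>
       (\<exists>\<delta>>0. \<forall>p \<gamma>1 \<gamma>2 \<gamma>3 \<gamma>4.
          dist p (1, 0) < \<delta> \<longrightarrow>
          generic_projection deltoid p \<longrightarrow>
          path_system (critical_values deltoid p) (of_real b) [\<gamma>1, \<gamma>2, \<gamma>3, \<gamma>4] \<longrightarrow>
          ends_near (critical_values deltoid p) (route_cusps r b) (-9/8) r \<gamma>1 \<longrightarrow>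
          meet_at_end deltoid p (of_real b) P \<gamma>1 A1 A2 \<longrightarrow>
          ends_near (critical_values deltoid p) (route_cusps r b) (-9/8) r \<gamma>2 \<longrightarrow>
          meet_at_end deltoid p (of_real b) P \<gamma>2 B1 B2 \<longrightarrow>
          ends_near (critical_values deltoid p) (route_tangency r b) (-1) r \<gamma>3 \<longrightarrow>
          ends_near (critical_values deltoid p) (route_origin r b) 0 r \<gamma>4 \<longrightarrow>
          braid_monodromy deltoid p (of_real b) P [\<gamma>1, \<gamma>2, \<gamma>3, \<gamma>4]
            [braid_power h1 3, braid_power h2 3, h3, braid_power h4 3]))"
proof -
  note br = assms(2) assms(3) assms(4)
  note rs = r_small[OF br]
  have P: "P = conf (upper_branches (of_real b))" using transported_names[OF br assms(5-13)] assms(14) by simp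
  define \<rho> where "\<rho> = min r (1/160)"
  have \<rho>: "0 < \<rho>" "\<rho> \<le> 1/160" "\<rho> \<le> r" using assms(2) by (simp_all add: \<rho>_def)
  obtain h1 where h1: "half_twist P (arc1 P) h1" "homotopic_paths config (conj_path (swap_labels A1 A2)
      (conf \<circ> (upper_branches \<circ> route_cusps r b)) (\<lambda>t. cusp_conf (cusp_turn r t) (cusp_turn r 0))) (braid_power h1 3)"
    using cusp_monodromy(1)[OF assms(2) rs(1) assms(1)] route_cusps[OF br] unfolding P by blast
  obtain h2 where h2: "half_twist P (arc2 P) h2" "homotopic_paths config (conj_path (swap_labels B2 B1)
      (conf \<circ> (upper_branches \<circ> route_cusps r b)) (\<lambda>t. cusp_conf (cusp_turn r 0) (cusp_turn r t))) (braid_power h2 3)"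
    using cusp_monodromy(2)[OF assms(2) rs(1) assms(1)] route_cusps[OF br] unfolding P by blast
  obtain h3 where h3: "half_twist P (arc3 P) h3" "\<And>g. path g \<Longrightarrow> path_image g \<subseteq> upper \<Longrightarrow> pathstart g = of_real b \<Longrightarrow> pathfinish g = of_real (-1 + \<rho>) \<Longrightarrow>
      homotopic_paths config (conj_path (swap_labels A1 B1) (conf \<circ> (upper_branches \<circ> g)) (conf \<circ> tangency_loop \<rho>)) h3"
    using tangency_monodromy[OF assms(1) \<rho>(1,2)] unfolding P by blast
  obtain h4 where h4: "half_twist P (arc4 P) h4" "\<And>g. path g \<Longrightarrow> path_image g \<subseteq> upper \<Longrightarrow> pathstart g = of_real b \<Longrightarrow> pathfinish g = of_real (- \<rho>) \<Longrightarrow>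
      homotopic_paths config (conj_path (swap_labels A2 B2) (conf \<circ> (upper_branches \<circ> g)) (conf \<circ> origin_loop \<rho>)) (braid_power h4 3)"
    using origin_monodromy[OF assms(1) \<rho>(1,2)] unfolding P by blast
  obtain \<delta>1 where \<delta>1: "0 < \<delta>1" "\<forall>p \<gamma>1 \<gamma>2. dist p (1, 0) < \<delta>1 \<longrightarrow> generic_projection deltoid p \<longrightarrow>
      critical_values deltoid p \<inter> cball (-9/8) r = {pathfinish \<gamma>1, pathfinish \<gamma>2} \<longrightarrow> pathfinish \<gamma>1 \<noteq> pathfinish \<gamma>2 \<longrightarrow>
      ends_near (critical_values deltoid p) (route_cusps r b) (-9/8) r \<gamma>1 \<longrightarrow> meet_at_end deltoid p (of_real b) P \<gamma>1 A1 A2 \<longrightarrow>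
      ends_near (critical_values deltoid p) (route_cusps r b) (-9/8) r \<gamma>2 \<longrightarrow> meet_at_end deltoid p (of_real b) P \<gamma>2 B1 B2 \<longrightarrow>
      monodromy_braid deltoid p (of_real b) P \<gamma>1 (braid_power h1 3) \<and> monodromy_braid deltoid p (of_real b) P \<gamma>2 (braid_power h2 3)"
    using cusps_braids[OF br h1(2) h2(2)] unfolding P by blast
  obtain \<delta>3 where \<delta>3: "0 < \<delta>3" "\<forall>p \<gamma>. dist p (1, 0) < \<delta>3 \<longrightarrow> ends_near (critical_values deltoid p) (route_tangency r b) (-1) r \<gamma> \<longrightarrow>
      critical_values deltoid p \<inter> cball (-1) r = {pathfinish \<gamma>} \<longrightarrow> monodromy_braid deltoid p (of_real b) P \<gamma> h3"
    using tangency_braid[OF br \<rho> h3(2)] unfolding P by blast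
  obtain \<delta>4 where \<delta>4: "0 < \<delta>4" "\<forall>p \<gamma>. dist p (1, 0) < \<delta>4 \<longrightarrow> ends_near (critical_values deltoid p) (route_origin r b) 0 r \<gamma> \<longrightarrow>
      critical_values deltoid p \<inter> cball 0 r = {pathfinish \<gamma>} \<longrightarrow> monodromy_braid deltoid p (of_real b) P \<gamma> (braid_power h4 3)"
    using origin_braid[OF br \<rho> h4(2)] unfolding P by blast
  have main: "braid_monodromy deltoid p (of_real b) P [\<gamma>1, \<gamma>2, \<gamma>3, \<gamma>4] [braid_power h1 3, braid_power h2 3, h3, braid_power h4 3]"
    if p: "dist p (1, 0) < min \<delta>1 (min \<delta>3 \<delta>4)" and gen: "generic_projection deltoid p"
      and sys: "path_system (critical_values deltoid p) (of_real b) [\<gamma>1, \<gamma>2, \<gamma>3, \<gamma>4]"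
      and n1: "ends_near (critical_values deltoid p) (route_cusps r b) (-9/8) r \<gamma>1" and m1: "meet_at_end deltoid p (of_real b) P \<gamma>1 A1 A2"
      and n2: "ends_near (critical_values deltoid p) (route_cusps r b) (-9/8) r \<gamma>2" and m2: "meet_at_end deltoid p (of_real b) P \<gamma>2 B1 B2"
      and n3: "ends_near (critical_values deltoid p) (route_tangency r b) (-1) r \<gamma>3"
      and n4: "ends_near (critical_values deltoid p) (route_origin r b) 0 r \<gamma>4" for p \<gamma>1 \<gamma>2 \<gamma>3 \<gamma>4
  proof -
    let ?K = "critical_values deltoid p"
    let ?f = "\<lambda>i. pathfinish ([\<gamma>1, \<gamma>2, \<gamma>3, \<gamma>4] ! i)"
    have "bij_betw ?f {..<length [\<gamma>1, \<gamma>2, \<gamma>3, \<gamma>4]} ?K" using sys unfolding path_system_def by blast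
    moreover have "length [\<gamma>1, \<gamma>2, \<gamma>3, \<gamma>4] = 4" by simp
    ultimately have bij: "bij_betw ?f {..<4} ?K" by (simp only:)
    have four: "{..<4 :: nat} = {0, 1, 2, 3}" by auto
    have "?K = ?f ` {0, 1, 2, 3}" using bij unfolding four by (simp only: bij_betw_def)
    then have K: "?K = {pathfinish \<gamma>1, pathfinish \<gamma>2, pathfinish \<gamma>3, pathfinish \<gamma>4}" by simp
    have "?f 0 \<noteq> ?f 1" using bij unfolding bij_betw_def inj_on_def four by force
    then have ne: "pathfinish \<gamma>1 \<noteq> pathfinish \<gamma>2" by simp
    have dst: "dist (-9/8 :: complex) (-1) = 1/8" "dist (-9/8 :: complex) 0 = 9/8" "dist (-1 :: complex) 0 = 1"
      by (simp_all add: dist_norm)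
    have apart: "x \<notin> cball (-1) r" "x \<notin> cball 0 r" if "x \<in> cball (-9/8) r" for x :: complex
      using that rs(1) dist_triangle2[of "-9/8" "-1" x] dist_triangle2[of "-9/8" 0 x] unfolding mem_cball dst by linarith+
    have apart': "x \<notin> cball 0 r" if "x \<in> cball (-1) r" for x :: complex
      using that rs(1) dist_triangle2[of "-1" 0 x] unfolding mem_cball dst by linarith
    note f = ends_near_pathfinish[OF n1] ends_near_pathfinish[OF n2] ends_near_pathfinish[OF n3] ends_near_pathfinish[OF n4]
    have K1: "?K \<inter> cball (-9/8) r = {pathfinish \<gamma>1, pathfinish \<gamma>2}" using f apart unfolding K by blast
    have K3: "?K \<inter> cball (-1) r = {pathfinish \<gamma>3}" using f apart apart' unfolding K by blast
    have K4: "?K \<inter> cball 0 r = {pathfinish \<gamma>4}" using f apart apart' unfolding K by blast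
    have "monodromy_braid deltoid p (of_real b) P \<gamma>1 (braid_power h1 3) \<and> monodromy_braid deltoid p (of_real b) P \<gamma>2 (braid_power h2 3)"
      using \<delta>1(2)[rule_format, of p \<gamma>1 \<gamma>2] p gen K1 ne n1 m1 n2 m2 by simp
    moreover have "monodromy_braid deltoid p (of_real b) P \<gamma>3 h3" using \<delta>3(2)[rule_format, of p \<gamma>3] p n3 K3 by simp
    moreover have "monodromy_braid deltoid p (of_real b) P \<gamma>4 (braid_power h4 3)" using \<delta>4(2)[rule_format, of p \<gamma>4] p n4 K4 by simp
    ultimately show ?thesis by (simp add: braid_monodromy_def)
  qed
  show ?thesis
  proof (intro conjI)
    show "\<forall>i. Re (P $ i) = 0" "Im (P $ B1) < Im (P $ A2)" "Im (P $ A2) < Im (P $ B2)" "Im (P $ B2) < Im (P $ A1)"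
      unfolding P using base_order[OF br] by blast+
    have "0 < min \<delta>1 (min \<delta>3 \<delta>4)" using \<delta>1(1) \<delta>3(1) \<delta>4(1) by simp
    with main h1(1) h2(1) h3(1) h4(1) show "\<exists>h1 h2 h3 h4.
       half_twist P (arc1 P) h1 \<and> half_twist P (arc2 P) h2 \<and>
       half_twist P (arc3 P) h3 \<and> half_twist P (arc4 P) h4 \<and>
       (\<exists>\<delta>>0. \<forall>p \<gamma>1 \<gamma>2 \<gamma>3 \<gamma>4.
          dist p (1, 0) < \<delta> \<longrightarrow>
          generic_projection deltoid p \<longrightarrow>
          path_system (critical_values deltoid p) (of_real b) [\<gamma>1, \<gamma>2, \<gamma>3, \<gamma>4] \<longrightarrow>
          ends_near (critical_values deltoid p) (route_cusps r b) (-9/8) r \<gamma>1 \<longrightarrow>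
          meet_at_end deltoid p (of_real b) P \<gamma>1 A1 A2 \<longrightarrow>
          ends_near (critical_values deltoid p) (route_cusps r b) (-9/8) r \<gamma>2 \<longrightarrow>
          meet_at_end deltoid p (of_real b) P \<gamma>2 B1 B2 \<longrightarrow>
          ends_near (critical_values deltoid p) (route_tangency r b) (-1) r \<gamma>3 \<longrightarrow>
          ends_near (critical_values deltoid p) (route_origin r b) 0 r \<gamma>4 \<longrightarrow>
          braid_monodromy deltoid p (of_real b) P [\<gamma>1, \<gamma>2, \<gamma>3, \<gamma>4]
            [braid_power h1 3, braid_power h2 3, h3, braid_power h4 3])"
      by (intro exI[of _ h1] exI[of _ h2] exI[of _ h3] exI[of _ h4] conjI exI[of _ "min \<delta>1 (min \<delta>3 \<delta>4)"] allI impI) assumption+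
  qed
qed

end
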